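(* Let $\mathcal{A}$ be a finite von Neumann algebra and let $M$ be a finitely generated $\mathcal{A}$-module. Let $F$ be a finitely generated free (or projective) $\mathcal{A}$-module that maps onto $M$ by some map $f$, and let $K$ be the kernel of $f$ (so $M\cong F/K$). Let $K_i$, $i\in I$, be any directed family of finitely generated submodules of $K$ (directed with respect to the inclusion maps) whose union $\varinjlim K_i$ is equal to $K$. Then, all closures being taken in $F$: (1) $\mathbf{t}M=\mathrm{cl}_{\mathbf{t}}(K)/K\cong\varinjlim_{i\in I}\left(\mathrm{cl}_{\mathbf{T}}(K_i)/K_i\right)=\varinjlim_{i\in I}\mathbf{T}(F/K_i)$. Moreover, $M$ is flat if and only if $\mathrm{cl}_{\mathbf{t}}(K)=\varinjlim\mathrm{cl}_{\mathbf{T}}(K_i)=K$. (2) $\mathbf{T}\mathbf{p}M\cong\mathrm{cl}_{\mathbf{T}}(K)/\mathrm{cl}_{\mathbf{t}}(K)\cong\varinjlim_{i\in I}\left(\mathrm{cl}_{\mathbf{T}}(K)/\mathrm{cl}_{\mathbf{T}}(K_i)\right)$. (3) $\mathbf{P}M\cong F/\mathrm{cl}_{\mathbf{T}}(K)$.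
   Context: A von Neumann algebra is finite if it has a normal faithful trace $\mathrm{tr}_{\mathcal{A}}$; such a trace is fixed and extended to square matrices by summing the diagonal traces. Modules are left modules. Dimension: if $P$ is a finitely generated projective $\mathcal{A}$-module, choose $n$ and $f:\mathcal{A}^n\to\mathcal{A}^n$ with $f=f^2=f^*$ and image (isomorphic to) $P$, and put $\dim_{\mathcal{A}}(P)=\mathrm{tr}_{\mathcal{A}}(f)$; for any $\mathcal{A}$-module $M$, $\dim_{\mathcal{A}}(M)=\sup\{\dim_{\mathcal{A}}(P): P\text{ a finitely generated projective submodule of }M\}$. $\mathcal{U}$ is the algebra of operators affiliated to $\mathcal{A}$ (closed densely defined operators on $l^2(\mathcal{A})$, the completion of $\mathcal{A}$ for $\langle a,b\rangle=\mathrm{tr}_{\mathcal{A}}(ab^* )$, commuting with the commutant of $\mathcal{A}$); it equals the classical ring of quotients of the Ore ring $\mathcal{A}$. For an $\mathcal{A}$-module $M$: $\mathbf{T}M$ is the largest submodule of dimension zero, $\mathbf{P}M=M/\mathbf{T}M$, $\mathbf{t}M=\ker(M\to\mathcal{U}\otimes_{\mathcal{A}}M)$, $\mathbf{p}M=M/\mathbf{t}M$, and $\mathbf{T}\mathbf{p}M=\mathbf{T}(\mathbf{p}M)$. For a submodule $K\subseteq F$ with projection $\pi:F\to F/K$, $\mathrm{cl}_{\mathbf{T}}(K)=\pi^{-1}(\mathbf{T}(F/K))$ and $\mathrm{cl}_{\mathbf{t}}(K)=\pi^{-1}(\mathbf{t}(F/K))$. Direct limits of the submodules $\mathrm{cl}_{\mathbf{T}}(K_i)$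 are directed unions inside $F$, and the direct limits of quotients are over the maps induced by the inclusions $K_i\subseteq K_j$, $i\le j$. *)

theory Defs
  imports "HOL-Analysis.Analysis" "HOL-Algebra.Module" "HOL-Algebra.AbelCoset"
    "HOL-Algebra.Free_Abelian_Groups" "HOL-Algebra.Generated_Groups"
begin

section \<open>Complex Hilbert spaces and von Neumann algebras\<close>

text \<open>The inner product is linear in the first argument, in accordance with the convention
  \<open>\<langle>a, b\<rangle> = tr (a b*)\<close> for the trace inner product below.\<close>

class chilbert = banach +
  fixes scaleC :: "complex \<Rightarrow> 'a \<Rightarrow> 'a"
    and cinner :: "'a \<Rightarrow> 'a \<Rightarrow> complex"
  assumes scaleC_complex_of_real: "scaleC (complex_of_real r) x = r *\<^sub>R x"
    and scaleC_add_right: "scaleC c (x + y) = scaleC c x + scaleC c y"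
    and scaleC_add_left: "scaleC (c + d) x = scaleC c x + scaleC d x"
    and scaleC_scaleC: "scaleC c (scaleC d x) = scaleC (c * d) x"
    and cinner_commute: "cinner x y = cnj (cinner y x)"
    and cinner_add_left: "cinner (x + y) z = cinner x z + cinner y z"
    and cinner_scaleC_left: "cinner (scaleC c x) y = c * cinner x y"
    and cinner_self: "cinner x x = complex_of_real ((norm x)\<^sup>2)"

text \<open>The type of bounded operators \<open>'h \<Rightarrow>\<^sub>L 'h\<close> of the library consists of the real-linear ones.\<close>

definition clinear_op :: "('h::chilbert \<Rightarrow>\<^sub>L 'h) \<Rightarrow> bool" where
  "clinear_op T \<longleftrightarrow> (\<forall>c x. T (scaleC c x) = scaleC c (T x))"

definition scalar_op :: "complex \<Rightarrow> ('h::chilbert \<Rightarrow>\<^sub>L 'h)" where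
  "scalar_op c = Blinfun (scaleC c)"

definition adj :: "('h::chilbert \<Rightarrow>\<^sub>L 'h) \<Rightarrow> ('h \<Rightarrow>\<^sub>L 'h)" where
  "adj T = (THE S. \<forall>x y. cinner (T x) y = cinner x (blinfun_apply S y))"

definition pos_op :: "('h::chilbert \<Rightarrow>\<^sub>L 'h) \<Rightarrow> bool" where
  "pos_op T \<longleftrightarrow> clinear_op T \<and> (\<forall>x. Im (cinner (T x) x) = 0 \<and> 0 \<le> Re (cinner (T x) x))"

definition commutant :: "('h::chilbert \<Rightarrow>\<^sub>L 'h) set \<Rightarrow> ('h \<Rightarrow>\<^sub>L 'h) set" where
  "commutant X = {T. clinear_op T \<and> (\<forall>S\<in>X. T o\<^sub>L S = S o\<^sub>L T)}"

definition von_Neumann_algebra :: "('h::chilbert \<Rightarrow>\<^sub>L 'h) set \<Rightarrow> bool" where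
  "von_Neumann_algebra A \<longleftrightarrow>
     (\<forall>a\<in>A. clinear_op a \<and> adj a \<in> A) \<and> commutant (commutant A) = A"

definition normal_faithful_trace ::
  "('h::chilbert \<Rightarrow>\<^sub>L 'h) set \<Rightarrow> (('h \<Rightarrow>\<^sub>L 'h) \<Rightarrow> complex) \<Rightarrow> bool" where
  "normal_faithful_trace A tr \<longleftrightarrow>
     (\<forall>a\<in>A. \<forall>b\<in>A. tr (a + b) = tr a + tr b) \<and>
     (\<forall>c. \<forall>a\<in>A. tr (scalar_op c o\<^sub>L a) = c * tr a) \<and>
     (\<forall>a\<in>A. \<forall>b\<in>A. tr (a o\<^sub>L b) = tr (b o\<^sub>L a)) \<and>
     (\<forall>a\<in>A. pos_op a \<longrightarrow> Im (tr a) = 0 \<and> 0 \<le> Re (tr a)) \<and>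
     (\<forall>a\<in>A. pos_op a \<and> tr a = 0 \<longrightarrow> a = 0) \<and>
     \<comment> \<open>normality: suprema of upward directed sets of positive elements are preserved\<close>
     (\<forall>D s. D \<noteq> {} \<and> D \<subseteq> {a\<in>A. pos_op a} \<and>
        (\<forall>a\<in>D. \<forall>b\<in>D. \<exists>c\<in>D. pos_op (c - a) \<and> pos_op (c - b)) \<and>
        s \<in> A \<and> (\<forall>a\<in>D. pos_op (s - a)) \<and>
        (\<forall>b\<in>A. (\<forall>a\<in>D. pos_op (b - a)) \<longrightarrow> pos_op (b - s))
        \<longrightarrow> Re (tr s) = (SUP a\<in>D. Re (tr a)))"

definition vn_ring :: "('h::chilbert \<Rightarrow>\<^sub>L 'h) set \<Rightarrow> ('h \<Rightarrow>\<^sub>L 'h) ring" where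
  "vn_ring A = \<lparr>carrier = A, mult = (o\<^sub>L), one = id_blinfun, ring.zero = 0, ring.add = (+)\<rparr>"


section \<open>The algebra of affiliated operators\<close>

text \<open>\<open>\<iota>\<close> exhibits the Hilbert space \<open>'l\<close> as the completion \<open>l\<^sup>2(A)\<close> of \<open>A\<close> for the inner product
  \<open>\<langle>a, b\<rangle> = tr (a b*)\<close>; this determines \<open>'l\<close> and \<open>\<iota>\<close> up to unique unitary equivalence.\<close>

definition l2_completion ::
  "('h::chilbert \<Rightarrow>\<^sub>L 'h) set \<Rightarrow> (('h \<Rightarrow>\<^sub>L 'h) \<Rightarrow> complex) \<Rightarrow> (('h \<Rightarrow>\<^sub>L 'h) \<Rightarrow> 'l::chilbert) \<Rightarrow> bool" where
  "l2_completion A tr \<iota> \<longleftrightarrow>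
     (\<forall>a\<in>A. \<forall>b\<in>A. \<iota> (a + b) = \<iota> a + \<iota> b) \<and>
     (\<forall>c. \<forall>a\<in>A. \<iota> (scalar_op c o\<^sub>L a) = scaleC c (\<iota> a)) \<and>
     (\<forall>a\<in>A. \<forall>b\<in>A. cinner (\<iota> a) (\<iota> b) = tr (a o\<^sub>L adj b)) \<and>
     closure (\<iota> ` A) = UNIV"

text \<open>The action of \<open>a \<in> A\<close> on \<open>l\<^sup>2(A)\<close>, the continuous extension of left multiplication.\<close>

definition left_mult ::
  "('h::chilbert \<Rightarrow>\<^sub>L 'h) set \<Rightarrow> (('h \<Rightarrow>\<^sub>L 'h) \<Rightarrow> 'l::chilbert) \<Rightarrow> ('h \<Rightarrow>\<^sub>L 'h) \<Rightarrow> ('l \<Rightarrow>\<^sub>L 'l)" where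
  "left_mult A \<iota> a = (THE T. \<forall>b\<in>A. blinfun_apply T (\<iota> b) = \<iota> (a o\<^sub>L b))"

text \<open>Unbounded operators on \<open>'l\<close> are represented by their graphs.\<close>

definition op_graph :: "('l::chilbert \<Rightarrow>\<^sub>L 'l) \<Rightarrow> ('l \<times> 'l) set" where
  "op_graph T = {(x, T x) | x. True}"

definition closed_densely_defined :: "('l::chilbert \<times> 'l) set \<Rightarrow> bool" where
  "closed_densely_defined T \<longleftrightarrow>
     (0, 0) \<in> T \<and>
     (\<forall>x y x' y'. (x, y) \<in> T \<and> (x', y') \<in> T \<longrightarrow> (x + x', y + y') \<in> T) \<and>
     (\<forall>c x y. (x, y) \<in> T \<longrightarrow> (scaleC c x, scaleC c y) \<in> T) \<and>
     single_valued T \<and> closed T \<and> closure (Domain T) = UNIV"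

definition affiliated :: "('l::chilbert \<Rightarrow>\<^sub>L 'l) set \<Rightarrow> ('l \<times> 'l) set \<Rightarrow> bool" where
  "affiliated B T \<longleftrightarrow> closed_densely_defined T \<and>
     (\<forall>S\<in>commutant B. \<forall>x y. (x, y) \<in> T \<longrightarrow> (S x, S y) \<in> T)"

text \<open>Sum and product of affiliated operators are the closures of the operator sum and of the
  composition (\<open>T O S\<close> is the graph of \<open>x \<mapsto> S (T x)\<close>).\<close>

definition affiliated_ring :: "('l::chilbert \<Rightarrow>\<^sub>L 'l) set \<Rightarrow> (('l \<times> 'l) set) ring" where
  "affiliated_ring B =
     \<lparr>carrier = {T. affiliated B T},
      mult = (\<lambda>S T. closure (T O S)),
      one = op_graph id_blinfun,
      ring.zero = op_graph 0,
      ring.add = (\<lambda>S T. closure {(x, y + z) | x y z. (x, y) \<in> S \<and> (x, z) \<in> T})\<rparr>"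

definition U_ring ::
  "('h::chilbert \<Rightarrow>\<^sub>L 'h) set \<Rightarrow> (('h \<Rightarrow>\<^sub>L 'h) \<Rightarrow> 'l::chilbert) \<Rightarrow> (('l \<times> 'l) set) ring" where
  "U_ring A \<iota> = affiliated_ring (left_mult A \<iota> ` A)"


section \<open>Left and right modules over a ring\<close>

text \<open>The library's record \<open>module\<close> and locale \<open>submodule\<close> are used as they stand, but its locale
  for modules is restricted to commutative rings.  The record fields \<open>mult\<close> and \<open>one\<close> of a module
  play no role.\<close>

definition left_module :: "('a, 'r) ring_scheme \<Rightarrow> ('a, 'b, 'm) module_scheme \<Rightarrow> bool" where
  "left_module R M \<longleftrightarrow> ring R \<and> abelian_group M \<and>
     (\<forall>a\<in>carrier R. \<forall>x\<in>carrier M. a \<odot>\<^bsub>M\<^esub> x \<in> carrier M) \<and>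
     (\<forall>a\<in>carrier R. \<forall>b\<in>carrier R. \<forall>x\<in>carrier M.
        (a \<oplus>\<^bsub>R\<^esub> b) \<odot>\<^bsub>M\<^esub> x = a \<odot>\<^bsub>M\<^esub> x \<oplus>\<^bsub>M\<^esub> b \<odot>\<^bsub>M\<^esub> x) \<and>
     (\<forall>a\<in>carrier R. \<forall>x\<in>carrier M. \<forall>y\<in>carrier M.
        a \<odot>\<^bsub>M\<^esub> (x \<oplus>\<^bsub>M\<^esub> y) = a \<odot>\<^bsub>M\<^esub> x \<oplus>\<^bsub>M\<^esub> a \<odot>\<^bsub>M\<^esub> y) \<and>
     (\<forall>a\<in>carrier R. \<forall>b\<in>carrier R. \<forall>x\<in>carrier M.
        (a \<otimes>\<^bsub>R\<^esub> b) \<odot>\<^bsub>M\<^esub> x = a \<odot>\<^bsub>M\<^esub> (b \<odot>\<^bsub>M\<^esub> x)) \<and>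
     (\<forall>x\<in>carrier M. \<one>\<^bsub>R\<^esub> \<odot>\<^bsub>M\<^esub> x = x)"

text \<open>A right module is a left module over the opposite ring, so \<open>a \<odot>\<^bsub>N\<^esub> x\<close> stands for \<open>x a\<close>.\<close>

definition right_module :: "('a, 'r) ring_scheme \<Rightarrow> ('a, 'b, 'm) module_scheme \<Rightarrow> bool" where
  "right_module R N \<longleftrightarrow> left_module (R\<lparr>mult := \<lambda>a b. b \<otimes>\<^bsub>R\<^esub> a\<rparr>) N"

definition mod_hom ::
  "('a, 'r) ring_scheme \<Rightarrow> ('a, 'b, 'm) module_scheme \<Rightarrow> ('a, 'c, 'n) module_scheme \<Rightarrow> ('b \<Rightarrow> 'c) set"
  where
  "mod_hom R M N = {h \<in> carrier M \<rightarrow> carrier N.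
     (\<forall>x\<in>carrier M. \<forall>y\<in>carrier M. h (x \<oplus>\<^bsub>M\<^esub> y) = h x \<oplus>\<^bsub>N\<^esub> h y) \<and>
     (\<forall>a\<in>carrier R. \<forall>x\<in>carrier M. h (a \<odot>\<^bsub>M\<^esub> x) = a \<odot>\<^bsub>N\<^esub> h x)}"

definition mod_iso ::
  "('a, 'r) ring_scheme \<Rightarrow> ('a, 'b, 'm) module_scheme \<Rightarrow> ('a, 'c, 'n) module_scheme \<Rightarrow> ('b \<Rightarrow> 'c) set"
  where
  "mod_iso R M N = {h \<in> mod_hom R M N. bij_betw h (carrier M) (carrier N)}"

definition mod_isomorphic ::
  "('a, 'r) ring_scheme \<Rightarrow> ('a, 'b, 'm) module_scheme \<Rightarrow> ('a, 'c, 'n) module_scheme \<Rightarrow> bool" where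
  "mod_isomorphic R M N \<longleftrightarrow> mod_iso R M N \<noteq> {}"

definition restrict_mod :: "('a, 'b, 'm) module_scheme \<Rightarrow> 'b set \<Rightarrow> ('a, 'b, 'm) module_scheme" where
  "restrict_mod M N = M\<lparr>carrier := N\<rparr>"

definition quot_mod :: "('a, 'b, 'm) module_scheme \<Rightarrow> 'b set \<Rightarrow> ('a, 'b set) module" where
  "quot_mod M K =
     \<lparr>carrier = a_rcosets\<^bsub>M\<^esub> K, mult = undefined, one = undefined,
      ring.zero = K, ring.add = set_add M, smult = (\<lambda>a X. \<Union>x\<in>X. K +>\<^bsub>M\<^esub> (a \<odot>\<^bsub>M\<^esub> x))\<rparr>"

definition fin_gen :: "('a, 'r) ring_scheme \<Rightarrow> ('a, 'b, 'm) module_scheme \<Rightarrow> bool" where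
  "fin_gen R M \<longleftrightarrow> (\<exists>S. finite S \<and> S \<subseteq> carrier M \<and>
     (\<forall>N. submodule N R M \<and> S \<subseteq> N \<longrightarrow> N = carrier M))"

text \<open>The free left module \<open>R\<^sup>n\<close>, consisting of functions on \<open>{..<n}\<close>.\<close>

definition free_mod :: "('a, 'r) ring_scheme \<Rightarrow> nat \<Rightarrow> ('a, nat \<Rightarrow> 'a) module" where
  "free_mod R n =
     \<lparr>carrier = {..<n} \<rightarrow>\<^sub>E carrier R, mult = undefined, one = undefined,
      ring.zero = (\<lambda>i\<in>{..<n}. \<zero>\<^bsub>R\<^esub>), ring.add = (\<lambda>x y. \<lambda>i\<in>{..<n}. x i \<oplus>\<^bsub>R\<^esub> y i),
      smult = (\<lambda>a x. \<lambda>i\<in>{..<n}. a \<otimes>\<^bsub>R\<^esub> x i)\<rparr>"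

definition fg_projective :: "('a, 'r) ring_scheme \<Rightarrow> ('a, 'b, 'm) module_scheme \<Rightarrow> bool" where
  "fg_projective R P \<longleftrightarrow> left_module R P \<and>
     (\<exists>n S S'. submodule S R (free_mod R n) \<and> submodule S' R (free_mod R n) \<and>
        S \<inter> S' = {\<zero>\<^bsub>free_mod R n\<^esub>} \<and> S <+>\<^bsub>free_mod R n\<^esub> S' = carrier (free_mod R n) \<and>
        mod_isomorphic R P (restrict_mod (free_mod R n) S))"

definition directed_on :: "'i set \<Rightarrow> ('i \<Rightarrow> 'i \<Rightarrow> bool) \<Rightarrow> bool" where
  "directed_on I leq \<longleftrightarrow> I \<noteq> {} \<and> (\<forall>i\<in>I. leq i i) \<and>
     (\<forall>i\<in>I. \<forall>j\<in>I. \<forall>k\<in>I. leq i j \<and> leq j k \<longrightarrow> leq i k) \<and>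
     (\<forall>i\<in>I. \<forall>j\<in>I. \<exists>k\<in>I. leq i k \<and> leq j k)"

text \<open>The direct limit of modules \<open>M i\<close> along maps \<open>\<phi> i j : M i \<rightarrow> M j\<close> (for \<open>leq i j\<close>): the disjoint
  union of the \<open>M i\<close> modulo eventual equality.\<close>

definition dl_class ::
  "'i set \<Rightarrow> ('i \<Rightarrow> 'i \<Rightarrow> bool) \<Rightarrow> ('i \<Rightarrow> ('a, 'b, 'm) module_scheme) \<Rightarrow> ('i \<Rightarrow> 'i \<Rightarrow> 'b \<Rightarrow> 'b) \<Rightarrow>
    'i \<Rightarrow> 'b \<Rightarrow> ('i \<times> 'b) set" where
  "dl_class I leq M \<phi> i x =
     {(j, y). j \<in> I \<and> y \<in> carrier (M j) \<and> (\<exists>k\<in>I. leq i k \<and> leq j k \<and> \<phi> i k x = \<phi> j k y)}"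

definition direct_limit ::
  "'i set \<Rightarrow> ('i \<Rightarrow> 'i \<Rightarrow> bool) \<Rightarrow> ('i \<Rightarrow> ('a, 'b, 'm) module_scheme) \<Rightarrow> ('i \<Rightarrow> 'i \<Rightarrow> 'b \<Rightarrow> 'b) \<Rightarrow>
    ('a, ('i \<times> 'b) set) module" where
  "direct_limit I leq M \<phi> =
     \<lparr>carrier = {dl_class I leq M \<phi> i x | i x. i \<in> I \<and> x \<in> carrier (M i)},
      mult = undefined, one = undefined,
      ring.zero = (\<Union>i\<in>I. dl_class I leq M \<phi> i \<zero>\<^bsub>M i\<^esub>),
      ring.add = (\<lambda>X Y. \<Union>{dl_class I leq M \<phi> k (\<phi> i k x \<oplus>\<^bsub>M k\<^esub> \<phi> j k y) | i x j y k.
               (i, x) \<in> X \<and> (j, y) \<in> Y \<and> k \<in> I \<and> leq i k \<and> leq j k}),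
      smult = (\<lambda>a X. \<Union>{dl_class I leq M \<phi> i (a \<odot>\<^bsub>M i\<^esub> x) | i x. i \<in> I \<and> (i, x) \<in> X})\<rparr>"


section \<open>Tensor products and flatness\<close>

text \<open>The tensor product of a right module \<open>N\<close> and a left module \<open>M\<close>, as a (multiplicatively
  written) abelian group.\<close>

definition tensor_rels ::
  "('a, 'r) ring_scheme \<Rightarrow> ('a, 'b, 'm) module_scheme \<Rightarrow> ('a, 'c, 'n) module_scheme \<Rightarrow>
    (('b \<times> 'c) \<Rightarrow>\<^sub>0 int) set" where
  "tensor_rels R N M = generate (free_Abelian_group (carrier N \<times> carrier M))
     ({frag_of (x \<oplus>\<^bsub>N\<^esub> y, m) - frag_of (x, m) - frag_of (y, m) | x y m.
         x \<in> carrier N \<and> y \<in> carrier N \<and> m \<in> carrier M} \<union>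
      {frag_of (x, m \<oplus>\<^bsub>M\<^esub> m') - frag_of (x, m) - frag_of (x, m') | x m m'.
         x \<in> carrier N \<and> m \<in> carrier M \<and> m' \<in> carrier M} \<union>
      {frag_of (a \<odot>\<^bsub>N\<^esub> x, m) - frag_of (x, a \<odot>\<^bsub>M\<^esub> m) | a x m.
         a \<in> carrier R \<and> x \<in> carrier N \<and> m \<in> carrier M})"

definition tensor ::
  "('a, 'r) ring_scheme \<Rightarrow> ('a, 'b, 'm) module_scheme \<Rightarrow> ('a, 'c, 'n) module_scheme \<Rightarrow>
    (('b \<times> 'c) \<Rightarrow>\<^sub>0 int) set monoid" where
  "tensor R N M = free_Abelian_group (carrier N \<times> carrier M) Mod tensor_rels R N M"

definition tensor_class ::
  "('a, 'r) ring_scheme \<Rightarrow> ('a, 'b, 'm) module_scheme \<Rightarrow> ('a, 'c, 'n) module_scheme \<Rightarrow>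
    (('b \<times> 'c) \<Rightarrow>\<^sub>0 int) \<Rightarrow> (('b \<times> 'c) \<Rightarrow>\<^sub>0 int) set" where
  "tensor_class R N M c =
     tensor_rels R N M #>\<^bsub>free_Abelian_group (carrier N \<times> carrier M)\<^esub> c"

definition tensor_map ::
  "('a, 'r) ring_scheme \<Rightarrow> ('a, 'b, 'm) module_scheme \<Rightarrow> ('a, 'c, 'n) module_scheme \<Rightarrow>
    ('b \<Rightarrow> 'c) \<Rightarrow> ('a, 'd, 'k) module_scheme \<Rightarrow>
    (('b \<times> 'd) \<Rightarrow>\<^sub>0 int) set \<Rightarrow> (('c \<times> 'd) \<Rightarrow>\<^sub>0 int) set" where
  "tensor_map R N N' f M X =
     (\<Union>c\<in>X. tensor_class R N' M (frag_extend (\<lambda>(x, m). frag_of (f x, m)) c))"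

text \<open>Flatness with respect to injections of right modules whose carriers live in the type \<open>'n\<close>;
  HOL cannot quantify over all types here.  As right ideals suffice to test flatness, any type
  \<open>'n\<close> into which the type of the ring elements embeds yields the usual notion.\<close>

definition flat :: "'n itself \<Rightarrow> ('a, 'r) ring_scheme \<Rightarrow> ('a, 'b, 'm) module_scheme \<Rightarrow> bool" where
  "flat (_ :: 'n itself) R M \<longleftrightarrow>
     (\<forall>(N :: ('a, 'n) module) (N' :: ('a, 'n) module) f.
        right_module R N \<and> right_module R N' \<and> f \<in> mod_hom R N N' \<and> inj_on f (carrier N) \<longrightarrow>
        inj_on (tensor_map R N N' f M) (carrier (tensor R N M)))"


section \<open>Dimension, torsion and closures\<close>

text \<open>An endomorphism \<open>x \<mapsto> x e\<close> of the left module \<open>A\<^sup>n\<close> of row vectors is given by an \<open>n \<times> n\<close> matrix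
  \<open>e\<close>; its adjoint is given by the conjugate transpose.\<close>

definition proj_matrix ::
  "('h::chilbert \<Rightarrow>\<^sub>L 'h) set \<Rightarrow> nat \<Rightarrow> (nat \<Rightarrow> nat \<Rightarrow> ('h \<Rightarrow>\<^sub>L 'h)) \<Rightarrow> bool" where
  "proj_matrix A n e \<longleftrightarrow>
     (\<forall>i<n. \<forall>j<n. e i j \<in> A \<and> adj (e i j) = e j i \<and> (\<Sum>k<n. e i k o\<^sub>L e k j) = e i j)"

definition matrix_image ::
  "('h::chilbert \<Rightarrow>\<^sub>L 'h) set \<Rightarrow> nat \<Rightarrow> (nat \<Rightarrow> nat \<Rightarrow> ('h \<Rightarrow>\<^sub>L 'h)) \<Rightarrow> (nat \<Rightarrow> ('h \<Rightarrow>\<^sub>L 'h)) set" where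
  "matrix_image A n e =
     (\<lambda>x. \<lambda>j\<in>{..<n}. \<Sum>i<n. x i o\<^sub>L e i j) ` carrier (free_mod (vn_ring A) n)"

definition dim_proj ::
  "('h::chilbert \<Rightarrow>\<^sub>L 'h) set \<Rightarrow> (('h \<Rightarrow>\<^sub>L 'h) \<Rightarrow> complex) \<Rightarrow>
    ('h \<Rightarrow>\<^sub>L 'h, 'b, 'm) module_scheme \<Rightarrow> real" where
  "dim_proj A tr P =
     (let (n, e) = SOME (n, e). proj_matrix A n e \<and>
            mod_isomorphic (vn_ring A) P (restrict_mod (free_mod (vn_ring A) n) (matrix_image A n e))
      in Re (\<Sum>i<n. tr (e i i)))"

definition dim_mod ::
  "('h::chilbert \<Rightarrow>\<^sub>L 'h) set \<Rightarrow> (('h \<Rightarrow>\<^sub>L 'h) \<Rightarrow> complex) \<Rightarrow>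
    ('h \<Rightarrow>\<^sub>L 'h, 'b, 'm) module_scheme \<Rightarrow> ereal" where
  "dim_mod A tr M =
     (SUP P \<in> {P. submodule P (vn_ring A) M \<and> fg_projective (vn_ring A) (restrict_mod M P)}.
        ereal (dim_proj A tr (restrict_mod M P)))"

definition T_sub ::
  "('h::chilbert \<Rightarrow>\<^sub>L 'h) set \<Rightarrow> (('h \<Rightarrow>\<^sub>L 'h) \<Rightarrow> complex) \<Rightarrow>
    ('h \<Rightarrow>\<^sub>L 'h, 'b, 'm) module_scheme \<Rightarrow> 'b set" where
  "T_sub A tr M =
     (GREATEST N. submodule N (vn_ring A) M \<and> dim_mod A tr (restrict_mod M N) = 0)"

definition U_right_mod ::
  "('h::chilbert \<Rightarrow>\<^sub>L 'h) set \<Rightarrow> (('h \<Rightarrow>\<^sub>L 'h) \<Rightarrow> 'l::chilbert) \<Rightarrow> ('h \<Rightarrow>\<^sub>L 'h, ('l \<times> 'l) set) module" where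
  "U_right_mod A \<iota> =
     \<lparr>carrier = carrier (U_ring A \<iota>), mult = mult (U_ring A \<iota>), one = one (U_ring A \<iota>),
      ring.zero = ring.zero (U_ring A \<iota>), ring.add = ring.add (U_ring A \<iota>),
      smult = (\<lambda>a u. u \<otimes>\<^bsub>U_ring A \<iota>\<^esub> op_graph (left_mult A \<iota> a))\<rparr>"

definition t_sub ::
  "('h::chilbert \<Rightarrow>\<^sub>L 'h) set \<Rightarrow> (('h \<Rightarrow>\<^sub>L 'h) \<Rightarrow> 'l::chilbert) \<Rightarrow>
    ('h \<Rightarrow>\<^sub>L 'h, 'b, 'm) module_scheme \<Rightarrow> 'b set" where
  "t_sub A \<iota> M = {m \<in> carrier M.
     tensor_class (vn_ring A) (U_right_mod A \<iota>) M (frag_of (\<one>\<^bsub>U_ring A \<iota>\<^esub>, m))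
       = \<one>\<^bsub>tensor (vn_ring A) (U_right_mod A \<iota>) M\<^esub>}"

definition cl_T ::
  "('h::chilbert \<Rightarrow>\<^sub>L 'h) set \<Rightarrow> (('h \<Rightarrow>\<^sub>L 'h) \<Rightarrow> complex) \<Rightarrow>
    ('h \<Rightarrow>\<^sub>L 'h, 'b, 'm) module_scheme \<Rightarrow> 'b set \<Rightarrow> 'b set" where
  "cl_T A tr F K = {x \<in> carrier F. K +>\<^bsub>F\<^esub> x \<in> T_sub A tr (quot_mod F K)}"

definition cl_t ::
  "('h::chilbert \<Rightarrow>\<^sub>L 'h) set \<Rightarrow> (('h \<Rightarrow>\<^sub>L 'h) \<Rightarrow> 'l::chilbert) \<Rightarrow>
    ('h \<Rightarrow>\<^sub>L 'h, 'b, 'm) module_scheme \<Rightarrow> 'b set \<Rightarrow> 'b set" where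
  "cl_t A \<iota> F K = {x \<in> carrier F. K +>\<^bsub>F\<^esub> x \<in> t_sub A \<iota> (quot_mod F K)}"

end

theory Submission
  imports Defs
begin

text \<open>
  Call \<open>a \<in> A\<close> regular if it is injective on the Hilbert space.  Regular elements satisfy the Ore
  condition, which is obtained from monotone strong limits of resolvents \<open>(1 + k)\<^sup>-\<^sup>1\<close> and the normality
  of the trace, without spectral theory or polar decomposition; and affiliated operators are
  fractions \<open>s\<^sup>-\<^sup>1 a\<close> with \<open>s\<close> regular.  Hence \<open>t M\<close> consists of the elements killed by a regular
  element, whereas \<open>T M\<close> consists of the elements none of whose multiples generates a nonzero
  projective submodule.

  If \<open>F\<close> is projective and \<open>K\<^sub>i\<close> is finitely generated, Gaussian elimination over the Ore ring \<open>A\<close> gives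
  finitely many functionals \<open>F \<rightarrow> A\<close> vanishing on \<open>K\<^sub>i\<close> whose common kernel is the set of \<open>x\<close> with
  \<open>s x \<in> K\<^sub>i\<close> for some regular \<open>s\<close>.  Torsion elements are killed by functionals, so this set is
  \<open>cl\<^sub>T K\<^sub>i\<close>, and the union over \<open>i\<close> is \<open>cl\<^sub>t K\<close>.  The isomorphisms follow from the isomorphism theorem
  and from the fact that direct limits commute with quotients.

  If \<open>M\<close> is flat, then regular elements act injectively on \<open>A \<otimes> M\<close>, so \<open>t M = 0\<close>.  Conversely let
  \<open>t M = 0\<close> and let \<open>d \<in> N \<otimes> M\<close> vanish in \<open>N' \<otimes> M\<close>.  The relations that witness this lift to \<open>F / K\<^sub>i\<close> for
  some \<open>i\<close>.  As \<open>A\<close> is semihereditary, the quotient \<open>F / cl\<^sub>T K\<^sub>i\<close>, through which \<open>F \<rightarrow> M\<close> factors, has a finite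
  dual basis; contracting \<open>d\<close> with its functionals gives elements of \<open>N\<close> that vanish in \<open>N'\<close>, so
  \<open>d = 0\<close>.
\<close>

section \<open>Operators on complex Hilbert spaces\<close>

text \<open>The relation \<open>t a = c s\<close> asks for a bounded operator
  \<open>t a s^-1\<close>, although \<open>a s^-1\<close> is in general unbounded. Damping by a
  resolvent of its square produces such a \<open>t\<close>; the difficulty is to show that
  \<open>t\<close> is injective, since it is only a strong limit. Finiteness enters through
  \<open>tau_res_commute\<close>: \<open>(1 + x adj x)^-1\<close> and
  \<open>(1 + adj x x)^-1\<close> have equal trace. This shows that injective elements have
  injective adjoints, and it supplies the uniform trace bound from which
  \<open>res_limit_injective\<close> excludes a kernel of the limit.

  On the module side only the vanishing of dimensions is tested. It is decided by annihilators,
  because the left annihilator of an element of \<open>A\<close> is cut out by its range projection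
  (\<open>left_annihilator\<close>).

  The two torsions differ in general: functionals detect \<open>T\<close>, regular multipliers
  detect \<open>t\<close>. Over a projective module they agree modulo finitely generated submodules,
  which is why the \<open>Ki\<close> appear in the statement. The test type of \<open>flat\<close>
  need not contain \<open>A\<close> itself, so \<open>A\<close> is moved there along an
  injection.\<close>

lemma cinner_add_right: "cinner x (y + z) = cinner x y + cinner x (z::'h::chilbert)"
  by (metis cinner_commute cinner_add_left complex_cnj_add)

lemma cinner_scaleC_right: "cinner x (scaleC c y) = cnj c * cinner x (y::'h::chilbert)"
  by (metis cinner_commute cinner_scaleC_left complex_cnj_mult)

lemma cinner_zero_left [simp]: "cinner 0 (x::'h::chilbert) = 0" using cinner_add_left[of 0 0 x] by simp

lemma cinner_zero_right [simp]: "cinner (x::'h::chilbert) 0 = 0" using cinner_add_right[of x 0 0] by simp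

lemma cinner_minus_left [simp]: "cinner (- x) (y::'h::chilbert) = - cinner x y"
  using cinner_add_left[of x "-x" y] by (simp add: eq_neg_iff_add_eq_0 add.commute)

lemma cinner_minus_right [simp]: "cinner x (- y) = - cinner x (y::'h::chilbert)"
  using cinner_add_right[of x y "-y"] by (simp add: eq_neg_iff_add_eq_0 add.commute)

lemma cinner_diff_left: "cinner (x - y) (z::'h::chilbert) = cinner x z - cinner y z"
  using cinner_add_left[of x "-y" z] by simp

lemma cinner_diff_right: "cinner x (y - z) = cinner x y - cinner x (z::'h::chilbert)"
  using cinner_add_right[of x y "-z"] by simp

lemma cinner_scaleR_left: "cinner (r *\<^sub>R x) (y::'h::chilbert) = of_real r * cinner x y"
  by (metis scaleC_complex_of_real cinner_scaleC_left)

lemma cinner_scaleR_right: "cinner x (r *\<^sub>R y) = of_real r * cinner x (y::'h::chilbert)"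
  using cinner_scaleC_right[of x "of_real r" y] by (simp add: scaleC_complex_of_real)

lemmas cinner_simps = cinner_add_left cinner_add_right cinner_diff_left cinner_diff_right
  cinner_scaleC_left cinner_scaleC_right cinner_scaleR_left cinner_scaleR_right

lemma scaleC_one [simp]: "scaleC 1 (x::'h::chilbert) = x" using scaleC_complex_of_real[of 1 x] by simp

lemma scaleC_zero_left [simp]: "scaleC 0 (x::'h::chilbert) = 0" using scaleC_complex_of_real[of 0 x] by simp

lemma scaleC_zero_right [simp]: "scaleC c (0::'h::chilbert) = 0" using scaleC_add_right[of c 0 0] by simp

lemma scaleC_minus_right: "scaleC c (- x) = - scaleC c (x::'h::chilbert)"
  using scaleC_add_right[of c x "-x"] by (simp add: eq_neg_iff_add_eq_0 add.commute)

lemma scaleC_diff_right: "scaleC c (x - y) = scaleC c x - scaleC c (y::'h::chilbert)"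
  using scaleC_add_right[of c x "-y"] by (simp add: scaleC_minus_right)

lemma scaleC_minus_one: "scaleC (-1) (x::'h::chilbert) = - x"
  using scaleC_complex_of_real[of "-1" x] by simp

lemma scaleC_scaleR: "scaleC c (r *\<^sub>R x) = r *\<^sub>R scaleC c (x::'h::chilbert)"
  by (simp add: scaleC_complex_of_real[symmetric] scaleC_scaleC mult.commute)

lemma cinner_self_Re: "Re (cinner x x) = (norm (x::'h::chilbert))\<^sup>2" by (simp add: cinner_self)

lemma cinner_self_Im [simp]: "Im (cinner x (x::'h::chilbert)) = 0" by (simp add: cinner_self)

lemma cinner_self_eq_zero [simp]: "cinner x x = 0 \<longleftrightarrow> (x::'h::chilbert) = 0" by (simp add: cinner_self)

lemma cinner_eqI: "(\<And>z. cinner x z = cinner y z) \<Longrightarrow> x = (y::'h::chilbert)"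
  by (metis cinner_diff_left cinner_self_eq_zero eq_iff_diff_eq_0)

lemma cinner_eqI_right: "(\<And>z. cinner z x = cinner z y) \<Longrightarrow> x = (y::'h::chilbert)"
  by (metis cinner_diff_right cinner_self_eq_zero eq_iff_diff_eq_0)

lemma Re_cinner_commute: "Re (cinner x y) = Re (cinner y (x::'h::chilbert))" by (subst cinner_commute) simp

lemma norm_scaleC: "norm (scaleC c x) = cmod c * norm (x::'h::chilbert)"
proof -
  have "of_real ((norm (scaleC c x))\<^sup>2) = (of_real ((cmod c * norm x)\<^sup>2) :: complex)"
    unfolding cinner_self[symmetric] cinner_scaleC_left cinner_scaleC_right
    by (simp add: cinner_self power_mult_distrib mult.assoc[symmetric] complex_norm_square[symmetric]
        del: of_real_power)
       (metis complex_norm_square mult.commute)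
  then have "(norm (scaleC c x))\<^sup>2 = (cmod c * norm x)\<^sup>2" using of_real_eq_iff by blast
  then show ?thesis by (simp add: power2_eq_iff_nonneg)
qed

text \<open>Cancels one factor \<open>n\<close> and absorbs the case \<open>n = 0\<close>. It closes
  the norm estimates for adjoints, where Cauchy-Schwarz bounds the square of a norm by a product
  that contains this norm.\<close>

lemma sq_le_imp_le:
  fixes n t x :: real
  assumes "n\<^sup>2 \<le> (t * n) * x" "0 \<le> t" "0 \<le> x"
  shows "n \<le> t * x"
proof (cases "n \<le> 0")
  case True
  with assms show ?thesis by (meson mult_nonneg_nonneg order.trans)
next
  case False
  have "n * n \<le> n * (t * x)" using assms(1) by (simp add: power2_eq_square mult_ac)
  with False show ?thesis by simp
qed

lemma cnj_sgn_mult: "cnj (sgn z) * z = of_real (cmod z)"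
proof (cases "z = 0")
  case False
  have "cnj (sgn z) * z = (z * cnj z) / of_real (cmod z)"
    by (simp add: sgn_div_norm scaleR_conv_of_real field_simps)
  also have "\<dots> = of_real (cmod z)"
    using False by (simp add: complex_norm_square[symmetric] power2_eq_square)
  finally show ?thesis .
qed simp

lemma quadratic_discriminant_le:
  fixes a b c :: real
  assumes c: "c \<ge> 0" and q: "\<And>t. 0 \<le> a + 2 * t * b + t\<^sup>2 * c"
  shows "b\<^sup>2 \<le> a * c"
proof (cases "c = 0")
  case True
  have "b = 0"
  proof (rule ccontr)
    assume "b \<noteq> 0"
    \<comment> \<open>With \<open>c = 0\<close> the polynomial is affine in \<open>t\<close>, and
      here it takes the value -1.\<close>
    then show False using q[of "- (a + 1) / (2 * b)"] True by (simp add: field_simps)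
  qed
  with True show ?thesis by simp
next
  case False
  then have "0 \<le> c * (a + 2 * (-b / c) * b + (-b / c)\<^sup>2 * c)"
    using q[of "-b / c"] c by (intro mult_nonneg_nonneg) auto
  also have "\<dots> = a * c - b\<^sup>2" using False by (simp add: field_simps power2_eq_square)
  finally show ?thesis by simp
qed

text \<open>Semi-definiteness is enough, so one inequality serves the inner product and the forms
  \<open>cinner (k x) y\<close> of positive operators \<open>k\<close> that may have a
  kernel.\<close>

lemma sesquilinear_Cauchy_Schwarz:
  fixes B :: "'h::chilbert \<Rightarrow> 'h \<Rightarrow> complex"
  assumes add: "\<And>x y z. B (x + y) z = B x z + B y z"
    and sc: "\<And>c x y. B (scaleC c x) y = c * B x y"
    and sym: "\<And>x y. B x y = cnj (B y x)"
    and pos: "\<And>x. 0 \<le> Re (B x x)"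
  shows "(cmod (B x y))\<^sup>2 \<le> Re (B x x) * Re (B y y)"
proof -
  have addr: "B x (y + z) = B x y + B x z" for x y z by (metis add sym complex_cnj_add)
  have scr: "B x (scaleC c y) = cnj c * B x y" for c x y by (metis sc sym complex_cnj_mult)
  \<comment> \<open>Rotating \<open>y\<close> by the phase of \<open>B x y\<close> makes
    \<open>B x w\<close> real and nonnegative, so that a real parameter \<open>t\<close> suffices
    below. The value 1 in the degenerate case keeps the factor unimodular.\<close>
  define w where "w = scaleC (if B x y = 0 then 1 else sgn (B x y)) y"
  have cu: "cmod (if B x y = 0 then 1 else sgn (B x y)) = 1" by (simp add: norm_sgn)
  have Bxw: "B x w = of_real (cmod (B x y))"
  proof (cases "B x y = 0")
    case False
    then show ?thesis using cnj_sgn_mult[of "B x y"] by (simp add: w_def scr)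
  qed (simp add: w_def scr)
  have Bwx: "B w x = of_real (cmod (B x y))" using Bxw sym[of w x] by simp
  have Bww: "Re (B w w) = Re (B y y)"
  proof -
    have "B w w = (if B x y = 0 then 1 else sgn (B x y)) * cnj (if B x y = 0 then 1 else sgn (B x y)) * B y y"
      by (simp add: w_def sc scr mult.assoc)
    then show ?thesis using cu by (metis complex_norm_square mult_1 of_real_1 power_one)
  qed
  have "0 \<le> Re (B x x) + 2 * t * cmod (B x y) + t\<^sup>2 * Re (B y y)" for t :: real
  proof -
    have "0 \<le> Re (B (x + scaleC (of_real t) w) (x + scaleC (of_real t) w))" by (rule pos)
    also have "\<dots> = Re (B x x) + 2 * t * cmod (B x y) + t\<^sup>2 * Re (B y y)"
      by (simp add: add sc addr scr Bxw Bwx Bww power2_eq_square algebra_simps)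
    finally show ?thesis .
  qed
  from quadratic_discriminant_le[OF pos this] show ?thesis .
qed

lemma cinner_Cauchy_Schwarz: "cmod (cinner x y) \<le> norm x * norm (y::'h::chilbert)"
proof -
  have "(cmod (cinner x y))\<^sup>2 \<le> Re (cinner x x) * Re (cinner y y)" by (rule sesquilinear_Cauchy_Schwarz)
      (auto simp: cinner_simps cinner_self_Re intro: cinner_commute)
  then have "(cmod (cinner x y))\<^sup>2 \<le> (norm x * norm y)\<^sup>2" by (simp add: cinner_self_Re power_mult_distrib)
  then show ?thesis by (rule power2_le_imp_le) simp
qed

lemma bounded_linear_scaleC: "bounded_linear (scaleC c :: 'h::chilbert \<Rightarrow> 'h)"
  by (rule bounded_linear_intro[where K="cmod c"])
    (simp_all add: scaleC_add_right scaleC_scaleR norm_scaleC mult.commute)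

lemma bounded_bilinear_cinner: "bounded_bilinear (cinner :: 'h::chilbert \<Rightarrow> 'h \<Rightarrow> complex)"
  by (rule bounded_bilinear.intro)
    (auto simp: cinner_simps scaleR_conv_of_real intro!: exI[of _ 1] cinner_Cauchy_Schwarz)

lemmas tendsto_cinner = bounded_bilinear.tendsto[OF bounded_bilinear_cinner]
lemmas tendsto_scaleC = bounded_linear.tendsto[OF bounded_linear_scaleC]

lemma norm_sq_add: "(norm (x + y))\<^sup>2 = (norm x)\<^sup>2 + 2 * Re (cinner x y) + (norm (y::'h::chilbert))\<^sup>2"
  by (simp add: cinner_self_Re[symmetric] cinner_simps Re_cinner_commute[of y x])

lemma norm_sq_diff: "(norm (x - y))\<^sup>2 = (norm x)\<^sup>2 - 2 * Re (cinner x y) + (norm (y::'h::chilbert))\<^sup>2"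
  using norm_sq_add[of x "-y"] by simp

lemma parallelogram_law:
  "(norm (x + y))\<^sup>2 + (norm (x - y))\<^sup>2 = 2 * (norm x)\<^sup>2 + 2 * (norm (y::'h::chilbert))\<^sup>2"
  by (simp add: norm_sq_add norm_sq_diff)

section \<open>Orthogonal projections and the Riesz representation\<close>

definition csubspace :: "'h::chilbert set \<Rightarrow> bool" where
  "csubspace V \<longleftrightarrow> 0 \<in> V \<and> (\<forall>x\<in>V. \<forall>y\<in>V. x + y \<in> V) \<and> (\<forall>c. \<forall>x\<in>V. scaleC c x \<in> V)"

lemma csubspaceD:
  assumes "csubspace V"
  shows "0 \<in> V" "x \<in> V \<Longrightarrow> y \<in> V \<Longrightarrow> x + y \<in> V" "x \<in> V \<Longrightarrow> scaleC c x \<in> V"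
    "x \<in> V \<Longrightarrow> r *\<^sub>R x \<in> V" "x \<in> V \<Longrightarrow> - x \<in> V" "x \<in> V \<Longrightarrow> y \<in> V \<Longrightarrow> x - y \<in> V"
proof -
  show 1: "0 \<in> V" "x \<in> V \<Longrightarrow> y \<in> V \<Longrightarrow> x + y \<in> V" "\<And>c x. x \<in> V \<Longrightarrow> scaleC c x \<in> V" for x y
    using assms by (auto simp: csubspace_def)
  show "x \<in> V \<Longrightarrow> r *\<^sub>R x \<in> V" by (metis 1(3) scaleC_complex_of_real)
  show 2: "x \<in> V \<Longrightarrow> - x \<in> V" for x by (metis 1(3) scaleC_minus_one)
  show "x \<in> V \<Longrightarrow> y \<in> V \<Longrightarrow> x - y \<in> V" by (metis 1(2) 2 diff_conv_add_uminus)
qed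

lemma csubspace_closure:
  assumes "csubspace V" shows "csubspace (closure V)" unfolding csubspace_def
proof (intro conjI ballI allI)
  show "0 \<in> closure V" using csubspaceD(1)[OF assms] closure_subset by auto
  fix x assume x: "x \<in> closure V"
  then obtain u where u: "\<And>n. u n \<in> V" "u \<longlonglongrightarrow> x" by (auto simp: closure_sequential)
  show "scaleC c x \<in> closure V" for c using u csubspaceD(3)[OF assms] tendsto_scaleC[OF u(2), of c]
    by (auto simp: closure_sequential intro!: exI[of _ "\<lambda>n. scaleC c (u n)"])
  fix y assume "y \<in> closure V"
  then obtain v where v: "\<And>n. v n \<in> V" "v \<longlonglongrightarrow> y" by (auto simp: closure_sequential)
  show "x + y \<in> closure V" using u v csubspaceD(2)[OF assms] tendsto_add[OF u(2) v(2)]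
    by (auto simp: closure_sequential intro!: exI[of _ "\<lambda>n. u n + v n"])
qed

text \<open>\<open>p\<close> is the point of \<open>V\<close> closest to \<open>x\<close>: a
  minimizing sequence is Cauchy by the parallelogram law, and minimality forces
  orthogonality.\<close>

lemma orthogonal_decomposition:
  fixes V :: "'h::chilbert set"
  assumes V: "csubspace V" and cl: "closed V"
  obtains p where "p \<in> V" "\<And>v. v \<in> V \<Longrightarrow> cinner (x - p) v = 0"
proof -
  define d where "d = (INF v\<in>V. (norm (x - v))\<^sup>2)"
  note VD = csubspaceD[OF V]
  have bdd: "bdd_below ((\<lambda>v. (norm (x - v))\<^sup>2) ` V)" by (rule bdd_belowI[of _ 0]) auto
  have dle: "d \<le> (norm (x - v))\<^sup>2" if "v \<in> V" for v unfolding d_def by (rule cINF_lower[OF bdd that])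
  have "\<exists>v\<in>V. (norm (x - v))\<^sup>2 < d + 1 / real (Suc n)" for n
  proof -
    have "d < d + 1 / real (Suc n)" by simp
    then show ?thesis using VD(1) cINF_less_iff[OF _ bdd, of "d + 1 / real (Suc n)"] d_def by auto
  qed
  then obtain u where uV: "\<And>n. u n \<in> V" and u: "\<And>n. (norm (x - u n))\<^sup>2 < d + 1 / real (Suc n)" by metis
  have near: "(norm (u m - u n))\<^sup>2 \<le> 2 / real (Suc m) + 2 / real (Suc n)" for m n
  proof -
    have "(norm ((x - u n) + (x - u m)))\<^sup>2 + (norm ((x - u n) - (x - u m)))\<^sup>2
       = 2 * (norm (x - u n))\<^sup>2 + 2 * (norm (x - u m))\<^sup>2" by (rule parallelogram_law)
    \<comment> \<open>The midpoint of \<open>u n\<close> and \<open>u m\<close> lies in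
      \<open>V\<close>, so its squared distance from \<open>x\<close> is at least
      \<open>d\<close>.\<close>
    moreover have "(norm ((x - u n) + (x - u m)))\<^sup>2 \<ge> 4 * d"
    proof -
      have "(x - u n) + (x - u m) = 2 *\<^sub>R (x - (1/2) *\<^sub>R (u n + u m))" by (simp add: algebra_simps scaleR_2)
      then have "(norm ((x - u n) + (x - u m)))\<^sup>2 = 4 * (norm (x - (1/2) *\<^sub>R (u n + u m)))\<^sup>2"
        by (simp add: power_mult_distrib)
      then show ?thesis using dle[OF VD(4)[OF VD(2)[OF uV uV]]] by simp
    qed
    moreover have "(x - u n) - (x - u m) = u m - u n" by simp
    moreover have "2 / real (Suc k) = 2 * (1 / real (Suc k))" for k by simp
    ultimately show ?thesis using u[of n] u[of m] by (smt (verit))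
  qed
  have "Cauchy u"
  proof (rule metric_CauchyI)
    fix e :: real assume e: "e > 0"
    obtain N where N: "inverse (real (Suc N)) < e\<^sup>2 / 4" using reals_Archimedean[of "e\<^sup>2/4"] e by auto
    have "dist (u m) (u n) < e" if "m \<ge> N" "n \<ge> N" for m n
    proof -
      have "1 / real (Suc m) \<le> inverse (real (Suc N))" "1 / real (Suc n) \<le> inverse (real (Suc N))"
        using that by (auto simp: field_simps)
      then have "(norm (u m - u n))\<^sup>2 < e\<^sup>2" using near[of m n] N by linarith
      then show ?thesis using e by (simp add: dist_norm power_less_imp_less_base)
    qed
    then show "\<exists>M. \<forall>m\<ge>M. \<forall>n\<ge>M. dist (u m) (u n) < e" by blast
  qed
  then obtain p where p: "u \<longlonglongrightarrow> p" using Cauchy_convergent convergent_def by blast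
  have pV: "p \<in> V" using closed_sequentially[OF cl] uV p by blast
  have "(\<lambda>n. (norm (x - u n))\<^sup>2) \<longlonglongrightarrow> (norm (x - p))\<^sup>2" by (intro tendsto_intros p)
  moreover have "(\<lambda>n. d + 1 / real (Suc n)) \<longlonglongrightarrow> d + 0" by (intro tendsto_intros LIMSEQ_Suc[OF lim_1_over_n])
  ultimately have "(norm (x - p))\<^sup>2 \<le> d + 0" by (rule LIMSEQ_le) (meson u less_imp_le)
  then have pd: "(norm (x - p))\<^sup>2 \<le> d" by simp
  have "cinner (x - p) v = 0" if v: "v \<in> V" for v
  proof -
    \<comment> \<open>Moving away from \<open>p\<close> along \<open>v\<close>, scaled by the inner
      product to be killed, cannot bring the point closer to \<open>x\<close>. The leading 0 is the
      constant term \<open>a\<close> of the discriminant lemma.\<close>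
    have "0 \<le> 0 + 2 * t * (cmod (cinner (x - p) v))\<^sup>2 + t\<^sup>2 * (norm (scaleC (cinner (x-p) v) v))\<^sup>2" for t
    proof -
      have "p - scaleC (of_real t * cinner (x - p) v) v \<in> V" by (intro VD(6) VD(3) v pV)
      from order.trans[OF pd dle[OF this]]
      have "(norm (x - p))\<^sup>2 \<le> (norm (x - (p - scaleC (of_real t * cinner (x - p) v) v)))\<^sup>2" .
      also have "x - (p - scaleC (of_real t * cinner (x - p) v) v) = (x - p) + t *\<^sub>R scaleC (cinner (x-p) v) v"
        by (simp add: scaleC_scaleC[symmetric] scaleC_complex_of_real)
      also have "(norm ((x - p) + t *\<^sub>R scaleC (cinner (x-p) v) v))\<^sup>2 = (norm (x - p))\<^sup>2
          + 2 * Re (cinner (x - p) (t *\<^sub>R scaleC (cinner (x-p) v) v))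
          + t\<^sup>2 * (norm (scaleC (cinner (x-p) v) v))\<^sup>2"
        by (simp only: norm_sq_add norm_scaleR power_mult_distrib power2_abs)
      also have "cinner (x - p) (t *\<^sub>R scaleC (cinner (x-p) v) v) = of_real (t * (cmod (cinner (x-p) v))\<^sup>2)"
        unfolding cinner_scaleR_right cinner_scaleC_right of_real_mult complex_norm_square
        by (simp only: mult.commute)
      finally show ?thesis by simp
    qed
    from quadratic_discriminant_le[OF _ this] have "((cmod (cinner (x - p) v))\<^sup>2)\<^sup>2 \<le> 0" by simp
    then show ?thesis by simp
  qed
  with pV show thesis by (rule that)
qed

lemma clinear_opD: "clinear_op T \<Longrightarrow> T (scaleC c x) = scaleC c (T x)" by (simp add: clinear_op_def)

lemma clinear_opE:
  fixes f :: "'h::chilbert \<Rightarrow> 'h"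
  assumes "\<And>x y. f (x + y) = f x + f y" "\<And>c x. f (scaleC c x) = scaleC c (f x)"
    "\<And>x. norm (f x) \<le> K * norm x"
  obtains T where "clinear_op T" "\<And>x. blinfun_apply T x = f x"
proof -
  have "bounded_linear f" by (rule bounded_linear_intro[where K=K])
      (use assms in \<open>auto simp: scaleC_complex_of_real[symmetric] mult.commute\<close>)
  then have "\<And>x. blinfun_apply (Blinfun f) x = f x" by (simp add: bounded_linear_Blinfun_apply)
  with that[of "Blinfun f"] assms(2) show thesis by (simp add: clinear_op_def)
qed

lemma projection_exists:
  fixes V :: "'h::chilbert set"
  assumes V: "csubspace V" and cl: "closed V"
  obtains P where "clinear_op P" "\<And>x. blinfun_apply P x \<in> V" "\<And>x v. v \<in> V \<Longrightarrow> cinner (x - blinfun_apply P x) v = 0"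
    "\<And>v. v \<in> V \<Longrightarrow> blinfun_apply P v = v" "\<And>x y. cinner (blinfun_apply P x) y = cinner x (blinfun_apply P y)"
proof -
  note VD = csubspaceD[OF V]
  have "\<exists>p. \<forall>x. p x \<in> V \<and> (\<forall>v\<in>V. cinner (x - p x) v = 0)"
  proof (rule choice, rule allI)
    fix x
    obtain q where "q \<in> V" "\<And>v. v \<in> V \<Longrightarrow> cinner (x - q) v = 0"
      using orthogonal_decomposition[OF V cl, of x] by blast
    then show "\<exists>q. q \<in> V \<and> (\<forall>v\<in>V. cinner (x - q) v = 0)" by blast
  qed
  then obtain p where pV: "\<And>x. p x \<in> V" and po: "\<And>x v. v \<in> V \<Longrightarrow> cinner (x - p x) v = 0" by blast
  have uniq: "p x = q" if "q \<in> V" "\<And>v. v \<in> V \<Longrightarrow> cinner (x - q) v = 0" for x q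
  proof -
    have "p x - q \<in> V" by (intro VD(6) pV that)
    then have "cinner (p x - q) (p x - q) = 0"
      using po[of "p x - q" x] that(2)[of "p x - q"] by (simp add: cinner_diff_left)
    then show ?thesis by simp
  qed
  have a: "p (x + y) = p x + p y" for x y
  proof (rule uniq)
    show "p x + p y \<in> V" by (intro VD(2) pV)
    show "cinner (x + y - (p x + p y)) v = 0" if "v \<in> V" for v
      using po[OF that, of x] po[OF that, of y] by (simp add: cinner_simps)
  qed
  have s: "p (scaleC c x) = scaleC c (p x)" for c x
  proof (rule uniq)
    show "scaleC c (p x) \<in> V" by (intro VD(3) pV)
    show "cinner (scaleC c x - scaleC c (p x)) v = 0" if "v \<in> V" for v
      using po[OF that, of x] by (simp add: scaleC_diff_right[symmetric] cinner_simps)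
  qed
  have n: "norm (p x) \<le> 1 * norm x" for x
  proof -
    have "(norm ((x - p x) + p x))\<^sup>2 = (norm (x - p x))\<^sup>2 + (norm (p x))\<^sup>2"
      using po[OF pV, of x x] by (simp only: norm_sq_add) simp
    then have "(norm (p x))\<^sup>2 \<le> (norm x)\<^sup>2"
      unfolding diff_add_cancel using zero_le_power2[of "norm (x - p x)"] by linarith
    from power2_le_imp_le[OF this norm_ge_zero] show ?thesis by simp
  qed
  obtain P where P: "clinear_op P" "\<And>x. blinfun_apply P x = p x" using clinear_opE[OF a s n] by blast
  have sa: "cinner (p x) y = cinner x (p y)" for x y
  proof -
    have 1: "cinner x (p y) = cinner (p x) (p y)" using po[OF pV, of x y] by (simp add: cinner_diff_left)
    have "cinner (p x) (y - p y) = cnj (cinner (y - p y) (p x))" by (rule cinner_commute)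
    also have "\<dots> = 0" by (simp only: po[OF pV] complex_cnj_zero)
    finally have "cinner (p x) y = cinner (p x) (p y)" by (simp only: cinner_diff_right right_minus_eq)
    then show ?thesis using 1 by (simp only:)
  qed
  have id: "p v = v" if "v \<in> V" for v by (rule uniq[OF that]) simp
  show thesis
  proof (rule that[OF P(1)], unfold P(2))
    show "p x \<in> V" for x by (rule pV)
    show "cinner (x - p x) v = 0" if "v \<in> V" for x v by (rule po[OF that])
    show "p v = v" if "v \<in> V" for v by (rule id[OF that])
    show "cinner (p x) y = cinner x (p y)" for x y by (rule sa)
  qed
qed

lemma Riesz_representation:
  fixes \<phi> :: "'h::chilbert \<Rightarrow> complex"
  assumes bl: "bounded_linear \<phi>" and sc: "\<And>c x. \<phi> (scaleC c x) = c * \<phi> x"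
  obtains z where "\<And>x. \<phi> x = cinner x z"
proof (cases "\<forall>x. \<phi> x = 0")
  case True then show thesis using that[of 0] by simp
next
  case False
  then obtain x where x: "\<phi> x \<noteq> 0" by blast
  interpret bounded_linear \<phi> by (rule bl)
  define V where "V = {v. \<phi> v = 0}"
  have V: "csubspace V" by (auto simp: csubspace_def V_def add sc zero)
  have "continuous_on UNIV \<phi>" using bl by (simp add: linear_continuous_on)
  then have cl: "closed V" unfolding V_def by (intro closed_Collect_eq continuous_on_const)
  obtain p where p: "p \<in> V" and po: "\<And>v. v \<in> V \<Longrightarrow> cinner (x - p) v = 0"
    using orthogonal_decomposition[OF V cl] by blast
  define w where "w = x - p"
  have pw: "\<phi> w = \<phi> x" using p by (simp add: w_def diff V_def)
  then have w0: "cinner w w \<noteq> 0" using x zero by auto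
  have "\<phi> y = cinner y (scaleC (cnj (\<phi> w) / cnj (cinner w w)) w)" for y
  proof -
    have "scaleC (\<phi> w) y - scaleC (\<phi> y) w \<in> V" by (simp add: V_def diff sc)
    then have "cinner w (scaleC (\<phi> w) y - scaleC (\<phi> y) w) = 0" using po w_def by simp
    then have "cnj (\<phi> w) * cinner w y = cnj (\<phi> y) * cinner w w" by (simp add: cinner_simps)
    then have "\<phi> w * cinner y w = \<phi> y * cinner w w"
      by (metis complex_cnj_cnj complex_cnj_mult cinner_commute)
    moreover have "cnj (cinner w w) = cinner w w" by (simp add: cinner_self)
    ultimately show ?thesis using w0 by (simp add: cinner_simps field_simps)
  qed
  then show thesis by (rule that)
qed

section \<open>Adjoints\<close>

lemma blinfun_cinner_eqI:
  "(\<And>x y. cinner (blinfun_apply S x) y = cinner (blinfun_apply T x) y) \<Longrightarrow> S = T"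
  for S T :: "'h::chilbert \<Rightarrow>\<^sub>L 'h" by (meson blinfun_eqI cinner_eqI)

lemma adj_eqI:
  assumes "\<And>x y. cinner (blinfun_apply T x) y = cinner x (blinfun_apply S y)"
  shows "adj T = S" unfolding adj_def
proof (rule the_equality)
  show "\<forall>x y. cinner (T x) y = cinner x (S y)" using assms by blast
  fix S' :: "'a \<Rightarrow>\<^sub>L 'a" assume "\<forall>x y. cinner (T x) y = cinner x (S' y)"
  then have "cinner x (S' y) = cinner x (S y)" for x y using assms by metis
  then show "S' = S" by (meson blinfun_eqI cinner_eqI_right)
qed

text \<open>Riesz representation in the first argument gives the values of the adjoint. Existence
  makes the definite description in \<open>adj\<close> denote.\<close>

lemma adj_exists:
  assumes "clinear_op T"
  obtains S where "clinear_op S" "\<And>x y. cinner (blinfun_apply T x) y = cinner x (blinfun_apply S y)"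
proof -
  have "\<exists>z. \<forall>x. cinner (T x) y = cinner x z" for y
  proof -
    have "bounded_linear (\<lambda>x. cinner (T x) y)"
      using bounded_linear_compose[OF bounded_bilinear.bounded_linear_left[OF bounded_bilinear_cinner, of y]
          blinfun.bounded_linear_right[of T]] by simp
    moreover have "cinner (T (scaleC c x)) y = c * cinner (T x) y" for c x
      using assms by (simp add: clinear_opD cinner_simps)
    ultimately obtain z where "\<And>x. cinner (T x) y = cinner x z"
      using Riesz_representation[of "\<lambda>x. cinner (T x) y"] by blast
    then show ?thesis by blast
  qed
  then have "\<exists>s. \<forall>y. \<forall>x. cinner (T x) y = cinner x (s y)" by (intro choice allI)
  then obtain s where s: "\<And>x y. cinner (T x) y = cinner x (s y)" by blast
  have 1: "s (x + y) = s x + s y" for x y by (rule cinner_eqI_right) (simp add: cinner_simps flip: s)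
  have 2: "s (scaleC c x) = scaleC c (s x)" for c x
    by (rule cinner_eqI_right) (simp add: cinner_simps flip: s)
  have 3: "norm (s x) \<le> norm T * norm x" for x
  proof -
    have "(norm (s x))\<^sup>2 = cmod (cinner (s x) (s x))" by (simp add: cinner_self norm_power)
    also have "\<dots> = cmod (cinner (T (s x)) x)" by (simp add: s)
    also have "\<dots> \<le> norm (T (s x)) * norm x" by (rule cinner_Cauchy_Schwarz)
    also have "\<dots> \<le> (norm T * norm (s x)) * norm x" by (intro mult_right_mono norm_blinfun) simp
    finally show ?thesis by (rule sq_le_imp_le) simp_all
  qed
  from clinear_opE[OF 1 2 3] obtain S where "clinear_op S" "\<And>x. blinfun_apply S x = s x" by blast
  with that[of S] s show thesis by simp
qed

lemma cinner_adj: "clinear_op T \<Longrightarrow> cinner (blinfun_apply T x) y = cinner x (blinfun_apply (adj T) y)"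
  by (metis adj_exists adj_eqI)

lemma clinear_adj: "clinear_op T \<Longrightarrow> clinear_op (adj T)" by (metis adj_exists adj_eqI)

lemma cinner_adj': "clinear_op T \<Longrightarrow> cinner (blinfun_apply (adj T) x) y = cinner x (blinfun_apply T y)"
  by (metis cinner_adj cinner_commute)

lemma adj_adj [simp]: "clinear_op T \<Longrightarrow> adj (adj T) = T" by (rule adj_eqI) (simp add: cinner_adj')

lemma clinear_op_intros [simp]:
  fixes S T :: "'h::chilbert \<Rightarrow>\<^sub>L 'h"
  shows "clinear_op (0 :: 'h \<Rightarrow>\<^sub>L 'h)" "clinear_op (id_blinfun :: 'h \<Rightarrow>\<^sub>L 'h)"
    "clinear_op S \<Longrightarrow> clinear_op T \<Longrightarrow> clinear_op (S + T)"
    "clinear_op S \<Longrightarrow> clinear_op T \<Longrightarrow> clinear_op (S - T)"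
    "clinear_op S \<Longrightarrow> clinear_op (- S)"
    "clinear_op S \<Longrightarrow> clinear_op (r *\<^sub>R S)"
    "clinear_op S \<Longrightarrow> clinear_op T \<Longrightarrow> clinear_op (S o\<^sub>L T)"
  by (auto simp: clinear_op_def blinfun.add_left blinfun.diff_left blinfun.minus_left blinfun.scaleR_left
      scaleC_add_right scaleC_diff_right scaleC_minus_right scaleC_scaleR)

lemma adj_simps:
  fixes S T :: "'h::chilbert \<Rightarrow>\<^sub>L 'h"
  shows "adj (0 :: 'h \<Rightarrow>\<^sub>L 'h) = 0" "adj (id_blinfun :: 'h \<Rightarrow>\<^sub>L 'h) = id_blinfun"
    "clinear_op S \<Longrightarrow> clinear_op T \<Longrightarrow> adj (S + T) = adj S + adj T"
    "clinear_op S \<Longrightarrow> clinear_op T \<Longrightarrow> adj (S - T) = adj S - adj T"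
    "clinear_op S \<Longrightarrow> adj (- S) = - adj S"
    "clinear_op S \<Longrightarrow> adj (r *\<^sub>R S) = r *\<^sub>R adj S"
    "clinear_op S \<Longrightarrow> clinear_op T \<Longrightarrow> adj (S o\<^sub>L T) = adj T o\<^sub>L adj S"
proof -
  note s = blinfun.add_left blinfun.diff_left blinfun.minus_left blinfun.scaleR_left blinfun.zero_left
      cinner_simps cinner_minus_left cinner_minus_right cinner_zero_left cinner_zero_right
      blinfun_apply_id_blinfun id_apply blinfun_compose.rep_eq comp_apply
  show "adj (0 :: 'h \<Rightarrow>\<^sub>L 'h) = 0" "adj (id_blinfun :: 'h \<Rightarrow>\<^sub>L 'h) = id_blinfun"
    by (rule adj_eqI; simp only: s)+
  assume S: "clinear_op S"
  show "adj (- S) = - adj S" "adj (r *\<^sub>R S) = r *\<^sub>R adj S" by (rule adj_eqI; simp only: s cinner_adj[OF S])+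
  assume T: "clinear_op T"
  show "adj (S + T) = adj S + adj T" "adj (S - T) = adj S - adj T" "adj (S o\<^sub>L T) = adj T o\<^sub>L adj S"
    by (rule adj_eqI; simp only: s cinner_adj[OF S] cinner_adj[OF T])+
qed

lemma norm_adj: "clinear_op T \<Longrightarrow> norm (adj T) = norm (T :: 'h::chilbert \<Rightarrow>\<^sub>L 'h)"
proof -
  have "norm (adj T) \<le> norm T" if T: "clinear_op T" for T :: "'h \<Rightarrow>\<^sub>L 'h"
  proof (rule norm_blinfun_bound)
    fix x
    have "(norm (adj T x))\<^sup>2 = cmod (cinner (adj T x) (adj T x))" by (simp add: cinner_self norm_power)
    also have "\<dots> = cmod (cinner (T (adj T x)) x)" by (simp add: T cinner_adj)
    also have "\<dots> \<le> norm (T (adj T x)) * norm x" by (rule cinner_Cauchy_Schwarz)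
    also have "\<dots> \<le> (norm T * norm (adj T x)) * norm x" by (intro mult_right_mono norm_blinfun) simp
    finally show "norm (adj T x) \<le> norm T * norm x" by (rule sq_le_imp_le) simp_all
  qed simp
  note * = this
  assume T: "clinear_op T"
  show "norm (adj T) = norm T"
    using *[OF T] *[OF clinear_adj[OF T]] unfolding adj_adj[OF T] by (rule antisym)
qed

section \<open>Positive operators\<close>

abbreviation qf :: "('h::chilbert \<Rightarrow>\<^sub>L 'h) \<Rightarrow> 'h \<Rightarrow> real" where
  "qf T x \<equiv> Re (cinner (blinfun_apply T x) x)"

abbreviation ple :: "('h::chilbert \<Rightarrow>\<^sub>L 'h) \<Rightarrow> ('h \<Rightarrow>\<^sub>L 'h) \<Rightarrow> bool" where
  "ple S T \<equiv> pos_op (T - S)"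

lemmas blinfun_simps = blinfun.add_left blinfun.diff_left blinfun.minus_left blinfun.scaleR_left
  blinfun.zero_left blinfun.add_right blinfun.diff_right blinfun.minus_right blinfun.scaleR_right
  blinfun.zero_right

lemma compose_distrib:
  "(S + T) o\<^sub>L U = (S o\<^sub>L U) + (T o\<^sub>L U)" "U' o\<^sub>L (S + T) = (U' o\<^sub>L S) + (U' o\<^sub>L T)"
  "(S - T) o\<^sub>L U = (S o\<^sub>L U) - (T o\<^sub>L U)" "U' o\<^sub>L (S - T) = (U' o\<^sub>L S) - (U' o\<^sub>L T)"
  "(- S) o\<^sub>L U = - (S o\<^sub>L U)" "U' o\<^sub>L (- S) = - (U' o\<^sub>L S)"
  "(r *\<^sub>R S) o\<^sub>L U = r *\<^sub>R (S o\<^sub>L U)" "U' o\<^sub>L (r *\<^sub>R S) = r *\<^sub>R (U' o\<^sub>L S)"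
  by (rule blinfun_eqI; simp add: blinfun_simps)+

lemma compose_id [simp]: "id_blinfun o\<^sub>L T = T" "T o\<^sub>L id_blinfun = T" by (rule blinfun_eqI; simp)+

lemma compose_0 [simp]: "0 o\<^sub>L T = 0" "T o\<^sub>L 0 = 0" by (rule blinfun_eqI; simp add: blinfun_simps)+

lemma compose_assoc: "(S o\<^sub>L T) o\<^sub>L U = S o\<^sub>L (T o\<^sub>L U)" by (rule blinfun_eqI) simp

text \<open>Polarization with \<open>x + y\<close> and \<open>x + i y\<close>. Complex linearity is
  essential: a quarter turn of a real plane has vanishing quadratic form.\<close>

lemma eq_zero_if_qform_zero:
  fixes D :: "'h::chilbert \<Rightarrow>\<^sub>L 'h"
  assumes D: "clinear_op D" and z: "\<And>x. cinner (D x) x = 0"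
  shows "D = 0"
proof (rule blinfun_cinner_eqI)
  fix x y
  have 1: "cinner (D x) y + cinner (D y) x = 0"
    using z[of "x + y"] z[of x] z[of y] by (simp add: blinfun_simps cinner_simps add.commute)
  have "cinner (D (x + scaleC \<i> y)) (x + scaleC \<i> y) =
    cinner (D x) x + \<i> * cinner (D y) x - \<i> * cinner (D x) y + cinner (D y) y"
    by (simp add: blinfun_simps cinner_simps clinear_opD[OF D] algebra_simps)
  then have "\<i> * (cinner (D y) x - cinner (D x) y) = 0" unfolding z by (simp add: right_diff_distrib)
  then have "cinner (D y) x = cinner (D x) y" by simp
  with 1 show "cinner (D x) y = cinner ((0 :: 'h \<Rightarrow>\<^sub>L 'h) x) y" by simp
qed

lemma pos_op_clinear [simp]: "pos_op T \<Longrightarrow> clinear_op T" by (simp add: pos_op_def)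

lemma pos_op_qf: "pos_op T \<Longrightarrow> 0 \<le> qf T x" by (simp add: pos_op_def)

lemma pos_op_adj: "pos_op T \<Longrightarrow> adj T = T"
proof -
  assume T: "pos_op T"
  then have c: "clinear_op T" by simp
  have "adj T - T = 0"
  proof (rule eq_zero_if_qform_zero)
    fix x
    have "cinner (adj T x) x = cnj (cinner (T x) x)" unfolding cinner_adj'[OF c] by (rule cinner_commute)
    also have "\<dots> = cinner (T x) x" using T by (simp add: pos_op_def complex_eq_iff)
    finally show "cinner ((adj T - T) x) x = 0" by (simp add: blinfun_simps cinner_simps)
  qed (simp add: c clinear_adj)
  then show ?thesis by simp
qed

lemma pos_op_sym: "pos_op T \<Longrightarrow> cinner (T x) y = cinner x (T y)"
  using cinner_adj[OF pos_op_clinear, of T x y] pos_op_adj[of T] by simp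

lemma pos_opI:
  assumes "clinear_op T" "adj T = T" "\<And>x. 0 \<le> qf T x"
  shows "pos_op T" unfolding pos_op_def
proof (intro conjI allI assms)
  fix x
  have "cinner (T x) x = cnj (cinner (T x) x)"
    using cinner_adj[OF assms(1), of x x] cinner_commute[of x "T x"] by (simp only: assms(2))
  then have "Im (cinner (T x) x) = Im (cnj (cinner (T x) x))" by (rule arg_cong)
  then show "Im (cinner (T x) x) = 0" by simp
qed

lemma pos_op_Cauchy_Schwarz:
  assumes k: "pos_op k"
  shows "(cmod (cinner (k x) y))\<^sup>2 \<le> qf k x * qf k y"
proof (rule sesquilinear_Cauchy_Schwarz[of "\<lambda>x y. cinner (k x) y"])
  show "cinner (k x) y = cnj (cinner (k y) x)" for x y
    unfolding pos_op_sym[OF k, of x] by (rule cinner_commute)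
qed (use k in \<open>simp_all add: blinfun_simps cinner_simps clinear_opD pos_op_qf\<close>)

lemma pos_op_0 [simp]: "pos_op 0" and pos_op_id [simp]: "pos_op id_blinfun"
  by (rule pos_opI; simp add: adj_simps cinner_self_Re)+

lemma pos_op_add: "pos_op S \<Longrightarrow> pos_op T \<Longrightarrow> pos_op (S + T)"
  by (rule pos_opI) (simp_all add: adj_simps pos_op_adj blinfun_simps cinner_simps pos_op_qf)

lemma pos_op_scaleR: "pos_op S \<Longrightarrow> 0 \<le> r \<Longrightarrow> pos_op (r *\<^sub>R S)"
  by (rule pos_opI) (simp_all add: adj_simps pos_op_adj blinfun_simps cinner_simps pos_op_qf)

lemma pos_op_congr:
  assumes "clinear_op b" "pos_op k" shows "pos_op (adj b o\<^sub>L k o\<^sub>L b)"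
  by (rule pos_opI) (use assms in \<open>simp_all add: adj_simps pos_op_adj clinear_adj compose_assoc
    cinner_adj' pos_op_qf\<close>)

lemma pos_op_congr': "clinear_op b \<Longrightarrow> pos_op k \<Longrightarrow> pos_op (b o\<^sub>L k o\<^sub>L adj b)"
  using pos_op_congr[of "adj b" k] by (simp add: clinear_adj)

lemma pos_op_adj_mult: "clinear_op b \<Longrightarrow> pos_op (adj b o\<^sub>L b)" using pos_op_congr[of b id_blinfun] by simp

lemma pos_op_mult_adj: "clinear_op b \<Longrightarrow> pos_op (b o\<^sub>L adj b)"
  using pos_op_adj_mult[of "adj b"] by (simp add: clinear_adj)

lemma pos_op_sum: "(\<And>i. i \<in> I \<Longrightarrow> pos_op (f i)) \<Longrightarrow> pos_op (\<Sum>i\<in>I. f i)"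
  by (induction I rule: infinite_finite_induct) (simp_all add: pos_op_add)

lemma qf_adj_mult: "clinear_op b \<Longrightarrow> qf (adj b o\<^sub>L b) x = (norm (b x))\<^sup>2"
  by (simp add: cinner_adj' cinner_self_Re)

lemma ple_iff:
  assumes "pos_op S" "pos_op T"
  shows "ple S T \<longleftrightarrow> (\<forall>x. qf S x \<le> qf T x)"
proof
  show "ple S T \<Longrightarrow> \<forall>x. qf S x \<le> qf T x" using pos_op_qf[of "T - S"] by (simp add: blinfun_simps cinner_simps)
  show "\<forall>x. qf S x \<le> qf T x \<Longrightarrow> ple S T"
    by (rule pos_opI) (use assms in \<open>simp_all add: adj_simps pos_op_adj blinfun_simps cinner_simps\<close>)
qed

lemma ple_qf: "ple S T \<Longrightarrow> qf S x \<le> qf T x"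
  using pos_op_qf[of "T - S" x] by (simp add: blinfun_simps cinner_simps)

lemma ple_trans: "ple S T \<Longrightarrow> ple T U \<Longrightarrow> ple S U"
  using pos_op_add[of "T - S" "U - T"] by (simp add: algebra_simps)

lemma ple_refl [simp]: "ple S S" by simp

lemma ple_congr: "clinear_op b \<Longrightarrow> ple S T \<Longrightarrow> ple (adj b o\<^sub>L S o\<^sub>L b) (adj b o\<^sub>L T o\<^sub>L b)"
  using pos_op_congr[of b "T - S"] by (simp add: compose_distrib)

lemma ple_congr': "clinear_op b \<Longrightarrow> ple S T \<Longrightarrow> ple (b o\<^sub>L S o\<^sub>L adj b) (b o\<^sub>L T o\<^sub>L adj b)"
  using pos_op_congr'[of b "T - S"] by (simp add: compose_distrib)

lemma qf_le_norm: "qf T x \<le> norm T * (norm x)\<^sup>2"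
proof -
  have "qf T x \<le> cmod (cinner (T x) x)" by (rule complex_Re_le_cmod)
  also have "\<dots> \<le> norm (T x) * norm x" by (rule cinner_Cauchy_Schwarz)
  also have "\<dots> \<le> (norm T * norm x) * norm x" by (intro mult_right_mono norm_blinfun) simp
  finally show ?thesis by (simp add: power2_eq_square)
qed

lemma qf_id: "qf (r *\<^sub>R id_blinfun) x = r * (norm x)\<^sup>2"
  by (simp add: blinfun_simps cinner_simps cinner_self_Re)

lemma ple_norm: "pos_op T \<Longrightarrow> ple T (norm T *\<^sub>R id_blinfun)"
  by (subst ple_iff) (simp_all add: qf_id qf_le_norm pos_op_scaleR)

text \<open>Cauchy-Schwarz for the form of \<open>k\<close> at \<open>x\<close> and
  \<open>k x\<close> takes the place of a square root of \<open>k\<close>. As \<open>qf k x\<close>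
  appears on the right, convergence of quadratic forms will imply strong convergence.\<close>

lemma norm_sq_le_qf:
  assumes k: "pos_op k" and le: "\<And>x. qf k x \<le> c * (norm x)\<^sup>2" and c: "0 \<le> c"
  shows "(norm (k x))\<^sup>2 \<le> c * qf k x"
proof (cases "k x = 0")
  case False
  have "((norm (k x))\<^sup>2)\<^sup>2 = (cmod (cinner (k x) (k x)))\<^sup>2" by (simp add: cinner_self norm_power)
  also have "\<dots> \<le> qf k x * qf k (k x)" by (rule pos_op_Cauchy_Schwarz[OF k])
  also have "\<dots> \<le> qf k x * (c * (norm (k x))\<^sup>2)" by (intro mult_left_mono le pos_op_qf k)
  finally have "(norm (k x))\<^sup>2 * (norm (k x))\<^sup>2 \<le> (c * qf k x) * (norm (k x))\<^sup>2"
    by (simp add: power2_eq_square mult_ac)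
  from mult_right_le_imp_le[OF this] show ?thesis using False by simp
qed (use k c pos_op_qf in auto)

lemma norm_le_of_qf_le:
  assumes k: "pos_op k" and le: "\<And>x. qf k x \<le> c * (norm x)\<^sup>2" and c: "0 \<le> c"
  shows "norm k \<le> c"
proof (rule norm_blinfun_bound[OF c])
  fix x
  have "(norm (k x))\<^sup>2 \<le> c * qf k x" by (rule norm_sq_le_qf[OF assms])
  also have "\<dots> \<le> c * (c * (norm x)\<^sup>2)" by (intro mult_left_mono le c)
  finally have "(norm (k x))\<^sup>2 \<le> (c * norm x)\<^sup>2" by (simp add: power2_eq_square mult_ac)
  then show "norm (k x) \<le> c * norm x" by (rule power2_le_imp_le) (use c in simp)
qed

section \<open>Resolvents of positive operators\<close>

lemma id_plus_pos_surj:
  fixes k :: "'h::chilbert \<Rightarrow>\<^sub>L 'h"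
  assumes k: "pos_op k"
  shows "\<exists>x. x + k x = y"
proof -
  define c where "c = norm k"
  have c: "c \<ge> 0" by (simp add: c_def)
  \<comment> \<open>Since \<open>1 + k = (1 + c) - D\<close> with \<open>norm D\<close> at most
    \<open>c\<close>, the equation \<open>x + k x = y\<close> becomes the fixed point equation of a
    contraction with constant \<open>c / (1 + c)\<close>.\<close>
  define D where "D = c *\<^sub>R id_blinfun - k"
  have D: "pos_op D" unfolding D_def c_def by (rule ple_norm[OF k])
  have nD: "norm D \<le> c"
  proof (rule norm_le_of_qf_le[OF D _ c])
    show "qf D x \<le> c * (norm x)\<^sup>2" for x
      using pos_op_qf[OF k, of x] by (simp add: D_def blinfun_simps cinner_simps cinner_self_Re)
  qed
  define f where "f = (\<lambda>x. (1 / (1 + c)) *\<^sub>R (y + D x))"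
  have "\<exists>!x. f x = x"
  proof (rule banach_fix_type[where c="c / (1 + c)"])
    show "\<forall>x z. dist (f x) (f z) \<le> c / (1 + c) * dist x z"
    proof (intro allI)
      fix x z
      have "norm (D (x - z)) \<le> c * norm (x - z)"
        using norm_blinfun[of D "x - z"] nD mult_right_mono[OF nD norm_ge_zero[of "x - z"]] by linarith
      moreover have "f x - f z = (1 / (1 + c)) *\<^sub>R D (x - z)"
        by (simp add: f_def blinfun_simps algebra_simps)
      ultimately show "dist (f x) (f z) \<le> c / (1 + c) * dist x z"
        using c by (simp add: dist_norm divide_right_mono)
    qed
  qed (use c in auto)
  then obtain x where x: "f x = x" by blast
  then have "(1 + c) *\<^sub>R f x = (1 + c) *\<^sub>R x" by simp
  then have "y + D x = (1 + c) *\<^sub>R x" using c by (simp add: f_def)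
  then have "x + k x = y" by (simp add: D_def blinfun_simps algebra_simps)
  then show ?thesis by blast
qed

lemma res_exists:
  fixes k :: "'h::chilbert \<Rightarrow>\<^sub>L 'h"
  assumes k: "pos_op k"
  shows "\<exists>R. pos_op R \<and> R o\<^sub>L (id_blinfun + k) = id_blinfun \<and> (id_blinfun + k) o\<^sub>L R = id_blinfun"
proof -
  obtain r where r: "\<And>y. r y + k (r y) = y" using id_plus_pos_surj[OF k] by metis
  \<comment> \<open>Positivity of \<open>k\<close> makes \<open>1 + k\<close> expand norms; this
    gives both injectivity and the bound 1 for the inverse.\<close>
  have nle: "norm x \<le> norm (x + k x)" for x
  proof (cases "x = 0")
    case False
    have "(norm x)\<^sup>2 \<le> Re (cinner (x + k x) x)"
      using pos_op_qf[OF k, of x] by (simp add: cinner_simps cinner_self_Re)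
    also have "\<dots> \<le> cmod (cinner (x + k x) x)" by (rule complex_Re_le_cmod)
    also have "\<dots> \<le> norm (x + k x) * norm x" by (rule cinner_Cauchy_Schwarz)
    finally show ?thesis using False by (simp add: power2_eq_square)
  qed simp
  have inj: "x = z" if "x + k x = z + k z" for x z
    using nle[of "x - z"] that by (simp add: blinfun_simps algebra_simps)
  have rk: "r (x + k x) = x" for x by (rule inj) (rule r)
  have 1: "r (x + y) = r x + r y" for x y
    by (rule inj) (use r[of x] r[of y] r[of "x+y"] in \<open>simp add: blinfun_simps algebra_simps\<close>)
  have 2: "r (scaleC c x) = scaleC c (r x)" for c x
    by (rule inj) (use k r[of x] r[of "scaleC c x"] in \<open>simp add: clinear_opD flip: scaleC_add_right\<close>)
  have 3: "norm (r x) \<le> 1 * norm x" for x using nle[of "r x"] r[of x] by simp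
  obtain R where R: "clinear_op R" "\<And>x. blinfun_apply R x = r x" using clinear_opE[OF 1 2 3] by blast
  have "adj R = R"
  proof (rule adj_eqI)
    fix x y
    have "cinner (R x) y = cinner (r x) (r y + k (r y))" by (simp add: R r)
    also have "\<dots> = cinner (r x + k (r x)) (r y)" using pos_op_sym[OF k] by (simp add: cinner_simps)
    finally show "cinner (R x) y = cinner x (R y)" by (simp add: R r)
  qed
  moreover have "0 \<le> qf R x" for x
  proof -
    have "qf R x = Re (cinner (r x) (r x + k (r x)))" by (simp add: R r)
    also have "\<dots> = (norm (r x))\<^sup>2 + qf k (r x)"
      using Re_cinner_commute by (simp add: cinner_simps cinner_self_Re)
    finally show ?thesis using pos_op_qf[OF k] by simp
  qed
  ultimately have "pos_op R" using R(1) by (intro pos_opI)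
  moreover have "R o\<^sub>L (id_blinfun + k) = id_blinfun" "(id_blinfun + k) o\<^sub>L R = id_blinfun"
    using rk by (auto intro!: blinfun_eqI simp: R r blinfun.add_left blinfun.zero_left)
  ultimately show ?thesis by blast
qed

definition res :: "('h::chilbert \<Rightarrow>\<^sub>L 'h) \<Rightarrow> ('h \<Rightarrow>\<^sub>L 'h)" where
  "res k = (SOME R. pos_op R \<and> R o\<^sub>L (id_blinfun + k) = id_blinfun \<and> (id_blinfun + k) o\<^sub>L R = id_blinfun)"

lemma res:
  assumes "pos_op k"
  shows res_pos: "pos_op (res k)" and res_left: "res k o\<^sub>L (id_blinfun + k) = id_blinfun"
    and res_right: "(id_blinfun + k) o\<^sub>L res k = id_blinfun"
  using someI_ex[OF res_exists[OF assms]] unfolding res_def by blast+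

lemma res_compl:
  assumes "pos_op k"
  shows "k o\<^sub>L res k = id_blinfun - res k" "res k o\<^sub>L k = id_blinfun - res k"
  using res_left[OF assms] res_right[OF assms] by (simp_all add: compose_distrib algebra_simps)

text \<open>Cauchy-Schwarz for the form of \<open>P\<close> at \<open>Q y\<close> and
  \<open>Q' y\<close>, after which one factor \<open>qf Q' y\<close> cancels. Explicit inverse pairs
  let it cover resolvents, their multiples and the squares of shifted inverses alike.\<close>

lemma inverse_antitone:
  assumes P: "pos_op P" "pos_op P'" "pos_op Q" "pos_op Q'"
    and inv: "P o\<^sub>L Q = id_blinfun" "P' o\<^sub>L Q' = id_blinfun" and le: "ple P P'"
  shows "ple Q' Q"
proof -
  have "qf Q' y \<le> qf Q y" for y
  proof -
    define w where "w = Q' y"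
    have 1: "P (Q y) = y" "P' w = y" using inv by (metis blinfun_apply_blinfun_compose blinfun_apply_id_blinfun id_apply w_def)+
    have a: "qf Q' y = Re (cinner y w)" by (simp add: w_def Re_cinner_commute)
    have a0: "0 \<le> qf Q' y" by (rule pos_op_qf[OF P(4)])
    have "(qf Q' y)\<^sup>2 \<le> (cmod (cinner (P (Q y)) w))\<^sup>2"
      using a0 unfolding a 1 by (intro power_mono complex_Re_le_cmod)
    also have "\<dots> \<le> qf P (Q y) * qf P w" by (rule pos_op_Cauchy_Schwarz[OF P(1)])
    also have "\<dots> \<le> qf P (Q y) * qf P' w" by (intro mult_left_mono pos_op_qf P ple_qf le)
    also have "qf P (Q y) = qf Q y" using 1 Re_cinner_commute by metis
    also have "qf P' w = qf Q' y" using 1 a by simp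
    finally have "qf Q' y * qf Q' y \<le> qf Q y * qf Q' y" by (simp add: power2_eq_square)
    then show ?thesis using a0 pos_op_qf[OF P(3), of y]
      by (cases "qf Q' y = 0") (auto simp: mult_le_cancel_right)
  qed
  then show ?thesis using P by (simp add: ple_iff)
qed

lemma res_antitone: "pos_op k \<Longrightarrow> pos_op k' \<Longrightarrow> ple k k' \<Longrightarrow> ple (res k') (res k)"
  by (rule inverse_antitone[of "id_blinfun + k" "id_blinfun + k'"])
    (simp_all add: res_pos res_right pos_op_add)

lemma res_le_id: "pos_op k \<Longrightarrow> ple (res k) id_blinfun"
  by (rule inverse_antitone[of "id_blinfun" "id_blinfun + k"]) (simp_all add: res_pos res_right pos_op_add)

text \<open>The left side is the inverse of \<open>1/t + k\<close>, which dominates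
  \<open>1 + k\<close>. Through it an estimate for small multiples of \<open>k\<close> controls the
  kernel of a limit of the resolvents of \<open>k\<close> itself.\<close>

lemma res_scale:
  assumes k: "pos_op k" and t: "0 < t" "t \<le> 1"
  shows "ple (t *\<^sub>R res (t *\<^sub>R k)) (res k)"
proof -
  have "ple (res (t *\<^sub>R k)) ((1/t) *\<^sub>R res k)"
  proof (rule inverse_antitone[of "t *\<^sub>R (id_blinfun + k)" "id_blinfun + t *\<^sub>R k"])
    have "id_blinfun + t *\<^sub>R k - t *\<^sub>R (id_blinfun + k) = (1 - t) *\<^sub>R id_blinfun"
      by (simp add: algebra_simps)
    then show "ple (t *\<^sub>R (id_blinfun + k)) (id_blinfun + t *\<^sub>R k)" using t by (auto intro: pos_op_scaleR)
    show "t *\<^sub>R (id_blinfun + k) o\<^sub>L (1 / t) *\<^sub>R res k = id_blinfun"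
      using t res_right[OF k] by (simp add: compose_distrib)
  qed (use k t in \<open>simp_all add: pos_op_scaleR pos_op_add res_pos res_right\<close>)
  from pos_op_scaleR[OF this, of t] have "pos_op (t *\<^sub>R ((1/t) *\<^sub>R res k - res (t *\<^sub>R k)))" using t by simp
  then show ?thesis using t by (simp add: scaleR_diff_right)
qed

lemma norm_res_le: "pos_op k \<Longrightarrow> norm (res k) \<le> 1"
  using ple_qf[OF res_le_id] by (intro norm_le_of_qf_le) (auto simp: cinner_self_Re res_pos)

text \<open>The column operator \<open>a k\<^sup>-\<^sup>1\<^sup>/\<^sup>2\<close> is a contraction; this form avoids square roots.\<close>

lemma contraction_of_ple:
  assumes a: "clinear_op a" and P: "pos_op P" "pos_op Q" "P o\<^sub>L Q = id_blinfun"
    and le: "ple (adj a o\<^sub>L a) P"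
  shows "ple (a o\<^sub>L Q o\<^sub>L adj a) id_blinfun"
proof -
  have "qf (a o\<^sub>L Q o\<^sub>L adj a) z \<le> qf id_blinfun z" for z
  proof -
    define w where "w = Q (adj a z)"
    have Pw: "P w = adj a z" using P(3) by (metis blinfun_apply_blinfun_compose blinfun_apply_id_blinfun id_apply w_def)
    have 1: "qf (a o\<^sub>L Q o\<^sub>L adj a) z = qf P w" unfolding Pw
      using Re_cinner_commute by (simp add: w_def cinner_adj[OF a])
    have aw: "(norm (a w))\<^sup>2 \<le> qf P w" using ple_qf[OF le, of w] by (simp add: cinner_adj'[OF a] cinner_self_Re)
    have "qf P w = Re (cinner z (a w))" unfolding Pw by (simp add: cinner_adj'[OF a])
    also have "\<dots> \<le> norm z * norm (a w)" using complex_Re_le_cmod cinner_Cauchy_Schwarz order.trans by blast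
    finally have "(qf P w)\<^sup>2 \<le> (norm z)\<^sup>2 * (norm (a w))\<^sup>2"
      using pos_op_qf[OF P(1), of w] by (metis power_mono power_mult_distrib)
    also have "\<dots> \<le> (norm z)\<^sup>2 * qf P w" by (intro mult_left_mono aw) simp
    finally show ?thesis unfolding 1 using pos_op_qf[OF P(1), of w]
      by (cases "qf P w = 0") (auto simp: power2_eq_square mult_le_cancel_right cinner_self_Re)
  qed
  then show ?thesis by (subst ple_iff) (auto simp: pos_op_congr'[OF a P(2)])
qed

section \<open>Strong limits\<close>

lemma strong_limit_exists:
  fixes X :: "nat \<Rightarrow> 'h::chilbert \<Rightarrow>\<^sub>L 'h"
  assumes c: "\<And>n. clinear_op (X n)" and K: "\<And>n. norm (X n) \<le> K" and cv: "\<And>y. Cauchy (\<lambda>n. X n y)"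
  obtains L where "clinear_op L" "\<And>y. (\<lambda>n. X n y) \<longlonglongrightarrow> blinfun_apply L y" "norm L \<le> K"
proof -
  have K0: "K \<ge> 0" using K[of 0] norm_ge_zero order.trans by blast
  have "\<forall>y. \<exists>l. (\<lambda>n. X n y) \<longlonglongrightarrow> l" using cv Cauchy_convergent convergent_def by blast
  then obtain l where l: "\<And>y. (\<lambda>n. X n y) \<longlonglongrightarrow> l y" by metis
  have 1: "l (x + y) = l x + l y" for x y
    by (rule LIMSEQ_unique[OF l]) (simp add: blinfun_simps tendsto_add l)
  have 2: "l (scaleC a x) = scaleC a (l x)" for a x
    by (rule LIMSEQ_unique[OF l]) (simp add: clinear_opD c tendsto_scaleC l)
  have 3: "norm (l x) \<le> K * norm x" for x
  proof (rule LIMSEQ_le_const2[OF tendsto_norm[OF l]])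
    show "\<exists>N. \<forall>n\<ge>N. norm (X n x) \<le> K * norm x"
      using norm_blinfun[of "X _" x] mult_right_mono[OF K norm_ge_zero[of x]] order.trans by blast
  qed
  obtain L where "clinear_op L" "\<And>x. blinfun_apply L x = l x" using clinear_opE[OF 1 2 3] by blast
  then show thesis using that[of L] l norm_blinfun_bound[OF K0, of L] 3 by simp
qed

lemma pos_op_strong_limit:
  assumes "clinear_op L" "\<And>n. pos_op (X n)" "\<And>y. (\<lambda>n. X n y) \<longlonglongrightarrow> blinfun_apply L y"
  shows "pos_op L" unfolding pos_op_def
proof (intro conjI allI assms(1))
  fix x
  have t: "(\<lambda>n. cinner (X n x) x) \<longlonglongrightarrow> cinner (L x) x" by (intro tendsto_cinner assms tendsto_const)
  have "(\<lambda>n. Im (cinner (X n x) x)) \<longlonglongrightarrow> Im (cinner (L x) x)" by (rule tendsto_Im[OF t])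
  moreover have "Im (cinner (X n x) x) = 0" for n using assms(2) by (simp add: pos_op_def)
  ultimately show "Im (cinner (L x) x) = 0" by (simp add: LIMSEQ_const_iff)
  show "0 \<le> qf L x" by (rule LIMSEQ_le_const[OF tendsto_Re[OF t]]) (use assms(2) pos_op_qf in blast)
qed

text \<open>Converts convergence of scalars into convergence of vectors: \<beta> will be the
  sequence of quadratic forms of a monotone sequence of operators at a fixed vector.\<close>

lemma Cauchy_norm_sq:
  fixes u :: "nat \<Rightarrow> 'a::real_normed_vector" and \<beta> :: "nat \<Rightarrow> real"
  assumes \<beta>: "Cauchy \<beta>" and K: "0 \<le> K"
    and le: "\<And>m n. m \<le> n \<Longrightarrow> (norm (u m - u n))\<^sup>2 \<le> K * \<bar>\<beta> m - \<beta> n\<bar>"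
  shows "Cauchy u"
proof (rule CauchyI)
  fix e :: real assume e: "e > 0"
  \<comment> \<open>\<open>K + 1\<close> keeps the divisor positive when
    \<open>K = 0\<close>.\<close>
  have "e\<^sup>2 / (K + 1) > 0" using e K by simp
  from CauchyD[OF \<beta> this]
  obtain M where M: "\<And>m n. m \<ge> M \<Longrightarrow> n \<ge> M \<Longrightarrow> \<bar>\<beta> m - \<beta> n\<bar> < e\<^sup>2 / (K + 1)" by auto
  have le: "norm (u m - u n) < e" if "M \<le> m" "m \<le> n" for m n
  proof -
    have "(K + 1) * \<bar>\<beta> m - \<beta> n\<bar> < e\<^sup>2" using M[of m n] that K by (simp add: field_simps)
    moreover have "K * \<bar>\<beta> m - \<beta> n\<bar> \<le> (K + 1) * \<bar>\<beta> m - \<beta> n\<bar>" by (rule mult_right_mono) simp_all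
    ultimately have "(norm (u m - u n))\<^sup>2 < e\<^sup>2" using le[OF that(2)] by linarith
    then show ?thesis using e by (simp add: power_less_imp_less_base)
  qed
  have "norm (u m - u n) < e" if "M \<le> m" "M \<le> n" for m n
    using le[OF that(1), of n] le[OF that(2), of m] by (metis nle_le norm_minus_commute)
  then show "\<exists>M. \<forall>m\<ge>M. \<forall>n\<ge>M. norm (u m - u n) < e" by (intro exI[of _ M] allI impI)
qed

text \<open>The quadratic forms converge as decreasing nonnegative numbers, and
  \<open>norm_sq_le_qf\<close> for the positive difference \<open>X m - X n\<close> lifts this to
  vectors.\<close>

lemma decreasing_strong_limit:
  fixes X :: "nat \<Rightarrow> 'h::chilbert \<Rightarrow>\<^sub>L 'h"
  assumes pos: "\<And>n. pos_op (X n)" and dec: "\<And>m n. m \<le> n \<Longrightarrow> ple (X n) (X m)"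
  obtains L where "pos_op L" "\<And>y. (\<lambda>n. X n y) \<longlonglongrightarrow> blinfun_apply L y" "\<And>n. ple L (X n)"
proof -
  define K where "K = norm (X 0)"
  have K: "K \<ge> 0" by (simp add: K_def)
  have qK: "qf (X n) x \<le> K * (norm x)\<^sup>2" for n x
    using ple_qf[OF dec[of 0 n], of x] qf_le_norm[of "X 0" x] by (simp add: K_def)
  have qdec: "decseq (\<lambda>n. qf (X n) y)" for y unfolding decseq_def by (intro allI impI ple_qf dec)
  have qcauchy: "Cauchy (\<lambda>n. qf (X n) y)" for y
    by (rule convergent_Cauchy, rule decseq_convergent[OF qdec, of 0]) (auto simp: pos_op_qf pos convergent_def)
  have diff: "(norm (X m y - X n y))\<^sup>2 \<le> K * (qf (X m) y - qf (X n) y)" if "m \<le> n" for m n y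
  proof -
    have "(norm ((X m - X n) y))\<^sup>2 \<le> K * qf (X m - X n) y"
    proof (rule norm_sq_le_qf[OF dec[OF that] _ K])
      show "qf (X m - X n) x \<le> K * (norm x)\<^sup>2" for x
        using qK[of m x] pos_op_qf[OF pos, of n x] by (simp add: blinfun_simps cinner_simps)
    qed
    then show ?thesis by (simp add: blinfun_simps cinner_simps)
  qed
  have "Cauchy (\<lambda>n. X n y)" for y
    by (rule Cauchy_norm_sq[OF qcauchy K]) (use diff decseqD[OF qdec] in \<open>simp add: abs_of_nonneg\<close>)
  from strong_limit_exists[OF pos_op_clinear[OF pos] norm_le_of_qf_le[OF pos qK K] this]
  obtain L where L: "clinear_op L" "\<And>y. (\<lambda>n. X n y) \<longlonglongrightarrow> blinfun_apply L y" by blast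
  have p: "pos_op L" by (rule pos_op_strong_limit[OF L(1) pos L(2)])
  have "ple L (X n)" for n
  proof (subst ple_iff[OF p pos], rule allI)
    fix x
    have "(\<lambda>n. qf (X n) x) \<longlonglongrightarrow> qf L x" by (intro tendsto_intros tendsto_cinner L)
    then show "qf L x \<le> qf (X n) x" using decseq_ge[OF qdec] by blast
  qed
  with p L show thesis by (intro that)
qed

section \<open>Finite von Neumann algebras\<close>

lemma pos_op_qf_zero:
  assumes k: "pos_op k" and z: "qf k x = 0" shows "k x = 0"
  using norm_sq_le_qf[OF k qf_le_norm norm_ge_zero, of x] z by simp

text \<open>A vector orthogonal to the range of \<open>T\<close> is killed by the adjoint; here it
  is the component of \<open>x\<close> orthogonal to the closed range.\<close>

lemma dense_range:
  assumes T: "clinear_op T" and inj: "\<And>y. adj T y = 0 \<Longrightarrow> y = 0"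
  shows "closure (range (blinfun_apply T)) = UNIV"
proof -
  have cs: "csubspace (range (blinfun_apply T))" unfolding csubspace_def
  proof (intro conjI ballI allI)
    show "0 \<in> range (blinfun_apply T)" by (rule range_eqI[of _ _ 0]) (simp add: blinfun_simps)
    fix u assume "u \<in> range (blinfun_apply T)"
    then obtain a where a: "u = T a" by blast
    show "scaleC c u \<in> range (blinfun_apply T)" for c
      by (rule range_eqI[of _ _ "scaleC c a"]) (simp add: a clinear_opD[OF T])
    fix v assume "v \<in> range (blinfun_apply T)"
    then obtain b where b: "v = T b" by blast
    show "u + v \<in> range (blinfun_apply T)"
      by (rule range_eqI[of _ _ "a + b"]) (simp add: a b blinfun.add_right)
  qed
  obtain P where P: "\<And>x. blinfun_apply P x \<in> closure (range (blinfun_apply T))"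
    "\<And>x v. v \<in> closure (range (blinfun_apply T)) \<Longrightarrow> cinner (x - blinfun_apply P x) v = 0"
    by (rule projection_exists[OF csubspace_closure[OF cs] closed_closure]) (rule that)
  have "x \<in> closure (range (blinfun_apply T))" for x
  proof -
    have "cinner (adj T (x - P x)) z = 0" for z
      unfolding cinner_adj'[OF T] by (rule P(2)) (rule subsetD[OF closure_subset rangeI])
    then have "cinner (adj T (x - P x)) (adj T (x - P x)) = 0" .
    then have "adj T (x - P x) = 0" by simp
    then have "x - P x = 0" by (rule inj)
    then have "x = P x" by simp
    then show ?thesis using P(1)[of x] by (simp only:)
  qed
  then show ?thesis by blast
qed

lemma Cauchy_of_dense:
  fixes X :: "nat \<Rightarrow> 'h::real_normed_vector \<Rightarrow>\<^sub>L 'h"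
  assumes K: "\<And>n. norm (X n) \<le> K" and D: "closure D = UNIV" and cv: "\<And>y. y \<in> D \<Longrightarrow> Cauchy (\<lambda>n. X n y)"
  shows "Cauchy (\<lambda>n. X n y)"
proof (rule CauchyI)
  fix e :: real assume e: "e > 0"
  have K0: "K \<ge> 0" using K[of 0] norm_ge_zero order.trans by blast
  have "y \<in> closure D" using D by simp
  then obtain d where d: "d \<in> D" "dist d y < e / (3 * (K + 1))"
    using e K0 unfolding closure_approachable by (metis add_nonneg_pos divide_pos_pos mult_pos_pos zero_less_numeral zero_less_one)
  have bd: "norm (X n y - X n d) < e / 3" for n
  proof -
    have "norm (X n (y - d)) \<le> norm (X n) * norm (y - d)" by (rule norm_blinfun)
    also have "\<dots> \<le> (K + 1) * norm (y - d)" using K[of n] by (intro mult_right_mono) auto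
    also have "\<dots> < (K + 1) * (e / (3 * (K + 1)))"
      using d(2) K0 by (intro mult_strict_left_mono) (auto simp: dist_norm norm_minus_commute)
    also have "\<dots> = e / 3"
    proof -
      have "K + 1 \<noteq> 0" using K0 by simp
      then show ?thesis by (simp add: field_simps)
    qed
    finally show ?thesis by (simp add: blinfun.diff_right)
  qed
  obtain M where M: "\<And>m n. M \<le> m \<Longrightarrow> M \<le> n \<Longrightarrow> norm (X m d - X n d) < e / 3"
    using CauchyD[OF cv[OF d(1)], of "e/3"] e by auto
  have "norm (X m y - X n y) < e" if "M \<le> m" "M \<le> n" for m n
  proof -
    have "X m y - X n y = (X m y - X m d) + (X m d - X n d) - (X n y - X n d)" by simp
    then have "norm (X m y - X n y) \<le> norm (X m y - X m d) + norm (X m d - X n d) + norm (X n y - X n d)"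
      using norm_triangle_ineq4[of "(X m y - X m d) + (X m d - X n d)" "X n y - X n d"]
        norm_triangle_ineq[of "X m y - X m d" "X m d - X n d"] by simp
    then show ?thesis using bd[of m] bd[of n] M[OF that] by linarith
  qed
  then show "\<exists>M. \<forall>m\<ge>M. \<forall>n\<ge>M. norm (X m y - X n y) < e" by (intro exI[of _ M]) simp
qed

lemma compose_eqD: "S o\<^sub>L T = U o\<^sub>L V \<Longrightarrow> S (T x) = U (V x)"
  by (drule arg_cong[of _ _ "\<lambda>T. blinfun_apply T x"]) simp

lemma compose_zeroD: "S o\<^sub>L T = 0 \<Longrightarrow> S (T x) = 0"
  by (drule arg_cong[of _ _ "\<lambda>T. blinfun_apply T x"]) (simp add: blinfun_simps)

lemma compose_eqD1: "S o\<^sub>L T = U \<Longrightarrow> S (T x) = U x"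
  by (drule arg_cong[of _ _ "\<lambda>T. blinfun_apply T x"]) simp

lemma scalar_op_apply [simp]: "blinfun_apply (scalar_op c) x = scaleC c (x::'h::chilbert)"
  unfolding scalar_op_def by (simp add: bounded_linear_Blinfun_apply bounded_linear_scaleC)

lemma clinear_scalar_op [simp]: "clinear_op (scalar_op c)"
  by (simp add: clinear_op_def scaleC_scaleC mult.commute)

lemma scalar_op_real: "scalar_op (of_real r) o\<^sub>L T = r *\<^sub>R T"
  by (rule blinfun_eqI) (simp add: scaleC_complex_of_real blinfun_simps)

locale finite_von_Neumann =
  fixes A :: "('h::chilbert \<Rightarrow>\<^sub>L 'h) set" and tr :: "('h \<Rightarrow>\<^sub>L 'h) \<Rightarrow> complex"
  assumes vN: "von_Neumann_algebra A" and trace: "normal_faithful_trace A tr"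
begin

lemma clinear [simp]: "a \<in> A \<Longrightarrow> clinear_op a"
  and adj_mem [simp]: "a \<in> A \<Longrightarrow> adj a \<in> A"
  and bicommutant: "commutant (commutant A) = A" using vN unfolding von_Neumann_algebra_def by auto

text \<open>Resolvents, strong limits and projections onto invariant subspaces all enter
  \<open>A\<close> through this rule: it suffices that they commute with the commutant.\<close>

lemma memI:
  assumes "clinear_op T" "\<And>S x. S \<in> commutant A \<Longrightarrow> T (S x) = S (T x)"
  shows "T \<in> A"
proof -
  have "T o\<^sub>L S = S o\<^sub>L T" if "S \<in> commutant A" for S by (rule blinfun_eqI) (simp add: assms(2) that)
  then have "T \<in> commutant (commutant A)" using assms(1) by (simp add: commutant_def[of "commutant A"])
  then show ?thesis by (simp add: bicommutant)
qed

lemma commutant_apply: "a \<in> A \<Longrightarrow> S \<in> commutant A \<Longrightarrow> S (a x) = a (S x)"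
  by (rule compose_eqD) (simp add: commutant_def)

lemma commutant_clinear: "S \<in> commutant A \<Longrightarrow> clinear_op S" by (simp add: commutant_def)

lemma commutant_adj:
  assumes S: "S \<in> commutant A" shows "adj S \<in> commutant A"
proof -
  have "adj S o\<^sub>L a = a o\<^sub>L adj S" if a: "a \<in> A" for a
  proof -
    have "S o\<^sub>L adj a = adj a o\<^sub>L S" using S a adj_mem by (simp add: commutant_def)
    then have "adj (S o\<^sub>L adj a) = adj (adj a o\<^sub>L S)" by simp
    then show ?thesis using a commutant_clinear[OF S] by (simp add: adj_simps)
  qed
  then show ?thesis using commutant_clinear[OF S] clinear_adj by (simp add: commutant_def)
qed

lemma mem_0 [simp]: "0 \<in> A" and mem_id [simp]: "id_blinfun \<in> A" by (rule memI; simp add: blinfun_simps)+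

lemma mem_closed [simp]:
  assumes "a \<in> A"
  shows "- a \<in> A" "r *\<^sub>R a \<in> A" "b \<in> A \<Longrightarrow> a + b \<in> A" "b \<in> A \<Longrightarrow> a - b \<in> A" "b \<in> A \<Longrightarrow> a o\<^sub>L b \<in> A"
proof -
  note 1 = commutant_apply[OF assms]
  show "- a \<in> A" "r *\<^sub>R a \<in> A" by (rule memI; simp add: blinfun_simps 1 assms)+
  assume b: "b \<in> A"
  note 2 = commutant_apply[OF b]
  show "a + b \<in> A" "a - b \<in> A" "a o\<^sub>L b \<in> A" by (rule memI; simp add: blinfun_simps 1 2 assms b)+
qed

lemma mem_scalar [simp]: "scalar_op c \<in> A" by (rule memI) (simp_all add: clinear_opD commutant_clinear)

lemma mem_sum [simp]: "(\<And>i. i \<in> I \<Longrightarrow> f i \<in> A) \<Longrightarrow> (\<Sum>i\<in>I. f i) \<in> A"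
  by (induction I rule: infinite_finite_induct) (simp_all add: mem_closed(3))

lemma mem_limit:
  assumes "clinear_op L" "\<And>n. X n \<in> A" "\<And>y. (\<lambda>n. X n y) \<longlonglongrightarrow> blinfun_apply L y"
  shows "L \<in> A"
proof (rule memI[OF assms(1)])
  fix S x assume S: "S \<in> commutant A"
  have "(\<lambda>n. S (X n x)) \<longlonglongrightarrow> S (L x)" by (intro blinfun.tendsto tendsto_const assms)
  then have "(\<lambda>n. X n (S x)) \<longlonglongrightarrow> S (L x)" using commutant_apply[OF assms(2) S] by simp
  then show "L (S x) = S (L x)" using assms(3) LIMSEQ_unique by blast
qed

lemma mem_res [simp]:
  assumes k: "k \<in> A" "pos_op k" shows "res k \<in> A"
proof (rule memI)
  fix S x assume S: "S \<in> commutant A"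
  have 1: "res k (y + k y) = y" for y
    using arg_cong[OF res_left[OF k(2)], of "\<lambda>T. T y"] by (simp add: blinfun_simps)
  have 2: "res k y + k (res k y) = y" for y
    using arg_cong[OF res_right[OF k(2)], of "\<lambda>T. T y"] by (simp add: blinfun_simps)
  have "S (res k x) = res k (S (res k x) + k (S (res k x)))" by (simp only: 1)
  also have "\<dots> = res k (S (res k x + k (res k x)))"
    by (simp only: blinfun.add_right commutant_apply[OF k(1) S])
  finally show "res k (S x) = S (res k x)" by (simp only: 2)
qed (simp add: res_pos[OF k(2)])

definition projection :: "('h \<Rightarrow>\<^sub>L 'h) \<Rightarrow> bool" where
  "projection e \<longleftrightarrow> e \<in> A \<and> e o\<^sub>L e = e \<and> adj e = e"

lemma projectionD: "projection e \<Longrightarrow> e \<in> A" "projection e \<Longrightarrow> e o\<^sub>L e = e" "projection e \<Longrightarrow> adj e = e"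
  "projection e \<Longrightarrow> e (e x) = e x" "projection e \<Longrightarrow> pos_op e"
proof -
  show 1: "e \<in> A" "e o\<^sub>L e = e" "adj e = e" if "projection e" using that by (simp_all add: projection_def)
  show "e (e x) = e x" if "projection e" by (rule compose_eqD1[OF 1(2)[OF that]])
  show "pos_op e" if "projection e" using pos_op_adj_mult[OF clinear[OF 1(1)[OF that]]] 1(2,3)[OF that] by simp
qed

text \<open>The commutant is closed under adjoints, so with \<open>V\<close> it also preserves the
  orthogonal complement of \<open>V\<close>. Hence it commutes with the projection.\<close>

lemma projection_onto:
  assumes V: "csubspace V" "closed V" and inv: "\<And>S x. S \<in> commutant A \<Longrightarrow> x \<in> V \<Longrightarrow> S x \<in> V"
  obtains e where "projection e" "\<And>x. blinfun_apply e x \<in> V" "\<And>x. x \<in> V \<Longrightarrow> blinfun_apply e x = x"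
proof -
  obtain P where P: "clinear_op P" "\<And>x. blinfun_apply P x \<in> V"
    and po: "\<And>x v. v \<in> V \<Longrightarrow> cinner (x - blinfun_apply P x) v = 0"
    and pid: "\<And>v. v \<in> V \<Longrightarrow> blinfun_apply P v = v"
    and sym: "\<And>x y. cinner (blinfun_apply P x) y = cinner x (blinfun_apply P y)"
    by (rule projection_exists[OF V]) (rule that)
  have z: "P y = 0" if "\<And>v. v \<in> V \<Longrightarrow> cinner y v = 0" for y
  proof -
    have "cinner (P y) (P y) = cinner y (P (P y))" by (rule sym)
    also have "\<dots> = 0" by (rule that) (rule P)
    finally show ?thesis by simp
  qed
  have "P \<in> A"
  proof (rule memI[OF P(1)])
    fix S x assume S: "S \<in> commutant A"
    have "P (S (x - P x)) = 0"
    proof (rule z)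
      fix v assume v: "v \<in> V"
      have "cinner (S (x - P x)) v = cinner (x - P x) (adj S v)" by (rule cinner_adj[OF commutant_clinear[OF S]])
      also have "\<dots> = 0" by (rule po) (rule inv[OF commutant_adj[OF S] v])
      finally show "cinner (S (x - P x)) v = 0" .
    qed
    then have "P (S x) = P (S (P x))" by (simp add: blinfun_simps)
    also have "\<dots> = S (P x)" by (rule pid) (rule inv[OF S P(2)])
    finally show "P (S x) = S (P x)" .
  qed
  moreover have "P o\<^sub>L P = P" by (rule blinfun_eqI) (simp add: pid P)
  moreover have "adj P = P" by (rule adj_eqI) (rule sym)
  ultimately have "projection P" by (simp add: projection_def)
  then show thesis using that P(2) pid by blast
qed

lemma kernel_projection:
  assumes a: "a \<in> A"
  obtains q where "projection q" "a o\<^sub>L q = 0" "\<And>x. blinfun_apply a x = 0 \<Longrightarrow> blinfun_apply q x = x"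
proof -
  have V: "csubspace {x. a x = 0}" using a by (auto simp: csubspace_def blinfun_simps clinear_opD)
  have cl: "closed {x. a x = 0}"
    by (intro closed_Collect_eq continuous_on_const linear_continuous_on blinfun.bounded_linear_right)
  have inv: "S x \<in> {x. a x = 0}" if "S \<in> commutant A" "x \<in> {x. a x = 0}" for S x
    using commutant_apply[OF a that(1), of x] that(2) by (simp add: blinfun_simps)
  obtain q where q: "projection q" "\<And>x. blinfun_apply q x \<in> {x. a x = 0}"
    and qid: "\<And>x. x \<in> {x. a x = 0} \<Longrightarrow> blinfun_apply q x = x"
    by (rule projection_onto[OF V cl]) (rule inv, assumption+, rule that)
  have "a o\<^sub>L q = 0" by (rule blinfun_eqI) (use q(2) in \<open>simp add: blinfun_simps\<close>)
  from that[OF q(1) this qid] show thesis by simp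
qed

text \<open>\<open>f\<close> is the range projection of \<open>b\<close>, the complement of the
  projection onto the kernel of \<open>adj b\<close>. It makes the left ideal \<open>A b\<close>
  isomorphic to the projective module \<open>A f\<close>.\<close>

lemma left_annihilator:
  assumes b: "b \<in> A"
  obtains f where "projection f" "\<And>x. x \<in> A \<Longrightarrow> x o\<^sub>L b = 0 \<longleftrightarrow> x o\<^sub>L f = 0"
proof -
  obtain q where q: "projection q" "adj b o\<^sub>L q = 0" "\<And>x. blinfun_apply (adj b) x = 0 \<Longrightarrow> blinfun_apply q x = x"
    by (rule kernel_projection[OF adj_mem[OF b]]) (rule that)
  note qD = projectionD[OF q(1)]
  define f where "f = id_blinfun - q"
  have "projection f" using qD by (simp add: projection_def f_def compose_distrib adj_simps)
  moreover have "x o\<^sub>L b = 0 \<longleftrightarrow> x o\<^sub>L f = 0" if x: "x \<in> A" for x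
  proof
    assume "x o\<^sub>L b = 0"
    then have "adj (x o\<^sub>L b) = 0" by (simp add: adj_simps)
    then have "adj b o\<^sub>L adj x = 0" by (simp add: adj_simps b x)
    then have "q o\<^sub>L adj x = adj x" by (intro blinfun_eqI) (simp add: q(3) compose_zeroD)
    then have "adj (q o\<^sub>L adj x) = x" using x by simp
    then have "x o\<^sub>L q = x" using x qD by (simp add: adj_simps clinear_adj)
    then show "x o\<^sub>L f = 0" by (simp add: f_def compose_distrib)
  next
    assume "x o\<^sub>L f = 0"
    then have xq: "x = x o\<^sub>L q" by (simp add: f_def compose_distrib)
    have "adj (adj b o\<^sub>L q) = 0" using q(2) by (simp add: adj_simps)
    then have "q o\<^sub>L b = 0" using b qD by (simp add: adj_simps clinear_adj)
    have "x o\<^sub>L b = x o\<^sub>L (q o\<^sub>L b)" by (subst xq) (rule compose_assoc)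
    then show "x o\<^sub>L b = 0" using \<open>q o\<^sub>L b = 0\<close> by simp
  qed
  ultimately show thesis by (rule that)
qed

subsection \<open>The trace\<close>

definition \<tau> :: "('h \<Rightarrow>\<^sub>L 'h) \<Rightarrow> real" where "\<tau> a = Re (tr a)"

lemma tr_add: "a \<in> A \<Longrightarrow> b \<in> A \<Longrightarrow> tr (a + b) = tr a + tr b"
  and tr_scalar: "a \<in> A \<Longrightarrow> tr (scalar_op c o\<^sub>L a) = c * tr a"
  and tr_commute: "a \<in> A \<Longrightarrow> b \<in> A \<Longrightarrow> tr (a o\<^sub>L b) = tr (b o\<^sub>L a)"
  and tr_pos: "a \<in> A \<Longrightarrow> pos_op a \<Longrightarrow> Im (tr a) = 0 \<and> 0 \<le> Re (tr a)"
  and tr_faithful: "a \<in> A \<Longrightarrow> pos_op a \<Longrightarrow> tr a = 0 \<Longrightarrow> a = 0"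
  using trace unfolding normal_faithful_trace_def by (elim conjE; simp)+

lemma tr_normal: "D \<noteq> {} \<Longrightarrow> D \<subseteq> {a\<in>A. pos_op a} \<Longrightarrow>
        (\<forall>a\<in>D. \<forall>b\<in>D. \<exists>c\<in>D. ple a c \<and> ple b c) \<Longrightarrow> s \<in> A \<Longrightarrow> (\<forall>a\<in>D. ple a s) \<Longrightarrow>
        (\<forall>b\<in>A. (\<forall>a\<in>D. ple a b) \<longrightarrow> ple s b) \<Longrightarrow> Re (tr s) = (SUP a\<in>D. Re (tr a))"
  using trace unfolding normal_faithful_trace_def
  apply (elim conjE)
  apply (erule allE[of _ D], erule allE[of _ s], erule mp)
  apply (intro conjI; assumption)
  done

lemma tau_add: "a \<in> A \<Longrightarrow> b \<in> A \<Longrightarrow> \<tau> (a + b) = \<tau> a + \<tau> b" by (simp add: \<tau>_def tr_add)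

lemma tau_scale: "a \<in> A \<Longrightarrow> \<tau> (r *\<^sub>R a) = r * \<tau> a"
  unfolding \<tau>_def scalar_op_real[symmetric] by (simp add: tr_scalar)

lemma tau_diff: "a \<in> A \<Longrightarrow> b \<in> A \<Longrightarrow> \<tau> (a - b) = \<tau> a - \<tau> b" using tau_add[of "a - b" b] by simp

lemma tau_0 [simp]: "\<tau> 0 = 0" using tau_add[of 0 0] by simp

lemma tau_commute: "a \<in> A \<Longrightarrow> b \<in> A \<Longrightarrow> \<tau> (a o\<^sub>L b) = \<tau> (b o\<^sub>L a)" by (simp add: \<tau>_def tr_commute)

lemma tau_nonneg: "a \<in> A \<Longrightarrow> pos_op a \<Longrightarrow> 0 \<le> \<tau> a" by (simp add: \<tau>_def tr_pos)

lemma tau_faithful: "a \<in> A \<Longrightarrow> pos_op a \<Longrightarrow> \<tau> a \<le> 0 \<Longrightarrow> a = 0"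
  by (rule tr_faithful) (use tr_pos[of a] in \<open>auto simp: \<tau>_def complex_eq_iff\<close>)

lemma tau_mono: "a \<in> A \<Longrightarrow> b \<in> A \<Longrightarrow> ple a b \<Longrightarrow> \<tau> a \<le> \<tau> b" using tau_nonneg[of "b - a"] by (simp add: tau_diff)

text \<open>Normality concerns increasing families of positive elements, so it is applied to
  \<open>X 0 - X n\<close>. Their strong limit is their least upper bound because positivity
  survives strong limits.\<close>

lemma tau_decreasing_limit:
  assumes X: "\<And>n. X n \<in> A" and L: "L \<in> A" and dec: "\<And>m n. m \<le> n \<Longrightarrow> ple (X n) (X m)"
    and lim: "\<And>y. (\<lambda>n. X n y) \<longlonglongrightarrow> blinfun_apply L y" and le: "\<And>n. ple L (X n)"
  shows "(\<lambda>n. \<tau> (X n)) \<longlonglongrightarrow> \<tau> L"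
proof -
  define Y where "Y = (\<lambda>n. X 0 - X n)"
  have YA: "Y n \<in> A" for n by (simp add: Y_def X)
  have Yinc: "ple (Y m) (Y n)" if "m \<le> n" for m n using dec[OF that] by (simp add: Y_def)
  have "Re (tr (X 0 - L)) = (SUP a\<in>range Y. Re (tr a))"
  proof (rule tr_normal)
    show "range Y \<subseteq> {a \<in> A. pos_op a}" using dec YA by (auto simp: Y_def X)
    show "\<forall>a\<in>range Y. \<forall>b\<in>range Y. \<exists>c\<in>range Y. ple a c \<and> ple b c"
    proof (clarsimp)
      fix m n show "\<exists>k. ple (Y m) (Y k) \<and> ple (Y n) (Y k)" by (intro exI[of _ "max m n"] conjI Yinc) auto
    qed
    show "\<forall>a\<in>range Y. ple a (X 0 - L)" using le by (auto simp: Y_def)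
    show "\<forall>b\<in>A. (\<forall>a\<in>range Y. ple a b) \<longrightarrow> ple (X 0 - L) b"
    proof (intro ballI impI)
      fix b assume b: "b \<in> A" "\<forall>a\<in>range Y. ple a b"
      show "ple (X 0 - L) b"
      proof (rule pos_op_strong_limit[where X="\<lambda>n. b - Y n"])
        show "(\<lambda>n. (b - Y n) y) \<longlonglongrightarrow> (b - (X 0 - L)) y" for y
          by (simp add: Y_def blinfun_simps) (intro tendsto_intros lim)
      qed (use b L X in auto)
    qed
  qed (use X L in auto)
  then have sup: "\<tau> (X 0 - L) = (SUP n. \<tau> (Y n))" by (simp add: \<tau>_def image_image)
  have "(\<lambda>n. \<tau> (Y n)) \<longlonglongrightarrow> (SUP n. \<tau> (Y n))"
  proof (rule LIMSEQ_incseq_SUP)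
    show "bdd_above (range (\<lambda>n. \<tau> (Y n)))"
      by (rule bdd_aboveI2[of _ _ "\<tau> (X 0 - L)"], rule tau_mono) (use X L le in \<open>auto simp: Y_def\<close>)
    show "incseq (\<lambda>n. \<tau> (Y n))" unfolding incseq_def by (intro allI impI tau_mono YA Yinc)
  qed
  then have "(\<lambda>n. \<tau> (X 0) - \<tau> (Y n)) \<longlonglongrightarrow> \<tau> (X 0) - \<tau> (X 0 - L)" unfolding sup by (intro tendsto_intros)
  then show ?thesis by (simp add: Y_def tau_diff X L)
qed

text \<open>In the block decomposition of \<open>x\<close> along \<open>q\<close> and
  \<open>1 - q\<close> the off-diagonal blocks have trace zero, and the second diagonal block has
  nonnegative trace.\<close>

lemma tau_compress:
  assumes q: "projection q" and x: "x \<in> A" "pos_op x"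
  shows "\<tau> (q o\<^sub>L x o\<^sub>L q) \<le> \<tau> x"
proof -
  define p where "p = id_blinfun - q"
  note qD = projectionD[OF q]
  have p: "p \<in> A" "adj p = p" using qD by (simp_all add: p_def adj_simps)
  have pq: "p o\<^sub>L q = 0" using qD by (simp add: p_def compose_distrib)
  have qp: "q o\<^sub>L p = 0" using qD by (simp add: p_def compose_distrib)
  have "x = (q + p) o\<^sub>L x o\<^sub>L (q + p)" by (simp add: p_def)
  also have "\<dots> = (q o\<^sub>L x o\<^sub>L q) + (p o\<^sub>L x o\<^sub>L p) + ((q o\<^sub>L x o\<^sub>L p) + (p o\<^sub>L x o\<^sub>L q))"
    by (simp add: compose_distrib algebra_simps)
  finally have "\<tau> x = \<tau> ((q o\<^sub>L x o\<^sub>L q) + (p o\<^sub>L x o\<^sub>L p) + ((q o\<^sub>L x o\<^sub>L p) + (p o\<^sub>L x o\<^sub>L q)))"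
    by (rule arg_cong)
  also have "\<dots> = \<tau> (q o\<^sub>L x o\<^sub>L q) + \<tau> (p o\<^sub>L x o\<^sub>L p) + (\<tau> (q o\<^sub>L x o\<^sub>L p) + \<tau> (p o\<^sub>L x o\<^sub>L q))"
    using x p qD by (simp add: tau_add)
  also have "\<tau> (q o\<^sub>L x o\<^sub>L p) = 0"
    using tau_commute[of "q o\<^sub>L x" p] x p qD pq by (simp add: compose_assoc[symmetric])
  also have "\<tau> (p o\<^sub>L x o\<^sub>L q) = 0"
    using tau_commute[of "p o\<^sub>L x" q] x p qD qp by (simp add: compose_assoc[symmetric])
  finally show ?thesis using tau_nonneg[of "p o\<^sub>L x o\<^sub>L p"] pos_op_congr[of p x] x p by simp
qed

text \<open>Follows from \<open>x (1 + adj x x)^-1 = (1 + x adj x)^-1 x\<close> and the trace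
  property, applied to the complements \<open>1 - res\<close>. It carries the comparison of left and
  right supports of \<open>x\<close>, without a polar decomposition.\<close>

lemma tau_res_commute:
  assumes x: "x \<in> A"
  shows "\<tau> (res (x o\<^sub>L adj x)) = \<tau> (res (adj x o\<^sub>L x))"
proof -
  define u v where "u = x o\<^sub>L adj x" and "v = adj x o\<^sub>L x"
  have p: "pos_op u" "pos_op v" using x by (simp_all add: u_def v_def pos_op_mult_adj pos_op_adj_mult)
  have m: "u \<in> A" "v \<in> A" using x by (simp_all add: u_def v_def)
  have "(id_blinfun + u) o\<^sub>L x = x o\<^sub>L (id_blinfun + v)"
    by (simp add: u_def v_def compose_distrib compose_assoc)
  moreover have "x o\<^sub>L res v = (res u o\<^sub>L (id_blinfun + u)) o\<^sub>L (x o\<^sub>L res v)"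
    by (simp only: res_left[OF p(1)] compose_id)
  ultimately have "x o\<^sub>L res v = res u o\<^sub>L (x o\<^sub>L ((id_blinfun + v) o\<^sub>L res v))"
    by (simp only: compose_assoc[symmetric]) (simp only: compose_assoc)
  then have c: "x o\<^sub>L res v = res u o\<^sub>L x" by (simp only: res_right[OF p(2)] compose_id)
  have "\<tau> (id_blinfun - res u) = \<tau> (res u o\<^sub>L u)" using res_compl[OF p(1)] by simp
  also have "\<dots> = \<tau> (x o\<^sub>L res v o\<^sub>L adj x)" by (simp add: u_def c compose_assoc[symmetric])
  also have "\<dots> = \<tau> (adj x o\<^sub>L (x o\<^sub>L res v))" using x m p by (intro tau_commute) auto
  also have "\<dots> = \<tau> (v o\<^sub>L res v)" by (simp add: v_def compose_assoc)
  also have "\<dots> = \<tau> (id_blinfun - res v)" using res_compl[OF p(2)] by simp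
  finally show ?thesis using m p by (simp add: tau_diff u_def v_def)
qed

lemma res_decreasing_limit:
  assumes k: "\<And>n. k n \<in> A" "\<And>n. pos_op (k n)" "\<And>m n. m \<le> n \<Longrightarrow> ple (k m) (k n)"
  obtains t where "t \<in> A" "pos_op t" "\<And>y. (\<lambda>n. res (k n) y) \<longlonglongrightarrow> blinfun_apply t y"
    "(\<lambda>n. \<tau> (res (k n))) \<longlonglongrightarrow> \<tau> t" "\<And>n. ple t (res (k n))"
proof -
  have dec: "ple (res (k n)) (res (k m))" if "m \<le> n" for m n by (intro res_antitone k that)
  obtain t where t: "pos_op t" "\<And>y. (\<lambda>n. res (k n) y) \<longlonglongrightarrow> blinfun_apply t y" "\<And>n. ple t (res (k n))"
    using decreasing_strong_limit[of "\<lambda>n. res (k n)", OF res_pos[OF k(2)] dec] by blast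
  have tA: "t \<in> A" by (rule mem_limit[OF pos_op_clinear[OF t(1)] mem_res[OF k(1,2)] t(2)])
  have "(\<lambda>n. \<tau> (res (k n))) \<longlonglongrightarrow> \<tau> t" by (rule tau_decreasing_limit[OF mem_res[OF k(1,2)] tA dec t(2,3)])
  from that[OF tA t(1,2) this t(3)] show thesis .
qed

text \<open>The hypothesis \<open>small\<close> says that the \<open>k n\<close> are bounded
  uniformly in \<open>n\<close> up to a part of small trace. If \<open>q\<close> projects onto the
  kernel of the limit \<open>t\<close>, then \<open>q\<close> is also killed by each limit
  \<open>s\<close> of \<open>res (\<delta> k n)\<close>; compressing \<open>1 - s\<close> by
  \<open>q\<close> gives \<open>q\<close> back, so the trace of \<open>q\<close> is at most
  \<open>e\<close>.\<close>

lemma res_limit_injective: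
  assumes k: "\<And>n. k n \<in> A" "\<And>n. pos_op (k n)" "\<And>m n. m \<le> n \<Longrightarrow> ple (k m) (k n)"
    and small: "\<And>e. e > 0 \<Longrightarrow> \<exists>\<delta>. 0 < \<delta> \<and> \<delta> \<le> 1 \<and> (\<forall>n. \<tau> (id_blinfun - res (\<delta> *\<^sub>R k n)) \<le> e)"
  obtains t where "t \<in> A" "pos_op t" "\<And>y. (\<lambda>n. res (k n) y) \<longlonglongrightarrow> blinfun_apply t y"
    "\<And>y. blinfun_apply t y = 0 \<Longrightarrow> y = 0" "\<And>n. ple t (res (k n))"
proof -
  obtain t where t: "t \<in> A" "pos_op t" "\<And>y. (\<lambda>n. res (k n) y) \<longlonglongrightarrow> blinfun_apply t y" "\<And>n. ple t (res (k n))"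
    by (rule res_decreasing_limit[of k, OF k(1,2)]) (rule k(3), assumption, rule that)
  obtain q where q: "projection q" "t o\<^sub>L q = 0" "\<And>x. blinfun_apply t x = 0 \<Longrightarrow> blinfun_apply q x = x"
    by (rule kernel_projection[OF t(1)]) (rule that)
  note qD = projectionD[OF q(1)]
  have "\<tau> q \<le> e" if e: "e > 0" for e
  proof -
    from small[OF e] obtain \<delta> where d: "0 < \<delta>" "\<delta> \<le> 1" and "\<forall>n. \<tau> (id_blinfun - res (\<delta> *\<^sub>R k n)) \<le> e"
      by (elim exE conjE) (rule that)
    then have d3: "\<tau> (id_blinfun - res (\<delta> *\<^sub>R k n)) \<le> e" for n by simp
    have k': "\<delta> *\<^sub>R k n \<in> A" "pos_op (\<delta> *\<^sub>R k n)" for n using d(1) by (simp_all add: k(1,2) pos_op_scaleR)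
    have k'': "ple (\<delta> *\<^sub>R k m) (\<delta> *\<^sub>R k n)" if "m \<le> n" for m n
      using pos_op_scaleR[OF k(3)[OF that], of \<delta>] d by (simp add: scaleR_diff_right)
    obtain s where s: "s \<in> A" "pos_op s" "\<And>y. (\<lambda>n. res (\<delta> *\<^sub>R k n) y) \<longlonglongrightarrow> blinfun_apply s y"
      "(\<lambda>n. \<tau> (res (\<delta> *\<^sub>R k n))) \<longlonglongrightarrow> \<tau> s" "\<And>n. ple s (res (\<delta> *\<^sub>R k n))"
      by (rule res_decreasing_limit[of "\<lambda>n. \<delta> *\<^sub>R k n"]) (rule k', rule k', rule k'', assumption, rule that)
    \<comment> \<open>\<open>res_scale\<close> passes to the strong limit; thus a vector killed by
      \<open>t\<close> has zero form under \<open>s\<close> and is killed by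
      \<open>s\<close>.\<close>
    have "ple (\<delta> *\<^sub>R s) t"
    proof (rule pos_op_strong_limit[where X="\<lambda>n. res (k n) - \<delta> *\<^sub>R res (\<delta> *\<^sub>R k n)"])
      show "(\<lambda>n. (res (k n) - \<delta> *\<^sub>R res (\<delta> *\<^sub>R k n)) y) \<longlonglongrightarrow> (t - \<delta> *\<^sub>R s) y" for y
        unfolding blinfun_simps by (intro tendsto_intros t s)
    qed (use s t in simp, rule res_scale[OF k(2) d(1,2)])
    then have "qf (\<delta> *\<^sub>R s) (q y) \<le> qf t (q y)" for y by (rule ple_qf)
    moreover have "t (q y) = 0" for y using q(2) by (rule compose_zeroD)
    ultimately have le0: "\<delta> * qf s (q y) \<le> 0" for y by (simp add: blinfun_simps cinner_simps)
    have "qf s (q y) = 0" for y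
    proof (rule antisym[OF _ pos_op_qf[OF s(2)]])
      show "qf s (q y) \<le> 0" using le0[of y] d(1) by (simp add: mult_le_0_iff)
    qed
    then have "s (q y) = 0" for y by (intro pos_op_qf_zero[OF s(2)])
    then have sq: "s o\<^sub>L q = 0" by (intro blinfun_eqI) (simp add: blinfun_simps)
    have "ple s id_blinfun" using ple_trans[OF s(5) res_le_id[OF k'(2)]] by simp
    then have "\<tau> (q o\<^sub>L (id_blinfun - s) o\<^sub>L q) \<le> \<tau> (id_blinfun - s)" using s by (intro tau_compress q) auto
    moreover have "q o\<^sub>L (id_blinfun - s) o\<^sub>L q = q"
      using sq qD by (simp add: compose_distrib compose_assoc)
    ultimately have "\<tau> q \<le> \<tau> id_blinfun - \<tau> s" using s by (simp add: tau_diff)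
    also have "\<dots> \<le> e"
    proof (rule LIMSEQ_le_const2)
      show "(\<lambda>n. \<tau> id_blinfun - \<tau> (res (\<delta> *\<^sub>R k n))) \<longlonglongrightarrow> \<tau> id_blinfun - \<tau> s" by (intro tendsto_intros s)
      show "\<exists>N. \<forall>n\<ge>N. \<tau> id_blinfun - \<tau> (res (\<delta> *\<^sub>R k n)) \<le> e" using d3 by (simp add: tau_diff k')
    qed
    finally show ?thesis .
  qed
  then have "\<tau> q \<le> 0" by (rule field_le_epsilon[of _ 0, simplified])
  then have "q = 0" using qD by (intro tau_faithful)
  then have "y = 0" if "t y = 0" for y using q(3)[OF that] by (simp add: blinfun_simps)
  from that[OF t(1-3) this t(4)] show thesis .
qed

text \<open>The limit is the projection onto the kernel of \<open>h\<close>. That \<open>h\<close>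
  kills it comes from \<open>h res (n h) = (1 - res (n h)) / n\<close>.\<close>

lemma res_multiples:
  assumes h: "h \<in> A" "pos_op h"
  obtains x where "x \<in> A" "pos_op x" "\<And>y. (\<lambda>n. res (real n *\<^sub>R h) y) \<longlonglongrightarrow> blinfun_apply x y"
    "(\<lambda>n. \<tau> (res (real n *\<^sub>R h))) \<longlonglongrightarrow> \<tau> x" "h o\<^sub>L x = 0"
proof -
  have k: "real n *\<^sub>R h \<in> A" "pos_op (real n *\<^sub>R h)" for n using h by (auto intro: pos_op_scaleR)
  have k': "ple (real m *\<^sub>R h) (real n *\<^sub>R h)" if "m \<le> n" for m n
    using pos_op_scaleR[OF h(2), of "real n - real m"] that by (simp add: scaleR_diff_left)
  obtain x where x: "x \<in> A" "pos_op x" "\<And>y. (\<lambda>n. res (real n *\<^sub>R h) y) \<longlonglongrightarrow> blinfun_apply x y"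
    "(\<lambda>n. \<tau> (res (real n *\<^sub>R h))) \<longlonglongrightarrow> \<tau> x" by (rule res_decreasing_limit[of "\<lambda>n. real n *\<^sub>R h", OF k]) (rule k', assumption, rule that)
  have "h (x y) = 0" for y
  proof -
    have 1: "(\<lambda>n. h (res (real n *\<^sub>R h) y)) \<longlonglongrightarrow> h (x y)" by (intro blinfun.tendsto tendsto_const x)
    \<comment> \<open>The index \<open>Suc n\<close> avoids a division by zero.\<close>
    have e: "h (res (real (Suc n) *\<^sub>R h) y) = (1 / real (Suc n)) *\<^sub>R (y - res (real (Suc n) *\<^sub>R h) y)" for n
    proof -
      have "(real (Suc n) *\<^sub>R h o\<^sub>L res (real (Suc n) *\<^sub>R h)) y = (id_blinfun - res (real (Suc n) *\<^sub>R h)) y"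
        unfolding res_compl(1)[OF k(2)] ..
      then show ?thesis by (simp add: blinfun_simps del: of_nat_Suc flip: scaleR_eq_iff)
          (metis (no_types, lifting) divide_self_if of_nat_eq_0_iff old.nat.distinct(2) scaleR_one scaleR_scaleR times_divide_eq_left mult_1)
    qed
    have "(\<lambda>n. (1 / real (Suc n)) *\<^sub>R (y - res (real (Suc n) *\<^sub>R h) y)) \<longlonglongrightarrow> 0 *\<^sub>R (y - x y)"
      by (intro tendsto_intros LIMSEQ_Suc[OF lim_1_over_n] LIMSEQ_Suc[OF x(3)])
    then have "(\<lambda>n. h (res (real (Suc n) *\<^sub>R h) y)) \<longlonglongrightarrow> 0" unfolding e by simp
    then show ?thesis using LIMSEQ_unique[OF LIMSEQ_Suc[OF 1]] by blast
  qed
  then have "h o\<^sub>L x = 0" by (intro blinfun_eqI) (simp add: blinfun_simps)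
  from that[OF x this] show thesis .
qed

lemma tau_res_multiples_injective:
  assumes h: "h \<in> A" "pos_op h" and inj: "\<And>y. blinfun_apply h y = 0 \<Longrightarrow> y = 0"
  shows "(\<lambda>n. \<tau> (res (real n *\<^sub>R h))) \<longlonglongrightarrow> 0"
proof -
  obtain x where x: "(\<lambda>n. \<tau> (res (real n *\<^sub>R h))) \<longlonglongrightarrow> \<tau> x" "h o\<^sub>L x = 0"
    by (rule res_multiples[OF h]) (rule that)
  have "x = 0"
    by (rule blinfun_eqI) (unfold blinfun.zero_left, rule inj, rule compose_zeroD[OF x(2)])
  with x(1) show ?thesis by simp
qed

subsection \<open>Non-zero-divisors and the Ore condition\<close>

text \<open>Injectivity is the form in which limits deliver regular elements. Cancellation from the
  right also holds for them, but rests on finiteness through \<open>adj_nzd\<close>.\<close>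

definition nzd :: "('h \<Rightarrow>\<^sub>L 'h) set" where
  "nzd = {s \<in> A. \<forall>y. s y = 0 \<longrightarrow> y = 0}"

lemma nzd_mem [simp]: "s \<in> nzd \<Longrightarrow> s \<in> A"
  and nzd_inj: "s \<in> nzd \<Longrightarrow> s y = 0 \<Longrightarrow> y = 0" unfolding nzd_def by blast+

lemma nzdI: "s \<in> A \<Longrightarrow> (\<And>y. s y = 0 \<Longrightarrow> y = 0) \<Longrightarrow> s \<in> nzd" unfolding nzd_def by (intro CollectI conjI allI impI)

lemma nzd_zero_iff: "s y = 0 \<longleftrightarrow> y = 0" if "s \<in> nzd"
proof
  show "s y = 0 \<Longrightarrow> y = 0" by (rule nzd_inj[OF that])
  show "y = 0 \<Longrightarrow> s y = 0" by (simp only: blinfun.zero_right)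
qed

lemma nzd_id [simp]: "id_blinfun \<in> nzd" by (rule nzdI) simp_all

lemma nzd_mult [intro]: "s \<in> nzd \<Longrightarrow> t \<in> nzd \<Longrightarrow> s o\<^sub>L t \<in> nzd" by (rule nzdI) (simp_all add: nzd_zero_iff)

text \<open>The kernel projections of \<open>s\<close> and \<open>adj s\<close> are the limits of
  \<open>res (n adj s s)\<close> and \<open>res (n s adj s)\<close>. These have equal traces, so the
  second kernel has trace zero along with the first.\<close>

lemma adj_nzd:
  assumes s: "s \<in> nzd" shows "adj s \<in> nzd"
proof (rule nzdI)
  show "adj s \<in> A" using s by simp
  have sA: "s \<in> A" and c: "clinear_op s" using s by simp_all
  have m: "adj s o\<^sub>L s \<in> A" "pos_op (adj s o\<^sub>L s)" "s o\<^sub>L adj s \<in> A" "pos_op (s o\<^sub>L adj s)"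
    using s by (simp_all add: pos_op_adj_mult pos_op_mult_adj)
  have inj: "y = 0" if "(adj s o\<^sub>L s) y = 0" for y
  proof -
    have "(norm (s y))\<^sup>2 = 0" using qf_adj_mult[OF c, of y] that by simp
    then show ?thesis using s by (simp add: nzd_zero_iff)
  qed
  obtain x where x: "x \<in> A" "pos_op x" "\<And>y. (\<lambda>n. res (real n *\<^sub>R (s o\<^sub>L adj s)) y) \<longlonglongrightarrow> blinfun_apply x y"
    "(\<lambda>n. \<tau> (res (real n *\<^sub>R (s o\<^sub>L adj s)))) \<longlonglongrightarrow> \<tau> x" by (rule res_multiples[OF m(3,4)]) (rule that)
  have e: "\<tau> (res (real n *\<^sub>R (s o\<^sub>L adj s))) = \<tau> (res (real n *\<^sub>R (adj s o\<^sub>L s)))" for n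
  proof -
    \<comment> \<open>The factor \<open>n\<close> is split into two square roots so that both
      products come from a single element, as \<open>tau_res_commute\<close> requires.\<close>
    have "(sqrt (real n) *\<^sub>R s) o\<^sub>L adj (sqrt (real n) *\<^sub>R s) = real n *\<^sub>R (s o\<^sub>L adj s)"
      "adj (sqrt (real n) *\<^sub>R s) o\<^sub>L (sqrt (real n) *\<^sub>R s) = real n *\<^sub>R (adj s o\<^sub>L s)"
      using c by (simp_all add: adj_simps compose_distrib)
    then show ?thesis using tau_res_commute[of "sqrt (real n) *\<^sub>R s"] sA by simp
  qed
  have "\<tau> x = 0" using LIMSEQ_unique[OF x(4)] tau_res_multiples_injective[OF m(1,2) inj] unfolding e by blast
  then have x0: "x = 0" using x by (intro tau_faithful) auto
  fix y assume y: "adj s y = 0"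
  have "res (real n *\<^sub>R (s o\<^sub>L adj s)) y = y" for n
  proof -
    have "(res (real n *\<^sub>R (s o\<^sub>L adj s)) o\<^sub>L (id_blinfun + real n *\<^sub>R (s o\<^sub>L adj s))) y = y"
      using res_left[of "real n *\<^sub>R (s o\<^sub>L adj s)"] m by (simp add: pos_op_scaleR)
    then show ?thesis using y by (simp add: blinfun_simps)
  qed
  then have "(\<lambda>n. y) \<longlonglongrightarrow> x y" using x(3)[of y] by simp
  then show "y = 0" using x0 by (simp add: LIMSEQ_const_iff blinfun_simps)
qed

lemma nzd_cancel_left: "s \<in> nzd \<Longrightarrow> s o\<^sub>L a = 0 \<Longrightarrow> a = 0"
  by (rule blinfun_eqI) (use nzd_zero_iff compose_zeroD[of s a] in \<open>simp add: blinfun_simps\<close>)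

lemma nzd_cancel_right:
  assumes s: "s \<in> nzd" and a: "clinear_op a" and z: "a o\<^sub>L s = 0" shows "a = 0"
proof -
  have "adj s o\<^sub>L adj a = 0" using arg_cong[OF z, of adj] s a by (simp add: adj_simps)
  then have "adj a = 0" by (rule nzd_cancel_left[OF adj_nzd[OF s]])
  then have "adj (adj a) = 0" by (simp add: adj_simps)
  then show ?thesis using a by simp
qed

lemma nzd_range_dense: "s \<in> nzd \<Longrightarrow> closure (range (blinfun_apply s)) = UNIV"
  by (rule dense_range) (simp_all add: nzd_zero_iff adj_nzd)

end

section \<open>The Ore condition\<close>

text \<open>The operator form of \<open>1 - 1/(1 + u) = 1/(1 + 1/u)\<close>.\<close>

lemma res_inverse_pair:
  assumes U: "pos_op U" "pos_op V" and VU: "V o\<^sub>L U = id_blinfun"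
  shows "id_blinfun - res U = res V"
proof -
  have "(id_blinfun + V) o\<^sub>L (id_blinfun - res U) = (id_blinfun + V) o\<^sub>L (U o\<^sub>L res U)"
    by (simp only: res_compl[OF U(1)])
  also have "\<dots> = (U o\<^sub>L res U) + ((V o\<^sub>L U) o\<^sub>L res U)"
    by (simp add: compose_distrib compose_assoc)
  also have "\<dots> = id_blinfun" by (simp add: VU res_compl[OF U(1)])
  finally have 1: "(id_blinfun + V) o\<^sub>L (id_blinfun - res U) = id_blinfun" .
  have "id_blinfun - res U = (res V o\<^sub>L (id_blinfun + V)) o\<^sub>L (id_blinfun - res U)"
    by (simp only: res_left[OF U(2)] compose_id)
  also have "\<dots> = res V" by (simp only: compose_assoc 1 compose_id)
  finally show ?thesis .
qed

text \<open>Cauchy-Schwarz for the form of \<open>D\<close> at \<open>adj b y\<close> and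
  \<open>adj a z\<close>, with \<open>z\<close> the vector to be estimated. It controls the mixed
  term by the two diagonal ones.\<close>

lemma sandwich_Cauchy_Schwarz:
  fixes a b D :: "'h::chilbert \<Rightarrow>\<^sub>L 'h"
  assumes a: "clinear_op a" and b: "clinear_op b" and D: "pos_op D"
    and le: "\<And>z. qf (a o\<^sub>L D o\<^sub>L adj a) z \<le> (norm z)\<^sup>2"
  shows "(norm ((a o\<^sub>L D o\<^sub>L adj b) y))\<^sup>2 \<le> qf (b o\<^sub>L D o\<^sub>L adj b) y"
proof -
  define z where "z = (a o\<^sub>L D o\<^sub>L adj b) y"
  have "((norm z)\<^sup>2)\<^sup>2 = (cmod (cinner z z))\<^sup>2" by (simp add: cinner_self norm_power)
  also have "cinner z z = cinner (D (adj b y)) (adj a z)" by (simp add: z_def cinner_adj[OF a])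
  also have "(cmod \<dots>)\<^sup>2 \<le> qf D (adj b y) * qf D (adj a z)" by (rule pos_op_Cauchy_Schwarz[OF D])
  also have "qf D (adj b y) = qf (b o\<^sub>L D o\<^sub>L adj b) y" by (simp add: cinner_adj[OF b])
  also have "qf D (adj a z) = qf (a o\<^sub>L D o\<^sub>L adj a) z" by (simp add: cinner_adj[OF a])
  also have "qf (b o\<^sub>L D o\<^sub>L adj b) y * qf (a o\<^sub>L D o\<^sub>L adj a) z \<le> qf (b o\<^sub>L D o\<^sub>L adj b) y * (norm z)\<^sup>2"
    by (intro mult_left_mono le pos_op_qf pos_op_congr'[OF b D])
  finally have "(norm z)\<^sup>2 * (norm z)\<^sup>2 \<le> qf (b o\<^sub>L D o\<^sub>L adj b) y * (norm z)\<^sup>2"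
    by (simp add: power2_eq_square)
  from mult_right_le_imp_le[OF this] have "(norm z)\<^sup>2 \<le> qf (b o\<^sub>L D o\<^sub>L adj b) y" if "z \<noteq> 0" using that by simp
  moreover have "0 \<le> qf (b o\<^sub>L D o\<^sub>L adj b) y" by (rule pos_op_qf[OF pos_op_congr'[OF b D]])
  ultimately show ?thesis unfolding z_def[symmetric] by (cases "z = 0") simp_all
qed

text \<open>The \<open>Q n\<close> themselves may grow without bound; what keeps the mixed products
  under control is that both diagonal products stay below 1. The forms of \<open>b Q n adj b\<close>
  are increasing and bounded, and the mixed differences are bounded by theirs.\<close>

lemma sandwich_strong_limit:
  fixes a b :: "'h::chilbert \<Rightarrow>\<^sub>L 'h"
  assumes a: "clinear_op a" and b: "clinear_op b" and Q: "\<And>n. pos_op (Q n)"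
    and inc: "\<And>m n. m \<le> n \<Longrightarrow> ple (Q m) (Q n)"
    and lea: "\<And>n. ple (a o\<^sub>L Q n o\<^sub>L adj a) id_blinfun" and leb: "\<And>n. ple (b o\<^sub>L Q n o\<^sub>L adj b) id_blinfun"
  obtains L where "clinear_op L" "\<And>y. (\<lambda>n. (a o\<^sub>L Q n o\<^sub>L adj b) y) \<longlonglongrightarrow> blinfun_apply L y"
proof -
  define \<beta> where "\<beta> = (\<lambda>n y. qf (b o\<^sub>L Q n o\<^sub>L adj b) y)"
  have \<beta>1: "\<beta> n y \<le> (norm y)\<^sup>2" for n y using ple_qf[OF leb, of n y] by (simp add: \<beta>_def cinner_self_Re)
  have \<beta>inc: "incseq (\<lambda>n. \<beta> n y)" for y
    unfolding incseq_def \<beta>_def by (intro allI impI ple_qf ple_congr'[OF b] inc)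
  have diff: "(norm ((a o\<^sub>L Q m o\<^sub>L adj b) y - (a o\<^sub>L Q n o\<^sub>L adj b) y))\<^sup>2 \<le> \<beta> m y - \<beta> n y" if "n \<le> m" for m n y
  proof -
    have "(norm ((a o\<^sub>L (Q m - Q n) o\<^sub>L adj b) y))\<^sup>2 \<le> qf (b o\<^sub>L (Q m - Q n) o\<^sub>L adj b) y"
    proof (rule sandwich_Cauchy_Schwarz[OF a b inc[OF that]])
      fix z
      have "0 \<le> qf (a o\<^sub>L Q n o\<^sub>L adj a) z" by (rule pos_op_qf[OF pos_op_congr'[OF a Q]])
      moreover have "qf (a o\<^sub>L Q m o\<^sub>L adj a) z \<le> (norm z)\<^sup>2"
        using ple_qf[OF lea, of m z] by (simp add: cinner_self_Re)
      ultimately show "qf (a o\<^sub>L (Q m - Q n) o\<^sub>L adj a) z \<le> (norm z)\<^sup>2"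
        by (simp add: blinfun_simps cinner_simps)
    qed
    then show ?thesis by (simp add: \<beta>_def blinfun_simps cinner_simps)
  qed
  have "Cauchy (\<lambda>n. \<beta> n y)" for y
  proof -
    obtain l where "(\<lambda>n. \<beta> n y) \<longlonglongrightarrow> l" by (rule incseq_convergent[OF \<beta>inc]) (use \<beta>1 in blast, rule that)
    then show ?thesis by (rule LIMSEQ_imp_Cauchy)
  qed
  then have cau: "Cauchy (\<lambda>n. (a o\<^sub>L Q n o\<^sub>L adj b) y)" for y
    by (rule Cauchy_norm_sq[where K=1]) (use diff incseqD[OF \<beta>inc] in \<open>simp_all add: norm_minus_commute abs_minus_commute\<close>)
  have n1: "norm (a o\<^sub>L Q n o\<^sub>L adj b) \<le> 1" for n
  proof (rule norm_blinfun_bound)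
    fix y
    have "(norm ((a o\<^sub>L Q n o\<^sub>L adj b) y))\<^sup>2 \<le> \<beta> n y" unfolding \<beta>_def
    proof (rule sandwich_Cauchy_Schwarz[OF a b Q])
      show "qf (a o\<^sub>L Q n o\<^sub>L adj a) z \<le> (norm z)\<^sup>2" for z
        using ple_qf[OF lea, of n z] by (simp add: cinner_self_Re)
    qed
    also have "\<dots> \<le> (1 * norm y)\<^sup>2" using \<beta>1 by simp
    finally show "norm ((a o\<^sub>L Q n o\<^sub>L adj b) y) \<le> 1 * norm y" by (rule power2_le_imp_le) simp
  qed simp
  have cl: "clinear_op (a o\<^sub>L Q n o\<^sub>L adj b)" for n using a b Q by (simp add: clinear_adj)
  show thesis by (rule strong_limit_exists[OF cl n1 cau]) (rule that)
qed

lemma clinear_op_sum: "(\<And>i. i \<in> I \<Longrightarrow> clinear_op (f i)) \<Longrightarrow> clinear_op (\<Sum>i\<in>I. f i)"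
  by (induction I rule: infinite_finite_induct) simp_all

context finite_von_Neumann
begin

text \<open>\<open>scaled_res h n\<close> is \<open>(h + 1/(n+1))\<^sup>-\<^sup>1\<close>.\<close>

definition scaled_res :: "('h \<Rightarrow>\<^sub>L 'h) \<Rightarrow> nat \<Rightarrow> ('h \<Rightarrow>\<^sub>L 'h)" where
  "scaled_res h n = real (Suc n) *\<^sub>R res (real (Suc n) *\<^sub>R h)"

lemma scaled_res:
  assumes h: "h \<in> A" "pos_op h"
  defines "P \<equiv> \<lambda>n. (1 / real (Suc n)) *\<^sub>R id_blinfun + h"
  shows scaled_res_mem: "scaled_res h n \<in> A" and scaled_res_pos: "pos_op (scaled_res h n)"
    and scaled_res_shift_pos: "pos_op (P n)"
    and scaled_res_right: "P n o\<^sub>L scaled_res h n = id_blinfun"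
    and scaled_res_left: "scaled_res h n o\<^sub>L P n = id_blinfun"
    and scaled_res_mult: "scaled_res h n o\<^sub>L h = id_blinfun - res (real (Suc n) *\<^sub>R h)"
proof -
  have k: "real (Suc n) *\<^sub>R h \<in> A" "pos_op (real (Suc n) *\<^sub>R h)" using h by (simp_all add: pos_op_scaleR)
  show "scaled_res h n \<in> A" "pos_op (scaled_res h n)"
    unfolding scaled_res_def by (simp_all add: k pos_op_scaleR res_pos del: of_nat_Suc)
  show P: "pos_op (P n)" unfolding P_def by (simp add: pos_op_add pos_op_scaleR h)
  have e: "real (Suc n) *\<^sub>R P n = id_blinfun + real (Suc n) *\<^sub>R h"
    by (simp add: P_def scaleR_add_right del: of_nat_Suc)
  have "P n o\<^sub>L scaled_res h n = (real (Suc n) *\<^sub>R P n) o\<^sub>L res (real (Suc n) *\<^sub>R h)"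
    by (simp only: scaled_res_def compose_distrib)
  then show "P n o\<^sub>L scaled_res h n = id_blinfun" unfolding e res_right[OF k(2)] .
  have "scaled_res h n o\<^sub>L P n = res (real (Suc n) *\<^sub>R h) o\<^sub>L (real (Suc n) *\<^sub>R P n)"
    by (simp only: scaled_res_def compose_distrib)
  then show "scaled_res h n o\<^sub>L P n = id_blinfun" unfolding e res_left[OF k(2)] .
  have "scaled_res h n o\<^sub>L h = res (real (Suc n) *\<^sub>R h) o\<^sub>L (real (Suc n) *\<^sub>R h)"
    by (simp only: scaled_res_def compose_distrib)
  then show "scaled_res h n o\<^sub>L h = id_blinfun - res (real (Suc n) *\<^sub>R h)" unfolding res_compl(2)[OF k(2)] .
qed

lemma scaled_res_mono:
  assumes h: "h \<in> A" "pos_op h" and mn: "m \<le> n"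
  shows "ple (scaled_res h m) (scaled_res h n)"
proof (rule inverse_antitone[OF scaled_res_shift_pos[OF h] scaled_res_shift_pos[OF h] scaled_res_pos[OF h]
      scaled_res_pos[OF h] scaled_res_right[OF h] scaled_res_right[OF h]])
  have "((1 / real (Suc m)) *\<^sub>R id_blinfun + h) - ((1 / real (Suc n)) *\<^sub>R id_blinfun + h)
    = (1 / real (Suc m) - 1 / real (Suc n)) *\<^sub>R (id_blinfun :: 'h \<Rightarrow>\<^sub>L 'h)" by (simp add: scaleR_diff_left)
  moreover have "0 \<le> 1 / real (Suc m) - 1 / real (Suc n)" using mn by (simp add: field_simps)
  ultimately show "ple ((1 / real (Suc n)) *\<^sub>R id_blinfun + h) ((1 / real (Suc m)) *\<^sub>R id_blinfun + h)"
    by (simp only: pos_op_scaleR pos_op_id)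
qed

text \<open>Squaring is not monotone on positive operators in general. Here the inverses
  \<open>1/(n+1) + h\<close> commute and the difference of their squares is an explicit positive
  combination of the identity and \<open>h\<close>.\<close>

lemma scaled_res_sq_mono:
  assumes h: "h \<in> A" "pos_op h" and mn: "m \<le> n"
  shows "ple (scaled_res h m o\<^sub>L scaled_res h m) (scaled_res h n o\<^sub>L scaled_res h n)"
proof -
  define P :: "nat \<Rightarrow> 'h \<Rightarrow>\<^sub>L 'h" where "P = (\<lambda>n. (1 / real (Suc n)) *\<^sub>R id_blinfun + h)"
  note Q = scaled_res_pos[OF h]
  have P: "pos_op (P n)" for n unfolding P_def by (rule scaled_res_shift_pos[OF h])
  have sq: "pos_op (T o\<^sub>L T)" if "pos_op T" for T :: "'h \<Rightarrow>\<^sub>L 'h"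
    using pos_op_adj_mult[of T] that by (simp add: pos_op_adj)
  have PQ: "P n o\<^sub>L scaled_res h n = id_blinfun" for n unfolding P_def by (rule scaled_res_right[OF h])
  have inv: "(P n o\<^sub>L P n) o\<^sub>L (scaled_res h n o\<^sub>L scaled_res h n) = id_blinfun" for n
  proof -
    have "(P n o\<^sub>L P n) o\<^sub>L (scaled_res h n o\<^sub>L scaled_res h n) = P n o\<^sub>L ((P n o\<^sub>L scaled_res h n) o\<^sub>L scaled_res h n)"
      by (simp only: compose_assoc)
    then show ?thesis by (simp add: PQ)
  qed
  show ?thesis
  proof (rule inverse_antitone[OF sq[OF P] sq[OF P] sq[OF Q] sq[OF Q] inv inv])
    define x y where "x = 1 / real (Suc m)" and "y = 1 / real (Suc n)"
    have xy: "0 \<le> y" "y \<le> x" using mn by (simp_all add: x_def y_def field_simps)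
    have "(P m o\<^sub>L P m) - (P n o\<^sub>L P n) = (x * x - y * y) *\<^sub>R id_blinfun + (2 * (x - y)) *\<^sub>R h"
      unfolding P_def x_def[symmetric] y_def[symmetric]
      by (rule blinfun_eqI) (simp add: blinfun_simps algebra_simps scaleR_2 flip: scaleR_scaleR)
    moreover have "0 \<le> x * x - y * y" using xy by (simp add: mult_mono)
    ultimately show "ple (P n o\<^sub>L P n) (P m o\<^sub>L P m)"
      using xy h by (simp only:) (intro pos_op_add pos_op_scaleR pos_op_id, simp_all)
  qed
qed

text \<open>With \<open>m = adj s s\<close> the element \<open>t\<close> plays the role of
  \<open>(1 + a m^-2 adj a)^-1\<close>, which damps \<open>a m^-1\<close> to a contraction
  \<open>L\<close>. Then \<open>L m = t a\<close>, and \<open>c = L adj s\<close>. The inverse of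
  \<open>m\<close> is replaced by the approximations \<open>Q n\<close> and the limit is taken at
  the end.\<close>

lemma left_Ore:
  assumes a: "a \<in> A" and s: "s \<in> nzd"
  obtains t c where "t \<in> nzd" "c \<in> A" "t o\<^sub>L a = c o\<^sub>L s"
proof -
  define m where "m = adj s o\<^sub>L s"
  have mN: "m \<in> nzd" unfolding m_def by (intro nzd_mult adj_nzd s)
  have m: "m \<in> A" "pos_op m" using s by (simp_all add: m_def pos_op_adj_mult)
  define Q where "Q = scaled_res m"
  define P :: "nat \<Rightarrow> 'h \<Rightarrow>\<^sub>L 'h" where "P = (\<lambda>n. (1 / real (Suc n)) *\<^sub>R id_blinfun + m)"
  have Q: "Q n \<in> A" "pos_op (Q n)" for n unfolding Q_def by (rule scaled_res_mem[OF m], rule scaled_res_pos[OF m])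
  have P: "pos_op (P n)" "P n o\<^sub>L Q n = id_blinfun" "Q n o\<^sub>L P n = id_blinfun" for n
    unfolding Q_def P_def by (rule scaled_res_shift_pos[OF m], rule scaled_res_right[OF m], rule scaled_res_left[OF m])
  have PA: "P n \<in> A" for n using m by (simp add: P_def)
  have ca: "clinear_op a" and cQ: "clinear_op (Q n)" for n using a Q by simp_all
  have aQ: "adj (Q n) = Q n" for n using Q by (simp add: pos_op_adj)
  define b where "b = (\<lambda>n. a o\<^sub>L Q n)"
  have b: "b n \<in> A" "clinear_op (b n)" for n using a Q by (simp_all add: b_def)
  have ab: "adj (b n) = Q n o\<^sub>L adj a" for n using ca cQ aQ by (simp add: b_def adj_simps)
  define k where "k = (\<lambda>n. b n o\<^sub>L adj (b n))"
  have k: "k n \<in> A" "pos_op (k n)" for n using b by (simp_all add: k_def pos_op_mult_adj)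
  have kinc: "ple (k i) (k j)" if "i \<le> j" for i j using ple_congr'[OF ca scaled_res_sq_mono[OF m that]]
    by (simp only: k_def ab) (simp only: b_def Q_def compose_assoc)
  \<comment> \<open>The square appears because \<open>k n\<close> contains \<open>Q n\<close> twice;
    \<open>res (n M)\<close> has traces tending to zero since \<open>M\<close> is injective.\<close>
  define M where "M = m o\<^sub>L m"
  have "adj m o\<^sub>L m = M" using m by (simp add: M_def pos_op_adj)
  then have M: "M \<in> A" "pos_op M" "M \<in> nzd" using pos_op_adj_mult[of m] m mN by (auto simp: M_def nzd_mult)
  have small: "\<exists>\<delta>. 0 < \<delta> \<and> \<delta> \<le> 1 \<and> (\<forall>n. \<tau> (id_blinfun - res (\<delta> *\<^sub>R k n)) \<le> e)" if e: "e > 0" for e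
  proof -
    from LIMSEQ_D[OF tau_res_multiples_injective[OF M(1,2) nzd_inj[OF M(3)]] e]
    obtain N where N: "\<And>n. n \<ge> N \<Longrightarrow> \<bar>\<tau> (res (real n *\<^sub>R M))\<bar> < e" by auto
    define N' where "N' = real (Suc N)"
    define C where "C = (norm a)\<^sup>2 + 1"
    have C: "C \<ge> 1" by (simp add: C_def)
    have N': "N' \<ge> 1" by (simp add: N'_def)
    \<comment> \<open>Chosen so that \<delta> times the squared norm of \<open>a\<close> is at most
      \<open>1 / N'\<close>. The summand 1 in \<open>C\<close> ensures that \<delta> is at most
      1.\<close>
    define \<delta> where "\<delta> = 1 / (N' * C)"
    have NC: "1 \<le> N' * C" using mult_mono[OF N' C] N' by simp
    have d: "0 < \<delta>" "\<delta> \<le> 1" using NC by (auto simp: \<delta>_def divide_le_eq_1)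
    have dC: "\<delta> * C = 1 / N'" using C N' by (simp add: \<delta>_def)
    have "\<tau> (id_blinfun - res (\<delta> *\<^sub>R k n)) \<le> e" for n
    proof -
      define x where "x = sqrt \<delta> *\<^sub>R b n"
      have x: "x \<in> A" "clinear_op x" using b by (simp_all add: x_def)
      have xx: "x o\<^sub>L adj x = \<delta> *\<^sub>R k n" "adj x o\<^sub>L x = \<delta> *\<^sub>R (adj (b n) o\<^sub>L b n)"
        using b d by (simp_all add: x_def k_def adj_simps compose_distrib)
      \<comment> \<open>By \<open>tau_res_commute\<close> the trace may be computed for
        \<open>adj x x\<close> instead of \<open>x adj x\<close>. That operator lies below
        \<open>U\<close>, whose inverse \<open>V\<close> lies above \<open>N' M\<close>, a bound
        independent of \<open>n\<close>.\<close>
      define U where "U = (1 / N') *\<^sub>R (Q n o\<^sub>L Q n)"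
      define V where "V = N' *\<^sub>R (P n o\<^sub>L P n)"
      have sq: "pos_op (T o\<^sub>L T)" if "pos_op T" for T :: "'h \<Rightarrow>\<^sub>L 'h"
        using pos_op_adj_mult[of T] that by (simp add: pos_op_adj)
      have UV: "pos_op U" "pos_op V" using N' by (simp_all add: U_def V_def pos_op_scaleR sq Q P)
      have UVA: "U \<in> A" "V \<in> A" using Q PA by (simp_all add: U_def V_def)
      have "V o\<^sub>L U = (P n o\<^sub>L P n) o\<^sub>L (Q n o\<^sub>L Q n)" using N' by (simp add: U_def V_def compose_distrib)
      also have "\<dots> = P n o\<^sub>L ((P n o\<^sub>L Q n) o\<^sub>L Q n)" by (simp only: compose_assoc)
      finally have VU: "V o\<^sub>L U = id_blinfun" by (simp add: P)
      have px: "pos_op (adj x o\<^sub>L x)" using x by (simp add: pos_op_adj_mult)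
      have le1: "ple (adj x o\<^sub>L x) U"
      proof (subst ple_iff[OF px UV(1)], rule allI)
        fix y
        have "norm (a (Q n y)) \<le> norm a * norm (Q n y)" by (rule norm_blinfun)
        then have "(norm (a (Q n y)))\<^sup>2 \<le> (norm a)\<^sup>2 * (norm (Q n y))\<^sup>2"
          by (metis norm_ge_zero power_mono power_mult_distrib)
        also have "\<dots> \<le> C * (norm (Q n y))\<^sup>2" by (intro mult_right_mono) (simp_all add: C_def)
        finally have 1: "(norm (a (Q n y)))\<^sup>2 \<le> C * (norm (Q n y))\<^sup>2" .
        have "qf (adj x o\<^sub>L x) y = \<delta> * (norm (a (Q n y)))\<^sup>2"
          unfolding qf_adj_mult[OF x(2)] using d by (simp add: x_def b_def blinfun_simps power_mult_distrib)
        also have "\<dots> \<le> \<delta> * (C * (norm (Q n y))\<^sup>2)" using 1 d by (intro mult_left_mono) auto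
        also have "\<dots> = (1 / N') * (norm (Q n y))\<^sup>2" by (simp only: dC mult.assoc[symmetric])
        also have "\<dots> = qf U y"
          using qf_adj_mult[OF cQ, of n y] by (simp add: U_def aQ blinfun_simps cinner_simps)
        finally show "qf (adj x o\<^sub>L x) y \<le> qf U y" .
      qed
      have le2: "ple (N' *\<^sub>R M) V"
      proof -
        define r where "r = 1 / real (Suc n)"
        have "V - N' *\<^sub>R M = N' *\<^sub>R ((r * r) *\<^sub>R id_blinfun + (2 * r) *\<^sub>R m)"
          unfolding V_def M_def P_def r_def[symmetric]
          by (rule blinfun_eqI) (simp add: blinfun_simps algebra_simps scaleR_2 flip: scaleR_scaleR)
        moreover have "r \<ge> 0" by (simp add: r_def)
        ultimately show ?thesis using N' m by (simp add: pos_op_scaleR pos_op_add)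
      qed
      have "\<tau> (id_blinfun - res (\<delta> *\<^sub>R k n)) = \<tau> (id_blinfun - res (adj x o\<^sub>L x))"
        using tau_res_commute[OF x(1)] x px k d unfolding xx(1)[symmetric]
        by (simp add: tau_diff pos_op_mult_adj)
      also have "\<dots> \<le> \<tau> (id_blinfun - res U)"
        using res_antitone[OF px UV(1) le1] x px UV UVA by (intro tau_mono) simp_all
      also have "\<dots> = \<tau> (res V)" by (simp only: res_inverse_pair[OF UV VU])
      also have "\<dots> \<le> \<tau> (res (N' *\<^sub>R M))"
        using res_antitone[OF _ UV(2) le2] UV UVA M N' by (intro tau_mono) (simp_all add: pos_op_scaleR)
      also have "\<dots> \<le> e" using N[of "Suc N"] by (simp add: N'_def)
      finally show ?thesis .
    qed
    with d show ?thesis by (intro exI[of _ \<delta>] conjI allI)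
  qed
  obtain t where t: "t \<in> A" "pos_op t" "\<And>y. (\<lambda>n. res (k n) y) \<longlonglongrightarrow> blinfun_apply t y"
    "\<And>y. blinfun_apply t y = 0 \<Longrightarrow> y = 0"
    by (rule res_limit_injective[of k]) (rule k, rule k, rule kinc, assumption, rule small, assumption, rule that)
  have tN: "t \<in> nzd" by (rule nzdI[OF t(1,4)])
  define c where "c = (\<lambda>n. res (k n) o\<^sub>L b n)"
  have cA: "c n \<in> A" for n using k b by (simp add: c_def)
  \<comment> \<open>The adjoint is estimated instead: for \<open>w = res (k n) y\<close> the squared
    norm of \<open>adj (b n) w\<close> is the form of \<open>k n\<close> at \<open>w\<close>, which
    is at most the form of \<open>res (k n)\<close> at \<open>y\<close>.\<close>
  have cn: "norm (c n) \<le> 1" for n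
  proof -
    have "adj (c n) = adj (b n) o\<^sub>L res (k n)"
      using b k res_pos[OF k(2)] by (simp add: c_def adj_simps pos_op_adj)
    have "norm (adj (c n)) \<le> 1"
    proof (rule norm_blinfun_bound)
      fix y
      define w where "w = res (k n) y"
      have w: "w + k n w = y" using compose_eqD1[OF res_right[OF k(2)], of n y] by (simp add: w_def blinfun_simps)
      have "(norm (adj (c n) y))\<^sup>2 = (norm (adj (b n) w))\<^sup>2"
        unfolding \<open>adj (c n) = adj (b n) o\<^sub>L res (k n)\<close> by (simp add: w_def)
      also have "\<dots> = qf (k n) w" using qf_adj_mult[OF clinear_adj[OF b(2)], of n w] b by (simp add: k_def)
      also have "\<dots> \<le> Re (cinner (w + k n w) w)" by (simp add: cinner_simps cinner_self_Re)
      also have "\<dots> = qf (res (k n)) y" unfolding w by (subst Re_cinner_commute) (simp add: w_def)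
      also have "\<dots> \<le> (1 * norm y)\<^sup>2" using ple_qf[OF res_le_id[OF k(2)], of n y] by (simp add: cinner_self_Re)
      finally show "norm (adj (c n) y) \<le> 1 * norm y" by (rule power2_le_imp_le) simp
    qed simp
    then show ?thesis using norm_adj[of "c n"] cA by simp
  qed
  \<comment> \<open>Multiplying \<open>c n = res (k n) a Q n\<close> by
    \<open>P n = 1/(n+1) + m\<close> gives \<open>res (k n) a\<close>. The extra term
    \<open>c n / (n+1)\<close> vanishes in the limit because the \<open>c n\<close> are
    contractions.\<close>
  have cm: "(\<lambda>n. c n (m y)) \<longlonglongrightarrow> t (a y)" for y
  proof -
    have "c n (m y) = res (k n) (a y) - (1 / real (Suc n)) *\<^sub>R c n y" for n
    proof -
      have "c n o\<^sub>L P n = res (k n) o\<^sub>L (a o\<^sub>L (Q n o\<^sub>L P n))" by (simp only: c_def b_def compose_assoc)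
      also have "\<dots> = res (k n) o\<^sub>L a" by (simp add: P)
      finally have "c n (P n y) = res (k n) (a y)" by (rule compose_eqD)
      then have "c n (m y) + (1 / real (Suc n)) *\<^sub>R c n y = res (k n) (a y)"
        by (simp add: P_def blinfun_simps add.commute del: of_nat_Suc)
      then show ?thesis by (simp only: eq_diff_eq)
    qed
    moreover have "(\<lambda>n. (1 / real (Suc n)) *\<^sub>R c n y) \<longlonglongrightarrow> 0"
    proof (rule Lim_null_comparison)
      show "\<forall>\<^sub>F n in sequentially. norm ((1 / real (Suc n)) *\<^sub>R c n y) \<le> 1 / real (Suc n) * norm y"
      proof (rule always_eventually, rule allI)
        fix n
        have "norm (c n y) \<le> 1 * norm y"
          using norm_blinfun[of "c n" y] mult_right_mono[OF cn norm_ge_zero[of y], of n] by linarith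
        then show "norm ((1 / real (Suc n)) *\<^sub>R c n y) \<le> 1 / real (Suc n) * norm y"
          by (simp add: divide_right_mono del: of_nat_Suc)
      qed
      have "(\<lambda>n. 1 / real (Suc n) * norm y) \<longlonglongrightarrow> 0 * norm y"
        by (intro tendsto_intros LIMSEQ_Suc[OF lim_1_over_n])
      then show "(\<lambda>n. 1 / real (Suc n) * norm y) \<longlonglongrightarrow> 0" by simp
    qed
    ultimately show ?thesis using tendsto_diff[OF t(3)[of "a y"], of "\<lambda>n. (1 / real (Suc n)) *\<^sub>R c n y" 0]
      by (simp del: of_nat_Suc)
  qed
  \<comment> \<open>Convergence is known on the range of \<open>m\<close>, which is dense; the
    uniform norm bound extends it to all vectors.\<close>
  have "Cauchy (\<lambda>n. c n y)" for y
  proof (rule Cauchy_of_dense[OF cn nzd_range_dense[OF mN]])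
    show "Cauchy (\<lambda>n. c n y)" if "y \<in> range (blinfun_apply m)" for y
      using that LIMSEQ_imp_Cauchy[OF cm] by blast
  qed
  then obtain L where L: "clinear_op L" "\<And>y. (\<lambda>n. c n y) \<longlonglongrightarrow> blinfun_apply L y"
    by (rule strong_limit_exists[OF clinear[OF cA] cn]) (rule that)
  have LA: "L \<in> A" by (rule mem_limit[OF L(1) cA L(2)])
  have "L (m y) = t (a y)" for y by (rule LIMSEQ_unique[OF L(2) cm])
  then have "t o\<^sub>L a = (L o\<^sub>L adj s) o\<^sub>L s" by (intro blinfun_eqI) (simp add: m_def)
  with tN LA s show thesis by (intro that[of t "L o\<^sub>L adj s"]) simp_all
qed

lemma right_Ore:
  assumes a: "a \<in> A" and s: "s \<in> nzd"
  obtains t c where "t \<in> nzd" "c \<in> A" "a o\<^sub>L t = s o\<^sub>L c"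
proof -
  obtain t c where tc: "t \<in> nzd" "c \<in> A" "t o\<^sub>L adj a = c o\<^sub>L adj s"
    using a by (rule left_Ore[OF adj_mem adj_nzd[OF s]]) (rule that)
  have "adj (t o\<^sub>L adj a) = adj (c o\<^sub>L adj s)" by (simp only: tc)
  then have "a o\<^sub>L adj t = s o\<^sub>L adj c" using a s tc(1,2) by (simp add: adj_simps clinear_adj)
  then show thesis using tc by (intro that[of "adj t" "adj c"]) (simp_all add: adj_nzd)
qed

lemma common_left_multiple:
  assumes "s1 \<in> nzd" "s2 \<in> nzd"
  obtains r1 r2 where "r1 \<in> A" "r2 \<in> A" "r1 o\<^sub>L s1 = r2 o\<^sub>L s2" "r1 o\<^sub>L s1 \<in> nzd"
proof -
  obtain t c where tc: "t \<in> nzd" "c \<in> A" "t o\<^sub>L s1 = c o\<^sub>L s2"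
    by (rule left_Ore[OF nzd_mem[OF assms(1)] assms(2)]) (rule that)
  have "t o\<^sub>L s1 \<in> nzd" by (rule nzd_mult[OF tc(1) assms(1)])
  with tc assms show thesis by (intro that[of t c]) simp_all
qed

text \<open>One positive element that stands for the whole column: it has the same right annihilator
  as the family of the \<alpha> (see \<open>gram_zero\<close>), so several elements can be treated
  like a single one.\<close>

definition gram :: "nat \<Rightarrow> (nat \<Rightarrow> ('h \<Rightarrow>\<^sub>L 'h)) \<Rightarrow> ('h \<Rightarrow>\<^sub>L 'h)" where
  "gram m \<alpha> = (\<Sum>j<m. adj (\<alpha> j) o\<^sub>L \<alpha> j)"

lemma compose_sum:
  "(\<Sum>j\<in>J. f j) o\<^sub>L T = (\<Sum>j\<in>J. f j o\<^sub>L T)" "T' o\<^sub>L (\<Sum>j\<in>J. f j) = (\<Sum>j\<in>J. T' o\<^sub>L f j)"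
  by (induction J rule: infinite_finite_induct) (simp_all add: compose_distrib)

lemma gram:
  assumes "\<And>j. j < m \<Longrightarrow> \<alpha> j \<in> A"
  shows gram_mem: "gram m \<alpha> \<in> A" and gram_pos: "pos_op (gram m \<alpha>)"
    and gram_ge: "j < m \<Longrightarrow> ple (adj (\<alpha> j) o\<^sub>L \<alpha> j) (gram m \<alpha>)"
    and gram_zero: "j < m \<Longrightarrow> gram m \<alpha> o\<^sub>L x = 0 \<Longrightarrow> \<alpha> j o\<^sub>L x = 0"
proof -
  show "gram m \<alpha> \<in> A" "pos_op (gram m \<alpha>)"
    unfolding gram_def using assms by (auto intro!: mem_sum pos_op_sum pos_op_adj_mult)
  show ge: "ple (adj (\<alpha> j) o\<^sub>L \<alpha> j) (gram m \<alpha>)" if "j < m"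
  proof -
    have "gram m \<alpha> = (adj (\<alpha> j) o\<^sub>L \<alpha> j) + (\<Sum>i\<in>{..<m} - {j}. adj (\<alpha> i) o\<^sub>L \<alpha> i)"
      unfolding gram_def using that by (subst sum.remove[of _ j]) auto
    then show ?thesis using assms by (auto intro!: pos_op_sum pos_op_adj_mult)
  qed
  show "\<alpha> j o\<^sub>L x = 0" if "j < m" "gram m \<alpha> o\<^sub>L x = 0"
  proof (rule blinfun_eqI)
    fix y
    have "(norm (\<alpha> j (x y)))\<^sup>2 \<le> qf (gram m \<alpha>) (x y)"
      using ple_qf[OF ge[OF that(1)], of "x y"] qf_adj_mult[of "\<alpha> j"] assms that(1) by simp
    also have "\<dots> = 0" by (simp add: compose_zeroD[OF that(2)])
    finally show "(\<alpha> j o\<^sub>L x) y = blinfun_apply 0 y" by simp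
  qed
qed

text \<open>Adding the kernel projection makes \<open>h\<close> regular, so that the Ore condition
  applies to \<open>h + q\<close>; multiplication by \<open>q\<close> afterwards removes the
  artificial part.\<close>

lemma kernel_complement_nzd:
  assumes h: "h \<in> A" "pos_op h"
  obtains q where "projection q" "h o\<^sub>L q = 0" "q o\<^sub>L h = 0" "h + q \<in> nzd"
proof -
  obtain q where q: "projection q" "h o\<^sub>L q = 0" and qid: "\<And>x. blinfun_apply h x = 0 \<Longrightarrow> blinfun_apply q x = x"
    by (rule kernel_projection[OF h(1)]) (rule that)
  note qD = projectionD[OF q(1)]
  have "adj (h o\<^sub>L q) = 0" using q by (simp add: adj_simps)
  then have "q o\<^sub>L h = 0" using h qD by (simp add: adj_simps pos_op_adj)
  moreover have "h + q \<in> nzd"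
  proof (rule nzdI)
    fix y assume "(h + q) y = 0"
    then have "qf (h + q) y = 0" by (simp only: cinner_zero_left zero_complex.simps)
    then have z: "qf h y + qf q y = 0" by (simp add: blinfun_simps cinner_simps)
    then have "qf h y = 0" "qf q y = 0" using pos_op_qf[OF h(2), of y] pos_op_qf[OF qD(5), of y] by linarith+
    then have "h y = 0" "q y = 0" using pos_op_qf_zero h(2) qD(5) by blast+
    with qid[of y] show "y = 0" by simp
  qed (use h qD in simp)
  ultimately show thesis by (rule that[OF q])
qed

text \<open>With \<open>h = \<Sum> \<alpha>\<^sub>j* \<alpha>\<^sub>j\<close> the maps
  \<open>x \<mapsto> lim x (h + \<epsilon>)\<^sup>-\<^sup>1 \<alpha>\<^sub>i*\<close> form a dual basis to the generators \<open>\<alpha>\<^sub>i\<close>.\<close>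

lemma ideal_dual_basis:
  fixes m :: nat and \<alpha> :: "nat \<Rightarrow> ('h \<Rightarrow>\<^sub>L 'h)"
  assumes \<alpha>: "\<And>j. j < m \<Longrightarrow> \<alpha> j \<in> A"
  defines "J \<equiv> {\<Sum>j<m. v j o\<^sub>L \<alpha> j | v. \<forall>j<m. v j \<in> A}"
  obtains \<theta> where "\<And>i x. i < m \<Longrightarrow> x \<in> J \<Longrightarrow> \<theta> i x \<in> A"
    "\<And>i x y. i < m \<Longrightarrow> x \<in> J \<Longrightarrow> y \<in> J \<Longrightarrow> \<theta> i (x + y) = \<theta> i x + \<theta> i y"
    "\<And>i a x. i < m \<Longrightarrow> a \<in> A \<Longrightarrow> x \<in> J \<Longrightarrow> \<theta> i (a o\<^sub>L x) = a o\<^sub>L \<theta> i x"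
    "\<And>x. x \<in> J \<Longrightarrow> (\<Sum>i<m. \<theta> i x o\<^sub>L \<alpha> i) = x"
proof -
  define h where "h = gram m \<alpha>"
  have h: "h \<in> A" "pos_op h" unfolding h_def by (rule gram_mem, rule \<alpha>, assumption, rule gram_pos, rule \<alpha>)
  define Q where "Q = scaled_res h"
  have Q: "Q n \<in> A" "pos_op (Q n)" for n unfolding Q_def by (rule scaled_res_mem[OF h], rule scaled_res_pos[OF h])
  have Qinc: "ple (Q i) (Q j)" if "i \<le> j" for i j unfolding Q_def by (rule scaled_res_mono[OF h that])
  define islim where "islim = (\<lambda>X L. clinear_op L \<and> (\<forall>y. (\<lambda>n. blinfun_apply (X n) y) \<longlonglongrightarrow> blinfun_apply (L :: 'h \<Rightarrow>\<^sub>L 'h) y))"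
  have uniq: "L = L'" if "islim X L" "islim X L'" for X L L'
    by (rule blinfun_eqI) (use that LIMSEQ_unique in \<open>unfold islim_def, blast\<close>)
  have limA: "L \<in> A" if "islim X L" "\<And>n. X n \<in> A" for X L
    by (rule mem_limit[where X=X, OF _ that(2)]) (use that(1) in \<open>simp_all add: islim_def\<close>)
  \<comment> \<open>One summand of \<open>h\<close> lies below \<open>h + 1/(n+1)\<close>, whose
    inverse is \<open>Q n\<close>.\<close>
  have contr: "ple (\<alpha> j o\<^sub>L Q n o\<^sub>L adj (\<alpha> j)) id_blinfun" if j: "j < m" for j n
  proof (rule contraction_of_ple[OF _ scaled_res_shift_pos[OF h, of n] Q(2)])
    show "(1 / real (Suc n)) *\<^sub>R id_blinfun + h o\<^sub>L Q n = id_blinfun"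
      unfolding Q_def by (rule scaled_res_right[OF h])
    have "ple h ((1 / real (Suc n)) *\<^sub>R id_blinfun + h)" by (simp add: pos_op_scaleR)
    then show "ple (adj (\<alpha> j) o\<^sub>L \<alpha> j) ((1 / real (Suc n)) *\<^sub>R id_blinfun + h)"
      by (rule ple_trans[rotated]) (unfold h_def, rule gram_ge, rule \<alpha>, assumption, rule j)
  qed (use \<alpha> j in simp)
  have "\<exists>L. islim (\<lambda>n. \<alpha> j o\<^sub>L Q n o\<^sub>L adj (\<alpha> i)) L" if ij: "i < m" "j < m" for i j
  proof -
    obtain L where "clinear_op L" "\<And>y. (\<lambda>n. (\<alpha> j o\<^sub>L Q n o\<^sub>L adj (\<alpha> i)) y) \<longlonglongrightarrow> blinfun_apply L y"
      by (rule sandwich_strong_limit[of "\<alpha> j" "\<alpha> i" Q])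
        (use \<alpha> ij in simp, use \<alpha> ij in simp, rule Q, rule Qinc, assumption, rule contr, rule ij, rule contr, rule ij, rule that)
    then show ?thesis unfolding islim_def by (intro exI[of _ L] conjI allI)
  qed
  note ex = this
  define p where "p = (\<lambda>i j. SOME L. islim (\<lambda>n. \<alpha> j o\<^sub>L Q n o\<^sub>L adj (\<alpha> i)) L)"
  have p: "islim (\<lambda>n. \<alpha> j o\<^sub>L Q n o\<^sub>L adj (\<alpha> i)) (p i j)" if "i < m" "j < m" for i j
    unfolding p_def by (rule someI_ex[OF ex[OF that]])
  have pc: "clinear_op (p i j)" "(\<lambda>n. (\<alpha> j o\<^sub>L Q n o\<^sub>L adj (\<alpha> i)) y) \<longlonglongrightarrow> p i j y" if "i < m" "j < m" for i j y
    using p[OF that] by (simp_all add: islim_def)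
  \<comment> \<open>Defined by a limit that involves \<open>x\<close> alone and not the coefficients
    of a representation of \<open>x\<close>; hence no choice of coefficients has to be shown
    irrelevant, and linearity follows from uniqueness of limits.\<close>
  define \<theta> where "\<theta> = (\<lambda>i x. SOME L. islim (\<lambda>n. x o\<^sub>L Q n o\<^sub>L adj (\<alpha> i)) L)"
  have \<theta>: "islim (\<lambda>n. x o\<^sub>L Q n o\<^sub>L adj (\<alpha> i)) (\<theta> i x)" if x: "x \<in> J" and i: "i < m" for x i
  proof -
    obtain v where v: "x = (\<Sum>j<m. v j o\<^sub>L \<alpha> j)" "\<And>j. j < m \<Longrightarrow> v j \<in> A" using x by (auto simp: J_def)
    have "islim (\<lambda>n. x o\<^sub>L Q n o\<^sub>L adj (\<alpha> i)) (\<Sum>j<m. v j o\<^sub>L p i j)" unfolding islim_def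
    proof (intro conjI allI)
      show "clinear_op (\<Sum>j<m. v j o\<^sub>L p i j)" by (rule clinear_op_sum) (use v(2) pc(1)[OF i] in simp)
      fix y
      have "(\<lambda>n. \<Sum>j<m. v j ((\<alpha> j o\<^sub>L Q n o\<^sub>L adj (\<alpha> i)) y)) \<longlonglongrightarrow> (\<Sum>j<m. v j (p i j y))"
        by (intro tendsto_sum blinfun.tendsto tendsto_const pc(2) i) simp
      then show "(\<lambda>n. (x o\<^sub>L Q n o\<^sub>L adj (\<alpha> i)) y) \<longlonglongrightarrow> (\<Sum>j<m. v j o\<^sub>L p i j) y"
        by (simp add: v(1) blinfun.sum_left)
    qed
    then show ?thesis unfolding \<theta>_def by (rule someI)
  qed
  have \<theta>t: "(\<lambda>n. (x o\<^sub>L Q n o\<^sub>L adj (\<alpha> i)) y) \<longlonglongrightarrow> \<theta> i x y" and \<theta>c: "clinear_op (\<theta> i x)"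
    if "x \<in> J" "i < m" for x i y using \<theta>[OF that] by (simp_all add: islim_def)
  have JA: "x \<in> A" if "x \<in> J" for x using that \<alpha> by (auto simp: J_def intro!: mem_sum)
  have Jadd: "x + y \<in> J" if xy: "x \<in> J" "y \<in> J" for x y
  proof -
    obtain v where v: "x = (\<Sum>j<m. v j o\<^sub>L \<alpha> j)" "\<And>j. j < m \<Longrightarrow> v j \<in> A" using xy by (auto simp: J_def)
    obtain w where w: "y = (\<Sum>j<m. w j o\<^sub>L \<alpha> j)" "\<And>j. j < m \<Longrightarrow> w j \<in> A" using xy by (auto simp: J_def)
    have "x + y = (\<Sum>j<m. (v j + w j) o\<^sub>L \<alpha> j)" by (simp add: v w compose_distrib sum.distrib)
    then show ?thesis unfolding J_def using v(2) w(2) by (intro CollectI exI[of _ "\<lambda>j. v j + w j"]) simp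
  qed
  have Jmul: "a o\<^sub>L x \<in> J" if ax: "a \<in> A" "x \<in> J" for a x
  proof -
    obtain v where v: "x = (\<Sum>j<m. v j o\<^sub>L \<alpha> j)" "\<And>j. j < m \<Longrightarrow> v j \<in> A" using ax by (auto simp: J_def)
    have "a o\<^sub>L x = (\<Sum>j<m. (a o\<^sub>L v j) o\<^sub>L \<alpha> j)" by (simp add: v compose_sum compose_assoc)
    then show ?thesis unfolding J_def using v(2) ax by (intro CollectI exI[of _ "\<lambda>j. a o\<^sub>L v j"]) simp
  qed
  show thesis
  proof (rule that[of \<theta>])
    show "\<theta> i x \<in> A" if "i < m" "x \<in> J" for i x
      by (rule limA[OF \<theta>[OF that(2,1)]]) (use JA[OF that(2)] Q \<alpha>[OF that(1)] in simp)
    show "\<theta> i (x + y) = \<theta> i x + \<theta> i y" if "i < m" "x \<in> J" "y \<in> J" for i x y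
    proof (rule uniq[OF \<theta>[OF Jadd[OF that(2,3)] that(1)]])
      show "islim (\<lambda>n. x + y o\<^sub>L Q n o\<^sub>L adj (\<alpha> i)) (\<theta> i x + \<theta> i y)"
        unfolding islim_def using tendsto_add[OF \<theta>t[OF that(2,1)] \<theta>t[OF that(3,1)]] \<theta>c that
        by (simp add: blinfun_simps)
    qed
    show "\<theta> i (a o\<^sub>L x) = a o\<^sub>L \<theta> i x" if "i < m" "a \<in> A" "x \<in> J" for i a x
    proof (rule uniq[OF \<theta>[OF Jmul[OF that(2,3)] that(1)]])
      show "islim (\<lambda>n. a o\<^sub>L x o\<^sub>L Q n o\<^sub>L adj (\<alpha> i)) (a o\<^sub>L \<theta> i x)"
        unfolding islim_def using blinfun.tendsto[OF tendsto_const \<theta>t[OF that(3,1)], of a] \<theta>c that by simp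
    qed
    show "(\<Sum>i<m. \<theta> i x o\<^sub>L \<alpha> i) = x" if x: "x \<in> J" for x
    proof (rule blinfun_eqI)
      fix y
      obtain v where v: "x = (\<Sum>j<m. v j o\<^sub>L \<alpha> j)" "\<And>j. j < m \<Longrightarrow> v j \<in> A" using x by (auto simp: J_def)
      have 1: "(\<lambda>n. \<Sum>i<m. (x o\<^sub>L Q n o\<^sub>L adj (\<alpha> i)) (\<alpha> i y)) \<longlonglongrightarrow> (\<Sum>i<m. \<theta> i x (\<alpha> i y))"
        by (intro tendsto_sum \<theta>t x) simp
      \<comment> \<open>Summation over \<open>i\<close> assembles \<open>h\<close>, and
        \<open>Q n h = 1 - res ((n+1) h)\<close>. The remaining resolvents tend to an operator
        killed by \<open>h\<close>, hence by every \<alpha>, hence by \<open>x\<close>.\<close>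
      have 2: "(\<Sum>i<m. (x o\<^sub>L Q n o\<^sub>L adj (\<alpha> i)) (\<alpha> i y)) = x y - x (res (real (Suc n) *\<^sub>R h) y)" for n
      proof -
        have "(\<Sum>i<m. (x o\<^sub>L Q n o\<^sub>L adj (\<alpha> i)) (\<alpha> i y)) = x ((Q n o\<^sub>L h) y)"
          by (simp add: h_def gram_def blinfun.sum_left blinfun.sum_right)
        also have "Q n o\<^sub>L h = id_blinfun - res (real (Suc n) *\<^sub>R h)" unfolding Q_def by (rule scaled_res_mult[OF h])
        finally show ?thesis by (simp add: blinfun_simps)
      qed
      obtain X where X: "\<And>y. (\<lambda>n. res (real n *\<^sub>R h) y) \<longlonglongrightarrow> blinfun_apply X y" "h o\<^sub>L X = 0"
        by (rule res_multiples[OF h]) (rule that)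
      have "\<alpha> j (X y) = 0" if "j < m" for j by (rule compose_zeroD, rule gram_zero[of m \<alpha>])
          (rule \<alpha>, assumption, rule that, rule X(2)[unfolded h_def])
      then have "x (X y) = 0" by (simp add: v(1) blinfun.sum_left blinfun_simps)
      moreover have "(\<lambda>n. x y - x (res (real (Suc n) *\<^sub>R h) y)) \<longlonglongrightarrow> x y - x (X y)"
        by (intro tendsto_intros blinfun.tendsto LIMSEQ_Suc[OF X(1)])
      ultimately have "(\<lambda>n. \<Sum>i<m. (x o\<^sub>L Q n o\<^sub>L adj (\<alpha> i)) (\<alpha> i y)) \<longlonglongrightarrow> x y" unfolding 2 by simp
      from LIMSEQ_unique[OF 1 this] show "(\<Sum>i<m. \<theta> i x o\<^sub>L \<alpha> i) y = x y" by (simp add: blinfun.sum_left)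
    qed
  qed
qed

end

section \<open>The representation on \<open>l\<^sup>2\<close> and affiliated operators\<close>

text \<open>The graph of an affiliated operator is a closed subspace of the product space, to which
  the projection theorem is to be applied.\<close>

instantiation prod :: (chilbert, chilbert) chilbert
begin

definition scaleC_prod :: "complex \<Rightarrow> 'a \<times> 'b \<Rightarrow> 'a \<times> 'b" where
  "scaleC_prod c z = (scaleC c (fst z), scaleC c (snd z))"

definition cinner_prod :: "'a \<times> 'b \<Rightarrow> 'a \<times> 'b \<Rightarrow> complex" where
  "cinner_prod z w = cinner (fst z) (fst w) + cinner (snd z) (snd w)"

instance
proof
  fix x y z :: "'a \<times> 'b" and c d :: complex and r :: real
  show "scaleC (complex_of_real r) x = r *\<^sub>R x"
    by (simp add: scaleC_prod_def scaleC_complex_of_real scaleR_prod_def)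
  show "scaleC c (x + y) = scaleC c x + scaleC c y" "scaleC (c + d) x = scaleC c x + scaleC d x"
    "scaleC c (scaleC d x) = scaleC (c * d) x"
    by (simp_all add: scaleC_prod_def scaleC_add_right scaleC_add_left scaleC_scaleC)
  show "cinner x y = cnj (cinner y x)"
    using cinner_commute[of "fst x" "fst y"] cinner_commute[of "snd x" "snd y"] by (simp add: cinner_prod_def)
  show "cinner (x + y) z = cinner x z + cinner y z" "cinner (scaleC c x) y = c * cinner x y"
    by (simp_all add: cinner_prod_def scaleC_prod_def cinner_simps algebra_simps)
  show "cinner x x = complex_of_real ((norm x)\<^sup>2)" by (simp add: cinner_prod_def cinner_self norm_prod_def)
qed

end

lemma blinfun_eq_dense:
  assumes D: "closure D = UNIV" and eq: "\<And>x. x \<in> D \<Longrightarrow> blinfun_apply S x = blinfun_apply T x"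
  shows "S = T"
proof (rule blinfun_eqI)
  fix x
  have "closed {x. S x = T x}"
    by (intro closed_Collect_eq linear_continuous_on blinfun.bounded_linear_right)
  moreover have "D \<subseteq> {x. S x = T x}" by (rule subsetI) (simp add: eq)
  ultimately have "closure D \<subseteq> {x. S x = T x}" by (intro closure_minimal)
  then show "S x = T x" using D by blast
qed

lemma clinear_opI_limit:
  fixes L :: "'h::chilbert \<Rightarrow>\<^sub>L 'h"
  assumes "\<And>n. clinear_op (X n)" "\<And>y. (\<lambda>n. X n y) \<longlonglongrightarrow> blinfun_apply L y"
  shows "clinear_op L" unfolding clinear_op_def
proof (intro allI)
  fix c x
  have "(\<lambda>n. X n (scaleC c x)) \<longlonglongrightarrow> scaleC c (L x)"
    unfolding clinear_opD[OF assms(1)] by (rule tendsto_scaleC[OF assms(2)])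
  with assms(2) show "L (scaleC c x) = scaleC c (L x)" by (rule LIMSEQ_unique)
qed

locale l2_representation = finite_von_Neumann A tr
  for A :: "('h::chilbert \<Rightarrow>\<^sub>L 'h) set" and tr +
  fixes \<iota> :: "('h \<Rightarrow>\<^sub>L 'h) \<Rightarrow> 'l::chilbert"
  assumes l2: "l2_completion A tr \<iota>"
begin

lemma iota_add: "a \<in> A \<Longrightarrow> b \<in> A \<Longrightarrow> \<iota> (a + b) = \<iota> a + \<iota> b"
  and iota_scalar: "a \<in> A \<Longrightarrow> \<iota> (scalar_op c o\<^sub>L a) = scaleC c (\<iota> a)"
  and cinner_iota: "a \<in> A \<Longrightarrow> b \<in> A \<Longrightarrow> cinner (\<iota> a) (\<iota> b) = tr (a o\<^sub>L adj b)"
  and iota_dense: "closure (\<iota> ` A) = UNIV" using l2 unfolding l2_completion_def by simp_all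

lemma iota_diff: "a \<in> A \<Longrightarrow> b \<in> A \<Longrightarrow> \<iota> (a - b) = \<iota> a - \<iota> b" using iota_add[of "a - b" b] by simp

lemma iota_0 [simp]: "\<iota> 0 = 0" using iota_add[of 0 0] by simp

lemma norm_iota: "a \<in> A \<Longrightarrow> (norm (\<iota> a))\<^sup>2 = \<tau> (a o\<^sub>L adj a)"
  using cinner_self_Re[of "\<iota> a"] by (simp add: cinner_iota \<tau>_def)

lemma norm_iota': "a \<in> A \<Longrightarrow> (norm (\<iota> a))\<^sup>2 = \<tau> (adj a o\<^sub>L a)" by (simp add: norm_iota tau_commute)

lemma iota_eq_0: "a \<in> A \<Longrightarrow> \<iota> a = 0 \<Longrightarrow> a = 0"
proof -
  assume a: "a \<in> A" "\<iota> a = 0"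
  then have "\<tau> (adj a o\<^sub>L a) = 0" using norm_iota'[OF a(1)] by simp
  then have z: "adj a o\<^sub>L a = 0" using a by (intro tau_faithful) (simp_all add: pos_op_adj_mult)
  show "a = 0"
  proof (rule blinfun_eqI)
    fix x
    have "(norm (a x))\<^sup>2 = 0" using qf_adj_mult[of a x] a z by (simp add: blinfun_simps)
    then show "a x = blinfun_apply 0 x" by simp
  qed
qed

lemma norm_iota_mult_le:
  assumes a: "a \<in> A" and b: "b \<in> A"
  shows "norm (\<iota> (a o\<^sub>L b)) \<le> norm a * norm (\<iota> b)"
proof -
  have ca: "clinear_op a" and cb: "clinear_op b" using assms by simp_all
  have pa: "pos_op (adj a o\<^sub>L a)" using ca by (rule pos_op_adj_mult)
  have le: "ple (adj a o\<^sub>L a) ((norm a)\<^sup>2 *\<^sub>R id_blinfun)"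
  proof (subst ple_iff, rule pa, simp add: pos_op_scaleR, rule allI)
    fix x
    have "(norm (a x))\<^sup>2 \<le> (norm a * norm x)\<^sup>2" by (intro power_mono norm_blinfun) simp
    then show "qf (adj a o\<^sub>L a) x \<le> qf ((norm a)\<^sup>2 *\<^sub>R id_blinfun) x"
      unfolding qf_adj_mult[OF ca] qf_id by (simp add: power_mult_distrib)
  qed
  have "(norm (\<iota> (a o\<^sub>L b)))\<^sup>2 = \<tau> (adj b o\<^sub>L (adj a o\<^sub>L a) o\<^sub>L b)"
    using a b by (simp add: norm_iota' adj_simps compose_assoc)
  also have "\<dots> \<le> \<tau> (adj b o\<^sub>L ((norm a)\<^sup>2 *\<^sub>R id_blinfun) o\<^sub>L b)"
    by (rule tau_mono[OF _ _ ple_congr[OF cb le]]) (use a b in simp_all)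
  also have "\<dots> = (norm a)\<^sup>2 * \<tau> (adj b o\<^sub>L b)" using b by (simp add: compose_distrib tau_scale)
  also have "\<dots> = (norm a * norm (\<iota> b))\<^sup>2" using b by (simp add: norm_iota' power_mult_distrib)
  finally show ?thesis by (rule power2_le_imp_le) simp
qed

lemma norm_iota_adj: "a \<in> A \<Longrightarrow> norm (\<iota> (adj a)) = norm (\<iota> a)"
proof -
  assume a: "a \<in> A"
  have "(norm (\<iota> (adj a)))\<^sup>2 = (norm (\<iota> a))\<^sup>2" using a norm_iota[of "adj a"] norm_iota'[of a] by simp
  then show ?thesis by (simp add: power2_eq_iff_nonneg)
qed

text \<open>The trace property makes the adjoint isometric for the trace norm, which turns the bound
  for left multiplication into one for right multiplication.\<close>

lemma norm_iota_mult_le':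
  assumes "a \<in> A" "b \<in> A"
  shows "norm (\<iota> (a o\<^sub>L b)) \<le> norm b * norm (\<iota> a)"
  using norm_iota_mult_le[of "adj b" "adj a"] norm_iota_adj[of "a o\<^sub>L b"] norm_iota_adj[of a] norm_adj[of b] assms
  by (simp add: adj_simps)

lemma dense_sequence:
  obtains b where "\<And>n::nat. b n \<in> A" "(\<lambda>n. \<iota> (b n)) \<longlonglongrightarrow> x"
proof -
  have "x \<in> closure (\<iota> ` A)" using iota_dense by simp
  then obtain u where u: "\<And>n. u n \<in> \<iota> ` A" "u \<longlonglongrightarrow> x" unfolding closure_sequential by blast
  then have "\<exists>b. \<forall>n. b n \<in> A \<and> u n = \<iota> (b n)" by (intro choice) blast
  then obtain b where b: "\<And>n. b n \<in> A" "\<And>n. u n = \<iota> (b n)" by blast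
  have "(\<lambda>n. \<iota> (b n)) \<longlonglongrightarrow> x" using u(2) unfolding b(2)[symmetric] by simp
  then show thesis using b(1) by (rule that[rotated])
qed

lemma extend_operator:
  assumes add: "\<And>a b. a \<in> A \<Longrightarrow> b \<in> A \<Longrightarrow> f (a + b) = f a + f b"
    and sc: "\<And>c a. a \<in> A \<Longrightarrow> f (scalar_op c o\<^sub>L a) = scaleC c (f a)"
    and bd: "\<And>a. a \<in> A \<Longrightarrow> norm (f a) \<le> K * norm (\<iota> a)"
  obtains T :: "'l \<Rightarrow>\<^sub>L 'l" where "clinear_op T" "\<And>a. a \<in> A \<Longrightarrow> T (\<iota> a) = f a" "norm T \<le> \<bar>K\<bar>"
proof -
  have diff: "f (a - b) = f a - f b" if "a \<in> A" "b \<in> A" for a b using add[of "a - b" b] that by simp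
  have near: "norm (f a - f b) \<le> \<bar>K\<bar> * norm (\<iota> a - \<iota> b)" if "a \<in> A" "b \<in> A" for a b
  proof -
    have "norm (f (a - b)) \<le> K * norm (\<iota> (a - b))" using that by (intro bd) simp
    also have "\<dots> \<le> \<bar>K\<bar> * norm (\<iota> (a - b))" by (intro mult_right_mono) simp_all
    finally show ?thesis using that by (simp add: diff iota_diff)
  qed
  have lim0: "(\<lambda>n. f (a n) - f (b n)) \<longlonglongrightarrow> 0"
    if ab: "\<And>n. a n \<in> A" "\<And>n. b n \<in> A" "(\<lambda>n. \<iota> (a n)) \<longlonglongrightarrow> x" "(\<lambda>n. \<iota> (b n)) \<longlonglongrightarrow> x"
    for a b :: "nat \<Rightarrow> 'h \<Rightarrow>\<^sub>L 'h" and x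
  proof (rule Lim_null_comparison)
    show "\<forall>\<^sub>F n in sequentially. norm (f (a n) - f (b n)) \<le> \<bar>K\<bar> * norm (\<iota> (a n) - \<iota> (b n))"
      by (intro always_eventually allI near ab)
    have "(\<lambda>n. \<bar>K\<bar> * norm (\<iota> (a n) - \<iota> (b n))) \<longlonglongrightarrow> \<bar>K\<bar> * norm (x - x)" by (intro tendsto_intros ab)
    then show "(\<lambda>n. \<bar>K\<bar> * norm (\<iota> (a n) - \<iota> (b n))) \<longlonglongrightarrow> 0" by simp
  qed
  \<comment> \<open>One limit is asserted for all approximating sequences at once, so that the
    choice \<open>t x\<close> below applies to any of them, in particular to sums and multiples of
    sequences.\<close>
  have ex: "\<exists>l. \<forall>b. (\<forall>n::nat. b n \<in> A) \<and> (\<lambda>n. \<iota> (b n)) \<longlonglongrightarrow> x \<longrightarrow> (\<lambda>n. f (b n)) \<longlonglongrightarrow> l" for x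
  proof -
    obtain a where a: "\<And>n::nat. a n \<in> A" "(\<lambda>n. \<iota> (a n)) \<longlonglongrightarrow> x" by (rule dense_sequence) (rule that)
    have "Cauchy (\<lambda>n. f (a n))"
    proof (rule CauchyI)
      fix e :: real assume e: "e > 0"
      have "e / (\<bar>K\<bar> + 1) > 0" using e by simp
      from CauchyD[OF LIMSEQ_imp_Cauchy[OF a(2)] this]
      obtain M where M: "\<And>m n. M \<le> m \<Longrightarrow> M \<le> n \<Longrightarrow> norm (\<iota> (a m) - \<iota> (a n)) < e / (\<bar>K\<bar> + 1)" by auto
      have "norm (f (a m) - f (a n)) < e" if "M \<le> m" "M \<le> n" for m n
      proof -
        have "norm (f (a m) - f (a n)) \<le> \<bar>K\<bar> * norm (\<iota> (a m) - \<iota> (a n))" by (rule near[OF a(1) a(1)])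
        also have "\<dots> \<le> (\<bar>K\<bar> + 1) * norm (\<iota> (a m) - \<iota> (a n))" by (intro mult_right_mono) simp_all
        also have "\<dots> < (\<bar>K\<bar> + 1) * (e / (\<bar>K\<bar> + 1))" using M[OF that] by (intro mult_strict_left_mono) simp_all
        also have "\<dots> = e" by simp
        finally show ?thesis .
      qed
      then show "\<exists>M. \<forall>m\<ge>M. \<forall>n\<ge>M. norm (f (a m) - f (a n)) < e" by (intro exI[of _ M] allI impI)
    qed
    then obtain l where l: "(\<lambda>n. f (a n)) \<longlonglongrightarrow> l" using Cauchy_convergent convergent_def by blast
    have "(\<lambda>n. f (b n)) \<longlonglongrightarrow> l" if "\<forall>n. b n \<in> A" "(\<lambda>n. \<iota> (b n)) \<longlonglongrightarrow> x" for b
      using tendsto_add[OF lim0[OF spec[OF that(1)] a(1) that(2) a(2)] l] by simp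
    then show ?thesis by (intro exI[of _ l] allI impI) (elim conjE)
  qed
  define t where "t = (\<lambda>x. SOME l. \<forall>b. (\<forall>n::nat. b n \<in> A) \<and> (\<lambda>n. \<iota> (b n)) \<longlonglongrightarrow> x \<longrightarrow> (\<lambda>n. f (b n)) \<longlonglongrightarrow> l)"
  have t: "(\<lambda>n. f (b n)) \<longlonglongrightarrow> t x" if "\<And>n. b n \<in> A" "(\<lambda>n. \<iota> (b n)) \<longlonglongrightarrow> x" for b x
    using someI_ex[OF ex[of x]] that unfolding t_def by simp
  have 1: "t (x + y) = t x + t y" for x y
  proof -
    obtain a where a: "\<And>n::nat. a n \<in> A" "(\<lambda>n. \<iota> (a n)) \<longlonglongrightarrow> x" by (rule dense_sequence) (rule that)
    obtain b where b: "\<And>n::nat. b n \<in> A" "(\<lambda>n. \<iota> (b n)) \<longlonglongrightarrow> y" by (rule dense_sequence) (rule that)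
    have "(\<lambda>n. f (a n + b n)) \<longlonglongrightarrow> t (x + y)"
      using tendsto_add[OF a(2) b(2)] a(1) b(1) by (intro t) (simp_all add: iota_add)
    moreover have "(\<lambda>n. f (a n + b n)) \<longlonglongrightarrow> t x + t y" unfolding add[OF a(1) b(1)] by (intro tendsto_add t a b)
    ultimately show ?thesis by (rule LIMSEQ_unique)
  qed
  have 2: "t (scaleC c x) = scaleC c (t x)" for c x
  proof -
    obtain a where a: "\<And>n::nat. a n \<in> A" "(\<lambda>n. \<iota> (a n)) \<longlonglongrightarrow> x" by (rule dense_sequence) (rule that)
    have "(\<lambda>n. f (scalar_op c o\<^sub>L a n)) \<longlonglongrightarrow> t (scaleC c x)"
      using tendsto_scaleC[OF a(2), of c] a(1) by (intro t) (simp_all add: iota_scalar)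
    moreover have "(\<lambda>n. f (scalar_op c o\<^sub>L a n)) \<longlonglongrightarrow> scaleC c (t x)"
      unfolding sc[OF a(1)] by (intro tendsto_scaleC t a)
    ultimately show ?thesis by (rule LIMSEQ_unique)
  qed
  have 3: "norm (t x) \<le> \<bar>K\<bar> * norm x" for x
  proof -
    obtain a where a: "\<And>n::nat. a n \<in> A" "(\<lambda>n. \<iota> (a n)) \<longlonglongrightarrow> x" by (rule dense_sequence) (rule that)
    have "norm (f (a n)) \<le> \<bar>K\<bar> * norm (\<iota> (a n))" for n
      using near[OF a(1) mem_0, of n] add[OF mem_0 mem_0] by simp
    then show ?thesis by (intro LIMSEQ_le[OF tendsto_norm[OF t[OF a]] tendsto_mult_left[OF tendsto_norm[OF a(2)]]]) simp
  qed
  obtain T where T: "clinear_op T" "\<And>x. blinfun_apply T x = t x" by (rule clinear_opE[OF 1 2 3]) (rule that)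
  have "T (\<iota> a) = f a" if "a \<in> A" for a using t[of "\<lambda>_. a" "\<iota> a"] that by (simp add: T(2) LIMSEQ_const_iff)
  moreover have "norm T \<le> \<bar>K\<bar>" by (rule norm_blinfun_bound) (simp_all add: T(2) 3)
  ultimately show thesis by (rule that[OF T(1)])
qed

section \<open>The left regular representation\<close>

definition lam :: "('h \<Rightarrow>\<^sub>L 'h) \<Rightarrow> ('l \<Rightarrow>\<^sub>L 'l)" where "lam = left_mult A \<iota>"

lemma scalar_commute: "clinear_op a \<Longrightarrow> a o\<^sub>L (scalar_op c o\<^sub>L b) = scalar_op c o\<^sub>L (a o\<^sub>L b)"
  by (rule blinfun_eqI) (simp add: clinear_opD)

text \<open>The bounded extension from the dense image of \<open>A\<close> is unique, so the
  definite description in \<open>left_mult\<close> denotes it.\<close>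

lemma lam:
  assumes a: "a \<in> A"
  shows lam_clinear: "clinear_op (lam a)" and lam_iota: "b \<in> A \<Longrightarrow> lam a (\<iota> b) = \<iota> (a o\<^sub>L b)"
    and norm_lam: "norm (lam a) \<le> norm a"
proof -
  obtain T where T: "clinear_op T" "\<And>b. b \<in> A \<Longrightarrow> T (\<iota> b) = \<iota> (a o\<^sub>L b)" "norm T \<le> \<bar>norm a\<bar>"
  proof (rule extend_operator[of "\<lambda>b. \<iota> (a o\<^sub>L b)" "norm a"])
    show "\<iota> (a o\<^sub>L b + c) = \<iota> (a o\<^sub>L b) + \<iota> (a o\<^sub>L c)" if "b \<in> A" "c \<in> A" for b c
      using a that by (simp add: compose_distrib iota_add)
    show "\<iota> (a o\<^sub>L (scalar_op c o\<^sub>L b)) = scaleC c (\<iota> (a o\<^sub>L b))" if "b \<in> A" for c b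
      using a that by (simp add: scalar_commute iota_scalar)
    show "norm (\<iota> (a o\<^sub>L b)) \<le> norm a * norm (\<iota> b)" if "b \<in> A" for b by (rule norm_iota_mult_le[OF a that])
  qed (rule that)
  have "lam a = T" unfolding lam_def left_mult_def
  proof (rule the_equality)
    show "\<forall>b\<in>A. T (\<iota> b) = \<iota> (a o\<^sub>L b)" by (intro ballI T(2))
    show "S = T" if S: "\<forall>b\<in>A. blinfun_apply S (\<iota> b) = \<iota> (a o\<^sub>L b)" for S
    proof (rule blinfun_eq_dense[OF iota_dense])
      show "blinfun_apply S x = blinfun_apply T x" if "x \<in> \<iota> ` A" for x
        using that by (elim imageE) (simp add: T(2) S)
    qed
  qed
  with T show "clinear_op (lam a)" "b \<in> A \<Longrightarrow> lam a (\<iota> b) = \<iota> (a o\<^sub>L b)" "norm (lam a) \<le> norm a" by simp_all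
qed

lemma blinfun_iota_eqI:
  assumes "\<And>b. b \<in> A \<Longrightarrow> blinfun_apply S (\<iota> b) = blinfun_apply T (\<iota> b)" shows "S = T"
proof (rule blinfun_eq_dense[OF iota_dense])
  show "blinfun_apply S x = blinfun_apply T x" if "x \<in> \<iota> ` A" for x
    using that by (elim imageE) (simp add: assms)
qed

lemma lam_hom:
  assumes a: "a \<in> A"
  shows lam_add: "b \<in> A \<Longrightarrow> lam (a + b) = lam a + lam b"
    and lam_diff: "b \<in> A \<Longrightarrow> lam (a - b) = lam a - lam b"
    and lam_mult: "b \<in> A \<Longrightarrow> lam (a o\<^sub>L b) = lam a o\<^sub>L lam b"
    and lam_scale: "lam (r *\<^sub>R a) = r *\<^sub>R lam a"
    and lam_adj: "lam (adj a) = adj (lam a)"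
proof -
  show "lam (a + b) = lam a + lam b" "lam (a - b) = lam a - lam b" "lam (a o\<^sub>L b) = lam a o\<^sub>L lam b" if "b \<in> A"
    by (rule blinfun_iota_eqI, use a that in
      \<open>simp add: lam_iota compose_distrib iota_add iota_diff blinfun_simps compose_assoc\<close>)+
  show "lam (r *\<^sub>R a) = r *\<^sub>R lam a"
  proof (rule blinfun_iota_eqI)
    fix b assume b: "b \<in> A"
    have "\<iota> ((r *\<^sub>R a) o\<^sub>L b) = scaleC (of_real r) (\<iota> (a o\<^sub>L b))"
      using a b iota_scalar[of "a o\<^sub>L b" "of_real r"] by (simp add: scalar_op_real compose_distrib)
    then show "lam (r *\<^sub>R a) (\<iota> b) = (r *\<^sub>R lam a) (\<iota> b)"
      using a b by (simp add: lam_iota blinfun_simps scaleC_complex_of_real)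
  qed
  show "lam (adj a) = adj (lam a)"
  proof (rule blinfun_iota_eqI)
    fix b assume b: "b \<in> A"
    have "cinner x (lam (adj a) (\<iota> b)) = cinner x (adj (lam a) (\<iota> b))" for x
    proof -
      \<comment> \<open>Both sides are continuous in \<open>x\<close>, so it suffices to compare
        them on the dense image of \<open>A\<close>, where the identity is the trace
        property.\<close>
      have cl: "closed {x. cinner x (lam (adj a) (\<iota> b)) = cinner (lam a x) (\<iota> b)}"
        by (intro closed_Collect_eq linear_continuous_on
            bounded_bilinear.bounded_linear_left[OF bounded_bilinear_cinner]
            bounded_linear_compose[OF bounded_bilinear.bounded_linear_left[OF bounded_bilinear_cinner]
              blinfun.bounded_linear_right])
      have "\<iota> ` A \<subseteq> {x. cinner x (lam (adj a) (\<iota> b)) = cinner (lam a x) (\<iota> b)}"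
      proof (clarsimp)
        fix c assume c: "c \<in> A"
        have "cinner (\<iota> c) (lam (adj a) (\<iota> b)) = tr (c o\<^sub>L (adj b o\<^sub>L a))"
          using a b c by (simp add: lam_iota cinner_iota adj_simps)
        also have "\<dots> = tr ((c o\<^sub>L adj b) o\<^sub>L a)" by (simp only: compose_assoc)
        also have "\<dots> = tr (a o\<^sub>L (c o\<^sub>L adj b))" using a b c by (intro tr_commute) simp_all
        also have "\<dots> = cinner (lam a (\<iota> c)) (\<iota> b)"
          using a b c by (simp add: lam_iota cinner_iota compose_assoc)
        finally show "cinner (\<iota> c) (lam (adj a) (\<iota> b)) = cinner (lam a (\<iota> c)) (\<iota> b)" .
      qed
      from closure_minimal[OF this cl] iota_dense
      have "cinner x (lam (adj a) (\<iota> b)) = cinner (lam a x) (\<iota> b)" by blast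
      then show ?thesis by (simp add: cinner_adj[OF lam_clinear[OF a]])
    qed
    then show "lam (adj a) (\<iota> b) = adj (lam a) (\<iota> b)" by (rule cinner_eqI_right)
  qed
qed

lemma lam_id [simp]: "lam id_blinfun = id_blinfun" by (rule blinfun_iota_eqI) (simp add: lam_iota)

lemma lam_inj:
  assumes "a \<in> A" "b \<in> A" "lam a = lam b" shows "a = b"
proof -
  have "lam a (\<iota> id_blinfun) = lam b (\<iota> id_blinfun)" using assms by simp
  then have "\<iota> a = \<iota> b" unfolding lam_iota[OF assms(1) mem_id] lam_iota[OF assms(2) mem_id] by simp
  then have "\<iota> (a - b) = 0" using assms(1,2) by (simp add: iota_diff)
  from iota_eq_0[OF _ this] show ?thesis using assms(1,2) by simp
qed

text \<open>Supplies the elements of the commutant that are needed to recover an operator of the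
  bicommutant from its value at \<open>\<iota> 1\<close>.\<close>

lemma right_mult:
  assumes b: "b \<in> A"
  obtains R where "R \<in> commutant (lam ` A)" "\<And>a. a \<in> A \<Longrightarrow> R (\<iota> a) = \<iota> (a o\<^sub>L b)"
proof -
  obtain T where T: "clinear_op T" "\<And>a. a \<in> A \<Longrightarrow> T (\<iota> a) = \<iota> (a o\<^sub>L b)"
  proof (rule extend_operator[of "\<lambda>a. \<iota> (a o\<^sub>L b)" "norm b"])
    show "\<iota> (a + c o\<^sub>L b) = \<iota> (a o\<^sub>L b) + \<iota> (c o\<^sub>L b)" if "a \<in> A" "c \<in> A" for a c
      using b that by (simp add: compose_distrib iota_add)
    show "\<iota> ((scalar_op c o\<^sub>L a) o\<^sub>L b) = scaleC c (\<iota> (a o\<^sub>L b))" if "a \<in> A" for c a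
      using b that by (simp add: compose_assoc iota_scalar)
    show "norm (\<iota> (a o\<^sub>L b)) \<le> norm b * norm (\<iota> a)" if "a \<in> A" for a by (rule norm_iota_mult_le'[OF that b])
  qed (rule that)
  have "T o\<^sub>L lam a = lam a o\<^sub>L T" if "a \<in> A" for a
    by (rule blinfun_iota_eqI) (use that b in \<open>simp add: T lam_iota compose_assoc\<close>)
  then have "T \<in> commutant (lam ` A)" using T(1) unfolding commutant_def by simp
  then show thesis using T(2) by (rule that)
qed

lemma lam_commutant_apply: "S \<in> commutant (lam ` A) \<Longrightarrow> a \<in> A \<Longrightarrow> S (lam a x) = lam a (S x)"
  by (rule compose_eqD) (simp add: commutant_def)

lemma lam_commutant_adj:
  assumes S: "S \<in> commutant (lam ` A)" shows "adj S \<in> commutant (lam ` A)"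
proof -
  have cS: "clinear_op S" using S by (simp add: commutant_def)
  have "adj S o\<^sub>L lam a = lam a o\<^sub>L adj S" if a: "a \<in> A" for a
  proof -
    have "S o\<^sub>L lam (adj a) = lam (adj a) o\<^sub>L S" using S a by (simp add: commutant_def)
    then have "adj (S o\<^sub>L adj (lam a)) = adj (adj (lam a) o\<^sub>L S)" using a by (simp add: lam_adj)
    then show ?thesis using cS lam_clinear[OF a] by (simp add: adj_simps clinear_adj)
  qed
  then show ?thesis unfolding commutant_def using clinear_adj[OF cS] by simp
qed

text \<open>A vector \<xi> killed by \<open>lam s\<close> is fixed by all
  \<open>lam (res (n adj s s))\<close>. Since their traces tend to zero, these operators tend
  strongly to zero, first on the image of \<open>A\<close> and then everywhere by
  boundedness.\<close>

lemma lam_injective: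
  assumes s: "s \<in> nzd" and z: "lam s \<xi> = 0" shows "\<xi> = 0"
proof -
  define m where "m = adj s o\<^sub>L s"
  have mN: "m \<in> nzd" unfolding m_def by (intro nzd_mult adj_nzd s)
  have m: "m \<in> A" "pos_op m" using s by (simp_all add: m_def pos_op_adj_mult)
  define X where "X = (\<lambda>n. res (real n *\<^sub>R m))"
  have k: "real n *\<^sub>R m \<in> A" "pos_op (real n *\<^sub>R m)" for n using m by (simp_all add: pos_op_scaleR)
  have X: "X n \<in> A" "pos_op (X n)" "norm (X n) \<le> 1" for n
    unfolding X_def using k[of n] by (simp_all add: res_pos norm_res_le)
  have \<tau>X: "(\<lambda>n. \<tau> (X n)) \<longlonglongrightarrow> 0" unfolding X_def by (rule tau_res_multiples_injective[OF m nzd_inj[OF mN]])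
  have fix\<xi>: "lam (X n) \<xi> = \<xi>" for n
  proof -
    have "lam (X n o\<^sub>L (id_blinfun + real n *\<^sub>R m)) = id_blinfun"
      unfolding X_def by (simp add: res_left[OF k(2)])
    then have "lam (X n) o\<^sub>L (id_blinfun + real n *\<^sub>R (adj (lam s) o\<^sub>L lam s)) = id_blinfun"
      using X m s by (simp add: lam_mult lam_add lam_scale lam_adj m_def)
    from compose_eqD1[OF this, of \<xi>] show ?thesis using z by (simp add: blinfun_simps)
  qed
  have lim: "(\<lambda>n. lam (X n) (\<iota> b)) \<longlonglongrightarrow> 0" if b: "b \<in> A" for b
  proof -
    have "(norm (lam (X n) (\<iota> b)))\<^sup>2 \<le> (norm b)\<^sup>2 * \<tau> (X n)" for n
    proof -
      have "(norm (\<iota> (X n o\<^sub>L b)))\<^sup>2 \<le> (norm b * norm (\<iota> (X n)))\<^sup>2"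
        by (intro power_mono norm_iota_mult_le' X b) simp
      also have "\<dots> = (norm b)\<^sup>2 * \<tau> (adj (X n) o\<^sub>L X n)" using X by (simp add: power_mult_distrib norm_iota')
      also have "\<dots> \<le> (norm b)\<^sup>2 * \<tau> (X n)"
      proof (intro mult_left_mono tau_mono)
        \<comment> \<open>\<open>X n\<close> is a positive contraction, so its square lies below
          it.\<close>
        show "ple (adj (X n) o\<^sub>L X n) (X n)"
        proof (subst ple_iff, use X in \<open>simp add: pos_op_adj_mult\<close>, rule X, rule allI)
          fix y
          have "(norm (X n y))\<^sup>2 \<le> 1 * qf (X n) y"
          proof (rule norm_sq_le_qf[OF X(2)])
            show "qf (X n) y \<le> 1 * (norm y)\<^sup>2" for y
              using qf_le_norm[of "X n" y] mult_right_mono[OF X(3), of "(norm y)\<^sup>2" n] by simp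
          qed simp
          then show "qf (adj (X n) o\<^sub>L X n) y \<le> qf (X n) y" using qf_adj_mult[of "X n" y] X by simp
        qed
      qed (use X in simp_all)
      finally show ?thesis using X b by (simp add: lam_iota)
    qed
    moreover have "(\<lambda>n. (norm b)\<^sup>2 * \<tau> (X n)) \<longlonglongrightarrow> (norm b)\<^sup>2 * 0" by (intro tendsto_intros \<tau>X)
    ultimately have "(\<lambda>n. (norm (lam (X n) (\<iota> b)))\<^sup>2) \<longlonglongrightarrow> 0"
      by (intro Lim_null_comparison[of "\<lambda>n. (norm (lam (X n) (\<iota> b)))\<^sup>2" "\<lambda>n. (norm b)\<^sup>2 * \<tau> (X n)"]) simp_all
    then have "(\<lambda>n. sqrt ((norm (lam (X n) (\<iota> b)))\<^sup>2)) \<longlonglongrightarrow> sqrt 0" by (rule tendsto_real_sqrt)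
    then show ?thesis by (simp add: tendsto_norm_zero_iff)
  qed
  have nl: "norm (lam (X n)) \<le> 1" for n using norm_lam[OF X(1)] X(3) order.trans by blast
  have "Cauchy (\<lambda>n. lam (X n) y)" for y
  proof (rule Cauchy_of_dense[OF nl iota_dense])
    show "Cauchy (\<lambda>n. lam (X n) y)" if "y \<in> \<iota> ` A" for y
      using that by (elim imageE) (simp add: LIMSEQ_imp_Cauchy[OF lim])
  qed
  then obtain L where L: "\<And>y. (\<lambda>n. lam (X n) y) \<longlonglongrightarrow> blinfun_apply L y"
    by (rule strong_limit_exists[OF lam_clinear[OF X(1)] nl]) (rule that)
  have "L = 0" by (rule blinfun_iota_eqI) (use LIMSEQ_unique[OF L lim] in \<open>simp add: blinfun_simps\<close>)
  then have "(\<lambda>n. \<xi>) \<longlonglongrightarrow> 0" using L[of \<xi>] fix\<xi> by (simp add: blinfun_simps)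
  then show ?thesis by (simp add: LIMSEQ_const_iff)
qed

text \<open>The kernel projection \<open>q\<close> of \<open>s\<close> would give the vector
  \<open>\<iota> q\<close> in the kernel of \<open>lam s\<close>.\<close>

lemma lam_nzdI:
  assumes s: "s \<in> A" and inj: "\<And>\<xi>. lam s \<xi> = 0 \<Longrightarrow> \<xi> = 0" shows "s \<in> nzd"
proof -
  obtain q where q: "projection q" "s o\<^sub>L q = 0" and qid: "\<And>x. blinfun_apply s x = 0 \<Longrightarrow> blinfun_apply q x = x"
    by (rule kernel_projection[OF s]) (rule that)
  have qA: "q \<in> A" using q projectionD by blast
  have "lam s (\<iota> q) = 0" using s qA q by (simp add: lam_iota)
  then have "\<iota> q = 0" by (rule inj)
  then have "q = 0" by (rule iota_eq_0[OF qA])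
  show ?thesis
  proof (rule nzdI[OF s])
    fix y assume "s y = 0"
    from qid[OF this] show "y = 0" unfolding \<open>q = 0\<close> by simp
  qed
qed

end

section \<open>Operators of the bicommutant as fractions\<close>

context l2_representation
begin

lemma mem_limit':
  assumes "\<And>n. X n \<in> A" "\<And>y. (\<lambda>n. X n y) \<longlonglongrightarrow> blinfun_apply L y"
  shows "L \<in> A" by (rule mem_limit[OF clinear_opI_limit[OF clinear[OF assms(1)] assms(2)] assms])

text \<open>The rate \<open>(1/8)^n\<close> leaves room for weights: the squared increments,
  multiplied by \<open>4^n\<close>, still have summable traces.\<close>

lemma fast_approximation:
  obtains a where "\<And>n::nat. a n \<in> A" "\<And>n. norm (\<iota> (a n) - \<xi>) \<le> (1/8) ^ n" "(\<lambda>n. \<iota> (a n)) \<longlonglongrightarrow> \<xi>"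
proof -
  have "\<exists>a. \<forall>n::nat. a n \<in> A \<and> norm (\<iota> (a n) - \<xi>) \<le> (1/8) ^ n"
  proof (rule choice, rule allI)
    fix n :: nat
    have "\<xi> \<in> closure (\<iota> ` A)" using iota_dense by simp
    then obtain y where "y \<in> \<iota> ` A" "dist y \<xi> < (1/8) ^ n"
      unfolding closure_approachable by (metis divide_pos_pos zero_less_one zero_less_numeral zero_less_power)
    then show "\<exists>b. b \<in> A \<and> norm (\<iota> b - \<xi>) \<le> (1/8) ^ n" by (auto simp: dist_norm intro: less_imp_le)
  qed
  then obtain a where a: "\<And>n::nat. a n \<in> A" "\<And>n. norm (\<iota> (a n) - \<xi>) \<le> (1/8) ^ n" by blast
  have "(\<lambda>n. \<iota> (a n) - \<xi>) \<longlonglongrightarrow> 0"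
  proof (rule Lim_null_comparison)
    show "\<forall>\<^sub>F n in sequentially. norm (\<iota> (a n) - \<xi>) \<le> (1/8) ^ n" by (intro always_eventually allI a)
    show "(\<lambda>n. (1/8::real) ^ n) \<longlonglongrightarrow> 0" by (rule LIMSEQ_power_zero) simp
  qed
  then have "(\<lambda>n. \<iota> (a n)) \<longlonglongrightarrow> \<xi>" by (simp add: LIM_zero_iff)
  with a show thesis by (rule that)
qed

lemma id_minus_res_le:
  assumes U: "pos_op U" shows "ple (id_blinfun - res U) U"
proof -
  have "U - (id_blinfun - res U) = U - (U o\<^sub>L res U)" by (simp only: res_compl[OF U])
  also have "\<dots> = U o\<^sub>L (id_blinfun - res U)" by (simp add: compose_distrib)
  also have "\<dots> = U o\<^sub>L res U o\<^sub>L U" by (simp only: res_compl(2)[OF U, symmetric] compose_assoc)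
  finally show ?thesis using pos_op_congr[OF pos_op_clinear[OF U] res_pos[OF U]] by (simp add: pos_op_adj U)
qed

text \<open>Operators in the bicommutant of \<open>lam ` A\<close> are right fractions of elements of \<open>A\<close>; this is
  enough to describe affiliated operators and avoids proving \<open>lam ` A\<close> to be a von Neumann algebra.
  The denominator is \<open>(1 + \<Sum> 4\<^sup>n (a\<^sub>n\<^sub>+\<^sub>1 - a\<^sub>n)*(a\<^sub>n\<^sub>+\<^sub>1 - a\<^sub>n))\<^sup>-\<^sup>1\<close> for a fast approximation \<open>a\<^sub>n\<close>
  of \<open>T 1\<close>.\<close>

lemma bicommutant_fraction:
  assumes T: "\<And>S x. S \<in> commutant (lam ` A) \<Longrightarrow> blinfun_apply T (S x) = S (T x)"
  obtains g c where "g \<in> nzd" "c \<in> A" "T o\<^sub>L lam g = lam c"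
proof -
  define \<xi> where "\<xi> = T (\<iota> id_blinfun)"
  obtain a where a: "\<And>n::nat. a n \<in> A" "\<And>n. norm (\<iota> (a n) - \<xi>) \<le> (1/8) ^ n" "(\<lambda>n. \<iota> (a n)) \<longlonglongrightarrow> \<xi>"
    by (rule fast_approximation) (rule that)
  define d where "d = (\<lambda>n. a (Suc n) - a n)"
  have d: "d n \<in> A" "clinear_op (d n)" for n using a(1) by (simp_all add: d_def)
  define e where "e = (\<lambda>n. 2 ^ n *\<^sub>R d n)"
  have e: "e n \<in> A" "clinear_op (e n)" for n using d by (simp_all add: e_def)
  define w where "w = (\<lambda>n. adj (e n) o\<^sub>L e n)"
  have w: "w n \<in> A" "pos_op (w n)" for n using e by (simp_all add: w_def pos_op_adj_mult)
  \<comment> \<open>The weight \<open>4^n\<close> against the squared bound \<open>4 / 64^n\<close>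
    leaves a geometric series of ratio 1/16, whose sum is less than 8.\<close>
  have \<tau>w: "\<tau> (w n) \<le> 4 * (1/16) ^ n" for n
  proof -
    have "norm (\<iota> (d n)) \<le> norm (\<iota> (a (Suc n)) - \<xi>) + norm (\<iota> (a n) - \<xi>)"
      using norm_triangle_ineq4[of "\<iota> (a (Suc n)) - \<xi>" "\<iota> (a n) - \<xi>"] a(1) by (simp add: d_def iota_diff)
    also have "\<dots> \<le> (1/8) ^ n + (1/8) ^ n"
      by (intro add_mono a order.trans[OF a(2)] power_decreasing) simp_all
    finally have "norm (\<iota> (d n)) \<le> 2 * (1/8) ^ n" by simp
    then have "(norm (\<iota> (d n)))\<^sup>2 \<le> (2 * (1/8) ^ n)\<^sup>2" by (intro power_mono) simp_all
    also have "\<dots> = 4 * (1/64) ^ n" by (simp add: power_mult_distrib power2_eq_square flip: power_mult_distrib)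
    finally have "\<tau> (adj (d n) o\<^sub>L d n) \<le> 4 * (1/64) ^ n" using norm_iota'[OF d(1)] by simp
    then have "4 ^ n * \<tau> (adj (d n) o\<^sub>L d n) \<le> 4 ^ n * (4 * (1/64) ^ n)" by (intro mult_left_mono) simp_all
    also have "\<dots> = 4 * (1/16) ^ n" by (simp add: power_mult_distrib[symmetric] mult.left_commute)
    also have "w n = 4 ^ n *\<^sub>R (adj (d n) o\<^sub>L d n)"
      using d by (simp add: w_def e_def adj_simps compose_distrib power_mult_distrib[symmetric])
    then have "4 ^ n * \<tau> (adj (d n) o\<^sub>L d n) = \<tau> (w n)" using d by (simp add: tau_scale)
    finally show ?thesis .
  qed
  define k where "k = (\<lambda>N. \<Sum>n<N. w n)"
  have k: "k N \<in> A" "pos_op (k N)" for N using w by (auto simp: k_def intro!: pos_op_sum)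
  have kinc: "ple (k M) (k N)" if "M \<le> N" for M N
  proof -
    have "k N - k M = (\<Sum>n\<in>{..<N} - {..<M}. w n)" unfolding k_def using that by (subst sum_diff) auto
    then show ?thesis using pos_op_sum[OF w(2)] by simp
  qed
  have wk: "ple (w n) (k (Suc n))" for n using k(2)[of n] by (simp add: k_def)
  have \<tau>k: "\<tau> (k N) \<le> 8" for N
  proof -
    have "\<tau> (k N) = (\<Sum>n<N. \<tau> (w n))" unfolding k_def by (induction N) (use w in \<open>simp_all add: tau_add\<close>)
    also have "\<dots> \<le> (\<Sum>n<N. 4 * (1/16) ^ n)" by (intro sum_mono \<tau>w)
    also have "\<dots> = 4 * (\<Sum>n<N. (1/16) ^ n)" by (simp add: sum_distrib_left)
    also have "\<dots> = 4 * ((1 - (1/16) ^ N) / (1 - 1/16))" by (subst sum_gp_strict) simp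
    also have "\<dots> \<le> 8" by (simp add: field_simps)
    finally show ?thesis .
  qed
  \<comment> \<open>As \<open>1 - res U\<close> lies below \<open>U\<close>, its trace for
    \<open>U = \<delta> k n\<close> is at most \<open>8 \<delta>\<close>.\<close>
  have small: "\<exists>\<delta>. 0 < \<delta> \<and> \<delta> \<le> 1 \<and> (\<forall>n. \<tau> (id_blinfun - res (\<delta> *\<^sub>R k n)) \<le> r)" if r: "r > 0" for r
  proof (intro exI[of _ "min 1 (r / 8)"] conjI allI)
    fix n
    define \<delta> where "\<delta> = min 1 (r / 8)"
    have \<delta>: "0 \<le> \<delta>" "\<delta> \<le> r / 8" using r by (simp_all add: \<delta>_def)
    have kd: "\<delta> *\<^sub>R k n \<in> A" "pos_op (\<delta> *\<^sub>R k n)" using k \<delta> by (simp_all add: pos_op_scaleR)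
    have "\<tau> (id_blinfun - res (\<delta> *\<^sub>R k n)) \<le> \<tau> (\<delta> *\<^sub>R k n)"
      by (rule tau_mono[OF _ _ id_minus_res_le[OF kd(2)]]) (use kd in simp_all)
    also have "\<dots> = \<delta> * \<tau> (k n)" using k by (simp add: tau_scale)
    also have "\<dots> \<le> (r / 8) * 8" using \<delta> \<tau>k tau_nonneg[OF k] by (intro mult_mono) simp_all
    finally show "\<tau> (id_blinfun - res (min 1 (r / 8) *\<^sub>R k n)) \<le> r" by (simp add: \<delta>_def)
  qed (use r in simp_all)
  obtain g where g: "g \<in> A" "pos_op g" "\<And>y. blinfun_apply g y = 0 \<Longrightarrow> y = 0" "\<And>n. ple g (res (k n))"
    by (rule res_limit_injective[of k]) (rule k, rule k, rule kinc, assumption, rule small, assumption, rule that)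
  have gN: "g \<in> nzd" by (rule nzdI[OF g(1,3)])
  have g1: "qf g x \<le> 1 * (norm x)\<^sup>2" for x
    using ple_qf[OF ple_trans[OF g(4)[of 0] res_le_id[OF k(2)]], of x] by (simp add: cinner_self_Re)
  \<comment> \<open>Because \<open>g\<close> lies below \<open>res (w n)\<close>, the product
    \<open>e n g\<close> is a contraction. The weight \<open>2^n\<close> hidden in
    \<open>e n\<close> then makes the telescoping series of the \<open>d n g\<close> converge in
    norm.\<close>
  have dg: "norm (d n o\<^sub>L g) \<le> (1/2) ^ n" for n
  proof -
    have "norm (g o\<^sub>L adj (e n)) \<le> 1"
    proof (rule norm_blinfun_bound)
      fix z
      have "(norm (g (adj (e n) z)))\<^sup>2 \<le> 1 * qf g (adj (e n) z)" by (rule norm_sq_le_qf[OF g(2) g1]) simp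
      also have "\<dots> \<le> qf (res (w n)) (adj (e n) z)"
        using ple_qf[OF ple_trans[OF g(4)[of "Suc n"] res_antitone[OF w(2) k(2) wk]]] by simp
      also have "\<dots> = qf (e n o\<^sub>L res (w n) o\<^sub>L adj (e n)) z" by (simp add: cinner_adj[OF e(2)])
      also have "\<dots> \<le> qf id_blinfun z"
      proof (rule ple_qf, rule contraction_of_ple[OF e(2) _ res_pos[OF w(2)] res_right[OF w(2)]])
        show "pos_op (id_blinfun + w n)" using w by (simp add: pos_op_add)
        show "ple (adj (e n) o\<^sub>L e n) (id_blinfun + w n)" by (simp add: w_def)
      qed
      also have "\<dots> = (1 * norm z)\<^sup>2" by (simp add: cinner_self_Re)
      finally show "norm ((g o\<^sub>L adj (e n)) z) \<le> 1 * norm z" unfolding blinfun_apply_blinfun_compose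
        by (rule power2_le_imp_le) simp
    qed simp
    moreover have "adj (g o\<^sub>L adj (e n)) = e n o\<^sub>L g" using e g by (simp add: adj_simps clinear_adj pos_op_adj)
    moreover have "norm (adj (g o\<^sub>L adj (e n))) = norm (g o\<^sub>L adj (e n))" using e g by (intro norm_adj) simp
    ultimately have "norm (e n o\<^sub>L g) \<le> 1" by simp
    then have "2 ^ n * norm (d n o\<^sub>L g) \<le> 1" by (simp add: e_def compose_distrib)
    then show ?thesis by (simp add: field_simps power_one_over)
  qed
  have "summable (\<lambda>n. norm (d n o\<^sub>L g))"
  proof (rule summable_comparison_test[OF _ summable_geometric])
    show "\<exists>N. \<forall>n\<ge>N. norm (norm (d n o\<^sub>L g)) \<le> (1/2::real) ^ n" using dg by simp
  qed simp
  then have "summable (\<lambda>n. d n o\<^sub>L g)" by (rule summable_norm_cancel)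
  then have "(\<lambda>N. \<Sum>n<N. d n o\<^sub>L g) \<longlonglongrightarrow> suminf (\<lambda>n. d n o\<^sub>L g)" by (rule summable_LIMSEQ)
  then have s: "(\<lambda>N. (a 0 o\<^sub>L g) + (\<Sum>n<N. d n o\<^sub>L g)) \<longlonglongrightarrow> (a 0 o\<^sub>L g) + suminf (\<lambda>n. d n o\<^sub>L g)"
    by (intro tendsto_intros)
  have "(a 0 o\<^sub>L g) + (\<Sum>n<N. d n o\<^sub>L g) = a N o\<^sub>L g" for N
    using sum_lessThan_telescope[of "\<lambda>n. a n o\<^sub>L g" N] by (simp add: d_def compose_distrib)
  with s obtain c where c: "(\<lambda>N. a N o\<^sub>L g) \<longlonglongrightarrow> c" by auto
  have cA: "c \<in> A"
  proof (rule mem_limit'[of "\<lambda>n. a n o\<^sub>L g"])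
    show "(\<lambda>n. (a n o\<^sub>L g) y) \<longlonglongrightarrow> c y" for y by (intro blinfun.tendsto c tendsto_const)
  qed (use a g in simp)
  have "T o\<^sub>L lam g = lam c"
  proof (rule blinfun_iota_eqI)
    fix b assume b: "b \<in> A"
    obtain R where R: "R \<in> commutant (lam ` A)" "\<And>a. a \<in> A \<Longrightarrow> R (\<iota> a) = \<iota> (a o\<^sub>L (g o\<^sub>L b))"
      by (rule right_mult[of "g o\<^sub>L b", OF mem_closed(5)[OF g(1) b]]) (rule that)
    \<comment> \<open>\<open>R\<close> is right multiplication by \<open>g b\<close>; as
      \<open>T\<close> commutes with it, the value of \<open>T\<close> at
      \<open>\<iota> (g b)\<close> is the value of \<open>R\<close> at \<xi>.\<close>
    have 1: "(T o\<^sub>L lam g) (\<iota> b) = R \<xi>"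
      using T[OF R(1), of "\<iota> id_blinfun"] b g by (simp add: lam_iota R(2) \<xi>_def)
    have "(\<lambda>n. R (\<iota> (a n))) \<longlonglongrightarrow> R \<xi>" by (intro blinfun.tendsto tendsto_const a)
    moreover have "(\<lambda>n. R (\<iota> (a n))) \<longlonglongrightarrow> lam c (\<iota> b)"
    proof (rule LIM_zero_cancel, rule Lim_null_comparison)
      show "\<forall>\<^sub>F n in sequentially. norm (R (\<iota> (a n)) - lam c (\<iota> b)) \<le> norm ((a n o\<^sub>L g) - c) * norm (\<iota> b)"
      proof (rule always_eventually, rule allI)
        fix n
        have "R (\<iota> (a n)) - lam c (\<iota> b) = \<iota> (((a n o\<^sub>L g) - c) o\<^sub>L b)"
          using a(1) b g cA by (simp add: R(2) lam_iota iota_diff compose_distrib compose_assoc)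
        then show "norm (R (\<iota> (a n)) - lam c (\<iota> b)) \<le> norm ((a n o\<^sub>L g) - c) * norm (\<iota> b)"
          using norm_iota_mult_le[of "(a n o\<^sub>L g) - c" b] a(1) b g cA by simp
      qed
      have "(\<lambda>n. norm ((a n o\<^sub>L g) - c) * norm (\<iota> b)) \<longlonglongrightarrow> norm (c - c) * norm (\<iota> b)"
        by (intro tendsto_intros c)
      then show "(\<lambda>n. norm ((a n o\<^sub>L g) - c) * norm (\<iota> b)) \<longlonglongrightarrow> 0" by simp
    qed
    ultimately show "(T o\<^sub>L lam g) (\<iota> b) = lam c (\<iota> b)" unfolding 1 by (rule LIMSEQ_unique)
  qed
  with gN cA show thesis by (rule that)
qed

end

lemma cinner_Pair: "cinner (a, b) (c, d) = cinner a c + cinner b d" by (simp add: cinner_prod_def)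

lemma scaleC_Pair: "scaleC c (a, b) = (scaleC c a, scaleC c b)" by (simp add: scaleC_prod_def)

lemma closed_densely_defined_alt:
  "closed_densely_defined T \<longleftrightarrow> csubspace T \<and> closed T \<and> (\<forall>y. (0, y) \<in> T \<longrightarrow> y = 0) \<and> closure (Domain T) = UNIV"
proof
  assume T: "closed_densely_defined T"
  then have z: "(0, 0) \<in> T" and sv: "single_valued T" by (simp_all add: closed_densely_defined_def)
  have "csubspace T" using T unfolding closed_densely_defined_def csubspace_def
    by (auto simp: scaleC_Pair zero_prod_def)
  moreover have "y = 0" if "(0, y) \<in> T" for y using single_valuedD[OF sv that z] .
  ultimately show "csubspace T \<and> closed T \<and> (\<forall>y. (0, y) \<in> T \<longrightarrow> y = 0) \<and> closure (Domain T) = UNIV"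
    using T unfolding closed_densely_defined_def by simp
next
  assume T: "csubspace T \<and> closed T \<and> (\<forall>y. (0, y) \<in> T \<longrightarrow> y = 0) \<and> closure (Domain T) = UNIV"
  then have cs: "csubspace T" and z: "\<And>y. (0, y) \<in> T \<Longrightarrow> y = 0" by blast+
  have "single_valued T"
  proof (rule single_valuedI)
    fix x y z assume "(x, y) \<in> T" "(x, z) \<in> T"
    then have "(x, y) - (x, z) \<in> T" by (rule csubspaceD(6)[OF cs])
    then have "(0, y - z) \<in> T" by simp
    then have "y - z = 0" by (rule z)
    then show "y = z" by simp
  qed
  moreover have "(0, 0) \<in> T" using csubspaceD(1)[OF cs] by (simp add: zero_prod_def)
  moreover have "(x + x', y + y') \<in> T" if "(x, y) \<in> T" "(x', y') \<in> T" for x y x' y'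
    using csubspaceD(2)[OF cs that] by simp
  moreover have "(scaleC c x, scaleC c y) \<in> T" if "(x, y) \<in> T" for c x y
    using csubspaceD(3)[OF cs that, of c] by (simp add: scaleC_Pair)
  ultimately show "closed_densely_defined T" unfolding closed_densely_defined_def using T by blast
qed

section \<open>Affiliated operators as fractions\<close>

context l2_representation
begin

definition U :: "('l \<times> 'l) set set" where "U = {u. affiliated (lam ` A) u}"

text \<open>Expresses \<open>u = s^-1 a\<close> without an unbounded inverse, as containment of
  \<open>u\<close> in the graph of \<open>s^-1 a\<close>. Since the domain of \<open>u\<close> is
  dense, this still determines \<open>a\<close>.\<close>

definition den :: "('l \<times> 'l) set \<Rightarrow> ('h \<Rightarrow>\<^sub>L 'h) \<Rightarrow> ('h \<Rightarrow>\<^sub>L 'h) \<Rightarrow> bool" where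
  "den u s a \<longleftrightarrow> s \<in> nzd \<and> a \<in> A \<and> (\<forall>x y. (x, y) \<in> u \<longrightarrow> lam s y = lam a x)"

lemma affiliatedD:
  assumes "u \<in> U"
  shows "csubspace u" "closed u" "(0, y) \<in> u \<Longrightarrow> y = 0" "closure (Domain u) = UNIV"
    "S \<in> commutant (lam ` A) \<Longrightarrow> (x, y) \<in> u \<Longrightarrow> (S x, S y) \<in> u"
proof -
  note * = assms[unfolded U_def affiliated_def closed_densely_defined_alt mem_Collect_eq]
  note u = conjunct1[OF *] conjunct2[OF *]
  show "csubspace u" by (rule u(1)[THEN conjunct1])
  show "closed u" by (rule u(1)[THEN conjunct2, THEN conjunct1])
  show "closure (Domain u) = UNIV" by (rule u(1)[THEN conjunct2, THEN conjunct2, THEN conjunct2])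
  show "(0, y) \<in> u \<Longrightarrow> y = 0" by (rule u(1)[THEN conjunct2, THEN conjunct2, THEN conjunct1, THEN spec, THEN mp])
  show "S \<in> commutant (lam ` A) \<Longrightarrow> (x, y) \<in> u \<Longrightarrow> (S x, S y) \<in> u"
    by (rule u(2)[THEN bspec, THEN spec, THEN spec, THEN mp])
qed

lemma denD: "den u s a \<Longrightarrow> (x, y) \<in> u \<Longrightarrow> lam s y = lam a x" by (simp add: den_def)

text \<open>Two kinds of denominators are produced: \<open>s\<close> on the left describes the
  values of \<open>u\<close>, and \<open>r\<close> on the right describes part of its domain. Both
  come from the matrix entries of the projection onto the graph: \<open>p11\<close> is
  \<open>(1 + adj u u)^-1\<close>, \<open>p21\<close> is \<open>u p11\<close>, and
  \<open>v = 1 - p22\<close> is \<open>(1 + u adj u)^-1\<close>; on the graph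
  \<open>v y = p21 x\<close>.\<close>

lemma affiliated_fractions:
  assumes u: "u \<in> U"
  obtains s a r where "den u s a" "r \<in> nzd" "\<And>x. lam r x \<in> Domain u"
proof -
  note uD = affiliatedD[OF u]
  obtain P where P: "clinear_op P" "\<And>z. blinfun_apply P z \<in> u"
    and po: "\<And>z v. v \<in> u \<Longrightarrow> cinner (z - blinfun_apply P z) v = 0"
    and pid: "\<And>v. v \<in> u \<Longrightarrow> blinfun_apply P v = v"
    and sym: "\<And>z w. cinner (blinfun_apply P z) w = cinner z (blinfun_apply P w)"
    by (rule projection_exists[OF uD(1,2)]) (rule that)
  have P0: "P t = 0" if "\<And>v. v \<in> u \<Longrightarrow> cinner t v = 0" for t
  proof -
    have "cinner (P t) (P t) = cinner t (P (P t))" by (rule sym)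
    also have "\<dots> = 0" by (rule that) (rule P)
    finally show ?thesis by simp
  qed
  \<comment> \<open>A commutant element acts diagonally on the product. It preserves the graph, and
    so does its adjoint, hence it also preserves the orthogonal complement of the graph.\<close>
  have comm: "P (S x, S y) = (S (fst (P (x, y))), S (snd (P (x, y))))" if S: "S \<in> commutant (lam ` A)" for S x y
  proof -
    define w where "w = P (x, y)"
    have cS: "clinear_op S" using S by (simp add: commutant_def)
    have wu: "(fst w, snd w) \<in> u" using P(2) by (simp add: w_def)
    have Sw: "(S (fst w), S (snd w)) \<in> u" by (rule uD(5)[OF S wu])
    have "P ((S x, S y) - (S (fst w), S (snd w))) = 0"
    proof (rule P0)
      fix v assume v: "v \<in> u"
      have v': "(adj S (fst v), adj S (snd v)) \<in> u"
        by (rule uD(5)[OF lam_commutant_adj[OF S]]) (simp add: v)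
      have "cinner ((S x, S y) - (S (fst w), S (snd w))) v
        = cinner (x - fst w) (adj S (fst v)) + cinner (y - snd w) (adj S (snd v))"
        by (cases v) (simp add: cinner_Pair cinner_adj[OF cS, symmetric] blinfun_simps)
      also have "\<dots> = cinner ((x, y) - w) (adj S (fst v), adj S (snd v))"
        by (cases w) (simp add: cinner_Pair)
      also have "\<dots> = 0" unfolding w_def by (rule po[OF v'])
      finally show "cinner ((S x, S y) - (S (fst w), S (snd w))) v = 0" .
    qed
    then have "P (S x, S y) = P (S (fst w), S (snd w))" by (simp only: blinfun.diff_right right_minus_eq)
    also have "\<dots> = (S (fst w), S (snd w))" by (rule pid[OF Sw])
    finally show ?thesis by (simp add: w_def)
  qed
  have nP: "norm (fst (P z)) \<le> norm P * norm z" "norm (snd (P z)) \<le> norm P * norm z" for z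
    using norm_fst_le[of "fst (P z)" "snd (P z)"] norm_snd_le[of "snd (P z)" "fst (P z)"]
      norm_blinfun[of P z] by simp_all
  have Padd: "P (x + x', y + y') = P (x, y) + P (x', y')" for x x' y y'
    by (simp only: add_Pair[symmetric] blinfun.add_right)
  have Psc: "P (scaleC c x, scaleC c y) = scaleC c (P (x, y))" for c x y
    by (simp only: scaleC_Pair[symmetric] clinear_opD[OF P(1)])
  obtain p11 where p11: "clinear_op p11" "\<And>x. blinfun_apply p11 x = fst (P (x, 0))"
  proof (rule clinear_opE[of "\<lambda>x. fst (P (x, 0))" "norm P"])
    show "fst (P (x + y, 0)) = fst (P (x, 0)) + fst (P (y, 0))" for x y using Padd[of x y 0 0] by simp
    show "fst (P (scaleC c x, 0)) = scaleC c (fst (P (x, 0)))" for c x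
      using Psc[of c x 0] by (simp add: scaleC_prod_def)
    show "norm (fst (P (x, 0))) \<le> norm P * norm x" for x using nP(1)[of "(x, 0)"] by (simp add: norm_Pair)
  qed (rule that)
  obtain p21 where p21: "clinear_op p21" "\<And>x. blinfun_apply p21 x = snd (P (x, 0))"
  proof (rule clinear_opE[of "\<lambda>x. snd (P (x, 0))" "norm P"])
    show "snd (P (x + y, 0)) = snd (P (x, 0)) + snd (P (y, 0))" for x y using Padd[of x y 0 0] by simp
    show "snd (P (scaleC c x, 0)) = scaleC c (snd (P (x, 0)))" for c x
      using Psc[of c x 0] by (simp add: scaleC_prod_def)
    show "norm (snd (P (x, 0))) \<le> norm P * norm x" for x using nP(2)[of "(x, 0)"] by (simp add: norm_Pair)
  qed (rule that)
  obtain p22 where p22: "clinear_op p22" "\<And>y. blinfun_apply p22 y = snd (P (0, y))"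
  proof (rule clinear_opE[of "\<lambda>x. snd (P (0, x))" "norm P"])
    show "snd (P (0, x + y)) = snd (P (0, x)) + snd (P (0, y))" for x y using Padd[of 0 0 x y] by simp
    show "snd (P (0, scaleC c x)) = scaleC c (snd (P (0, x)))" for c x
      using Psc[of c 0 x] by (simp add: scaleC_prod_def)
    show "norm (snd (P (0, x))) \<le> norm P * norm x" for x using nP(2)[of "(0, x)"] by (simp add: norm_Pair)
  qed (rule that)
  define v where "v = id_blinfun - p22"
  have cv: "clinear_op v" using p22 by (simp add: v_def)
  have bc: "p11 (S x) = S (p11 x)" "p21 (S x) = S (p21 x)" "v (S x) = S (v x)"
    if S: "S \<in> commutant (lam ` A)" for S x
    using comm[OF S, of x 0] comm[OF S, of 0 x] by (simp_all add: p11 p21 p22 v_def blinfun_simps)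
  have bca: "adj T (S x) = S (adj T x)"
    if T: "clinear_op T" "\<And>S x. S \<in> commutant (lam ` A) \<Longrightarrow> T (S x) = S (T x)" and S: "S \<in> commutant (lam ` A)"
    for T :: "'l \<Rightarrow>\<^sub>L 'l" and S x
  proof -
    have cS: "clinear_op S" using S by (simp add: commutant_def)
    have "T o\<^sub>L adj S = adj S o\<^sub>L T" by (rule blinfun_eqI) (simp add: T(2)[OF lam_commutant_adj[OF S]])
    then have "adj (T o\<^sub>L adj S) = adj (adj S o\<^sub>L T)" by simp
    then have "S o\<^sub>L adj T = adj T o\<^sub>L S" using T(1) cS by (simp add: adj_simps clinear_adj)
    then show ?thesis by (rule compose_eqD[symmetric])
  qed
  \<comment> \<open>If \<open>p11 x = 0\<close>, the projection of \<open>(x, 0)\<close> is a graph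
    point with first component 0, hence zero. Then \<open>x\<close> is orthogonal to the dense
    domain.\<close>
  have inj11: "x = 0" if x: "p11 x = 0" for x
  proof -
    have "P (x, 0) \<in> u" by (rule P)
    then have "(fst (P (x, 0)), snd (P (x, 0))) \<in> u" by simp
    then have "(0, p21 x) \<in> u" by (simp only: p11(2)[symmetric] p21(2)[symmetric] x)
    then have "p21 x = 0" by (rule uD(3))
    then have Pz: "P (x, 0) = 0" using x by (simp add: p11 p21 prod_eq_iff)
    have "cinner x y = 0" if y: "y \<in> Domain u" for y
    proof -
      obtain z where z: "(y, z) \<in> u" using y by blast
      from po[OF z, of "(x, 0)"] show ?thesis by (simp add: Pz cinner_Pair)
    qed
    then have "Domain u \<subseteq> {y. cinner x y = 0}" by blast
    moreover have "closed {y. cinner x y = 0}"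
      by (intro closed_Collect_eq continuous_on_const linear_continuous_on
          bounded_bilinear.bounded_linear_right[OF bounded_bilinear_cinner])
    ultimately have "closure (Domain u) \<subseteq> {y. cinner x y = 0}" by (rule closure_minimal)
    then have "cinner x x = 0" using uD(4) by blast
    then show ?thesis by simp
  qed
  \<comment> \<open>If \<open>v y = 0\<close>, the projection of \<open>(0, y)\<close> has second
    component \<open>y\<close>, and orthogonality forces its first component to vanish;
    single-valuedness then gives \<open>y = 0\<close>.\<close>
  have injv: "y = 0" if y: "v y = 0" for y
  proof -
    define w where "w = P (0, y)"
    have sw: "snd w = y" using y by (simp add: v_def p22 w_def blinfun_simps)
    have "cinner ((0, y) - w) w = 0" unfolding w_def by (rule po[OF P(2)])
    then have "cinner (fst w) (fst w) = 0" by (cases w) (use sw in \<open>simp add: cinner_Pair\<close>)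
    then have "w = (0, y)" using sw by (simp add: prod_eq_iff)
    then have "(0, y) \<in> u" using P(2)[of "(0, y)"] by (simp only: w_def)
    then show "y = 0" by (rule uD(3))
  qed
  obtain g c where gc: "g \<in> nzd" "c \<in> A" "p11 o\<^sub>L lam g = lam c"
    by (rule bicommutant_fraction[OF bc(1)]) (assumption, rule that)
  have cN: "c \<in> nzd"
  proof (rule lam_nzdI[OF gc(2)])
    fix x assume "lam c x = 0"
    then have "p11 (lam g x) = 0" by (simp only: compose_eqD1[OF gc(3)])
    then have "lam g x = 0" by (rule inj11)
    then show "x = 0" by (rule lam_injective[OF gc(1)])
  qed
  have dom: "lam c x \<in> Domain u" for x
  proof -
    have "(fst (P (lam g x, 0)), snd (P (lam g x, 0))) \<in> u" using P(2) by simp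
    then have "(lam c x, snd (P (lam g x, 0))) \<in> u"
      by (simp only: p11(2)[symmetric] compose_eqD1[OF gc(3)])
    then show ?thesis by (rule DomainI)
  qed
  \<comment> \<open>\<open>bicommutant_fraction\<close> yields denominators on the right. Applying
    it to the adjoints of \<open>v\<close> and \<open>p21\<close> and taking adjoints again moves
    them to the left, where they are made equal.\<close>
  obtain g1 c1 where g1: "g1 \<in> nzd" "c1 \<in> A" "adj v o\<^sub>L lam g1 = lam c1"
    by (rule bicommutant_fraction[OF bca[OF cv bc(3)]]) (assumption, assumption, rule that)
  obtain g2 c2 where g2: "g2 \<in> nzd" "c2 \<in> A" "adj p21 o\<^sub>L lam g2 = lam c2"
    by (rule bicommutant_fraction[OF bca[OF p21(1) bc(2)]]) (assumption, assumption, rule that)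
  have "adj (adj v o\<^sub>L lam g1) = lam (adj g1) o\<^sub>L v"
    using g1(1) cv by (simp add: adj_simps clinear_adj lam_adj lam_clinear)
  then have v1: "lam (adj g1) o\<^sub>L v = lam (adj c1)" using g1(2) by (simp only: g1(3) lam_adj)
  have "adj (adj p21 o\<^sub>L lam g2) = lam (adj g2) o\<^sub>L p21"
    using g2(1) p21(1) by (simp add: adj_simps clinear_adj lam_adj lam_clinear)
  then have v2: "lam (adj g2) o\<^sub>L p21 = lam (adj c2)" using g2(2) by (simp only: g2(3) lam_adj)
  obtain x1 x2 where x: "x1 \<in> A" "x2 \<in> A" "x1 o\<^sub>L adj g1 = x2 o\<^sub>L adj g2" "x1 o\<^sub>L adj g1 \<in> nzd"
    by (rule common_left_multiple[OF adj_nzd[OF g1(1)] adj_nzd[OF g2(1)]]) (rule that)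
  have e1: "lam (x1 o\<^sub>L adj c1) y = lam (x1 o\<^sub>L adj g1) (v y)" for y
    using x(1,2) g1(1,2) by (simp add: lam_mult compose_eqD1[OF v1])
  have e2: "lam (x2 o\<^sub>L adj c2) y = lam (x2 o\<^sub>L adj g2) (p21 y)" for y
    using x(1,2) g2(1,2) by (simp add: lam_mult compose_eqD1[OF v2])
  have "x1 o\<^sub>L adj c1 \<in> nzd"
  proof (rule lam_nzdI)
    fix y assume "lam (x1 o\<^sub>L adj c1) y = 0"
    then have "v y = 0" unfolding e1 by (rule lam_injective[OF x(4)])
    then show "y = 0" by (rule injv)
  qed (use x g1 in simp)
  moreover have "lam (x1 o\<^sub>L adj c1) y = lam (x2 o\<^sub>L adj c2) x" if xy: "(x, y) \<in> u" for x y
  proof -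
    have "P (x, y) = P (x, 0) + P (0, y)" using Padd[of x 0 0 y] by simp
    then have "(x, y) = P (x, 0) + P (0, y)" using pid[OF xy] by simp
    then have "y = p21 x + p22 y" by (simp add: p21 p22 prod_eq_iff)
    then have "v y = p21 x" by (simp add: v_def blinfun_simps algebra_simps)
    then show ?thesis unfolding e1 e2 using x(3) by simp
  qed
  ultimately have "den u (x1 o\<^sub>L adj c1) (x2 o\<^sub>L adj c2)" using x g2 by (simp add: den_def)
  with cN dom show thesis by (intro that)
qed

lemma den_unique:
  assumes "u \<in> U" "den u s a" "den u s a'" shows "a = a'"
proof -
  have "lam a = lam a'"
  proof (rule blinfun_eq_dense[OF affiliatedD(4)[OF assms(1)]])
    show "lam a x = lam a' x" if "x \<in> Domain u" for x
    proof -
      obtain y where y: "(x, y) \<in> u" using \<open>x \<in> Domain u\<close> by blast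
      show ?thesis using denD[OF assms(2) y] denD[OF assms(3) y] by simp
    qed
  qed
  then show ?thesis using lam_inj assms(2,3) by (simp add: den_def)
qed

lemma den_mult:
  assumes "den u s a" "r \<in> A" "r o\<^sub>L s \<in> nzd" shows "den u (r o\<^sub>L s) (r o\<^sub>L a)"
  using assms unfolding den_def by (simp add: lam_mult)

lemma common_den:
  assumes "den u s a" "den v s' b"
  obtains r c d where "den u r c" "den v r d"
proof -
  have N: "s \<in> nzd" "s' \<in> nzd" using assms by (simp_all add: den_def)
  obtain x y where xy: "x \<in> A" "y \<in> A" "x o\<^sub>L s = y o\<^sub>L s'" "x o\<^sub>L s \<in> nzd"
    by (rule common_left_multiple[OF N]) (rule that)
  show thesis by (rule that[OF den_mult[OF assms(1) xy(1,4)]]) (use den_mult[OF assms(2) xy(2)] xy in simp)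
qed

text \<open>The criterion by which sums, products and inverses become affiliated: a left denominator
  makes \<open>W\<close> closable, and a regular \<open>t\<close> with range inside the domain makes
  it densely defined.\<close>

lemma affiliated_closure:
  assumes W: "csubspace W" and inv: "\<And>S x y. S \<in> commutant (lam ` A) \<Longrightarrow> (x, y) \<in> W \<Longrightarrow> (S x, S y) \<in> W"
    and den: "den W s a" and t: "t \<in> nzd" "\<And>x. lam t x \<in> Domain W"
  shows "closure W \<in> U" "den (closure W) s a"
proof -
  have s: "s \<in> nzd" "a \<in> A" using den by (simp_all add: den_def)
  have "closed {z. lam s (snd z) = lam a (fst z)}"
    by (intro closed_Collect_eq linear_continuous_on bounded_linear_compose[OF blinfun.bounded_linear_right]
        bounded_linear_fst bounded_linear_snd)
  moreover have "W \<subseteq> {z. lam s (snd z) = lam a (fst z)}" using den unfolding den_def by auto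
  ultimately have "closure W \<subseteq> {z. lam s (snd z) = lam a (fst z)}" by (intro closure_minimal)
  then show dc: "den (closure W) s a" using s unfolding den_def by auto
  have "csubspace (closure W)" by (rule csubspace_closure[OF W])
  moreover have "y = 0" if "(0, y) \<in> closure W" for y
  proof -
    have "lam s y = lam a 0" by (rule denD[OF dc that])
    then have "lam s y = 0" by (simp add: blinfun_simps)
    then show ?thesis by (rule lam_injective[OF s(1)])
  qed
  moreover have "closure (Domain (closure W)) = UNIV"
  proof -
    have "range (blinfun_apply (lam t)) \<subseteq> Domain W" using t(2) by blast
    also have "\<dots> \<subseteq> Domain (closure W)" by (rule Domain_mono[OF closure_subset])
    finally have "closure (range (blinfun_apply (lam t))) \<subseteq> closure (Domain (closure W))" by (rule closure_mono)
    moreover have "closure (range (blinfun_apply (lam t))) = UNIV"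
    proof (rule dense_range)
      fix y assume "adj (lam t) y = 0"
      then have "lam (adj t) y = 0" using t(1) by (simp add: lam_adj)
      then show "y = 0" by (rule lam_injective[OF adj_nzd[OF t(1)]])
    qed (use t lam_clinear in simp)
    ultimately show ?thesis by blast
  qed
  moreover have "(S x, S y) \<in> closure W" if S: "S \<in> commutant (lam ` A)" and xy: "(x, y) \<in> closure W" for S x y
  proof -
    obtain z where z: "\<And>n. z n \<in> W" "z \<longlonglongrightarrow> (x, y)" using xy unfolding closure_sequential by blast
    have "(S (fst (z n)), S (snd (z n))) \<in> W" for n by (rule inv[OF S]) (simp add: z)
    moreover have "(\<lambda>n. (S (fst (z n)), S (snd (z n)))) \<longlonglongrightarrow> (S x, S y)"
      using tendsto_fst[OF z(2)] tendsto_snd[OF z(2)] by (intro tendsto_Pair blinfun.tendsto tendsto_const) simp_all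
    ultimately show ?thesis unfolding closure_sequential by (intro exI[of _ "\<lambda>n. (S (fst (z n)), S (snd (z n)))"] conjI allI)
  qed
  ultimately show "closure W \<in> U"
    unfolding U_def affiliated_def closed_densely_defined_alt by (simp add: mem_Collect_eq)
qed

section \<open>Sums, right multiples and inverses in the algebra of affiliated operators\<close>

definition U_add :: "('l \<times> 'l) set \<Rightarrow> ('l \<times> 'l) set \<Rightarrow> ('l \<times> 'l) set" where
  "U_add S T = closure {(x, y + z) | x y z. (x, y) \<in> S \<and> (x, z) \<in> T}"

definition U_act :: "('h \<Rightarrow>\<^sub>L 'h) \<Rightarrow> ('l \<times> 'l) set \<Rightarrow> ('l \<times> 'l) set" where
  "U_act a u = closure (op_graph (lam a) O u)"

definition U_one :: "('l \<times> 'l) set" where "U_one = op_graph id_blinfun"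

lemma U_add_closed:
  assumes u: "u \<in> U" and v: "v \<in> U"
  shows "U_add u v \<in> U" and U_add_den: "den u s a \<Longrightarrow> den v s b \<Longrightarrow> den (U_add u v) s (a + b)"
proof -
  define W where "W = {(x, y + z) | x y z. (x, y) \<in> u \<and> (x, z) \<in> v}"
  note uD = affiliatedD[OF u] and vD = affiliatedD[OF v]
  have WI: "(x, y + z) \<in> W" if "(x, y) \<in> u" "(x, z) \<in> v" for x y z using that by (auto simp: W_def)
  have WE: "\<exists>y z. w = (fst w, y + z) \<and> (fst w, y) \<in> u \<and> (fst w, z) \<in> v" if "w \<in> W" for w
    using that unfolding W_def by fastforce
  have W: "csubspace W" unfolding csubspace_def
  proof (intro conjI ballI allI)
    show "0 \<in> W" using WI[of 0 0 0] csubspaceD(1)[OF uD(1)] csubspaceD(1)[OF vD(1)] by (simp add: zero_prod_def)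
    fix w assume "w \<in> W"
    from WE[OF this] obtain y z where w: "w = (fst w, y + z)" "(fst w, y) \<in> u" "(fst w, z) \<in> v" by blast
    have "(scaleC c (fst w), scaleC c y + scaleC c z) \<in> W" for c
      using csubspaceD(3)[OF uD(1) w(2), of c] csubspaceD(3)[OF vD(1) w(3), of c]
      by (intro WI) (simp_all add: scaleC_Pair)
    then show "scaleC c w \<in> W" for c by (subst w(1)) (simp add: scaleC_Pair scaleC_add_right)
    fix w' assume "w' \<in> W"
    from WE[OF this] obtain y' z' where w': "w' = (fst w', y' + z')" "(fst w', y') \<in> u" "(fst w', z') \<in> v" by blast
    have "(fst w + fst w', (y + y') + (z + z')) \<in> W"
      using csubspaceD(2)[OF uD(1) w(2) w'(2)] csubspaceD(2)[OF vD(1) w(3) w'(3)] by (intro WI) simp_all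
    moreover have "(fst w + fst w', (y + y') + (z + z')) = (fst w, y + z) + (fst w', y' + z')" by (simp add: algebra_simps)
    ultimately show "w + w' \<in> W" by (simp only: w(1)[symmetric] w'(1)[symmetric])
  qed
  have inv: "(S x, S y) \<in> W" if S: "S \<in> commutant (lam ` A)" and xy: "(x, y) \<in> W" for S x y
  proof -
    from WE[OF xy] obtain p q where pq: "y = p + q" "(x, p) \<in> u" "(x, q) \<in> v" by auto
    show ?thesis unfolding pq(1) blinfun.add_right by (intro WI uD(5)[OF S] vD(5)[OF S] pq)
  qed
  have denW: "den W s (a + b)" if d: "den u s a" "den v s b" for s a b
  proof -
    have "lam s y = lam (a + b) x" if xy: "(x, y) \<in> W" for x y
    proof -
      from WE[OF xy] obtain p q where pq: "y = p + q" "(x, p) \<in> u" "(x, q) \<in> v" by auto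
      then have "lam s p = lam a x" "lam s q = lam b x" using denD[OF d(1)] denD[OF d(2)] by blast+
      then show ?thesis using d unfolding den_def by (simp add: pq(1) lam_add blinfun_simps)
    qed
    then show ?thesis using d unfolding den_def by simp
  qed
  obtain s1 a1 r1 where 1: "den u s1 a1" "r1 \<in> nzd" "\<And>x. lam r1 x \<in> Domain u" by (rule affiliated_fractions[OF u]) (rule that)
  obtain s2 a2 r2 where 2: "den v s2 a2" "r2 \<in> nzd" "\<And>x. lam r2 x \<in> Domain v" by (rule affiliated_fractions[OF v]) (rule that)
  \<comment> \<open>The common right multiple of \<open>r1\<close> and \<open>r2\<close> has its
    range in both domains, so the sum of the two operators is densely defined.\<close>
  obtain t c where tc: "t \<in> nzd" "c \<in> A" "r1 o\<^sub>L t = r2 o\<^sub>L c" by (rule right_Ore[OF nzd_mem[OF 1(2)] 2(2)]) (rule that)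
  have N: "r1 o\<^sub>L t \<in> nzd" by (rule nzd_mult[OF 1(2) tc(1)])
  have dom: "lam (r1 o\<^sub>L t) x \<in> Domain W" for x
  proof -
    have "lam (r1 o\<^sub>L t) x \<in> Domain u" using 1 tc(1) by (simp add: lam_mult)
    moreover have "lam (r1 o\<^sub>L t) x \<in> Domain v" unfolding tc(3) using 2 tc by (simp add: lam_mult)
    ultimately show ?thesis by (elim DomainE) (rule DomainI, erule WI)
  qed
  obtain s a b where sab: "den u s a" "den v s b" by (rule common_den[OF 1(1) 2(1)]) (rule that)
  have e: "U_add u v = closure W" by (simp add: U_add_def W_def)
  show "U_add u v \<in> U" unfolding e by (rule affiliated_closure(1)[OF W inv denW[OF sab] N dom])
  show "den (U_add u v) s (a + b)" if d: "den u s a" "den v s b" for s a b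
    unfolding e by (rule affiliated_closure(2)[OF W inv denW[OF d] N dom])
qed

lemma U_act_closed:
  assumes u: "u \<in> U" and a': "a' \<in> A"
  shows "U_act a' u \<in> U" and U_act_den: "den u s a \<Longrightarrow> den (U_act a' u) s (a o\<^sub>L a')"
proof -
  define W where "W = op_graph (lam a') O u"
  note uD = affiliatedD[OF u]
  have Wiff: "(x, y) \<in> W \<longleftrightarrow> (lam a' x, y) \<in> u" for x y by (auto simp: W_def op_graph_def)
  have W: "csubspace W" unfolding csubspace_def
  proof (intro conjI ballI allI)
    show "0 \<in> W" using csubspaceD(1)[OF uD(1)] by (simp add: zero_prod_def Wiff blinfun_simps)
    fix w assume w: "w \<in> W"
    obtain x y where xy: "w = (x, y)" by (cases w)
    show "scaleC c w \<in> W" for c using csubspaceD(3)[OF uD(1), of "(lam a' x, y)" c] w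
      by (simp add: xy scaleC_Pair Wiff clinear_opD[OF lam_clinear[OF a']])
    fix w' assume w': "w' \<in> W"
    obtain x' y' where xy': "w' = (x', y')" by (cases w')
    show "w + w' \<in> W" using csubspaceD(2)[OF uD(1), of "(lam a' x, y)" "(lam a' x', y')"] w w'
      by (simp add: xy xy' Wiff blinfun_simps)
  qed
  have inv: "(S x, S y) \<in> W" if S: "S \<in> commutant (lam ` A)" and xy: "(x, y) \<in> W" for S x y
    using uD(5)[OF S] xy lam_commutant_apply[OF S a', of x, symmetric] by (simp add: Wiff)
  have denW: "den W s (a o\<^sub>L a')" if d: "den u s a" for s a
    using d a' unfolding den_def by (simp add: Wiff lam_mult)
  obtain s a r where 1: "den u s a" "r \<in> nzd" "\<And>x. lam r x \<in> Domain u" by (rule affiliated_fractions[OF u]) (rule that)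
  \<comment> \<open>\<open>a'\<close> maps the range of \<open>t\<close> into the range of
    \<open>r\<close>, hence into the domain of \<open>u\<close>.\<close>
  obtain t c where tc: "t \<in> nzd" "c \<in> A" "a' o\<^sub>L t = r o\<^sub>L c" by (rule right_Ore[OF a' 1(2)]) (rule that)
  have dom: "lam t x \<in> Domain W" for x
  proof -
    have "lam a' (lam t x) = lam r (lam c x)"
      using arg_cong[OF tc(3), of "\<lambda>T. lam T x"] a' tc(1,2) 1(2) by (simp add: lam_mult)
    then have "lam a' (lam t x) \<in> Domain u" using 1(3) by simp
    then obtain y where "(lam a' (lam t x), y) \<in> u" by blast
    then have "(lam t x, y) \<in> W" by (simp add: Wiff)
    then show ?thesis by blast
  qed
  have e: "U_act a' u = closure W" by (simp add: U_act_def W_def)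
  show "U_act a' u \<in> U" unfolding e by (rule affiliated_closure(1)[OF W inv denW[OF 1(1)] tc(1) dom])
  show "den (U_act a' u) s (a o\<^sub>L a')" if d: "den u s a" for s a
    unfolding e by (rule affiliated_closure(2)[OF W inv denW[OF d] tc(1) dom])
qed

lemma U_one_den: "s \<in> nzd \<Longrightarrow> den U_one s s" by (auto simp: den_def U_one_def op_graph_def)

lemma closed_id_graph: "closed (op_graph (id_blinfun :: 'l \<Rightarrow>\<^sub>L 'l))"
proof -
  have "op_graph (id_blinfun :: 'l \<Rightarrow>\<^sub>L 'l) = {z. fst z = snd z}" by (auto simp: op_graph_def)
  then show ?thesis by (simp add: closed_Collect_eq continuous_on_fst continuous_on_snd)
qed

lemma U_one_closed: "U_one \<in> U"
proof -
  have W: "csubspace U_one" unfolding U_one_def csubspace_def op_graph_def by (auto simp: zero_prod_def scaleC_Pair)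
  have "closure U_one \<in> U"
    by (rule affiliated_closure(1)[OF W _ U_one_den[OF nzd_id] nzd_id]) (auto simp: U_one_def op_graph_def)
  then show ?thesis unfolding U_one_def by (simp add: closed_id_graph)
qed

text \<open>The flipped graph of \<open>lam s\<close>, after closure, inverts \<open>s\<close>
  inside \<open>U\<close>; this is what makes elements killed by \<open>s\<close> vanish in the
  tensor product with \<open>U\<close>.\<close>

lemma U_inverse:
  assumes s: "s \<in> nzd"
  obtains u where "u \<in> U" "U_act s u = U_one"
proof -
  define W where "W = {(lam s x, x) | x. True}"
  have sA: "s \<in> A" using s by simp
  have W: "csubspace W" unfolding csubspace_def
  proof (intro conjI ballI allI)
    show "0 \<in> W" by (auto simp: W_def zero_prod_def blinfun_simps)
    show "scaleC c w \<in> W" if "w \<in> W" for c w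
      using that by (auto simp: W_def scaleC_Pair clinear_opD[OF lam_clinear[OF sA]])
    show "w + w' \<in> W" if "w \<in> W" "w' \<in> W" for w w' using that by (auto simp: W_def blinfun_simps)
  qed
  have inv: "(S x, S y) \<in> W" if S: "S \<in> commutant (lam ` A)" and xy: "(x, y) \<in> W" for S x y
    using xy lam_commutant_apply[OF S sA] by (auto simp: W_def)
  have d: "den W s id_blinfun" using s by (auto simp: den_def W_def)
  have dom: "lam s x \<in> Domain W" for x by (auto simp: W_def)
  have cl: "closure W \<in> U" "den (closure W) s id_blinfun"
    by (rule affiliated_closure[OF W inv d s dom], assumption+)+
  have "op_graph (lam s) O closure W = op_graph id_blinfun"
  proof (intro equalityI subsetI)
    fix z assume "z \<in> op_graph (lam s) O closure W"
    then obtain x y where z: "z = (x, y)" "(lam s x, y) \<in> closure W" by (auto simp: op_graph_def)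
    then have "lam s y = lam id_blinfun (lam s x)" using denD[OF cl(2)] by blast
    then have "lam s (y - x) = 0" by (simp add: blinfun_simps)
    then have "y - x = 0" by (rule lam_injective[OF s])
    then show "z \<in> op_graph id_blinfun" by (simp add: z op_graph_def)
  next
    fix z :: "'l \<times> 'l" assume "z \<in> op_graph id_blinfun"
    then obtain x where z: "z = (x, x)" by (auto simp: op_graph_def)
    have "(lam s x, x) \<in> closure W" using closure_subset[of W] by (auto simp: W_def)
    then show "z \<in> op_graph (lam s) O closure W" unfolding z op_graph_def by blast
  qed
  then have "U_act s (closure W) = U_one" unfolding U_act_def U_one_def by (simp add: closed_id_graph)
  with cl(1) show thesis by (rule that)
qed

end

section \<open>Left modules\<close>

locale lmodule = R?: ring R + M?: abelian_group M
  for R :: "('a, 'r) ring_scheme" and M :: "('a, 'b, 'm) module_scheme" (structure) +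
  assumes smult_closed [simp]: "a \<in> carrier R \<Longrightarrow> x \<in> carrier M \<Longrightarrow> a \<odot> x \<in> carrier M"
    and smult_l_distr: "a \<in> carrier R \<Longrightarrow> b \<in> carrier R \<Longrightarrow> x \<in> carrier M \<Longrightarrow>
      (a \<oplus>\<^bsub>R\<^esub> b) \<odot> x = a \<odot> x \<oplus> b \<odot> x"
    and smult_r_distr: "a \<in> carrier R \<Longrightarrow> x \<in> carrier M \<Longrightarrow> y \<in> carrier M \<Longrightarrow>
      a \<odot> (x \<oplus> y) = a \<odot> x \<oplus> a \<odot> y"
    and smult_assoc1: "a \<in> carrier R \<Longrightarrow> b \<in> carrier R \<Longrightarrow> x \<in> carrier M \<Longrightarrow>
      (a \<otimes>\<^bsub>R\<^esub> b) \<odot> x = a \<odot> (b \<odot> x)"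
    and smult_one [simp]: "x \<in> carrier M \<Longrightarrow> \<one>\<^bsub>R\<^esub> \<odot> x = x"

lemma left_module_iff: "left_module R M \<longleftrightarrow> lmodule R M"
proof
  assume "left_module R M"
  then show "lmodule R M" unfolding left_module_def lmodule_def lmodule_axioms_def by simp
next
  assume "lmodule R M"
  then interpret lmodule R M .
  show "left_module R M" unfolding left_module_def
    by (simp add: R.ring_axioms M.abelian_group_axioms smult_l_distr smult_r_distr smult_assoc1)
qed

context lmodule
begin

lemma diff_zero [simp]: "x \<in> carrier M \<Longrightarrow> x \<ominus> \<zero> = x" using M.add.inv_one by (simp add: M.minus_eq a_inv_def)

lemma diff_self [simp]: "x \<in> carrier M \<Longrightarrow> x \<ominus> x = \<zero>" by (simp add: M.minus_eq M.r_neg)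

lemma diff_eq_zero_iff:
  assumes "x \<in> carrier M" "y \<in> carrier M" shows "x \<ominus> y = \<zero> \<longleftrightarrow> x = y"
proof
  assume "x \<ominus> y = \<zero>"
  then have "(x \<ominus> y) \<oplus> y = y" using assms by simp
  then show "x = y" using assms by (simp add: M.minus_eq M.a_assoc M.l_neg)
qed (use assms in simp)

lemma smult_l_null [simp]:
  assumes "x \<in> carrier M" shows "\<zero>\<^bsub>R\<^esub> \<odot> x = \<zero>"
proof -
  have "\<zero>\<^bsub>R\<^esub> \<odot> x \<oplus> \<zero>\<^bsub>R\<^esub> \<odot> x = \<zero>\<^bsub>R\<^esub> \<odot> x" using assms smult_l_distr[of "\<zero>\<^bsub>R\<^esub>" "\<zero>\<^bsub>R\<^esub>" x] by simp
  then show ?thesis using assms by (metis M.add.r_cancel_one' R.zero_closed smult_closed)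
qed

lemma smult_r_null [simp]:
  assumes "a \<in> carrier R" shows "a \<odot> \<zero> = \<zero>"
proof -
  have "a \<odot> \<zero> \<oplus> a \<odot> \<zero> = a \<odot> \<zero>" using assms smult_r_distr[of a "\<zero>" "\<zero>"] by simp
  then show ?thesis using assms by (metis M.add.r_cancel_one' M.zero_closed smult_closed)
qed

lemma smult_r_minus:
  assumes "a \<in> carrier R" "x \<in> carrier M" shows "a \<odot> (\<ominus> x) = \<ominus> (a \<odot> x)"
proof -
  have "a \<odot> (\<ominus> x) \<oplus> a \<odot> x = \<zero>" using assms smult_r_distr[of a "\<ominus> x" x] by (simp add: M.l_neg)
  then show ?thesis using assms by (simp add: M.minus_equality)
qed

lemma smult_diff:
  assumes "a \<in> carrier R" "x \<in> carrier M" "y \<in> carrier M"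
  shows "a \<odot> (x \<ominus> y) = a \<odot> x \<ominus> a \<odot> y" using assms by (simp add: M.minus_eq smult_r_distr smult_r_minus)

lemma smult_minus_one:
  assumes "x \<in> carrier M" shows "(\<ominus>\<^bsub>R\<^esub> \<one>\<^bsub>R\<^esub>) \<odot> x = \<ominus> x"
proof -
  have "(\<ominus>\<^bsub>R\<^esub> \<one>\<^bsub>R\<^esub>) \<odot> x \<oplus> x = \<zero>" using assms smult_l_distr[of "\<ominus>\<^bsub>R\<^esub> \<one>\<^bsub>R\<^esub>" "\<one>\<^bsub>R\<^esub>" x] by (simp add: R.l_neg)
  then show ?thesis using assms by (simp add: M.minus_equality)
qed

lemma submoduleI:
  assumes "N \<subseteq> carrier M" "\<zero> \<in> N" "\<And>x y. x \<in> N \<Longrightarrow> y \<in> N \<Longrightarrow> x \<oplus> y \<in> N"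
    "\<And>a x. a \<in> carrier R \<Longrightarrow> x \<in> N \<Longrightarrow> a \<odot> x \<in> N"
  shows "submodule N R M"
proof -
  have "\<ominus> x \<in> N" if "x \<in> N" for x
    using assms(4)[of "\<ominus>\<^bsub>R\<^esub> \<one>\<^bsub>R\<^esub>" x] that assms(1) by (simp add: smult_minus_one subset_iff)
  then have "subgroup N (add_monoid M)"
    by (intro M.add.subgroupI) (use assms in \<open>auto simp: a_inv_def[symmetric]\<close>)
  then show ?thesis using assms(4) by (simp add: submodule_def submodule_axioms_def)
qed

lemma submoduleD:
  assumes "submodule N R M"
  shows "N \<subseteq> carrier M" "\<zero> \<in> N" "x \<in> N \<Longrightarrow> y \<in> N \<Longrightarrow> x \<oplus> y \<in> N"
    "a \<in> carrier R \<Longrightarrow> x \<in> N \<Longrightarrow> a \<odot> x \<in> N" "x \<in> N \<Longrightarrow> \<ominus> x \<in> N"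
    "x \<in> N \<Longrightarrow> y \<in> N \<Longrightarrow> x \<ominus> y \<in> N" "x \<in> N \<Longrightarrow> x \<in> carrier M"
    "abelian_subgroup N M"
proof -
  interpret N: submodule N R M by (rule assms)
  show 1: "N \<subseteq> carrier M" "\<zero> \<in> N" "\<And>x y. x \<in> N \<Longrightarrow> y \<in> N \<Longrightarrow> x \<oplus> y \<in> N"
    "a \<in> carrier R \<Longrightarrow> x \<in> N \<Longrightarrow> a \<odot> x \<in> N" "\<And>x. x \<in> N \<Longrightarrow> \<ominus> x \<in> N"
    using N.subset N.one_closed N.m_closed N.m_inv_closed N.smult_closed by (auto simp: a_inv_def)
  then show "x \<in> N \<Longrightarrow> y \<in> N \<Longrightarrow> x \<ominus> y \<in> N" "x \<in> N \<Longrightarrow> x \<in> carrier M" by (auto simp: M.minus_eq)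
  show "abelian_subgroup N M"
    by (intro abelian_subgroupI3 additive_subgroup.intro N.subgroup_axioms M.abelian_group_axioms)
qed

lemma submodule_carrier: "submodule (carrier M) R M" by (rule submoduleI) simp_all

lemma submodule_zero: "submodule {\<zero>} R M" by (rule submoduleI) simp_all

lemma restrict_lmodule:
  assumes "submodule N R M" shows "lmodule R (restrict_mod M N)"
proof -
  note N = submoduleD[OF assms]
  have "abelian_group (restrict_mod M N)"
  proof (rule abelian_groupI)
    show "\<exists>y\<in>carrier (restrict_mod M N). y \<oplus>\<^bsub>restrict_mod M N\<^esub> x = \<zero>\<^bsub>restrict_mod M N\<^esub>"
      if "x \<in> carrier (restrict_mod M N)" for x
      using that N(5)[of x] N(7)[of x] by (intro bexI[of _ "\<ominus> x"]) (simp_all add: restrict_mod_def M.l_neg)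
  qed (use N(2,3,7) in \<open>simp_all add: restrict_mod_def M.a_ac\<close>)
  moreover have "lmodule_axioms R (restrict_mod M N)" unfolding lmodule_axioms_def restrict_mod_def
    using N(4,7) by (simp add: smult_l_distr smult_r_distr smult_assoc1)
  ultimately show ?thesis by (simp add: lmodule_def R.ring_axioms)
qed

lemma restrict_simps [simp]:
  "carrier (restrict_mod M N) = N" "\<zero>\<^bsub>restrict_mod M N\<^esub> = \<zero>"
  "x \<oplus>\<^bsub>restrict_mod M N\<^esub> y = x \<oplus> y" "a \<odot>\<^bsub>restrict_mod M N\<^esub> x = a \<odot> x" by (simp_all add: restrict_mod_def)

lemma submodule_restrict_iff:
  assumes "submodule N R M"
  shows "submodule P R (restrict_mod M N) \<longleftrightarrow> submodule P R M \<and> P \<subseteq> N"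
proof -
  interpret N: lmodule R "restrict_mod M N" by (rule restrict_lmodule[OF assms])
  note ND = submoduleD[OF assms]
  show ?thesis
  proof
    assume P: "submodule P R (restrict_mod M N)"
    have "submodule P R M" by (rule submoduleI) (use N.submoduleD(1-4)[OF P] ND(1) in auto)
    then show "submodule P R M \<and> P \<subseteq> N" using N.submoduleD(1)[OF P] by simp
  next
    assume P: "submodule P R M \<and> P \<subseteq> N"
    show "submodule P R (restrict_mod M N)" by (rule N.submoduleI) (use submoduleD[of P] P in auto)
  qed
qed

subsection \<open>Quotients\<close>

lemma coset_eq_iff:
  assumes K: "submodule K R M" and xy: "x \<in> carrier M" "y \<in> carrier M"
  shows "K +> x = K +> y \<longleftrightarrow> x \<ominus> y \<in> K"
proof -
  interpret K: abelian_subgroup K M by (rule submoduleD(8)[OF K])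
  have "x \<in> K +> y \<longleftrightarrow> x \<ominus> y \<in> K" using K.a_rcos_module[OF xy(2,1)] by (simp add: M.minus_eq)
  moreover have "K +> x = K +> y \<longleftrightarrow> x \<in> K +> y"
  proof
    show "K +> x = K +> y \<Longrightarrow> x \<in> K +> y" using K.a_rcos_self[OF xy(1)] by simp
    show "x \<in> K +> y \<Longrightarrow> K +> x = K +> y" using M.a_repr_independence[OF _ xy(2) K.a_subgroup] by simp
  qed
  ultimately show ?thesis by simp
qed

lemma coset_mem_iff:
  assumes K: "submodule K R M" and xy: "x \<in> carrier M" "y \<in> carrier M"
  shows "y \<in> K +> x \<longleftrightarrow> y \<ominus> x \<in> K"
proof -
  interpret K: abelian_subgroup K M by (rule submoduleD(8)[OF K])
  show ?thesis using K.a_rcos_module[OF xy] by (simp add: M.minus_eq)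
qed

lemma coset_subset: "submodule K R M \<Longrightarrow> x \<in> carrier M \<Longrightarrow> K +> x \<subseteq> carrier M"
  using submoduleD(1)[of K] by (simp add: M.a_r_coset_subset_G)

lemma coset_self: "submodule K R M \<Longrightarrow> x \<in> carrier M \<Longrightarrow> x \<in> K +> x"
  using abelian_subgroup.a_rcos_self[OF submoduleD(8)] .

lemma quot_carrier: "carrier (quot_mod M K) = {K +> x | x. x \<in> carrier M}"
  by (auto simp: quot_mod_def A_RCOSETS_def' )

lemma quot_carrierI: "x \<in> carrier M \<Longrightarrow> K +> x \<in> carrier (quot_mod M K)" by (auto simp: quot_carrier)

lemma quot_zero: "\<zero>\<^bsub>quot_mod M K\<^esub> = K" by (simp add: quot_mod_def)

lemma quot_zero': "submodule K R M \<Longrightarrow> \<zero>\<^bsub>quot_mod M K\<^esub> = K +> \<zero>"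
  using submoduleD(1)[of K] by (simp add: quot_zero M.a_coset_add_zero)

lemma quot_add:
  assumes "submodule K R M" "x \<in> carrier M" "y \<in> carrier M"
  shows "(K +> x) \<oplus>\<^bsub>quot_mod M K\<^esub> (K +> y) = K +> (x \<oplus> y)"
  using abelian_subgroup.a_rcos_sum[OF submoduleD(8)[OF assms(1)] assms(2,3)] by (simp add: quot_mod_def)

lemma quot_smult:
  assumes K: "submodule K R M" and x: "x \<in> carrier M" and a: "a \<in> carrier R"
  shows "a \<odot>\<^bsub>quot_mod M K\<^esub> (K +> x) = K +> (a \<odot> x)"
proof -
  have "K +> (a \<odot> y) = K +> (a \<odot> x)" if y: "y \<in> K +> x" for y
  proof -
    have yc: "y \<in> carrier M" using coset_subset[OF K x] y by blast
    have "a \<odot> (y \<ominus> x) \<in> K" using coset_mem_iff[OF K x yc] y submoduleD(4)[OF K a] by blast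
    then show ?thesis using coset_eq_iff[OF K, of "a \<odot> y" "a \<odot> x"] a x yc by (simp add: smult_diff)
  qed
  then have "(\<Union>y\<in>K +> x. K +> (a \<odot> y)) = (\<Union>y\<in>K +> x. K +> (a \<odot> x))" by (rule SUP_cong[OF refl])
  then show ?thesis using coset_self[OF K x] unfolding quot_mod_def by auto
qed

lemma quot_lmodule:
  assumes K: "submodule K R M" shows "lmodule R (quot_mod M K)"
proof -
  have "abelian_group (quot_mod M K)"
  proof (rule abelian_groupI)
    show "\<exists>y\<in>carrier (quot_mod M K). y \<oplus>\<^bsub>quot_mod M K\<^esub> X = \<zero>\<^bsub>quot_mod M K\<^esub>"
      if X: "X \<in> carrier (quot_mod M K)" for X
    proof -
      obtain x where x: "X = K +> x" "x \<in> carrier M" using X by (auto simp: quot_carrier)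
      show ?thesis by (rule bexI[of _ "K +> (\<ominus> x)"])
          (use x in \<open>simp_all add: quot_carrierI quot_add[OF K] quot_zero'[OF K] M.l_neg\<close>)
    qed
  qed (auto simp: quot_carrier quot_add[OF K] quot_zero'[OF K] M.a_ac)
  moreover have "lmodule_axioms R (quot_mod M K)" unfolding lmodule_axioms_def
    by (auto simp: quot_carrier quot_add[OF K] quot_smult[OF K] smult_l_distr smult_r_distr smult_assoc1)
  ultimately show ?thesis by (simp add: lmodule_def R.ring_axioms)
qed

lemma quot_eq_zero_iff:
  assumes K: "submodule K R M" and x: "x \<in> carrier M"
  shows "K +> x = \<zero>\<^bsub>quot_mod M K\<^esub> \<longleftrightarrow> x \<in> K"
  using coset_eq_iff[OF K x M.zero_closed] x by (simp add: quot_zero'[OF K])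

text \<open>An equality of records, because restriction changes only the carrier. It reduces
  quotients of submodules to cosets in the ambient module.\<close>

lemma restrict_quot:
  "quot_mod (restrict_mod M L) K = restrict_mod (quot_mod M K) {K +> x | x. x \<in> L}"
proof -
  have "a_r_coset (restrict_mod M L) = a_r_coset M" "set_add (restrict_mod M L) = set_add M"
    by (auto simp: fun_eq_iff a_r_coset_def r_coset_def set_add_def set_mult_def)
  moreover have "a_rcosets\<^bsub>restrict_mod M L\<^esub> K = {K +> x | x. x \<in> L}"
    by (auto simp: A_RCOSETS_def' a_r_coset_def')
  ultimately show ?thesis by (simp add: quot_mod_def restrict_mod_def)
qed

lemma restrict_carrier: "restrict_mod M (carrier M) = M" by (simp add: restrict_mod_def)

end

subsection \<open>Homomorphisms\<close>

lemma mod_homD: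
  assumes "h \<in> mod_hom R M N"
  shows "x \<in> carrier M \<Longrightarrow> h x \<in> carrier N"
    "x \<in> carrier M \<Longrightarrow> y \<in> carrier M \<Longrightarrow> h (x \<oplus>\<^bsub>M\<^esub> y) = h x \<oplus>\<^bsub>N\<^esub> h y"
    "a \<in> carrier R \<Longrightarrow> x \<in> carrier M \<Longrightarrow> h (a \<odot>\<^bsub>M\<^esub> x) = a \<odot>\<^bsub>N\<^esub> h x" using assms by (auto simp: mod_hom_def)

lemma mod_homI:
  assumes "\<And>x. x \<in> carrier M \<Longrightarrow> h x \<in> carrier N"
    "\<And>x y. x \<in> carrier M \<Longrightarrow> y \<in> carrier M \<Longrightarrow> h (x \<oplus>\<^bsub>M\<^esub> y) = h x \<oplus>\<^bsub>N\<^esub> h y"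
    "\<And>a x. a \<in> carrier R \<Longrightarrow> x \<in> carrier M \<Longrightarrow> h (a \<odot>\<^bsub>M\<^esub> x) = a \<odot>\<^bsub>N\<^esub> h x"
  shows "h \<in> mod_hom R M N" using assms by (auto simp: mod_hom_def)

locale lmodule_hom = M: lmodule R M + N: lmodule R N
  for R :: "('a, 'r) ring_scheme" and M :: "('a, 'b, 'm) module_scheme" (structure)
    and N :: "('a, 'c, 'n) module_scheme" +
  fixes h assumes hom: "h \<in> mod_hom R M N"
begin

lemmas hom_closed [simp] = mod_homD(1)[OF hom]
lemmas hom_add = mod_homD(2)[OF hom]
lemmas hom_smult = mod_homD(3)[OF hom]

lemma hom_zero [simp]: "h \<zero> = \<zero>\<^bsub>N\<^esub>" using hom_smult[of "\<zero>\<^bsub>R\<^esub>" "\<zero>"] by simp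

lemma hom_minus: "x \<in> carrier M \<Longrightarrow> h (\<ominus> x) = \<ominus>\<^bsub>N\<^esub> h x"
  using hom_smult[of "\<ominus>\<^bsub>R\<^esub> \<one>\<^bsub>R\<^esub>" x] by (simp add: M.smult_minus_one N.smult_minus_one)

lemma hom_diff: "x \<in> carrier M \<Longrightarrow> y \<in> carrier M \<Longrightarrow> h (x \<ominus> y) = h x \<ominus>\<^bsub>N\<^esub> h y"
  by (simp add: M.M.minus_eq N.M.minus_eq hom_add hom_minus)

lemma kernel_iff: "x \<in> a_kernel M N h \<longleftrightarrow> x \<in> carrier M \<and> h x = \<zero>\<^bsub>N\<^esub>" by (auto simp: a_kernel_def')

lemma kernel_submodule: "submodule (a_kernel M N h) R M"
  by (rule M.submoduleI) (auto simp: kernel_iff hom_add hom_smult)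

lemma hom_eq_iff:
  assumes "x \<in> carrier M" "y \<in> carrier M"
  shows "h x = h y \<longleftrightarrow> x \<ominus> y \<in> a_kernel M N h"
proof -
  have "h x = h y \<longleftrightarrow> h x \<ominus>\<^bsub>N\<^esub> h y = \<zero>\<^bsub>N\<^esub>" using assms by (simp add: N.diff_eq_zero_iff)
  then show ?thesis using assms by (simp add: kernel_iff hom_diff)
qed

text \<open>The map is explicit since the first claim of the theorem is an equality under the
  identification of \<open>F / K\<close> with \<open>M\<close> given by \<open>f\<close>, not a mere
  isomorphism.\<close>

lemma first_isomorphism:
  assumes L: "submodule L R M" and ker: "a_kernel M N h \<subseteq> L" and im: "h ` L = P" and P: "submodule P R N"
  shows "(\<lambda>X. the_elem (h ` X)) \<in> mod_iso R (quot_mod (restrict_mod M L) (a_kernel M N h)) (restrict_mod N P)"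
proof -
  define K where "K = a_kernel M N h"
  have K: "submodule K R M" unfolding K_def by (rule kernel_submodule)
  note LD = M.submoduleD[OF L]
  have Lc: "x \<in> carrier M" if "x \<in> L" for x using LD(7) that .
  have "submodule K R (restrict_mod M L)" using M.submodule_restrict_iff[OF L] K ker K_def by simp
  have the: "the_elem (h ` (K +> x)) = h x" if x: "x \<in> carrier M" for x
  proof -
    have "h ` (K +> x) = {h x}"
    proof
      show "h ` (K +> x) \<subseteq> {h x}"
      proof (clarsimp)
        fix y assume y: "y \<in> K +> x"
        then have yc: "y \<in> carrier M" using M.coset_subset[OF K x] by blast
        show "h y = h x" using hom_eq_iff[OF yc x] M.coset_mem_iff[OF K x yc] y by (simp add: K_def)
      qed
      show "{h x} \<subseteq> h ` (K +> x)" using M.coset_self[OF K x] by blast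
    qed
    then show ?thesis by simp
  qed
  have C: "carrier (restrict_mod (quot_mod M K) {K +> x |x. x \<in> L}) = {K +> x |x. x \<in> L}"
    by (simp add: restrict_mod_def)
  have "(\<lambda>X. the_elem (h ` X)) \<in> mod_hom R (quot_mod (restrict_mod M L) K) (restrict_mod N P)"
    unfolding M.restrict_quot
  proof (rule mod_homI, unfold C)
    show "the_elem (h ` X) \<in> carrier (restrict_mod N P)" if "X \<in> {K +> x |x. x \<in> L}" for X
      using that im by (auto simp: the Lc)
    show "the_elem (h ` (X \<oplus>\<^bsub>restrict_mod (quot_mod M K) {K +> x |x. x \<in> L}\<^esub> Y)) =
        the_elem (h ` X) \<oplus>\<^bsub>restrict_mod N P\<^esub> the_elem (h ` Y)"
      if "X \<in> {K +> x |x. x \<in> L}" "Y \<in> {K +> x |x. x \<in> L}" for X Y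
      using that by (auto simp: restrict_mod_def M.quot_add[OF K] Lc the hom_add)
    show "the_elem (h ` (a \<odot>\<^bsub>restrict_mod (quot_mod M K) {K +> x |x. x \<in> L}\<^esub> X)) =
        a \<odot>\<^bsub>restrict_mod N P\<^esub> the_elem (h ` X)"
      if "a \<in> carrier R" "X \<in> {K +> x |x. x \<in> L}" for a X
      using that by (auto simp: restrict_mod_def M.quot_smult[OF K] Lc the hom_smult)
  qed
  moreover have "bij_betw (\<lambda>X. the_elem (h ` X)) {K +> x |x. x \<in> L} P"
  proof (rule bij_betwI')
    show "(the_elem (h ` X) = the_elem (h ` Y)) = (X = Y)"
      if XY: "X \<in> {K +> x |x. x \<in> L}" "Y \<in> {K +> x |x. x \<in> L}" for X Y
    proof -
      obtain x y where xy: "X = K +> x" "x \<in> L" "Y = K +> y" "y \<in> L" using XY by blast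
      show ?thesis
        unfolding xy(1,3) the[OF Lc[OF xy(2)]] the[OF Lc[OF xy(4)]] M.coset_eq_iff[OF K Lc[OF xy(2)] Lc[OF xy(4)]]
          hom_eq_iff[OF Lc[OF xy(2)] Lc[OF xy(4)], folded K_def] ..
    qed
    show "the_elem (h ` X) \<in> P" if "X \<in> {K +> x |x. x \<in> L}" for X using that im by (auto simp: the Lc)
    show "\<exists>X\<in>{K +> x |x. x \<in> L}. p = the_elem (h ` X)" if p: "p \<in> P" for p
    proof -
      obtain x where "x \<in> L" "p = h x" using p im by blast
      then show ?thesis by (intro bexI[of _ "K +> x"]) (auto simp: the Lc)
    qed
  qed
  ultimately show ?thesis unfolding mod_iso_def K_def[symmetric] M.restrict_quot by (simp add: restrict_mod_def)
qed

end

lemma mod_isomorphicI: "h \<in> mod_iso R M N \<Longrightarrow> mod_isomorphic R M N" unfolding mod_isomorphic_def by blast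

lemma mod_isomorphic_sym:
  assumes "lmodule R M" "lmodule R N" "mod_isomorphic R M N" shows "mod_isomorphic R N M"
proof -
  obtain h where h: "h \<in> mod_hom R M N" "bij_betw h (carrier M) (carrier N)"
    using assms(3) unfolding mod_isomorphic_def mod_iso_def by blast
  interpret lmodule_hom R M N h using assms h by (simp add: lmodule_hom_def lmodule_hom_axioms_def)
  define g where "g = inv_into (carrier M) h"
  have b: "bij_betw g (carrier N) (carrier M)" unfolding g_def by (rule bij_betw_inv_into[OF h(2)])
  have gc: "g y \<in> carrier M" if "y \<in> carrier N" for y using b that by (auto simp: bij_betw_def)
  have hg: "h (g y) = y" if "y \<in> carrier N" for y unfolding g_def by (rule bij_betw_inv_into_right[OF h(2) that])
  have inj: "x = y" if "x \<in> carrier M" "y \<in> carrier M" "h x = h y" for x y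
    using h(2) that by (auto simp: bij_betw_def inj_on_def)
  have "g \<in> mod_hom R N M" by (rule mod_homI; (rule inj)?) (simp_all add: gc hg hom_add hom_smult)
  then show ?thesis using b unfolding mod_isomorphic_def mod_iso_def by blast
qed

subsection \<open>Direct limits of quotients\<close>

text \<open>A common frame for both limits of the theorem: \<open>Li i\<close> is the closure of
  \<open>Ki i\<close> in the first, and constant in the second, where the closures play the role of
  \<open>Ki\<close>.\<close>

locale quotient_system = lmodule R F
  for R :: "('a, 'r) ring_scheme" and F :: "('a, 'f, 'm) module_scheme" (structure) +
  fixes I :: "'i set" and leq :: "'i \<Rightarrow> 'i \<Rightarrow> bool" and Ki Li :: "'i \<Rightarrow> 'f set"
  assumes dir: "directed_on I leq"
    and Ki: "\<And>i. i \<in> I \<Longrightarrow> submodule (Ki i) R F" and Li: "\<And>i. i \<in> I \<Longrightarrow> submodule (Li i) R F"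
    and KL: "\<And>i. i \<in> I \<Longrightarrow> Ki i \<subseteq> Li i"
    and Kmono: "\<And>i j. i \<in> I \<Longrightarrow> j \<in> I \<Longrightarrow> leq i j \<Longrightarrow> Ki i \<subseteq> Ki j"
    and Lmono: "\<And>i j. i \<in> I \<Longrightarrow> j \<in> I \<Longrightarrow> leq i j \<Longrightarrow> Li i \<subseteq> Li j"
begin

abbreviation "K \<equiv> \<Union>i\<in>I. Ki i"
abbreviation "L \<equiv> \<Union>i\<in>I. Li i"
abbreviation "Q \<equiv> \<lambda>i. quot_mod (restrict_mod F (Li i)) (Ki i)"
abbreviation "\<phi> \<equiv> \<lambda>i j X. Ki j <+>\<^bsub>F\<^esub> X"

lemma I_nonempty: "I \<noteq> {}"
  and leq_trans: "i \<in> I \<Longrightarrow> j \<in> I \<Longrightarrow> k \<in> I \<Longrightarrow> leq i j \<Longrightarrow> leq j k \<Longrightarrow> leq i k"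
  and upper: "i \<in> I \<Longrightarrow> j \<in> I \<Longrightarrow> \<exists>k\<in>I. leq i k \<and> leq j k" using dir unfolding directed_on_def by blast+

lemma union_submodule:
  assumes N: "\<And>i. i \<in> I \<Longrightarrow> submodule (Ni i) R F"
    and mono: "\<And>i j. i \<in> I \<Longrightarrow> j \<in> I \<Longrightarrow> leq i j \<Longrightarrow> Ni i \<subseteq> Ni j"
  shows "submodule (\<Union>i\<in>I. Ni i) R F"
proof (rule submoduleI)
  show "(\<Union>i\<in>I. Ni i) \<subseteq> carrier F" using submoduleD(1)[OF N] by blast
  show "\<zero> \<in> (\<Union>i\<in>I. Ni i)" using I_nonempty submoduleD(2)[OF N] by blast
  show "a \<odot> x \<in> (\<Union>i\<in>I. Ni i)" if "a \<in> carrier R" "x \<in> (\<Union>i\<in>I. Ni i)" for a x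
    using that submoduleD(4)[OF N] by blast
  show "x \<oplus> y \<in> (\<Union>i\<in>I. Ni i)" if xy: "x \<in> (\<Union>i\<in>I. Ni i)" "y \<in> (\<Union>i\<in>I. Ni i)" for x y
  proof -
    obtain i j where ij: "i \<in> I" "x \<in> Ni i" "j \<in> I" "y \<in> Ni j" using xy by blast
    obtain k where k: "k \<in> I" "leq i k" "leq j k" using upper ij by blast
    then have "x \<in> Ni k" "y \<in> Ni k" using ij mono by blast+
    then show ?thesis using submoduleD(3)[OF N[OF k(1)]] k(1) by blast
  qed
qed

lemma K_sub: "submodule K R F" by (rule union_submodule[OF Ki Kmono])
lemma L_sub: "submodule L R F" by (rule union_submodule[OF Li Lmono])

lemma Li_carrier: "i \<in> I \<Longrightarrow> x \<in> Li i \<Longrightarrow> x \<in> carrier F" using submoduleD(7)[OF Li] by blast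

lemma Q_carrier: "carrier (Q i) = {Ki i +> x | x. x \<in> Li i}"
  unfolding restrict_quot by (simp add: restrict_mod_def)

lemma Q_ops:
  assumes i: "i \<in> I"
  shows "\<zero>\<^bsub>Q i\<^esub> = Ki i +> \<zero>"
    "x \<in> carrier F \<Longrightarrow> y \<in> carrier F \<Longrightarrow> (Ki i +> x) \<oplus>\<^bsub>Q i\<^esub> (Ki i +> y) = Ki i +> (x \<oplus> y)"
    "a \<in> carrier R \<Longrightarrow> x \<in> carrier F \<Longrightarrow> a \<odot>\<^bsub>Q i\<^esub> (Ki i +> x) = Ki i +> (a \<odot> x)" unfolding restrict_quot
  using quot_zero'[OF Ki[OF i]] quot_add[OF Ki[OF i]] quot_smult[OF Ki[OF i]]
  by (simp_all add: restrict_mod_def)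

text \<open>The set sum merges a coset of \<open>Ki i\<close> into the coset of the larger
  \<open>Ki j\<close> that contains it, so it is the map induced by the inclusion.\<close>

lemma \<phi>_coset:
  assumes ij: "i \<in> I" "j \<in> I" "leq i j" and x: "x \<in> carrier F"
  shows "\<phi> i j (Ki i +> x) = Ki j +> x"
proof -
  note Kj = submoduleD[OF Ki[OF ij(2)]] and Ki' = submoduleD[OF Ki[OF ij(1)]]
  have sub: "Ki i \<subseteq> Ki j" by (rule Kmono[OF ij])
  show ?thesis
  proof
    show "Ki j <+>\<^bsub>F\<^esub> (Ki i +> x) \<subseteq> Ki j +> x"
    proof
      fix z assume "z \<in> Ki j <+>\<^bsub>F\<^esub> (Ki i +> x)"
      then obtain a b where ab: "a \<in> Ki j" "b \<in> Ki i" "z = a \<oplus> (b \<oplus> x)"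
        by (auto simp: set_add_def' a_r_coset_def')
      then have "z = (a \<oplus> b) \<oplus> x" "a \<oplus> b \<in> Ki j" using Kj(3)[of a b] sub x Kj(7) by (auto simp: M.a_assoc)
      then show "z \<in> Ki j +> x" by (auto simp: a_r_coset_def')
    qed
    show "Ki j +> x \<subseteq> Ki j <+>\<^bsub>F\<^esub> (Ki i +> x)"
    proof
      fix z assume "z \<in> Ki j +> x"
      then obtain a where "a \<in> Ki j" "z = a \<oplus> x" by (auto simp: a_r_coset_def')
      then show "z \<in> Ki j <+>\<^bsub>F\<^esub> (Ki i +> x)"
        using coset_self[OF Ki[OF ij(1)] x] unfolding set_add_def' by blast
    qed
  qed
qed

text \<open>The class of \<open>u\<close> in the direct limit, described without an index at which
  \<open>u\<close> first appears. Hence it depends on \<open>u\<close> only modulo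
  \<open>K\<close>.\<close>

definition limit_class :: "'f \<Rightarrow> ('i \<times> 'f set) set" where
  "limit_class u = {(j, X). j \<in> I \<and> (\<exists>v\<in>Li j. X = Ki j +> v \<and> u \<ominus> v \<in> K)}"

lemma limit_class_iff:
  "(j, X) \<in> limit_class u \<longleftrightarrow> j \<in> I \<and> (\<exists>v\<in>Li j. X = Ki j +> v \<and> u \<ominus> v \<in> K)" by (simp add: limit_class_def)

lemma dl_class_eq:
  assumes i: "i \<in> I" and u: "u \<in> Li i"
  shows "dl_class I leq Q \<phi> i (Ki i +> u) = limit_class u"
proof -
  have uc: "u \<in> carrier F" by (rule Li_carrier[OF i u])
  have eq: "(\<exists>k\<in>I. leq i k \<and> leq j k \<and> \<phi> i k (Ki i +> u) = \<phi> j k (Ki j +> v)) \<longleftrightarrow> u \<ominus> v \<in> K"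
    if j: "j \<in> I" and v: "v \<in> carrier F" for j v
  proof
    assume "\<exists>k\<in>I. leq i k \<and> leq j k \<and> \<phi> i k (Ki i +> u) = \<phi> j k (Ki j +> v)"
    then obtain k where k: "k \<in> I" "leq i k" "leq j k" "\<phi> i k (Ki i +> u) = \<phi> j k (Ki j +> v)" by blast
    then have "Ki k +> u = Ki k +> v" using \<phi>_coset[OF i k(1,2) uc] \<phi>_coset[OF j k(1,3) v] by simp
    then show "u \<ominus> v \<in> K" using coset_eq_iff[OF Ki[OF k(1)] uc v] k(1) by blast
  next
    assume "u \<ominus> v \<in> K"
    then obtain l where l: "l \<in> I" "u \<ominus> v \<in> Ki l" by blast
    \<comment> \<open>Three indices have to be dominated: \<open>i\<close>, \<open>j\<close>, and
      the stage \<open>l\<close> at which the difference lies in the kernel.\<close>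
    obtain k1 where k1: "k1 \<in> I" "leq i k1" "leq j k1" using upper[OF i j] by blast
    obtain k where k: "k \<in> I" "leq k1 k" "leq l k" using upper[OF k1(1) l(1)] by blast
    have ik: "leq i k" "leq j k" using leq_trans[OF i k1(1) k(1)] leq_trans[OF j k1(1) k(1)] k1 k by blast+
    have "u \<ominus> v \<in> Ki k" using Kmono[OF l(1) k(1,3)] l(2) by blast
    then have "Ki k +> u = Ki k +> v" using coset_eq_iff[OF Ki[OF k(1)] uc v] by blast
    then have "\<phi> i k (Ki i +> u) = \<phi> j k (Ki j +> v)"
      using \<phi>_coset[OF i k(1) ik(1) uc] \<phi>_coset[OF j k(1) ik(2) v] by simp
    then show "\<exists>k\<in>I. leq i k \<and> leq j k \<and> \<phi> i k (Ki i +> u) = \<phi> j k (Ki j +> v)" using k(1) ik by blast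
  qed
  have "(j, X) \<in> dl_class I leq Q \<phi> i (Ki i +> u) \<longleftrightarrow> (j, X) \<in> limit_class u" for j X
  proof -
    have "(j, X) \<in> dl_class I leq Q \<phi> i (Ki i +> u) \<longleftrightarrow> j \<in> I \<and> (\<exists>v\<in>Li j. X = Ki j +> v \<and>
      (\<exists>k\<in>I. leq i k \<and> leq j k \<and> \<phi> i k (Ki i +> u) = \<phi> j k X))" unfolding dl_class_def Q_carrier by blast
    also have "\<dots> \<longleftrightarrow> (j, X) \<in> limit_class u" unfolding limit_class_iff
    proof (intro conj_cong refl bex_cong)
      fix v assume "j \<in> I" "v \<in> Li j" "X = Ki j +> v"
      then show "(\<exists>k\<in>I. leq i k \<and> leq j k \<and> \<phi> i k (Ki i +> u) = \<phi> j k X) \<longleftrightarrow> u \<ominus> v \<in> K"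
        using eq[OF \<open>j \<in> I\<close> Li_carrier[OF \<open>j \<in> I\<close> \<open>v \<in> Li j\<close>]] by (simp only:)
    qed
    finally show ?thesis .
  qed
  then show ?thesis by (simp add: set_eq_iff split_paired_all)
qed

lemma limit_class_eq_iff:
  assumes u: "u \<in> L" and v: "v \<in> L"
  shows "limit_class u = limit_class v \<longleftrightarrow> u \<ominus> v \<in> K"
proof -
  note LD = submoduleD[OF L_sub] and KD = submoduleD[OF K_sub]
  have c: "u \<in> carrier F" "v \<in> carrier F" using LD(7) u v by blast+
  show ?thesis
  proof
    assume e: "limit_class u = limit_class v"
    obtain j where j: "j \<in> I" "v \<in> Li j" using v by blast
    have "v \<ominus> v \<in> K" using KD(2) c by simp
    then have "(j, Ki j +> v) \<in> limit_class u" unfolding e limit_class_iff using j by blast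
    then obtain w where w: "Ki j +> v = Ki j +> w" "w \<in> Li j" "u \<ominus> w \<in> K" unfolding limit_class_iff by blast
    have wc: "w \<in> carrier F" by (rule Li_carrier[OF j(1) w(2)])
    have "w \<ominus> v \<in> K" using coset_eq_iff[OF Ki[OF j(1)] wc c(2)] w(1) j(1) by auto
    with w(3) have "(u \<ominus> w) \<oplus> (w \<ominus> v) \<in> K" by (rule KD(3))
    also have "(u \<ominus> w) \<oplus> (w \<ominus> v) = u \<ominus> v"
      using c wc by (simp add: M.minus_eq M.a_assoc M.l_neg flip: M.a_assoc) (simp add: M.a_assoc M.l_neg)
    finally show "u \<ominus> v \<in> K" .
  next
    assume d: "u \<ominus> v \<in> K"
    have "u \<ominus> w \<in> K \<longleftrightarrow> v \<ominus> w \<in> K" if w: "w \<in> carrier F" for w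
    proof -
      have "K +> u = K +> v" using coset_eq_iff[OF K_sub c] d by blast
      then show ?thesis using coset_eq_iff[OF K_sub c(1) w] coset_eq_iff[OF K_sub c(2) w] by simp
    qed
    then have "(j, X) \<in> limit_class u \<longleftrightarrow> (j, X) \<in> limit_class v" for j X
      unfolding limit_class_iff using Li_carrier[of j] by (intro conj_cong bex_cong refl) blast
    then show "limit_class u = limit_class v" by (simp add: set_eq_iff split_paired_all)
  qed
qed

abbreviation "D \<equiv> direct_limit I leq Q \<phi>"

lemma limit_class_mem:
  "i \<in> I \<Longrightarrow> u \<in> Li i \<Longrightarrow> (i, Ki i +> u) \<in> limit_class u"
  unfolding limit_class_iff using Li_carrier[of i u] submoduleD(2)[OF K_sub] by (intro conjI bexI[of _ u]) simp_all

lemma limit_class_memD: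
  assumes "(j, X) \<in> limit_class u" "u \<in> L"
  obtains v where "j \<in> I" "v \<in> Li j" "X = Ki j +> v" "limit_class v = limit_class u"
proof -
  obtain v where v: "j \<in> I" "v \<in> Li j" "X = Ki j +> v" "u \<ominus> v \<in> K"
    using assms unfolding limit_class_iff by blast
  have "v \<in> L" using v by blast
  then have "limit_class u = limit_class v" using limit_class_eq_iff[OF assms(2)] v(4) by blast
  then show thesis using that v by simp
qed

lemma D_carrier: "carrier D = limit_class ` L"
proof -
  have "carrier D = {dl_class I leq Q \<phi> i X | i X. i \<in> I \<and> X \<in> {Ki i +> x | x. x \<in> Li i}}"
    unfolding direct_limit_def Q_carrier by simp
  also have "\<dots> = {dl_class I leq Q \<phi> i (Ki i +> x) | i x. i \<in> I \<and> x \<in> Li i}" by blast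
  also have "\<dots> = {limit_class x | i x. i \<in> I \<and> x \<in> Li i}"
  proof -
    have "(c = dl_class I leq Q \<phi> i (Ki i +> x) \<and> i \<in> I \<and> x \<in> Li i) =
      (c = limit_class x \<and> i \<in> I \<and> x \<in> Li i)" for c i x
      by (cases "i \<in> I \<and> x \<in> Li i") (simp_all only: dl_class_eq simp_thms)
    then show ?thesis by (simp only:)
  qed
  also have "\<dots> = limit_class ` L" by blast
  finally show ?thesis .
qed

lemma D_add:
  assumes u: "u \<in> L" and v: "v \<in> L"
  shows "limit_class u \<oplus>\<^bsub>D\<^esub> limit_class v = limit_class (u \<oplus> v)"
proof -
  note LD = submoduleD[OF L_sub] and KD = submoduleD[OF K_sub]
  define S where "S = {dl_class I leq Q \<phi> k (\<phi> i k x \<oplus>\<^bsub>Q k\<^esub> \<phi> j k y) | i x j y k.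
               (i, x) \<in> limit_class u \<and> (j, y) \<in> limit_class v \<and> k \<in> I \<and> leq i k \<and> leq j k}"
  have "limit_class u \<oplus>\<^bsub>D\<^esub> limit_class v = \<Union>S" unfolding direct_limit_def S_def by simp
  \<comment> \<open>Addition in the direct limit is a union over all choices of representatives and
    of a common index. It is well defined because all choices give one class and at least one choice
    exists.\<close>
  also have "S = {limit_class (u \<oplus> v)}"
  proof -
    have val: "dl_class I leq Q \<phi> k (\<phi> i k x \<oplus>\<^bsub>Q k\<^esub> \<phi> j k y) = limit_class (u \<oplus> v)"
      if h: "(i, x) \<in> limit_class u" "(j, y) \<in> limit_class v" "k \<in> I" "leq i k" "leq j k" for i x j y k
    proof -
      obtain u' where u': "i \<in> I" "u' \<in> Li i" "x = Ki i +> u'" "limit_class u' = limit_class u"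
        by (rule limit_class_memD[OF h(1) u])
      obtain v' where v': "j \<in> I" "v' \<in> Li j" "y = Ki j +> v'" "limit_class v' = limit_class v"
        by (rule limit_class_memD[OF h(2) v])
      have k': "u' \<in> Li k" "v' \<in> Li k" using Lmono[OF u'(1) h(3,4)] Lmono[OF v'(1) h(3,5)] u' v' by blast+
      have c: "u' \<in> carrier F" "v' \<in> carrier F" "u \<in> carrier F" "v \<in> carrier F"
        using Li_carrier[OF h(3)] k' LD(7) u v by blast+
      have "dl_class I leq Q \<phi> k (\<phi> i k x \<oplus>\<^bsub>Q k\<^esub> \<phi> j k y) = dl_class I leq Q \<phi> k (Ki k +> (u' \<oplus> v'))"
        using \<phi>_coset[OF u'(1) h(3,4) c(1)] \<phi>_coset[OF v'(1) h(3,5) c(2)] u'(3) v'(3) Q_ops(2)[OF h(3) c(1,2)]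
        by simp
      also have "\<dots> = limit_class (u' \<oplus> v')" by (rule dl_class_eq[OF h(3) submoduleD(3)[OF Li[OF h(3)] k']])
      also have "\<dots> = limit_class (u \<oplus> v)"
      proof -
        have uu: "u' \<in> L" "v' \<in> L" using h(3) k' by blast+
        have "u' \<ominus> u \<in> K" "v' \<ominus> v \<in> K"
          using limit_class_eq_iff[OF uu(1) u] limit_class_eq_iff[OF uu(2) v] by (simp_all only: u'(4) v'(4) simp_thms)
        then have "(u' \<ominus> u) \<oplus> (v' \<ominus> v) \<in> K" by (rule KD(3))
        also have "(u' \<ominus> u) \<oplus> (v' \<ominus> v) = (u' \<oplus> v') \<ominus> (u \<oplus> v)"
          using c by (simp add: M.minus_eq M.minus_add M.a_ac)
        finally show ?thesis using limit_class_eq_iff[OF LD(3)[OF uu] LD(3)[OF u v]] by (simp only: simp_thms)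
      qed
      finally show ?thesis .
    qed
    obtain i j where ij: "i \<in> I" "u \<in> Li i" "j \<in> I" "v \<in> Li j" using u v by blast
    obtain k where k: "k \<in> I" "leq i k" "leq j k" using upper ij by blast
    have "limit_class (u \<oplus> v) \<in> S" unfolding S_def
      by (rule CollectI, rule exI[of _ i], rule exI[of _ "Ki i +> u"], rule exI[of _ j],
          rule exI[of _ "Ki j +> v"], rule exI[of _ k], intro conjI
          val[OF limit_class_mem[OF ij(1,2)] limit_class_mem[OF ij(3,4)] k, symmetric]
          limit_class_mem[OF ij(1,2)] limit_class_mem[OF ij(3,4)] k)
    moreover have "S \<subseteq> {limit_class (u \<oplus> v)}" unfolding S_def using val by blast
    ultimately show ?thesis by blast
  qed
  finally show ?thesis by simp
qed

lemma D_smult: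
  assumes a: "a \<in> carrier R" and u: "u \<in> L"
  shows "a \<odot>\<^bsub>D\<^esub> limit_class u = limit_class (a \<odot> u)"
proof -
  note LD = submoduleD[OF L_sub] and KD = submoduleD[OF K_sub]
  define S where "S = {dl_class I leq Q \<phi> i (a \<odot>\<^bsub>Q i\<^esub> x) | i x. i \<in> I \<and> (i, x) \<in> limit_class u}"
  have "a \<odot>\<^bsub>D\<^esub> limit_class u = \<Union>S" unfolding direct_limit_def S_def by simp
  also have "S = {limit_class (a \<odot> u)}"
  proof -
    have val: "dl_class I leq Q \<phi> i (a \<odot>\<^bsub>Q i\<^esub> x) = limit_class (a \<odot> u)"
      if h: "(i, x) \<in> limit_class u" for i x
    proof -
      obtain u' where u': "i \<in> I" "u' \<in> Li i" "x = Ki i +> u'" "limit_class u' = limit_class u"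
        by (rule limit_class_memD[OF h(1) u])
      have c: "u' \<in> carrier F" "u \<in> carrier F" using Li_carrier[OF u'(1,2)] LD(7) u by blast+
      have "dl_class I leq Q \<phi> i (a \<odot>\<^bsub>Q i\<^esub> x) = limit_class (a \<odot> u')"
        using Q_ops(3)[OF u'(1) a c(1)] u'(3) dl_class_eq[OF u'(1) submoduleD(4)[OF Li[OF u'(1)] a u'(2)]] by simp
      also have "\<dots> = limit_class (a \<odot> u)"
      proof -
        have uu: "u' \<in> L" using u' by blast
        have "u' \<ominus> u \<in> K" using limit_class_eq_iff[OF uu(1) u] by (simp only: u'(4) simp_thms)
        then have "a \<odot> (u' \<ominus> u) \<in> K" by (rule KD(4)[OF a])
        then have "a \<odot> u' \<ominus> a \<odot> u \<in> K" using smult_diff[OF a c] by simp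
        then show ?thesis using limit_class_eq_iff[OF LD(4)[OF a uu] LD(4)[OF a u]] by (simp only: simp_thms)
      qed
      finally show ?thesis .
    qed
    obtain i where i: "i \<in> I" "u \<in> Li i" using u by blast
    have "limit_class (a \<odot> u) \<in> S" unfolding S_def
      by (rule CollectI, rule exI[of _ i], rule exI[of _ "Ki i +> u"], intro conjI
          val[OF limit_class_mem[OF i], symmetric] limit_class_mem[OF i] i(1))
    moreover have "S \<subseteq> {limit_class (a \<odot> u)}" unfolding S_def using val by blast
    ultimately show ?thesis by blast
  qed
  finally show ?thesis by simp
qed

text \<open>By \<open>limit_class_eq_iff\<close> limit classes and cosets of the union
  \<open>K\<close> identify the same pairs of elements of \<open>L\<close>.\<close>

theorem quotient_limit_iso: "mod_isomorphic R (quot_mod (restrict_mod F L) K) D"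
proof -
  note LD = submoduleD[OF L_sub]
  define g where "g = (\<lambda>X. limit_class (SOME x. x \<in> L \<and> X = K +> x))"
  have g: "g (K +> x) = limit_class x" if x: "x \<in> L" for x
  proof -
    define y where "y = (SOME y. y \<in> L \<and> K +> x = K +> y)"
    have y: "y \<in> L \<and> K +> x = K +> y" unfolding y_def by (rule someI[of _ x]) (use x in simp)
    then have "limit_class y = limit_class x"
      using coset_eq_iff[OF K_sub LD(7) LD(7), of y x] limit_class_eq_iff[of y x] x by simp
    then show ?thesis by (simp add: g_def y_def)
  qed
  have C: "carrier (restrict_mod (quot_mod F K) {K +> x |x. x \<in> L}) = {K +> x |x. x \<in> L}"
    by (simp add: restrict_mod_def)
  have E: "quot_mod (restrict_mod F L) K = restrict_mod (quot_mod F K) {K +> x |x. x \<in> L}"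
    by (rule restrict_quot)
  have "g \<in> mod_hom R (quot_mod (restrict_mod F L) K) D" unfolding E
  proof (rule mod_homI, unfold C)
    show "g X \<in> carrier D" if X: "X \<in> {K +> x |x. x \<in> L}" for X
    proof -
      obtain x where x: "x \<in> L" "X = K +> x" using X by blast
      show ?thesis unfolding x(2) g[OF x(1)] D_carrier by (rule imageI[OF x(1)])
    qed
    show "g (X \<oplus>\<^bsub>restrict_mod (quot_mod F K) {K +> x |x. x \<in> L}\<^esub> Y) = g X \<oplus>\<^bsub>D\<^esub> g Y"
      if XY: "X \<in> {K +> x |x. x \<in> L}" "Y \<in> {K +> x |x. x \<in> L}" for X Y
    proof -
      obtain x where x: "x \<in> L" "X = K +> x" using XY by blast
      obtain y where y: "y \<in> L" "Y = K +> y" using XY by blast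
      have "X \<oplus>\<^bsub>restrict_mod (quot_mod F K) {K +> x |x. x \<in> L}\<^esub> Y = K +> (x \<oplus> y)"
        using quot_add[OF K_sub LD(7)[OF x(1)] LD(7)[OF y(1)]] by (simp add: restrict_mod_def x y)
      then show ?thesis by (simp only: x(2) y(2) g[OF x(1)] g[OF y(1)] g[OF LD(3)[OF x(1) y(1)]] D_add[OF x(1) y(1)])
    qed
    show "g (a \<odot>\<^bsub>restrict_mod (quot_mod F K) {K +> x |x. x \<in> L}\<^esub> X) = a \<odot>\<^bsub>D\<^esub> g X"
      if aX: "a \<in> carrier R" "X \<in> {K +> x |x. x \<in> L}" for a X
    proof -
      obtain x where x: "x \<in> L" "X = K +> x" using aX by blast
      have "a \<odot>\<^bsub>restrict_mod (quot_mod F K) {K +> x |x. x \<in> L}\<^esub> X = K +> (a \<odot> x)"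
        using quot_smult[OF K_sub LD(7)[OF x(1)] aX(1)] by (simp add: restrict_mod_def x)
      then show ?thesis by (simp only: x(2) g[OF x(1)] g[OF LD(4)[OF aX(1) x(1)]] D_smult[OF aX(1) x(1)])
    qed
  qed
  moreover have "bij_betw g {K +> x |x. x \<in> L} (carrier D)"
  proof (rule bij_betwI')
    show "(g X = g Y) = (X = Y)" if XY: "X \<in> {K +> x |x. x \<in> L}" "Y \<in> {K +> x |x. x \<in> L}" for X Y
    proof -
      obtain x where x: "x \<in> L" "X = K +> x" using XY by blast
      obtain y where y: "y \<in> L" "Y = K +> y" using XY by blast
      show ?thesis unfolding x(2) y(2) g[OF x(1)] g[OF y(1)] limit_class_eq_iff[OF x(1) y(1)]
        coset_eq_iff[OF K_sub LD(7)[OF x(1)] LD(7)[OF y(1)]] by (rule refl)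
    qed
    show "g X \<in> carrier D" if X: "X \<in> {K +> x |x. x \<in> L}" for X
    proof -
      obtain x where x: "x \<in> L" "X = K +> x" using X by blast
      show ?thesis unfolding x(2) g[OF x(1)] D_carrier by (rule imageI[OF x(1)])
    qed
    show "\<exists>X\<in>{K +> x |x. x \<in> L}. d = g X" if d: "d \<in> carrier D" for d
    proof -
      obtain x where x: "x \<in> L" "d = limit_class x" using d unfolding D_carrier by blast
      have "d = g (K +> x)" unfolding x(2) g[OF x(1)] ..
      moreover have "K +> x \<in> {K +> x |x. x \<in> L}" using x(1) by blast
      ultimately show ?thesis by (rule bexI)
    qed
  qed
  moreover have "carrier (quot_mod (restrict_mod F L) K) = {K +> x |x. x \<in> L}" unfolding E by (rule C)
  ultimately have "g \<in> mod_iso R (quot_mod (restrict_mod F L) K) D" unfolding mod_iso_def by simp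
  then show ?thesis by (rule mod_isomorphicI)
qed

end

text \<open>Agreement is asked for on \<open>I\<close> only, and the result is an equality of
  records; so the two forms of the first limit are equal and not merely isomorphic.\<close>

lemma direct_limit_cong:
  assumes "\<And>i. i \<in> I \<Longrightarrow> M i = N i"
  shows "direct_limit I leq M \<phi> = direct_limit I leq N \<phi>"
proof -
  have 1: "dl_class I leq M \<phi> = dl_class I leq N \<phi>" unfolding dl_class_def fun_eq_iff using assms by auto
  have 2: "{dl_class I leq M \<phi> i x | i x. i \<in> I \<and> x \<in> carrier (M i)} = {dl_class I leq N \<phi> i x | i x. i \<in> I \<and> x \<in> carrier (N i)}"
    unfolding 1 by (intro Collect_cong iff_exI) (rule iffI; elim conjE; intro conjI; simp only: assms)
  have 3: "(\<Union>i\<in>I. dl_class I leq M \<phi> i \<zero>\<^bsub>M i\<^esub>) = (\<Union>i\<in>I. dl_class I leq N \<phi> i \<zero>\<^bsub>N i\<^esub>)"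
    unfolding 1 using assms by simp
  have 4: "{dl_class I leq M \<phi> k (\<phi> i k x \<oplus>\<^bsub>M k\<^esub> \<phi> j k y) | i x j y k. (i, x) \<in> X \<and> (j, y) \<in> Y \<and> k \<in> I \<and> leq i k \<and> leq j k}
    = {dl_class I leq N \<phi> k (\<phi> i k x \<oplus>\<^bsub>N k\<^esub> \<phi> j k y) | i x j y k. (i, x) \<in> X \<and> (j, y) \<in> Y \<and> k \<in> I \<and> leq i k \<and> leq j k}" for X Y
    unfolding 1 by (intro Collect_cong iff_exI) (rule iffI; elim conjE; intro conjI; simp only: assms)
  have 5: "{dl_class I leq M \<phi> i (a \<odot>\<^bsub>M i\<^esub> x) | i x. i \<in> I \<and> (i, x) \<in> X} = {dl_class I leq N \<phi> i (a \<odot>\<^bsub>N i\<^esub> x) | i x. i \<in> I \<and> (i, x) \<in> X}" for a X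
    unfolding 1 by (intro Collect_cong iff_exI) (rule iffI; elim conjE; intro conjI; simp only: assms)
  show ?thesis unfolding direct_limit_def 2 3 4 5 ..
qed

section \<open>Dimension and torsion\<close>

lemma free_mod_simps:
  "x \<in> carrier (free_mod R n) \<longleftrightarrow> (\<forall>i<n. x i \<in> carrier R) \<and> (\<forall>i. \<not> i < n \<longrightarrow> x i = undefined)"
  "(x \<oplus>\<^bsub>free_mod R n\<^esub> y) i = (if i < n then x i \<oplus>\<^bsub>R\<^esub> y i else undefined)"
  "(a \<odot>\<^bsub>free_mod R n\<^esub> x) i = (if i < n then a \<otimes>\<^bsub>R\<^esub> x i else undefined)"
  "\<zero>\<^bsub>free_mod R n\<^esub> i = (if i < n then \<zero>\<^bsub>R\<^esub> else undefined)"
  by (auto simp: free_mod_def PiE_iff extensional_def)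

lemma free_mod_lmodule:
  assumes "ring R" shows "lmodule R (free_mod R n)"
proof -
  let ?F = "free_mod R n"
  interpret R: ring R by (rule assms)
  have "abelian_group ?F"
  proof (rule abelian_groupI)
    show "\<exists>y\<in>carrier ?F. y \<oplus>\<^bsub>?F\<^esub> x = \<zero>\<^bsub>?F\<^esub>"
      if x: "x \<in> carrier ?F" for x
    proof (rule bexI[of _ "\<lambda>i\<in>{..<n}. \<ominus>\<^bsub>R\<^esub> x i"])
      show "(\<lambda>i\<in>{..<n}. \<ominus>\<^bsub>R\<^esub> x i) \<oplus>\<^bsub>?F\<^esub> x = \<zero>\<^bsub>?F\<^esub>"
        using x by (intro ext) (simp add: free_mod_simps R.l_neg)
    qed (use x in \<open>simp add: free_mod_simps\<close>)
  next
    show "x \<oplus>\<^bsub>?F\<^esub> y = y \<oplus>\<^bsub>?F\<^esub> x"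
      if "x \<in> carrier ?F" "y \<in> carrier ?F" for x y
      using that by (intro ext) (simp add: free_mod_simps R.a_comm)
    show "x \<oplus>\<^bsub>?F\<^esub> y \<oplus>\<^bsub>?F\<^esub> z = x \<oplus>\<^bsub>?F\<^esub> (y \<oplus>\<^bsub>?F\<^esub> z)"
      if "x \<in> carrier ?F" "y \<in> carrier ?F" "z \<in> carrier ?F" for x y z
      using that by (intro ext) (simp add: free_mod_simps R.a_assoc)
    show "\<zero>\<^bsub>?F\<^esub> \<oplus>\<^bsub>?F\<^esub> x = x" if "x \<in> carrier ?F" for x
      using that by (intro ext) (simp add: free_mod_simps)
  qed (simp_all add: free_mod_simps)
  moreover have "lmodule_axioms R ?F" unfolding lmodule_axioms_def
    by (intro conjI allI impI ext)
      (simp_all add: free_mod_simps R.l_distr R.r_distr R.m_assoc)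
  ultimately show ?thesis by (simp add: lmodule_def assms)
qed

lemma free_mod_ext:
  "x \<in> carrier (free_mod R n) \<Longrightarrow> y \<in> carrier (free_mod R n) \<Longrightarrow> (\<And>i. i < n \<Longrightarrow> x i = y i) \<Longrightarrow> x = y"
  unfolding free_mod_simps(1) by (intro ext) metis

context finite_von_Neumann
begin

lemma vn_simps [simp]:
  "carrier (vn_ring A) = A" "x \<otimes>\<^bsub>vn_ring A\<^esub> y = x o\<^sub>L y" "x \<oplus>\<^bsub>vn_ring A\<^esub> y = x + y"
  "\<one>\<^bsub>vn_ring A\<^esub> = id_blinfun" "\<zero>\<^bsub>vn_ring A\<^esub> = 0" by (simp_all add: vn_ring_def)

lemma vn_ring: "ring (vn_ring A)"
proof (rule ringI)
  show "abelian_group (vn_ring A)"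
  proof (rule abelian_groupI)
    show "\<exists>y\<in>carrier (vn_ring A). y \<oplus>\<^bsub>vn_ring A\<^esub> x = \<zero>\<^bsub>vn_ring A\<^esub>" if "x \<in> carrier (vn_ring A)" for x
      using that by (intro bexI[of _ "- x"]) simp_all
  qed (simp_all add: algebra_simps)
  show "Group.monoid (vn_ring A)" by (rule monoidI) (simp_all add: compose_assoc)
qed (simp_all add: compose_distrib)

lemma vn_minus [simp]: "a \<in> A \<Longrightarrow> \<ominus>\<^bsub>vn_ring A\<^esub> a = - a"
  using abelian_group.minus_equality[OF ring.is_abelian_group[OF vn_ring], of "- a" a] by simp

abbreviation R :: "('h \<Rightarrow>\<^sub>L 'h) ring" where "R \<equiv> vn_ring A"

definition ann_by :: "('h \<Rightarrow>\<^sub>L 'h, 'b, 'm) module_scheme \<Rightarrow> 'b \<Rightarrow> ('h \<Rightarrow>\<^sub>L 'h) \<Rightarrow> bool" where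
  "ann_by M x e \<longleftrightarrow> projection e \<and> (\<forall>b\<in>A. b \<odot>\<^bsub>M\<^esub> x = \<zero>\<^bsub>M\<^esub> \<longleftrightarrow> b o\<^sub>L e = 0)"

abbreviation trace_sum :: "nat \<Rightarrow> (nat \<Rightarrow> nat \<Rightarrow> ('h \<Rightarrow>\<^sub>L 'h)) \<Rightarrow> real" where
  "trace_sum n e \<equiv> Re (\<Sum>i<n. tr (e i i))"

text \<open>As \<open>e = e adj e\<close>, each diagonal entry is a sum of
  \<open>e i k adj (e i k)\<close>. The trace is a sum of nonnegative terms, and faithfulness
  applies to each of them.\<close>

lemma proj_matrix_trace:
  assumes e: "proj_matrix A n e"
  shows "0 \<le> trace_sum n e" and "trace_sum n e \<le> 0 \<Longrightarrow> i < n \<Longrightarrow> j < n \<Longrightarrow> e i j = 0"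
proof -
  have eA: "e i j \<in> A" "adj (e i j) = e j i" "(\<Sum>k<n. e i k o\<^sub>L e k j) = e i j" if "i < n" "j < n" for i j
    using e that unfolding proj_matrix_def by blast+
  have pos: "0 \<le> \<tau> (e i k o\<^sub>L adj (e i k))" if "i < n" "k < n" for i k
    using eA(1)[OF that] by (intro tau_nonneg) (simp_all add: pos_op_mult_adj)
  have \<tau>: "\<tau> (e i i) = (\<Sum>k<n. \<tau> (e i k o\<^sub>L adj (e i k)))" if i: "i < n" for i
  proof -
    have "(\<Sum>k<m. \<tau> (e i k o\<^sub>L e k i)) = \<tau> (\<Sum>k<m. e i k o\<^sub>L e k i)" if "m \<le> n" for m using that
    proof (induction m)
      case (Suc m)
      have "(\<Sum>k<m. e i k o\<^sub>L e k i) \<in> A" using eA(1) i Suc.prems by (intro mem_sum) simp_all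
      then show ?case using Suc eA(1)[OF i, of m] eA(1)[of m i] i by (simp add: tau_add)
    qed simp
    then have "\<tau> (e i i) = (\<Sum>k<n. \<tau> (e i k o\<^sub>L e k i))" using eA(3)[OF i i] by simp
    also have "\<dots> = (\<Sum>k<n. \<tau> (e i k o\<^sub>L adj (e i k)))" using eA(2)[OF i] by (intro sum.cong) simp_all
    finally show ?thesis .
  qed
  have ts: "trace_sum n e = (\<Sum>i<n. \<Sum>k<n. \<tau> (e i k o\<^sub>L adj (e i k)))" using \<tau> by (simp add: \<tau>_def)
  show "0 \<le> trace_sum n e" unfolding ts by (intro sum_nonneg pos) simp_all
  show "e i j = 0" if z: "trace_sum n e \<le> 0" and ij: "i < n" "j < n"
  proof -
    have "\<tau> (e i j o\<^sub>L adj (e i j)) \<le> (\<Sum>k<n. \<tau> (e i k o\<^sub>L adj (e i k)))"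
      using ij by (intro member_le_sum pos) simp_all
    also have "\<dots> \<le> (\<Sum>i<n. \<Sum>k<n. \<tau> (e i k o\<^sub>L adj (e i k)))"
      using ij by (intro member_le_sum[of i _ "\<lambda>i. \<Sum>k<n. \<tau> (e i k o\<^sub>L adj (e i k))"] sum_nonneg pos) simp_all
    also have "\<dots> \<le> 0" using z unfolding ts .
    finally have "e i j o\<^sub>L adj (e i j) = 0" using eA(1)[OF ij]
      by (intro tau_faithful) (simp_all add: pos_op_mult_adj)
    then have "adj (adj (e i j)) o\<^sub>L adj (e i j) = 0" using eA(1)[OF ij] by simp
    then have "(norm (adj (e i j) x))\<^sup>2 = 0" for x
      using qf_adj_mult[of "adj (e i j)" x] eA(1)[OF ij] by (simp add: blinfun_simps clinear_adj)
    then have "adj (e i j) = 0" by (intro blinfun_eqI) simp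
    then have "adj (adj (e i j)) = 0" by (simp add: adj_simps)
    then show ?thesis using eA(1)[OF ij] by simp
  qed
qed

definition represents :: "('h \<Rightarrow>\<^sub>L 'h, 'b, 'm) module_scheme \<Rightarrow> nat \<Rightarrow> (nat \<Rightarrow> nat \<Rightarrow> ('h \<Rightarrow>\<^sub>L 'h)) \<Rightarrow> bool" where
  "represents P n e \<longleftrightarrow> proj_matrix A n e \<and>
     mod_isomorphic R P (restrict_mod (free_mod R n) (matrix_image A n e))"

text \<open>\<open>dim_proj\<close> picks a representing matrix by \<open>SOME\<close>, and the
  picked one is exposed here. Whether its trace vanishes is decided by the module alone, through
  \<open>represents_zero\<close> and \<open>represents_nonzero\<close>.\<close>

lemma dim_proj_some:
  assumes "represents P n e"
  obtains n' e' where "represents P n' e'" "dim_proj A tr P = trace_sum n' e'"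
proof -
  define p where "p = (SOME (n, e). represents P n e)"
  have "(\<lambda>(n, e). represents P n e) (n, e)" using assms by simp
  then have "(\<lambda>(n, e). represents P n e) p" unfolding p_def by (rule someI)
  then have "represents P (fst p) (snd p)" by (simp add: case_prod_beta)
  moreover have "dim_proj A tr P = trace_sum (fst p) (snd p)"
    unfolding dim_proj_def p_def represents_def by (simp add: Let_def case_prod_beta)
  ultimately show thesis by (rule that)
qed

lemma represents_zero:
  assumes "represents P n e" and z: "\<And>i j. i < n \<Longrightarrow> j < n \<Longrightarrow> e i j = 0"
    and xy: "x \<in> carrier P" "y \<in> carrier P"
  shows "x = y"
proof -
  obtain h where h: "h \<in> carrier P \<rightarrow> matrix_image A n e" "inj_on h (carrier P)"
    using assms(1) unfolding represents_def mod_isomorphic_def mod_iso_def mod_hom_def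
    by (auto simp: bij_betw_def restrict_mod_def)
  have c: "v = (\<lambda>j\<in>{..<n}. 0)" if v: "v \<in> matrix_image A n e" for v
  proof -
    obtain w where "v = (\<lambda>j\<in>{..<n}. \<Sum>i<n. w i o\<^sub>L e i j)" using v unfolding matrix_image_def by (rule imageE)
    then show ?thesis by (auto simp: fun_eq_iff z intro!: sum.neutral)
  qed
  have "h x = h y" using c[OF funcset_mem[OF h(1) xy(1)]] c[OF funcset_mem[OF h(1) xy(2)]] by simp
  then show ?thesis using h(2) xy by (simp add: inj_on_def)
qed

lemma represents_nonzero:
  assumes "represents P n e" and P: "\<And>x y. x \<in> carrier P \<Longrightarrow> y \<in> carrier P \<Longrightarrow> x = y"
    and ij: "i < n" "j < n"
  shows "e i j = 0"
proof -
  obtain h where h: "h ` carrier P = matrix_image A n e"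
    using assms(1) unfolding represents_def mod_isomorphic_def mod_iso_def
    by (auto simp: bij_betw_def restrict_mod_def)
  have eq: "v = w" if "v \<in> matrix_image A n e" "w \<in> matrix_image A n e" for v w
    using that P unfolding h[symmetric] by blast
  \<comment> \<open>The unit row vector at position \<open>i\<close>, whose image is the
    \<open>i\<close>-th row of \<open>e\<close>.\<close>
  define u :: "nat \<Rightarrow> 'h \<Rightarrow>\<^sub>L 'h" where "u = (\<lambda>k\<in>{..<n}. if k = i then id_blinfun else 0)"
  have u: "u \<in> carrier (free_mod R n)" by (auto simp: u_def free_mod_simps)
  have z: "(\<lambda>i\<in>{..<n}. 0) \<in> carrier (free_mod R n)" by (auto simp: free_mod_simps)
  have "(\<lambda>j\<in>{..<n}. \<Sum>k<n. u k o\<^sub>L e k j) = (\<lambda>j\<in>{..<n}. \<Sum>k<n. (\<lambda>i\<in>{..<n}. 0) k o\<^sub>L e k j)"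
    by (rule eq) (simp_all only: matrix_image_def, rule imageI[OF u], rule imageI[OF z])
  from fun_cong[OF this, of j] have "(\<Sum>k<n. u k o\<^sub>L e k j) = (\<Sum>k<n. (\<lambda>i\<in>{..<n}. 0) k o\<^sub>L e k j)"
    using ij by simp
  also have "\<dots> = 0" by (rule sum.neutral) simp
  also have "(\<Sum>k<n. u k o\<^sub>L e k j) = (\<Sum>k<n. if k = i then e k j else 0)"
    by (rule sum.cong) (auto simp: u_def)
  also have "\<dots> = e i j" using ij by simp
  finally show ?thesis .
qed

text \<open>The sum of the \<open>y i adj (y i)\<close> has the same left annihilator as the whole
  tuple, so the range projection of this one element serves.\<close>

lemma tuple_annihilator:
  fixes y :: "nat \<Rightarrow> ('h \<Rightarrow>\<^sub>L 'h)"
  assumes y: "\<And>i. i < n \<Longrightarrow> y i \<in> A"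
  obtains f where "projection f" "\<And>c. c \<in> A \<Longrightarrow> (\<forall>i<n. c o\<^sub>L y i = 0) \<longleftrightarrow> c o\<^sub>L f = 0"
proof -
  define G where "G = gram n (\<lambda>i. adj (y i))"
  have yA: "adj (y i) \<in> A" if "i < n" for i using y[OF that] by simp
  have G: "G \<in> A" "pos_op G" unfolding G_def by (rule gram_mem, rule yA, assumption, rule gram_pos, rule yA)
  have Gsum: "G = (\<Sum>i<n. y i o\<^sub>L adj (y i))" unfolding G_def gram_def using y by (intro sum.cong) simp_all
  obtain f where f: "projection f" "\<And>x. x \<in> A \<Longrightarrow> x o\<^sub>L G = 0 \<longleftrightarrow> x o\<^sub>L f = 0"
    by (rule left_annihilator[OF G(1)]) (rule that)
  have "(\<forall>i<n. c o\<^sub>L y i = 0) \<longleftrightarrow> c o\<^sub>L G = 0" if c: "c \<in> A" for c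
  proof
    assume "\<forall>i<n. c o\<^sub>L y i = 0"
    then have "c o\<^sub>L (y i o\<^sub>L adj (y i)) = 0" if "i < n" for i
      using that by (simp add: compose_assoc[symmetric])
    then show "c o\<^sub>L G = 0" unfolding Gsum compose_sum by (intro sum.neutral) simp
  next
    assume "c o\<^sub>L G = 0"
    then have "adj (c o\<^sub>L G) = 0" by (simp add: adj_simps)
    then have Gc: "G o\<^sub>L adj c = 0" using c G by (simp add: adj_simps pos_op_adj)
    show "\<forall>i<n. c o\<^sub>L y i = 0"
    proof (intro allI impI)
      fix i assume i: "i < n"
      have "adj (y i) o\<^sub>L adj c = 0"
        by (rule gram_zero[of n "\<lambda>i. adj (y i)"]) (rule yA, assumption, rule i, rule Gc[unfolded G_def])
      then have "adj (adj (y i) o\<^sub>L adj c) = 0" by (simp add: adj_simps)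
      then show "c o\<^sub>L y i = 0" using c y[OF i] by (simp add: adj_simps clinear_adj)
    qed
  qed
  with f show thesis by (intro that[of f]) blast+
qed

end

locale vn_module = finite_von_Neumann A tr + M: lmodule "vn_ring A" M
  for A :: "('h::chilbert \<Rightarrow>\<^sub>L 'h) set" and tr and M :: "('h \<Rightarrow>\<^sub>L 'h, 'b, 'm) module_scheme" (structure)
begin

lemma smult_closed' [simp]: "a \<in> A \<Longrightarrow> x \<in> carrier M \<Longrightarrow> a \<odot> x \<in> carrier M" using M.smult_closed[of a x] by simp

lemma smult_simps:
  "a \<in> A \<Longrightarrow> b \<in> A \<Longrightarrow> x \<in> carrier M \<Longrightarrow> (a + b) \<odot> x = a \<odot> x \<oplus> b \<odot> x"
  "a \<in> A \<Longrightarrow> x \<in> carrier M \<Longrightarrow> y \<in> carrier M \<Longrightarrow> a \<odot> (x \<oplus> y) = a \<odot> x \<oplus> a \<odot> y"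
  "a \<in> A \<Longrightarrow> b \<in> A \<Longrightarrow> x \<in> carrier M \<Longrightarrow> (a o\<^sub>L b) \<odot> x = a \<odot> (b \<odot> x)"
  "x \<in> carrier M \<Longrightarrow> id_blinfun \<odot> x = x" "x \<in> carrier M \<Longrightarrow> 0 \<odot> x = \<zero>"
  "a \<in> A \<Longrightarrow> a \<odot> \<zero> = \<zero>"
  "a \<in> A \<Longrightarrow> x \<in> carrier M \<Longrightarrow> y \<in> carrier M \<Longrightarrow> a \<odot> (x \<ominus> y) = a \<odot> x \<ominus> a \<odot> y"
  using M.smult_l_distr M.smult_r_distr M.smult_assoc1 M.smult_one M.smult_l_null M.smult_r_null M.smult_diff
  by simp_all

lemma smult_eq_of_diff_zero:
  assumes ab: "a \<in> A" "b \<in> A" and x: "x \<in> carrier M" and z: "(a - b) \<odot> x = \<zero>"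
  shows "a \<odot> x = b \<odot> x" using smult_simps(1)[of "a - b" b x] ab x z by simp

lemma smult_diff_zero:
  assumes ab: "a \<in> A" "b \<in> A" and x: "x \<in> carrier M" and e: "a \<odot> x = b \<odot> x"
  shows "(a - b) \<odot> x = \<zero>"
proof -
  have "(a - b) \<odot> x \<oplus> b \<odot> x = \<zero> \<oplus> b \<odot> x" using smult_simps(1)[of "a - b" b x] ab x e by simp
  then show ?thesis using ab x by (simp only: M.M.add.right_cancel smult_closed' mem_closed M.M.zero_closed)
qed

lemma ann_by_fix:
  assumes "ann_by M x e" "x \<in> carrier M" shows "e \<odot> x = x"
proof -
  have e: "projection e" "\<And>b. b \<in> A \<Longrightarrow> b \<odot> x = \<zero> \<longleftrightarrow> b o\<^sub>L e = 0" using assms(1) by (simp_all add: ann_by_def)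
  note eD = projectionD[OF e(1)]
  have "(e - id_blinfun) \<odot> x = \<zero>" using eD by (simp add: e(2) compose_distrib)
  then have "e \<odot> x = id_blinfun \<odot> x" by (rule smult_eq_of_diff_zero[rotated 3]) (use eD assms(2) in simp_all)
  then show ?thesis using assms(2) by (simp add: smult_simps)
qed

lemma cyclic_submodule:
  assumes "x \<in> carrier M" shows "submodule {a \<odot> x | a. a \<in> A} R M"
proof (rule M.submoduleI)
  show "\<zero> \<in> {a \<odot> x | a. a \<in> A}" using smult_simps(5)[OF assms] mem_0 by (metis (mono_tags, lifting) mem_Collect_eq)
  show "{a \<odot> x | a. a \<in> A} \<subseteq> carrier M" using assms by auto
  show "u \<oplus> v \<in> {a \<odot> x | a. a \<in> A}" if uv: "u \<in> {a \<odot> x | a. a \<in> A}" "v \<in> {a \<odot> x | a. a \<in> A}" for u v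
  proof -
    obtain a where a: "u = a \<odot> x" "a \<in> A" using uv by blast
    obtain b where b: "v = b \<odot> x" "b \<in> A" using uv by blast
    show ?thesis using a b assms by (intro CollectI exI[of _ "a + b"]) (simp add: smult_simps)
  qed
  show "c \<odot> u \<in> {a \<odot> x | a. a \<in> A}" if cu: "c \<in> carrier R" "u \<in> {a \<odot> x | a. a \<in> A}" for c u
  proof -
    obtain a where a: "u = a \<odot> x" "a \<in> A" using cu by blast
    show ?thesis using a cu assms by (intro CollectI exI[of _ "c o\<^sub>L a"]) (simp add: smult_simps)
  qed
qed

text \<open>\<open>a x = 0\<close> holds exactly if \<open>a e = 0\<close>, so \<open>a e\<close>
  and \<open>a x\<close> correspond to each other. The matrix has size 1, and its complement in the
  free module is given by \<open>1 - e\<close>.\<close>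

lemma cyclic_represents:
  assumes x: "x \<in> carrier M" and e: "ann_by M x e"
  defines "P \<equiv> restrict_mod M {a \<odot> x | a. a \<in> A}"
  shows "represents P 1 (\<lambda>_ _. e)" "fg_projective R P"
proof -
  let ?F = "free_mod R 1"
  have ep: "projection e" and ann: "\<And>b. b \<in> A \<Longrightarrow> b \<odot> x = \<zero> \<longleftrightarrow> b o\<^sub>L e = 0" using e by (simp_all add: ann_by_def)
  note eD = projectionD[OF ep]
  interpret P: lmodule R P unfolding P_def by (rule M.restrict_lmodule[OF cyclic_submodule[OF x]])
  interpret F: lmodule R ?F by (rule free_mod_lmodule[OF vn_ring])
  define vec :: "('h \<Rightarrow>\<^sub>L 'h) \<Rightarrow> nat \<Rightarrow> 'h \<Rightarrow>\<^sub>L 'h" where "vec = (\<lambda>a. \<lambda>j\<in>{..<1}. a)"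
  have vec: "vec a \<in> carrier ?F" if "a \<in> A" for a using that by (auto simp: vec_def free_mod_simps)
  have vec0: "vec a 0 = a" for a by (simp add: vec_def)
  have img: "matrix_image A 1 (\<lambda>_ _. f) = {vec (a o\<^sub>L f) | a. a \<in> A}" for f
  proof -
    have "v 0 \<in> A" if "v \<in> carrier ?F" for v using that by (simp add: free_mod_simps)
    moreover have "(\<lambda>j\<in>{..<1}. \<Sum>i<1. v i o\<^sub>L f) = vec (v 0 o\<^sub>L f)" for v :: "nat \<Rightarrow> 'h \<Rightarrow>\<^sub>L 'h" by (simp add: vec_def)
    ultimately show ?thesis unfolding matrix_image_def using vec vec0 by (auto simp: image_iff) metis
  qed
  have sub: "submodule (matrix_image A 1 (\<lambda>_ _. f)) R ?F" if f: "f \<in> A" for f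
    unfolding img
  proof (rule F.submoduleI)
    show "{vec (a o\<^sub>L f) | a. a \<in> A} \<subseteq> carrier ?F" using vec f by auto
    show "\<zero>\<^bsub>?F\<^esub> \<in> {vec (a o\<^sub>L f) | a. a \<in> A}"
      by (rule CollectI, rule exI[of _ 0]) (simp add: vec_def free_mod_def)
    show "u \<oplus>\<^bsub>?F\<^esub> v \<in> {vec (a o\<^sub>L f) | a. a \<in> A}"
      if uv: "u \<in> {vec (a o\<^sub>L f) | a. a \<in> A}" "v \<in> {vec (a o\<^sub>L f) | a. a \<in> A}" for u v
    proof -
      obtain a where a: "u = vec (a o\<^sub>L f)" "a \<in> A" using uv by blast
      obtain b where b: "v = vec (b o\<^sub>L f)" "b \<in> A" using uv by blast
      show ?thesis using a b f by (intro CollectI exI[of _ "a + b"] conjI)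
          (auto simp: vec_def free_mod_def compose_distrib fun_eq_iff)
    qed
    show "c \<odot>\<^bsub>?F\<^esub> u \<in> {vec (a o\<^sub>L f) | a. a \<in> A}"
      if cu: "c \<in> carrier R" "u \<in> {vec (a o\<^sub>L f) | a. a \<in> A}" for c u
    proof -
      obtain a where a: "u = vec (a o\<^sub>L f)" "a \<in> A" using cu by blast
      show ?thesis using a cu by (intro CollectI exI[of _ "c o\<^sub>L a"] conjI)
          (auto simp: vec_def free_mod_def compose_assoc fun_eq_iff)
    qed
  qed
  define S where "S = matrix_image A 1 (\<lambda>_ _. e)"
  define S' where "S' = matrix_image A 1 (\<lambda>_ _. id_blinfun - e)"
  have S: "submodule S R ?F" "submodule S' R ?F"
    unfolding S_def S'_def by (rule sub, use eD in simp)+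
  interpret SM: lmodule R "restrict_mod ?F S" by (rule F.restrict_lmodule[OF S(1)])
  have Sv: "v \<in> S \<longleftrightarrow> (\<exists>a\<in>A. v = vec (a o\<^sub>L e))" for v unfolding S_def img by blast
  have "(\<lambda>v. v 0 \<odot> x) \<in> mod_iso R (restrict_mod ?F S) P"
    unfolding mod_iso_def
  proof (intro CollectI conjI mod_homI)
    have S0: "v 0 \<in> A" if "v \<in> S" for v using that eD by (auto simp: Sv vec0)
    show "v 0 \<odot> x \<in> carrier P" if "v \<in> carrier (restrict_mod ?F S)" for v
      using that S0 by (auto simp: P_def restrict_mod_def)
    show "(v \<oplus>\<^bsub>restrict_mod ?F S\<^esub> w) 0 \<odot> x = v 0 \<odot> x \<oplus>\<^bsub>P\<^esub> w 0 \<odot> x"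
      if "v \<in> carrier (restrict_mod ?F S)" "w \<in> carrier (restrict_mod ?F S)" for v w
      using that S0[of v] S0[of w] x by (simp add: P_def restrict_mod_def free_mod_simps smult_simps)
    show "(a \<odot>\<^bsub>restrict_mod ?F S\<^esub> v) 0 \<odot> x = a \<odot>\<^bsub>P\<^esub> (v 0 \<odot> x)"
      if "a \<in> carrier R" "v \<in> carrier (restrict_mod ?F S)" for a v
      using that S0[of v] x by (simp add: P_def restrict_mod_def free_mod_simps smult_simps)
    show "bij_betw (\<lambda>v. v 0 \<odot> x) (carrier (restrict_mod ?F S)) (carrier P)"
    proof (rule bij_betwI')
      fix v w assume "v \<in> carrier (restrict_mod ?F S)" "w \<in> carrier (restrict_mod ?F S)"
      then obtain a b where ab: "a \<in> A" "v = vec (a o\<^sub>L e)" "b \<in> A" "w = vec (b o\<^sub>L e)" by (auto simp: restrict_mod_def Sv)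
      show "(v 0 \<odot> x = w 0 \<odot> x) = (v = w)"
      proof
        assume "v 0 \<odot> x = w 0 \<odot> x"
        then have "a \<odot> x = b \<odot> x" using ab x eD by (simp add: vec0 smult_simps ann_by_fix[OF e x])
        then have "(a - b) \<odot> x = \<zero>" by (rule smult_diff_zero[OF ab(1,3) x])
        then have "(a - b) o\<^sub>L e = 0" using ann[of "a - b"] ab by simp
        then show "v = w" using ab by (simp add: compose_distrib)
      qed simp
    next
      fix v assume "v \<in> carrier (restrict_mod ?F S)"
      then show "v 0 \<odot> x \<in> carrier P" using S0 by (auto simp: P_def restrict_mod_def)
    next
      fix y assume "y \<in> carrier P"
      then obtain a where a: "a \<in> A" "y = a \<odot> x" by (auto simp: P_def restrict_mod_def)
      have "y = vec (a o\<^sub>L e) 0 \<odot> x" using a x eD by (simp add: vec0 smult_simps ann_by_fix[OF e x])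
      moreover have "vec (a o\<^sub>L e) \<in> S" using a(1) by (auto simp: Sv)
      ultimately show "\<exists>v\<in>carrier (restrict_mod ?F S). y = v 0 \<odot> x"
        by (auto simp: restrict_mod_def)
    qed
  qed
  then have iso: "mod_isomorphic R P (restrict_mod ?F S)"
    by (intro mod_isomorphic_sym[OF SM.lmodule_axioms P.lmodule_axioms] mod_isomorphicI)
  have "proj_matrix A 1 (\<lambda>_ _. e)" using eD by (simp add: proj_matrix_def)
  then show "represents P 1 (\<lambda>_ _. e)" using iso unfolding represents_def S_def by simp
  have "S \<inter> S' = {\<zero>\<^bsub>?F\<^esub>}"
  proof
    show "S \<inter> S' \<subseteq> {\<zero>\<^bsub>?F\<^esub>}"
    proof
      fix v assume "v \<in> S \<inter> S'"
      then obtain a b where ab: "v = vec (a o\<^sub>L e)" "a \<in> A" "v = vec (b o\<^sub>L (id_blinfun - e))" "b \<in> A"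
        unfolding S_def S'_def img by blast
      then have "a o\<^sub>L e = b o\<^sub>L (id_blinfun - e)" by (metis vec0)
      then have "(a o\<^sub>L e) o\<^sub>L e = (b o\<^sub>L (id_blinfun - e)) o\<^sub>L e" by simp
      then have "a o\<^sub>L e = 0" using eD by (simp add: compose_assoc compose_distrib)
      then show "v \<in> {\<zero>\<^bsub>?F\<^esub>}" using ab by (simp add: vec_def free_mod_def)
    qed
  qed (use F.submoduleD(2)[OF S(1)] F.submoduleD(2)[OF S(2)] in blast)
  moreover have "S <+>\<^bsub>?F\<^esub> S' = carrier ?F"
  proof
    show "S <+>\<^bsub>?F\<^esub> S' \<subseteq> carrier ?F"
    proof
      fix v assume "v \<in> S <+>\<^bsub>?F\<^esub> S'"
      then obtain p q where "v = p \<oplus>\<^bsub>?F\<^esub> q" "p \<in> S" "q \<in> S'"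
        unfolding set_add_def' by blast
      then show "v \<in> carrier ?F"
        using F.M.a_closed[OF F.submoduleD(7)[OF S(1)] F.submoduleD(7)[OF S(2)]] by (simp only:)
    qed
    show "carrier ?F \<subseteq> S <+>\<^bsub>?F\<^esub> S'"
    proof
      fix v assume v: "v \<in> carrier ?F"
      then have v0: "v 0 \<in> A" by (simp add: free_mod_simps)
      have "v = vec (v 0 o\<^sub>L e) \<oplus>\<^bsub>?F\<^esub> vec (v 0 o\<^sub>L (id_blinfun - e))"
        using v v0 eD by (intro ext) (simp add: free_mod_simps vec_def compose_distrib)
      moreover have "vec (v 0 o\<^sub>L e) \<in> S" "vec (v 0 o\<^sub>L (id_blinfun - e)) \<in> S'"
        unfolding S_def S'_def img by (rule CollectI, rule exI[of _ "v 0"], intro conjI refl v0)+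
      ultimately show "v \<in> S <+>\<^bsub>?F\<^esub> S'" unfolding set_add_def' by blast
    qed
  qed
  ultimately show "fg_projective R P"
    unfolding fg_projective_def left_module_iff using P.lmodule_axioms S iso by blast
qed

lemma zero_represents:
  defines "P \<equiv> restrict_mod M {\<zero>}"
  shows "represents P 0 e" "fg_projective R P"
proof -
  let ?F = "free_mod R 0"
  interpret P: lmodule R P unfolding P_def by (rule M.restrict_lmodule[OF M.submodule_zero])
  interpret F: lmodule R ?F by (rule free_mod_lmodule[OF vn_ring])
  have c0: "carrier ?F = {\<zero>\<^bsub>?F\<^esub>}" by (auto simp: free_mod_def)
  have img: "matrix_image A 0 e = carrier ?F"
    unfolding matrix_image_def c0 by (auto simp: free_mod_def)
  have "(\<lambda>_. \<zero>\<^bsub>?F\<^esub>) \<in> mod_iso R P ?F"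
    unfolding mod_iso_def
    by (intro CollectI conjI mod_homI) (simp_all add: P_def c0 bij_betw_def F.smult_r_null[simplified])
  then have iso: "mod_isomorphic R P (restrict_mod ?F (carrier ?F))"
    unfolding F.restrict_carrier by (rule mod_isomorphicI)
  show "represents P 0 e" unfolding represents_def img using iso by (simp add: proj_matrix_def)
  have "carrier ?F <+>\<^bsub>?F\<^esub> carrier ?F = carrier ?F"
    unfolding set_add_def' c0 by simp
  then show "fg_projective R P"
    unfolding fg_projective_def left_module_iff using P.lmodule_axioms F.submodule_carrier iso c0 by blast
qed

text \<open>Inside a free module an element is a tuple of elements of \<open>A\<close>, and
  \<open>tuple_annihilator\<close> applies to its coordinates.\<close>

lemma fg_projective_annihilator:
  assumes P: "fg_projective R M" and x: "x \<in> carrier M"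
  obtains e where "ann_by M x e"
proof -
  obtain n S where S: "submodule S R (free_mod R n)"
    and iso: "mod_isomorphic R M (restrict_mod (free_mod R n) S)"
    using P unfolding fg_projective_def by blast
  let ?F = "free_mod R n"
  interpret F: lmodule R ?F by (rule free_mod_lmodule[OF vn_ring])
  interpret SM: lmodule R "restrict_mod ?F S" by (rule F.restrict_lmodule[OF S])
  obtain h where h: "h \<in> mod_hom R M (restrict_mod ?F S)" "inj_on h (carrier M)"
    using iso unfolding mod_isomorphic_def mod_iso_def bij_betw_def by blast
  interpret h: lmodule_hom R M "restrict_mod ?F S" h
    by (simp add: lmodule_hom_def lmodule_hom_axioms_def M.lmodule_axioms SM.lmodule_axioms h)
  define y where "y = h x"
  have y: "y \<in> carrier ?F" using h.hom_closed[OF x] F.submoduleD(7)[OF S] by (simp add: y_def)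
  then have yA: "y i \<in> A" if "i < n" for i using that by (simp add: free_mod_simps)
  obtain f where f: "projection f" "\<And>c. c \<in> A \<Longrightarrow> (\<forall>i<n. c o\<^sub>L y i = 0) \<longleftrightarrow> c o\<^sub>L f = 0"
    by (rule tuple_annihilator[of n y]) (rule yA, assumption, rule that)
  have "b \<odot> x = \<zero> \<longleftrightarrow> b o\<^sub>L f = 0" if b: "b \<in> A" for b
  proof -
    have bc: "b \<in> carrier R" using b by simp
    have "b \<odot> x = \<zero> \<longleftrightarrow> h (b \<odot> x) = h \<zero>" using h(2) b x by (metis M.M.zero_closed inj_onD smult_closed')
    also have "\<dots> \<longleftrightarrow> b \<odot>\<^bsub>?F\<^esub> y = \<zero>\<^bsub>?F\<^esub>"
      using h.hom_smult[OF bc x] h.hom_zero by (simp add: y_def)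
    also have "\<dots> \<longleftrightarrow> (\<forall>i<n. b o\<^sub>L y i = 0)"
    proof
      assume e: "b \<odot>\<^bsub>?F\<^esub> y = \<zero>\<^bsub>?F\<^esub>"
      show "\<forall>i<n. b o\<^sub>L y i = 0" using fun_cong[OF e] by (simp add: free_mod_def) metis
    next
      assume z: "\<forall>i<n. b o\<^sub>L y i = 0"
      show "b \<odot>\<^bsub>?F\<^esub> y = \<zero>\<^bsub>?F\<^esub>"
        using z by (auto simp: free_mod_def fun_eq_iff)
    qed
    also have "\<dots> \<longleftrightarrow> b o\<^sub>L f = 0" by (rule f(2)[OF b])
    finally show ?thesis .
  qed
  then show thesis using f(1) by (intro that[of f]) (simp add: ann_by_def)
qed

text \<open>If \<open>x\<close> has a projection \<open>e\<close>, then \<open>A x\<close> is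
  projective; dimension zero makes its matrix, and so \<open>A x\<close>, vanish. Conversely every
  element of a projective submodule has such a projection, so only the zero submodule contributes to
  the supremum.\<close>

lemma dim_zero_iff:
  "dim_mod A tr M = 0 \<longleftrightarrow> (\<forall>x\<in>carrier M. \<forall>e. ann_by M x e \<longrightarrow> x = \<zero>)"
proof
  assume d: "dim_mod A tr M = 0"
  show "\<forall>x\<in>carrier M. \<forall>e. ann_by M x e \<longrightarrow> x = \<zero>"
  proof (intro ballI allI impI)
    fix x e assume x: "x \<in> carrier M" and e: "ann_by M x e"
    define N where "N = {a \<odot> x | a. a \<in> A}"
    have N: "submodule N R M" unfolding N_def by (rule cyclic_submodule[OF x])
    have rep: "represents (restrict_mod M N) 1 (\<lambda>_ _. e)" "fg_projective R (restrict_mod M N)"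
      unfolding N_def by (rule cyclic_represents[OF x e])+
    obtain n e' where e': "represents (restrict_mod M N) n e'" "dim_proj A tr (restrict_mod M N) = trace_sum n e'"
      by (rule dim_proj_some[OF rep(1)])
    have "ereal (dim_proj A tr (restrict_mod M N)) \<le> dim_mod A tr M"
      unfolding dim_mod_def using N rep(2) by (intro SUP_upper) simp
    then have le: "trace_sum n e' \<le> 0" using e'(2) d by simp
    have z: "e' i j = 0" if "i < n" "j < n" for i j
      by (rule proj_matrix_trace(2)[of n e']) (use e'(1) le that in \<open>simp_all only: represents_def\<close>)
    have "x \<in> N" unfolding N_def using x by (intro CollectI exI[of _ id_blinfun]) (simp add: smult_simps)
    moreover have "\<zero> \<in> N" by (rule M.submoduleD(2)[OF N])
    ultimately show "x = \<zero>" by (intro represents_zero[OF e'(1) z]) simp_all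
  qed
next
  assume t: "\<forall>x\<in>carrier M. \<forall>e. ann_by M x e \<longrightarrow> x = \<zero>"
  have "P = {\<zero>}" if P: "submodule P R M" "fg_projective R (restrict_mod M P)" for P
  proof -
    interpret P: lmodule R "restrict_mod M P" by (rule M.restrict_lmodule[OF P(1)])
    interpret PV: vn_module A tr "restrict_mod M P" by unfold_locales
    have "x = \<zero>" if x: "x \<in> P" for x
    proof -
      have "x \<in> carrier (restrict_mod M P)" using x by simp
      then obtain e where "ann_by (restrict_mod M P) x e" by (rule PV.fg_projective_annihilator[OF P(2)])
      then have "ann_by M x e" by (simp add: ann_by_def)
      then show ?thesis using t M.submoduleD(7)[OF P(1) x] by blast
    qed
    then show ?thesis using M.submoduleD(2)[OF P(1)] by blast
  qed
  then have "{P. submodule P R M \<and> fg_projective R (restrict_mod M P)} = {{\<zero>}}"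
    using M.submodule_zero zero_represents(2) by blast
  then have "dim_mod A tr M = ereal (dim_proj A tr (restrict_mod M {\<zero>}))" by (simp add: dim_mod_def)
  also have "dim_proj A tr (restrict_mod M {\<zero>}) = 0"
  proof -
    obtain n e' where e': "represents (restrict_mod M {\<zero>}) n e'" "dim_proj A tr (restrict_mod M {\<zero>}) = trace_sum n e'"
      by (rule dim_proj_some[OF zero_represents(1)])
    have "e' i j = 0" if "i < n" "j < n" for i j by (rule represents_nonzero[OF e'(1) _ that]) simp
    moreover have "tr 0 = 0" using tr_add[of 0 0] by simp
    ultimately show ?thesis using e'(2) by simp
  qed
  finally show "dim_mod A tr M = 0" by (simp add: zero_ereal_def)
qed

end

section \<open>The two torsion submodules in terms of annihilators\<close>

context finite_von_Neumann
begin

text \<open>If the annihilator of \<open>x\<close> is \<open>A (1 - e)\<close>, then \<open>A x\<close> is isomorphic to the projective module \<open>A e\<close>.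
  So \<open>torsion M\<close> consists of the elements none of whose multiples generates a nonzero projective
  submodule.\<close>

definition torsion :: "('h \<Rightarrow>\<^sub>L 'h, 'b, 'm) module_scheme \<Rightarrow> 'b set" where
  "torsion M = {x \<in> carrier M. \<forall>a\<in>A. \<forall>e. ann_by M (a \<odot>\<^bsub>M\<^esub> x) e \<longrightarrow> a \<odot>\<^bsub>M\<^esub> x = \<zero>\<^bsub>M\<^esub>}"

definition nzd_torsion :: "('h \<Rightarrow>\<^sub>L 'h, 'b, 'm) module_scheme \<Rightarrow> 'b set" where
  "nzd_torsion M = {x \<in> carrier M. \<exists>s\<in>nzd. s \<odot>\<^bsub>M\<^esub> x = \<zero>\<^bsub>M\<^esub>}"

lemma torsionD: "x \<in> torsion M \<Longrightarrow> a \<in> A \<Longrightarrow> ann_by M (a \<odot>\<^bsub>M\<^esub> x) e \<Longrightarrow> a \<odot>\<^bsub>M\<^esub> x = \<zero>\<^bsub>M\<^esub>"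
  unfolding torsion_def by blast

lemma torsionI:
  "x \<in> carrier M \<Longrightarrow> (\<And>a e. a \<in> A \<Longrightarrow> ann_by M (a \<odot>\<^bsub>M\<^esub> x) e \<Longrightarrow> a \<odot>\<^bsub>M\<^esub> x = \<zero>\<^bsub>M\<^esub>) \<Longrightarrow> x \<in> torsion M"
  unfolding torsion_def by blast

lemma ann_byD:
  assumes "ann_by M x e"
  shows "projection e" and "b \<in> A \<Longrightarrow> b \<odot>\<^bsub>M\<^esub> x = \<zero>\<^bsub>M\<^esub> \<longleftrightarrow> b o\<^sub>L e = 0"
  using assms unfolding ann_by_def by blast+

end

context vn_module
begin

lemma torsion_carrier: "x \<in> torsion M \<Longrightarrow> x \<in> carrier M" by (simp add: torsion_def)

lemma torsion_smult:
  assumes "c \<in> A" "x \<in> torsion M" shows "c \<odot> x \<in> torsion M"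
proof (rule torsionI)
  show "c \<odot> x \<in> carrier M" using assms torsion_carrier by simp
  fix a e assume a: "a \<in> A" "ann_by M (a \<odot> (c \<odot> x)) e"
  have eq: "(a o\<^sub>L c) \<odot> x = a \<odot> (c \<odot> x)"
    by (rule smult_simps(3)[OF a(1) assms(1) torsion_carrier[OF assms(2)]])
  show "a \<odot> (c \<odot> x) = \<zero>" using torsionD[OF assms(2), of "a o\<^sub>L c" e] a assms(1) unfolding eq by simp
qed

lemma ann_by_zero:
  assumes x: "x \<in> carrier M" and e: "ann_by M x e" and z: "e = 0" shows "x = \<zero>"
  using ann_byD(2)[OF e mem_id] x z by (simp add: smult_simps)

text \<open>\<open>A b z\<close> is isomorphic to \<open>A b e\<close>, which is again cut out by a
  projection, the range projection of \<open>b e\<close>. A torsion element of this kind is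
  zero.\<close>

lemma torsion_multiple_zero:
  assumes z: "z \<in> carrier M" and e: "ann_by M z e" and b: "b \<in> A" and t: "b \<odot> z \<in> torsion M"
  shows "b \<odot> z = \<zero>"
proof -
  have eA: "e \<in> A" by (rule projectionD(1)[OF ann_byD(1)[OF e]])
  obtain f where f: "projection f" "\<And>c. c \<in> A \<Longrightarrow> c o\<^sub>L (b o\<^sub>L e) = 0 \<longleftrightarrow> c o\<^sub>L f = 0"
    by (rule left_annihilator[of "b o\<^sub>L e"]) (use b eA in simp, rule that)
  have bz: "b \<odot> z \<in> carrier M" using b z by simp
  have "c \<odot> (b \<odot> z) = \<zero> \<longleftrightarrow> c o\<^sub>L f = 0" if c: "c \<in> A" for c
  proof -
    have "c \<odot> (b \<odot> z) = \<zero> \<longleftrightarrow> (c o\<^sub>L b) o\<^sub>L e = 0"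
      using ann_byD(2)[OF e, of "c o\<^sub>L b"] b c smult_simps(3)[OF c b z] by simp
    then show ?thesis using f(2)[OF c] by (simp add: compose_assoc)
  qed
  then have "ann_by M (b \<odot> z) f" using f(1) by (simp add: ann_by_def)
  then show ?thesis using torsionD[OF t mem_id, of f] bz by (simp add: smult_simps)
qed

text \<open>Let \<open>e\<close> belong to the sum \<open>z\<close> of the multiples
  \<open>x'\<close> and \<open>y'\<close>. If \<open>b\<close> kills \<open>x'\<close>, then
  \<open>b z = b y'\<close> is a torsion multiple of \<open>z\<close>, hence zero. So
  \<open>e\<close> also cuts out the annihilator of \<open>e x'\<close>, and torsion of
  \<open>x'\<close> forces \<open>e = 0\<close>.\<close>

lemma torsion_add:
  assumes x: "x \<in> torsion M" and y: "y \<in> torsion M" shows "x \<oplus> y \<in> torsion M"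
proof (rule torsionI)
  note xc = torsion_carrier[OF x] and yc = torsion_carrier[OF y]
  show "x \<oplus> y \<in> carrier M" using xc yc by simp
  fix a e assume a: "a \<in> A" and e: "ann_by M (a \<odot> (x \<oplus> y)) e"
  define x' where "x' = a \<odot> x"
  define y' where "y' = a \<odot> y"
  define z where "z = x' \<oplus> y'"
  have z: "a \<odot> (x \<oplus> y) = z" using a xc yc by (simp add: z_def x'_def y'_def smult_simps)
  have t: "x' \<in> torsion M" "y' \<in> torsion M" using a x y by (simp_all add: x'_def y'_def torsion_smult)
  have c: "x' \<in> carrier M" "y' \<in> carrier M" "z \<in> carrier M" using t torsion_carrier by (simp_all add: z_def)
  note e = e[unfolded z]
  note ep = projectionD[OF ann_byD(1)[OF e]]
  have key: "b o\<^sub>L e = 0" if b: "b \<in> A" and bx: "b \<odot> x' = \<zero>" for b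
  proof -
    have "b \<odot> z = b \<odot> y'" using b bx c by (simp add: z_def smult_simps)
    then have "b \<odot> z \<in> torsion M" using torsion_smult[OF b t(2)] by simp
    then have "b \<odot> z = \<zero>" by (rule torsion_multiple_zero[OF c(3) e b])
    then show ?thesis using ann_byD(2)[OF e b] by simp
  qed
  have "b \<odot> (e \<odot> x') = \<zero> \<longleftrightarrow> b o\<^sub>L e = 0" if b: "b \<in> A" for b
  proof
    assume "b \<odot> (e \<odot> x') = \<zero>"
    then have "(b o\<^sub>L e) o\<^sub>L e = 0" using b ep c by (intro key) (simp_all add: smult_simps)
    then show "b o\<^sub>L e = 0" using ep by (simp add: compose_assoc)
  next
    assume be: "b o\<^sub>L e = 0"
    have "b \<odot> (e \<odot> x') = (b o\<^sub>L e) \<odot> x'" by (rule smult_simps(3)[symmetric, OF b ep(1) c(1)])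
    then show "b \<odot> (e \<odot> x') = \<zero>" unfolding be using c by (simp add: smult_simps)
  qed
  then have "ann_by M (e \<odot> x') e" using ann_byD(1)[OF e] by (simp add: ann_by_def)
  then have "e \<odot> x' = \<zero>" by (rule torsionD[OF t(1) ep(1)])
  then have "e o\<^sub>L e = 0" by (rule key[OF ep(1)])
  then have "e = 0" using ep(2) by simp
  then show "a \<odot> (x \<oplus> y) = \<zero>" unfolding z by (rule ann_by_zero[OF c(3) e])
qed

lemma torsion_zero: "\<zero> \<in> torsion M" by (rule torsionI) (simp_all add: smult_simps)

lemma torsion_submodule: "submodule (torsion M) R M"
  by (rule M.submoduleI) (use torsion_carrier torsion_zero torsion_add torsion_smult in auto)

text \<open>\<open>ann_by\<close> does not notice the restriction to \<open>N\<close>, and closure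
  of \<open>N\<close> under multiples absorbs the multiplier in the definition of
  \<open>torsion\<close>.\<close>

lemma dim_zero_submodule_iff:
  assumes N: "submodule N R M"
  shows "dim_mod A tr (restrict_mod M N) = 0 \<longleftrightarrow> N \<subseteq> torsion M"
proof -
  interpret NM: lmodule R "restrict_mod M N" by (rule M.restrict_lmodule[OF N])
  interpret NV: vn_module A tr "restrict_mod M N" by unfold_locales
  have ann: "ann_by (restrict_mod M N) x e \<longleftrightarrow> ann_by M x e" for x e by (simp add: ann_by_def)
  have "(\<forall>x\<in>N. \<forall>e. ann_by M x e \<longrightarrow> x = \<zero>) \<longleftrightarrow> N \<subseteq> torsion M"
  proof
    assume l: "\<forall>x\<in>N. \<forall>e. ann_by M x e \<longrightarrow> x = \<zero>"
    show "N \<subseteq> torsion M"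
    proof
      fix x assume x: "x \<in> N"
      show "x \<in> torsion M"
      proof (rule torsionI)
        show "x \<in> carrier M" by (rule M.submoduleD(7)[OF N x])
        fix a e assume a: "a \<in> A" "ann_by M (a \<odot> x) e"
        have "a \<odot> x \<in> N" using M.submoduleD(4)[OF N _ x, of a] a by simp
        then show "a \<odot> x = \<zero>" using l a(2) by blast
      qed
    qed
  next
    assume s: "N \<subseteq> torsion M"
    show "\<forall>x\<in>N. \<forall>e. ann_by M x e \<longrightarrow> x = \<zero>"
    proof (intro ballI allI impI)
      fix x e assume x: "x \<in> N" "ann_by M x e"
      have "x \<in> torsion M" using s x by blast
      then show "x = \<zero>" using torsionD[of x M id_blinfun e] x(2) torsion_carrier[of x]
        by (simp add: smult_simps)
    qed
  qed
  then show ?thesis unfolding NV.dim_zero_iff ann by simp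
qed

theorem T_sub_eq: "T_sub A tr M = torsion M" unfolding T_sub_def
  by (rule Greatest_equality) (use dim_zero_submodule_iff torsion_submodule in blast)+

lemma quot_vn_module: "submodule K R M \<Longrightarrow> vn_module A tr (quot_mod M K)"
  unfolding vn_module_def using finite_von_Neumann_axioms M.quot_lmodule by blast

lemma ann_by_quot:
  assumes K: "submodule K R M" and x: "x \<in> carrier M"
  shows "ann_by (quot_mod M K) (K +> x) e \<longleftrightarrow> projection e \<and> (\<forall>b\<in>A. b \<odot> x \<in> K \<longleftrightarrow> b o\<^sub>L e = 0)"
  unfolding ann_by_def using x by (simp add: M.quot_smult[OF K] M.quot_eq_zero_iff[OF K])

lemma torsion_quot_iff:
  assumes K: "submodule K R M" and x: "x \<in> carrier M"
  shows "K +> x \<in> torsion (quot_mod M K) \<longleftrightarrow>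
    (\<forall>a\<in>A. \<forall>e. projection e \<and> (\<forall>b\<in>A. b \<odot> (a \<odot> x) \<in> K \<longleftrightarrow> b o\<^sub>L e = 0) \<longrightarrow> a \<odot> x \<in> K)"
proof -
  have "ann_by (quot_mod M K) (a \<odot>\<^bsub>quot_mod M K\<^esub> (K +> x)) e \<longleftrightarrow>
      projection e \<and> (\<forall>b\<in>A. b \<odot> (a \<odot> x) \<in> K \<longleftrightarrow> b o\<^sub>L e = 0)" if "a \<in> A" for a e
    using ann_by_quot[OF K, of "a \<odot> x" e] that x by (simp add: M.quot_smult[OF K])
  moreover have "a \<odot>\<^bsub>quot_mod M K\<^esub> (K +> x) = \<zero>\<^bsub>quot_mod M K\<^esub> \<longleftrightarrow> a \<odot> x \<in> K" if "a \<in> A" for a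
    using that x by (simp add: M.quot_smult[OF K] M.quot_eq_zero_iff[OF K])
  ultimately show ?thesis unfolding torsion_def using M.quot_carrierI[OF x, of K] by blast
qed

text \<open>Torsion of the quotient by a torsion submodule is the quotient of the torsion. One
  direction holds because torsion multiples of an element with a projection vanish, so annihilators
  modulo \<open>N\<close> and in \<open>M\<close> agree. For the other, \<open>a x\<close> is
  replaced by \<open>e a x\<close>, whose annihilator in \<open>M\<close> itself is cut out by
  \<open>e\<close>.\<close>

lemma torsion_quot_torsion_iff:
  assumes N: "submodule N R M" and NT: "N \<subseteq> torsion M" and x: "x \<in> carrier M"
  shows "N +> x \<in> torsion (quot_mod M N) \<longleftrightarrow> x \<in> torsion M" unfolding torsion_quot_iff[OF N x]
proof
  assume l: "\<forall>a\<in>A. \<forall>e. projection e \<and> (\<forall>b\<in>A. b \<odot> (a \<odot> x) \<in> N \<longleftrightarrow> b o\<^sub>L e = 0) \<longrightarrow> a \<odot> x \<in> N"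
  show "x \<in> torsion M"
  proof (rule torsionI[OF x])
    fix a e assume a: "a \<in> A" and e: "ann_by M (a \<odot> x) e"
    have ax: "a \<odot> x \<in> carrier M" using a x by simp
    have N0: "b \<odot> (a \<odot> x) \<in> N \<longleftrightarrow> b o\<^sub>L e = 0" if b: "b \<in> A" for b unfolding ann_byD(2)[OF e b, symmetric]
    proof
      assume "b \<odot> (a \<odot> x) \<in> N"
      then have "b \<odot> (a \<odot> x) \<in> torsion M" using NT by blast
      then show "b \<odot> (a \<odot> x) = \<zero>" by (rule torsion_multiple_zero[OF ax e b])
    qed (simp add: M.submoduleD(2)[OF N])
    have "a \<odot> x \<in> N" using l a ann_byD(1)[OF e] N0 by blast
    then have "a \<odot> x \<in> torsion M" using NT by blast
    then show "a \<odot> x = \<zero>" using torsion_multiple_zero[OF ax e mem_id] ax by (simp add: smult_simps)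
  qed
next
  assume t: "x \<in> torsion M"
  show "\<forall>a\<in>A. \<forall>e. projection e \<and> (\<forall>b\<in>A. b \<odot> (a \<odot> x) \<in> N \<longleftrightarrow> b o\<^sub>L e = 0) \<longrightarrow> a \<odot> x \<in> N"
  proof (intro ballI allI impI)
    fix a e assume a: "a \<in> A" and e: "projection e \<and> (\<forall>b\<in>A. b \<odot> (a \<odot> x) \<in> N \<longleftrightarrow> b o\<^sub>L e = 0)"
    have e2: "b \<odot> (a \<odot> x) \<in> N \<longleftrightarrow> b o\<^sub>L e = 0" if "b \<in> A" for b using e that by blast
    note eD = projectionD[OF conjunct1[OF e]]
    have ax: "a \<odot> x \<in> carrier M" using a x by simp
    have "b \<odot> ((e o\<^sub>L a) \<odot> x) = \<zero> \<longleftrightarrow> b o\<^sub>L e = 0" if b: "b \<in> A" for b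
    proof
      assume "b \<odot> ((e o\<^sub>L a) \<odot> x) = \<zero>"
      then have "(b o\<^sub>L e) \<odot> (a \<odot> x) \<in> N" using b a x eD(1) M.submoduleD(2)[OF N] by (simp add: smult_simps)
      then have "(b o\<^sub>L e) o\<^sub>L e = 0" using e2[of "b o\<^sub>L e"] b eD(1) by simp
      then show "b o\<^sub>L e = 0" using eD by (simp add: compose_assoc)
    next
      assume be: "b o\<^sub>L e = 0"
      have "b \<odot> ((e o\<^sub>L a) \<odot> x) = (b o\<^sub>L e) \<odot> (a \<odot> x)" using b a x eD(1) by (simp add: smult_simps)
      then show "b \<odot> ((e o\<^sub>L a) \<odot> x) = \<zero>" unfolding be using ax by (simp add: smult_simps)
    qed
    then have "ann_by M ((e o\<^sub>L a) \<odot> x) e" using e by (simp add: ann_by_def)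
    then have "(e o\<^sub>L a) \<odot> x = \<zero>" using a eD(1) by (intro torsionD[OF t]) simp_all
    then have "e \<odot> (a \<odot> x) \<in> N" using a x eD(1) M.submoduleD(2)[OF N] by (simp add: smult_simps)
    then have "e = 0" using e2[OF eD(1)] eD(2) by simp
    then show "a \<odot> x \<in> N" using e2[OF mem_id] ax by (simp add: smult_simps)
  qed
qed

text \<open>The Ore condition moves the regular annihilator of \<open>x\<close> past
  \<open>a\<close>. A regular \<open>t\<close> with \<open>t (a x) = 0\<close> satisfies
  \<open>t e = 0\<close>, so \<open>e = 0\<close>.\<close>

lemma nzd_torsion_subset: "nzd_torsion M \<subseteq> torsion M"
proof
  fix x assume "x \<in> nzd_torsion M"
  then obtain s where x: "x \<in> carrier M" and s: "s \<in> nzd" "s \<odot> x = \<zero>" unfolding nzd_torsion_def by blast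
  show "x \<in> torsion M"
  proof (rule torsionI[OF x])
    fix a e assume a: "a \<in> A" and e: "ann_by M (a \<odot> x) e"
    obtain t c where tc: "t \<in> nzd" "c \<in> A" "t o\<^sub>L a = c o\<^sub>L s" by (rule left_Ore[OF a s(1)]) (rule that)
    have "t \<odot> (a \<odot> x) = (t o\<^sub>L a) \<odot> x" using tc(1) a x by (simp add: smult_simps)
    also have "\<dots> = \<zero>" unfolding tc(3) using tc(2) s x by (simp add: smult_simps)
    finally have "t o\<^sub>L e = 0" using ann_byD(2)[OF e, of t] tc(1) by simp
    then have "e = 0" by (rule nzd_cancel_left[OF tc(1)])
    then show "a \<odot> x = \<zero>" using a x by (intro ann_by_zero[OF _ e]) simp_all
  qed
qed

lemma nzd_torsion_submodule: "submodule (nzd_torsion M) R M"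
proof (rule M.submoduleI)
  show "nzd_torsion M \<subseteq> carrier M" by (auto simp: nzd_torsion_def)
  show "\<zero> \<in> nzd_torsion M" unfolding nzd_torsion_def
    using nzd_id by (intro CollectI conjI bexI[of _ id_blinfun]) (simp_all add: smult_simps)
  show "x \<oplus> y \<in> nzd_torsion M" if xy: "x \<in> nzd_torsion M" "y \<in> nzd_torsion M" for x y
  proof -
    obtain s where s: "s \<in> nzd" "s \<odot> x = \<zero>" and x: "x \<in> carrier M" using xy unfolding nzd_torsion_def by blast
    obtain t where t: "t \<in> nzd" "t \<odot> y = \<zero>" and y: "y \<in> carrier M" using xy unfolding nzd_torsion_def by blast
    obtain p q where pq: "p \<in> A" "q \<in> A" "p o\<^sub>L s = q o\<^sub>L t" "p o\<^sub>L s \<in> nzd"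
      by (rule common_left_multiple[OF s(1) t(1)]) (rule that)
    have "(p o\<^sub>L s) \<odot> (x \<oplus> y) = (p o\<^sub>L s) \<odot> x \<oplus> (q o\<^sub>L t) \<odot> y"
      using pq x y by (metis nzd_mem smult_simps(2))
    also have "\<dots> = \<zero>" using pq(1,2) s t x y by (simp add: smult_simps)
    finally show ?thesis using pq(4) x y unfolding nzd_torsion_def by blast
  qed
  show "a \<odot> x \<in> nzd_torsion M" if ax: "a \<in> carrier R" "x \<in> nzd_torsion M" for a x
  proof -
    have a: "a \<in> A" using ax by simp
    obtain s where s: "s \<in> nzd" "s \<odot> x = \<zero>" and x: "x \<in> carrier M" using ax unfolding nzd_torsion_def by blast
    obtain t c where tc: "t \<in> nzd" "c \<in> A" "t o\<^sub>L a = c o\<^sub>L s" by (rule left_Ore[OF a s(1)]) (rule that)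
    have "t \<odot> (a \<odot> x) = (t o\<^sub>L a) \<odot> x" using tc(1) a x by (simp add: smult_simps)
    also have "\<dots> = \<zero>" unfolding tc(3) using tc(2) s x by (simp add: smult_simps)
    finally show ?thesis using tc(1) a x unfolding nzd_torsion_def by auto
  qed
qed

lemma nzd_torsion_quot_iff:
  assumes K: "submodule K R M" and x: "x \<in> carrier M"
  shows "K +> x \<in> nzd_torsion (quot_mod M K) \<longleftrightarrow> (\<exists>s\<in>nzd. s \<odot> x \<in> K)"
  unfolding nzd_torsion_def using x M.quot_carrierI[OF x, of K]
  by (simp add: M.quot_smult[OF K] M.quot_eq_zero_iff[OF K] cong: bex_cong)

end

section \<open>Functionals on finitely generated projective modules\<close>

context vn_module
begin

definition functional :: "('b \<Rightarrow> ('h \<Rightarrow>\<^sub>L 'h)) \<Rightarrow> bool" where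
  "functional \<phi> \<longleftrightarrow> (\<forall>x\<in>carrier M. \<phi> x \<in> A) \<and>
     (\<forall>x\<in>carrier M. \<forall>y\<in>carrier M. \<phi> (x \<oplus> y) = \<phi> x + \<phi> y) \<and>
     (\<forall>a\<in>A. \<forall>x\<in>carrier M. \<phi> (a \<odot> x) = a o\<^sub>L \<phi> x)"

lemma functionalD:
  assumes "functional \<phi>"
  shows "x \<in> carrier M \<Longrightarrow> \<phi> x \<in> A"
    and "x \<in> carrier M \<Longrightarrow> y \<in> carrier M \<Longrightarrow> \<phi> (x \<oplus> y) = \<phi> x + \<phi> y"
    and "a \<in> A \<Longrightarrow> x \<in> carrier M \<Longrightarrow> \<phi> (a \<odot> x) = a o\<^sub>L \<phi> x"
    and "\<phi> \<zero> = 0"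
    and "x \<in> carrier M \<Longrightarrow> y \<in> carrier M \<Longrightarrow> \<phi> (x \<ominus> y) = \<phi> x - \<phi> y"
proof -
  show add: "\<phi> (x \<oplus> y) = \<phi> x + \<phi> y" if "x \<in> carrier M" "y \<in> carrier M" for x y
    using assms that unfolding functional_def by blast
  show "x \<in> carrier M \<Longrightarrow> \<phi> x \<in> A" "a \<in> A \<Longrightarrow> x \<in> carrier M \<Longrightarrow> \<phi> (a \<odot> x) = a o\<^sub>L \<phi> x"
    using assms unfolding functional_def by blast+
  show z: "\<phi> \<zero> = 0" using add[of "\<zero>" "\<zero>"] by simp
  show "\<phi> (x \<ominus> y) = \<phi> x - \<phi> y" if "x \<in> carrier M" "y \<in> carrier M"
  proof -
    have "\<phi> (\<ominus> y) + \<phi> y = 0" using add[of "\<ominus> y" y] that z by (simp add: M.M.l_neg)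
    then have "\<phi> (\<ominus> y) = - \<phi> y" by (rule eq_neg_iff_add_eq_0[THEN iffD2])
    then show ?thesis using add[of x "\<ominus> y"] that by (simp add: M.M.minus_eq)
  qed
qed

lemma functional_kernel_submodule:
  assumes "functional \<phi>" "submodule N R M"
  shows "submodule {x \<in> N. \<phi> x = 0} R M" by (rule M.submoduleI)
    (use M.submoduleD[OF assms(2)] functionalD[OF assms(1)] in auto)

text \<open>Recursion on the length makes the laws below inductions on \<open>m\<close>, with
  coefficient and vector functions unconstrained beyond \<open>m\<close>.\<close>

primrec lincomb :: "nat \<Rightarrow> (nat \<Rightarrow> ('h \<Rightarrow>\<^sub>L 'h)) \<Rightarrow> (nat \<Rightarrow> 'b) \<Rightarrow> 'b" where
  "lincomb 0 a k = \<zero>"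
| "lincomb (Suc m) a k = lincomb m a k \<oplus> a m \<odot> k m"

lemma lincomb_mem:
  assumes "submodule N R M" "\<And>j. j < m \<Longrightarrow> a j \<in> A" "\<And>j. j < m \<Longrightarrow> k j \<in> N"
  shows "lincomb m a k \<in> N"
  using assms(2,3) by (induction m) (use M.submoduleD(2-4)[OF assms(1)] in simp_all)

lemma lincomb_closed [simp]:
  "(\<And>j. j < m \<Longrightarrow> a j \<in> A) \<Longrightarrow> (\<And>j. j < m \<Longrightarrow> k j \<in> carrier M) \<Longrightarrow> lincomb m a k \<in> carrier M"
  by (rule lincomb_mem[OF M.submodule_carrier])

lemma functional_lincomb:
  assumes \<phi>: "functional \<phi>" and "\<And>j. j < m \<Longrightarrow> a j \<in> A" "\<And>j. j < m \<Longrightarrow> k j \<in> carrier M"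
  shows "\<phi> (lincomb m a k) = (\<Sum>j<m. a j o\<^sub>L \<phi> (k j))"
  using assms(2,3) by (induction m) (simp_all add: functionalD[OF \<phi>])

lemma lincomb_smult:
  assumes c: "c \<in> A" and "\<And>j. j < m \<Longrightarrow> a j \<in> A" "\<And>j. j < m \<Longrightarrow> k j \<in> carrier M"
  shows "c \<odot> lincomb m a k = lincomb m (\<lambda>j. c o\<^sub>L a j) k"
  using assms(2,3) by (induction m) (use c in \<open>simp_all add: smult_simps\<close>)

lemma lincomb_cong:
  "(\<And>j. j < m \<Longrightarrow> a j = b j) \<Longrightarrow> (\<And>j. j < m \<Longrightarrow> k j = l j) \<Longrightarrow> lincomb m a k = lincomb m b l"
  by (induction m) simp_all

lemma lincomb_zero:
  "(\<And>j. j < m \<Longrightarrow> a j = 0) \<Longrightarrow> (\<And>j. j < m \<Longrightarrow> k j \<in> carrier M) \<Longrightarrow> lincomb m a k = \<zero>"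
  by (induction m) (simp_all add: smult_simps)

lemma lincomb_add:
  assumes "\<And>j. j < m \<Longrightarrow> a j \<in> A" "\<And>j. j < m \<Longrightarrow> b j \<in> A" "\<And>j. j < m \<Longrightarrow> k j \<in> carrier M"
  shows "lincomb m (\<lambda>j. a j + b j) k = lincomb m a k \<oplus> lincomb m b k" using assms
proof (induction m)
  case (Suc m)
  have c: "lincomb m a k \<in> carrier M" "lincomb m b k \<in> carrier M" using Suc.prems by simp_all
  have "lincomb m (\<lambda>j. a j + b j) k = lincomb m a k \<oplus> lincomb m b k" using Suc by simp
  then show ?case using Suc.prems c by (simp add: smult_simps M.M.a_ac)
qed simp

lemma lincomb_append:
  assumes "\<And>j. j < m \<Longrightarrow> a j \<in> A" "\<And>j. j < m \<Longrightarrow> k j \<in> carrier M"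
    "\<And>j. j < n \<Longrightarrow> b j \<in> A" "\<And>j. j < n \<Longrightarrow> l j \<in> carrier M"
  shows "lincomb (m + n) (\<lambda>j. if j < m then a j else b (j - m)) (\<lambda>j. if j < m then k j else l (j - m))
    = lincomb m a k \<oplus> lincomb n b l" using assms(3,4)
proof (induction n)
  case 0
  have "lincomb m a k \<in> carrier M" using assms(1,2) by simp
  moreover have "lincomb m (\<lambda>j. if j < m then a j else b (j - m)) (\<lambda>j. if j < m then k j else l (j - m))
    = lincomb m a k" by (rule lincomb_cong) simp_all
  ultimately show ?case by simp
next
  case (Suc n)
  have "lincomb m a k \<in> carrier M" "lincomb n b l \<in> carrier M" using Suc.prems assms by simp_all
  then show ?case using Suc by (simp add: M.M.a_assoc)
qed

lemma functional_comb:
  assumes "functional \<phi>" "functional \<psi>" "a \<in> A" "b \<in> A"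
  shows "functional (\<lambda>x. (\<phi> x o\<^sub>L a) + (\<psi> x o\<^sub>L b))" unfolding functional_def
  using assms(3,4) functionalD(1-3)[OF assms(1)] functionalD(1-3)[OF assms(2)]
  by (auto simp: compose_distrib compose_assoc)

lemma functional_mult: "functional \<phi> \<Longrightarrow> a \<in> A \<Longrightarrow> functional (\<lambda>x. \<phi> x o\<^sub>L a)"
  using functional_comb[of \<phi> \<phi> a 0] by simp

text \<open>\<Psi> vanishes on the \<open>k j\<close>, and an \<open>x\<close> killed by \<Psi> has
  a regular multiple that agrees with an element of their span as far as the first \<open>n\<close>
  coordinates can see. The span is encoded by quantifying over all submodules \<open>N\<close> that
  contain the \<open>k j\<close>.\<close>

definition separates ::
  "nat \<Rightarrow> (nat \<Rightarrow> 'b \<Rightarrow> ('h \<Rightarrow>\<^sub>L 'h)) \<Rightarrow> nat \<Rightarrow> (nat \<Rightarrow> 'b) \<Rightarrow> ('b \<Rightarrow> ('h \<Rightarrow>\<^sub>L 'h)) set \<Rightarrow> bool" where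
  "separates n \<phi> m k \<Psi> \<longleftrightarrow> finite \<Psi> \<and> (\<forall>\<psi>\<in>\<Psi>. functional \<psi> \<and> (\<forall>j<m. \<psi> (k j) = 0)) \<and>
    (\<forall>x\<in>carrier M. (\<forall>\<psi>\<in>\<Psi>. \<psi> x = 0) \<longrightarrow>
      (\<forall>N. submodule N R M \<and> (\<forall>j<m. k j \<in> N) \<longrightarrow>
        (\<exists>s\<in>nzd. \<exists>y\<in>N. \<forall>i<n. \<phi> i (s \<odot> x \<ominus> y) = 0)))"

lemma separatesD:
  assumes "separates n \<phi> m k \<Psi>"
  shows "finite \<Psi>" "\<psi> \<in> \<Psi> \<Longrightarrow> functional \<psi>" "\<psi> \<in> \<Psi> \<Longrightarrow> j < m \<Longrightarrow> \<psi> (k j) = 0"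
    "x \<in> carrier M \<Longrightarrow> \<forall>\<psi>\<in>\<Psi>. \<psi> x = 0 \<Longrightarrow> submodule N R M \<Longrightarrow> \<forall>j<m. k j \<in> N \<Longrightarrow>
      \<exists>s\<in>nzd. \<exists>y\<in>N. \<forall>i<n. \<phi> i (s \<odot> x \<ominus> y) = 0"
  using assms unfolding separates_def by blast+

text \<open>Gaussian elimination over the Ore ring \<open>A\<close>: after left multiplication by injective elements
  the linear combination \<open>k0\<close> of the \<open>k j\<close> clears the value of one functional.\<close>

lemma separation:
  fixes n m :: nat
  assumes "\<And>i. i < n \<Longrightarrow> functional (\<phi> i)" and "\<And>j. j < m \<Longrightarrow> k j \<in> carrier M"
  shows "\<exists>\<Psi>. separates n \<phi> m k \<Psi>" using assms
proof (induction n arbitrary: k)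
  case 0
  show ?case unfolding separates_def
    by (rule exI[of _ "{}"]) (use nzd_id M.submoduleD(2) in \<open>auto intro!: exI[of _ id_blinfun]\<close>)
next
  case (Suc n)
  define \<alpha> where "\<alpha> = (\<lambda>j. \<phi> n (k j))"
  define h where "h = gram m \<alpha>"
  \<comment> \<open>The pivot: its value under \<open>\<phi> n\<close> is the positive element
    \<open>h\<close>, built from all the values \<alpha>.\<close>
  define k0 where "k0 = lincomb m (\<lambda>j. adj (\<alpha> j)) k"
  have \<phi>: "functional (\<phi> n)" by (rule Suc.prems(1)) simp
  have k: "k j \<in> carrier M" if "j < m" for j by (rule Suc.prems(2)[OF that])
  have \<alpha>: "\<alpha> j \<in> A" if "j < m" for j using functionalD(1)[OF \<phi> k[OF that]] by (simp add: \<alpha>_def)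
  have hA: "h \<in> A" "pos_op h" unfolding h_def by (rule gram_mem, rule \<alpha>, assumption, rule gram_pos, rule \<alpha>)
  obtain q where q: "projection q" "h o\<^sub>L q = 0" "q o\<^sub>L h = 0" "h + q \<in> nzd"
    by (rule kernel_complement_nzd[OF hA]) (rule that)
  note qD = projectionD[OF q(1)]
  have k0: "k0 \<in> carrier M" unfolding k0_def using \<alpha> k by simp
  have \<phi>k0: "\<phi> n k0 = h" unfolding k0_def h_def gram_def
    using \<alpha> k by (subst functional_lincomb[OF \<phi>]) (simp_all add: \<alpha>_def)
  have \<alpha>q: "\<alpha> j o\<^sub>L q = 0" if "j < m" for j
    by (rule gram_zero[of m \<alpha>]) (rule \<alpha>, assumption, rule that, rule q(2)[unfolded h_def])
  have q\<alpha>: "q o\<^sub>L adj (\<alpha> j) = 0" if "j < m" for j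
  proof -
    have "adj (\<alpha> j o\<^sub>L q) = 0" using \<alpha>q[OF that] by (simp add: adj_simps)
    then show ?thesis using \<alpha>[OF that] qD by (simp add: adj_simps clinear)
  qed
  have qk0: "q \<odot> k0 = \<zero>"
  proof -
    have "q \<odot> k0 = lincomb m (\<lambda>j. q o\<^sub>L adj (\<alpha> j)) k"
      unfolding k0_def by (rule lincomb_smult) (simp_all add: qD \<alpha> k)
    then show ?thesis using lincomb_zero[of m "\<lambda>j. q o\<^sub>L adj (\<alpha> j)" k] q\<alpha> k by simp
  qed
  \<comment> \<open>The Ore condition with the regular denominator \<open>h + q\<close> leaves a
    term \<open>c q\<close>; multiplying by \<open>q\<close> from the right shows that it is
    zero.\<close>
  have red: "\<exists>t c. t \<in> nzd \<and> c \<in> A \<and> t o\<^sub>L a = c o\<^sub>L h" if a: "a \<in> A" "a o\<^sub>L q = 0" for a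
  proof -
    obtain t c where tc: "t \<in> nzd" "c \<in> A" "t o\<^sub>L a = c o\<^sub>L (h + q)" by (rule left_Ore[OF a(1) q(4)]) (rule that)
    have "c o\<^sub>L q = (c o\<^sub>L (h + q)) o\<^sub>L q"
      using q qD by (simp add: compose_assoc compose_distrib)
    also have "\<dots> = 0" unfolding tc(3)[symmetric] using a(2) by (simp add: compose_assoc)
    finally show ?thesis using tc by (auto simp: compose_distrib)
  qed
  have "\<forall>j. \<exists>t c. j < m \<longrightarrow> t \<in> nzd \<and> c \<in> A \<and> t o\<^sub>L \<alpha> j = c o\<^sub>L h" using red \<alpha> \<alpha>q by blast
  then obtain t c where tc0: "\<forall>j. j < m \<longrightarrow> t j \<in> nzd \<and> c j \<in> A \<and> t j o\<^sub>L \<alpha> j = c j o\<^sub>L h" by metis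
  then have tc: "t j \<in> nzd" "c j \<in> A" "t j o\<^sub>L \<alpha> j = c j o\<^sub>L h" if "j < m" for j using that by blast+
  \<comment> \<open>Row operation: the pivot clears the value of \<open>\<phi> n\<close>, at the
    price of a regular factor on \<open>k j\<close>.\<close>
  define k' where "k' = (\<lambda>j. t j \<odot> k j \<ominus> c j \<odot> k0)"
  have k': "k' j \<in> carrier M" if "j < m" for j using tc[OF that] k[OF that] k0 by (simp add: k'_def)
  have \<phi>k': "\<phi> n (k' j) = 0" if "j < m" for j
    using tc[OF that] k[OF that] k0 by (simp add: k'_def functionalD[OF \<phi>] \<phi>k0 \<alpha>_def)
  have "\<exists>\<Psi>. separates n \<phi> m k' \<Psi>" by (rule Suc.IH) (simp_all add: Suc.prems(1) k')
  then obtain \<Psi> where \<Psi>0: "separates n \<phi> m k' \<Psi>" by (rule exE)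
  note \<Psi> = separatesD(1-3)[OF \<Psi>0] and sep = separatesD(4)[OF \<Psi>0]
  have "\<exists>t c. t \<in> nzd \<and> c \<in> A \<and> \<psi> k0 o\<^sub>L t = h o\<^sub>L c" if \<psi>: "\<psi> \<in> \<Psi>" for \<psi>
  proof -
    note \<psi>D = functionalD[OF \<Psi>(2)[OF \<psi>]]
    have a: "\<psi> k0 \<in> A" by (rule \<psi>D(1)[OF k0])
    have qa: "q o\<^sub>L \<psi> k0 = 0" using \<psi>D(3)[OF qD(1) k0] \<psi>D(4) qk0 by simp
    obtain t c where tc: "t \<in> nzd" "c \<in> A" "\<psi> k0 o\<^sub>L t = (h + q) o\<^sub>L c" by (rule right_Ore[OF a q(4)]) (rule that)
    have "q o\<^sub>L c = q o\<^sub>L ((h + q) o\<^sub>L c)"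
      using q qD by (simp add: compose_assoc[symmetric] compose_distrib)
    also have "\<dots> = 0" unfolding tc(3)[symmetric] using qa by (simp add: compose_assoc[symmetric])
    finally show ?thesis using tc by (auto simp: compose_distrib)
  qed
  then have "\<forall>\<psi>. \<exists>t c. \<psi> \<in> \<Psi> \<longrightarrow> t \<in> nzd \<and> c \<in> A \<and> \<psi> k0 o\<^sub>L t = h o\<^sub>L c" by blast
  then obtain T \<eta> where T0: "\<forall>\<psi>. \<psi> \<in> \<Psi> \<longrightarrow> T \<psi> \<in> nzd \<and> \<eta> \<psi> \<in> A \<and> \<psi> k0 o\<^sub>L T \<psi> = h o\<^sub>L \<eta> \<psi>" by metis
  then have T: "T \<psi> \<in> nzd" "\<eta> \<psi> \<in> A" "\<psi> k0 o\<^sub>L T \<psi> = h o\<^sub>L \<eta> \<psi>" if "\<psi> \<in> \<Psi>" for \<psi> using that by blast+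
  \<comment> \<open>Functionals from the induction hypothesis need not vanish at the pivot. A
    multiple of \<open>\<phi> n\<close> is subtracted so that they do; they then vanish at the
    \<open>k j\<close>, since \<open>t j\<close> is regular.\<close>
  define E where "E = (\<lambda>\<psi> x. (\<psi> x o\<^sub>L T \<psi>) + (\<phi> n x o\<^sub>L (- \<eta> \<psi>)))"
  \<comment> \<open>This extra functional vanishes at \<open>x\<close> exactly if
    \<open>\<phi> n x\<close> is killed by \<open>q\<close>, which is what \<open>red\<close> needs
    in order to divide by \<open>h\<close>.\<close>
  define \<theta> where "\<theta> = (\<lambda>x. \<phi> n x o\<^sub>L q)"
  have E: "functional (E \<psi>)" if "\<psi> \<in> \<Psi>" for \<psi>
    unfolding E_def by (rule functional_comb[OF \<Psi>(2)[OF that] \<phi>]) (use T[OF that] in simp_all)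
  have \<theta>: "functional \<theta>" unfolding \<theta>_def by (rule functional_mult[OF \<phi> qD(1)])
  have Ek0: "E \<psi> k0 = 0" if "\<psi> \<in> \<Psi>" for \<psi>
    using T(3)[OF that] by (simp add: E_def \<phi>k0 compose_distrib)
  have Ek: "E \<psi> (k j) = 0" if \<psi>: "\<psi> \<in> \<Psi>" and j: "j < m" for \<psi> j
  proof -
    note ED = functionalD[OF E[OF \<psi>]]
    have "E \<psi> (k' j) = 0" using \<Psi>(3)[OF \<psi> j] \<phi>k'[OF j] by (simp add: E_def)
    then have "t j o\<^sub>L E \<psi> (k j) = 0" using tc[OF j] k[OF j] k0 Ek0[OF \<psi>] by (simp add: k'_def ED)
    then show ?thesis by (rule nzd_cancel_left[OF tc(1)[OF j]])
  qed
  have \<theta>k: "\<theta> (k j) = 0" if "j < m" for j using \<alpha>q[OF that] by (simp add: \<theta>_def \<alpha>_def)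
  show ?case unfolding separates_def
  proof (rule exI[of _ "insert \<theta> (E ` \<Psi>)"], intro conjI ballI allI impI)
    show "finite (insert \<theta> (E ` \<Psi>))" using \<Psi>(1) by simp
    show "functional \<psi>" if "\<psi> \<in> insert \<theta> (E ` \<Psi>)" for \<psi> using that E \<theta> by blast
    show "\<psi> (k j) = 0" if "\<psi> \<in> insert \<theta> (E ` \<Psi>)" "j < m" for \<psi> j using that Ek \<theta>k by blast
    fix x N assume x: "x \<in> carrier M" and z: "\<forall>\<psi>\<in>insert \<theta> (E ` \<Psi>). \<psi> x = 0"
      and N: "submodule N R M \<and> (\<forall>j<m. k j \<in> N)"
    have NS: "submodule N R M" and kN: "\<And>j. j < m \<Longrightarrow> k j \<in> N" using N by blast+
    have "\<phi> n x o\<^sub>L q = 0" using z by (simp add: \<theta>_def)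
    with red[OF functionalD(1)[OF \<phi> x]] obtain s d where sd: "s \<in> nzd" "d \<in> A" "s o\<^sub>L \<phi> n x = d o\<^sub>L h" by blast
    define x' where "x' = s \<odot> x \<ominus> d \<odot> k0"
    have x': "x' \<in> carrier M" using x k0 sd by (simp add: x'_def)
    have \<phi>x': "\<phi> n x' = 0" using x k0 sd by (simp add: x'_def functionalD[OF \<phi>] \<phi>k0)
    have "\<psi> x' = 0" if \<psi>: "\<psi> \<in> \<Psi>" for \<psi>
    proof -
      note ED = functionalD[OF E[OF \<psi>]]
      have "E \<psi> x' = 0" using z \<psi> x k0 sd by (simp add: x'_def ED Ek0)
      then have "\<psi> x' o\<^sub>L T \<psi> = 0" by (simp add: E_def \<phi>x')
      then show ?thesis
        using nzd_cancel_right[OF T(1)[OF \<psi>]] functionalD(1)[OF \<Psi>(2)[OF \<psi>] x'] clinear by blast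
    qed
    then have zx': "\<forall>\<psi>\<in>\<Psi>. \<psi> x' = 0" by blast
    \<comment> \<open>The induction hypothesis is used inside the kernel of \<open>\<phi> n\<close>,
      so that the correction \<open>y\<close> leaves coordinate \<open>n\<close> at zero.\<close>
    define N' where "N' = {y \<in> N. \<phi> n y = 0}"
    have N': "submodule N' R M" unfolding N'_def by (rule functional_kernel_submodule[OF \<phi> NS])
    have k0N: "k0 \<in> N" unfolding k0_def by (rule lincomb_mem[OF NS]) (simp_all add: \<alpha> kN)
    have k'N: "\<forall>j<m. k' j \<in> N'"
    proof (intro allI impI)
      fix j assume j: "j < m"
      have "t j \<odot> k j \<in> N" "c j \<odot> k0 \<in> N" using M.submoduleD(4)[OF NS] tc[OF j] kN[OF j] k0N by simp_all
      then show "k' j \<in> N'" unfolding N'_def k'_def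
        using M.submoduleD(6)[OF NS] \<phi>k'[OF j] by (simp add: k'_def)
    qed
    obtain u y where uy: "u \<in> nzd" "y \<in> N'" "\<forall>i<n. \<phi> i (u \<odot> x' \<ominus> y) = 0"
      using sep[OF x' zx' N' k'N] by blast
    have yN: "y \<in> N" "\<phi> n y = 0" "y \<in> carrier M" using uy(2) M.submoduleD(7)[OF NS] by (simp_all add: N'_def)
    define w where "w = (u o\<^sub>L d) \<odot> k0 \<oplus> y"
    have wN: "w \<in> N" unfolding w_def
      by (rule M.submoduleD(3)[OF NS M.submoduleD(4)[OF NS] yN(1)]) (use uy(1) sd k0N in simp_all)
    have us: "u o\<^sub>L s \<in> nzd" by (rule nzd_mult[OF uy(1) sd(1)])
    have eq: "(u o\<^sub>L s) \<odot> x \<ominus> w = u \<odot> x' \<ominus> y"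
    proof -
      have "u \<odot> x' = (u o\<^sub>L s) \<odot> x \<ominus> (u o\<^sub>L d) \<odot> k0"
        unfolding x'_def using uy(1) sd x k0 by (simp add: smult_simps)
      moreover have "p \<ominus> (r \<oplus> y) = p \<ominus> r \<ominus> y" if "p \<in> carrier M" "r \<in> carrier M" for p r
        using that yN(3) by (simp add: M.M.minus_eq M.M.minus_add M.M.a_ac)
      ultimately show ?thesis unfolding w_def using uy(1) sd x k0 by simp
    qed
    have "\<phi> i ((u o\<^sub>L s) \<odot> x \<ominus> w) = 0" if i: "i < Suc n" for i
    proof (cases "i = n")
      case True
      show ?thesis unfolding eq True using uy(1) x' yN by (simp add: functionalD[OF \<phi>] \<phi>x')
    next
      case False
      then show ?thesis unfolding eq using i uy(3) by simp
    qed
    then show "\<exists>s\<in>nzd. \<exists>y\<in>N. \<forall>i<Suc n. \<phi> i (s \<odot> x \<ominus> y) = 0" using us wN by blast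
  qed
qed

end

lemma (in finite_von_Neumann) hom_lincomb:
  assumes M: "vn_module A tr M" and N: "vn_module A tr N" and h: "h \<in> mod_hom R M N"
    and "\<And>j. j < m \<Longrightarrow> a j \<in> A" "\<And>j. j < m \<Longrightarrow> k j \<in> carrier M"
  shows "h (vn_module.lincomb M m a k) = vn_module.lincomb N m a (\<lambda>j. h (k j))"
proof -
  interpret M: vn_module A tr M by (rule M)
  interpret N: vn_module A tr N by (rule N)
  interpret h: lmodule_hom R M N h
    by (simp add: lmodule_hom_def lmodule_hom_axioms_def M.M.lmodule_axioms N.M.lmodule_axioms h)
  show ?thesis using assms(4,5) by (induction m) (simp_all add: h.hom_add h.hom_smult)
qed

section \<open>Dual bases from the semihereditary property of \<open>A\<close>\<close>

context vn_module
begin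

lemma vn_module': "vn_module A tr M" by unfold_locales

definition spans :: "nat \<Rightarrow> (nat \<Rightarrow> 'b) \<Rightarrow> bool" where
  "spans m k \<longleftrightarrow> (\<forall>j<m. k j \<in> carrier M) \<and>
     (\<forall>x\<in>carrier M. \<exists>v. (\<forall>j<m. v j \<in> A) \<and> x = lincomb m v k)"

text \<open>A dual basis for \<open>M\<close> modulo the common kernel of the \<phi>: the \<xi>
  factor through this quotient, and every \<open>x\<close> agrees with its expansion modulo that
  kernel.\<close>

definition dual_system ::
  "nat \<Rightarrow> (nat \<Rightarrow> 'b \<Rightarrow> ('h \<Rightarrow>\<^sub>L 'h)) \<Rightarrow> nat \<Rightarrow> (nat \<Rightarrow> 'b) \<Rightarrow> (nat \<Rightarrow> 'b \<Rightarrow> ('h \<Rightarrow>\<^sub>L 'h)) \<Rightarrow> bool" where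
  "dual_system n \<phi> r p \<xi> \<longleftrightarrow> (\<forall>l<r. p l \<in> carrier M \<and> functional (\<xi> l) \<and>
        (\<forall>x\<in>carrier M. (\<forall>i<n. \<phi> i x = 0) \<longrightarrow> \<xi> l x = 0)) \<and>
    (\<forall>x\<in>carrier M. \<forall>i<n. \<phi> i (x \<ominus> lincomb r (\<lambda>l. \<xi> l x) p) = 0)"

lemma dual_systemD:
  assumes "dual_system n \<phi> r p \<xi>"
  shows "l < r \<Longrightarrow> p l \<in> carrier M" "l < r \<Longrightarrow> functional (\<xi> l)"
    "l < r \<Longrightarrow> x \<in> carrier M \<Longrightarrow> \<forall>i<n. \<phi> i x = 0 \<Longrightarrow> \<xi> l x = 0"
    "x \<in> carrier M \<Longrightarrow> i < n \<Longrightarrow> \<phi> i (x \<ominus> lincomb r (\<lambda>l. \<xi> l x) p) = 0"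
  using assms unfolding dual_system_def by blast+

text \<open>The image of \<open>\<phi> n\<close> is a finitely generated left ideal, so
  \<open>ideal_dual_basis\<close> lifts it back to \<open>M\<close> and splits off the kernel of
  \<open>\<phi> n\<close>. The induction hypothesis is applied to the remaining functionals composed
  with the projection \<open>T\<close> onto this kernel, and the two systems are
  concatenated.\<close>

lemma dual_basis:
  fixes n m :: nat
  assumes "\<And>i. i < n \<Longrightarrow> functional (\<phi> i)" and k: "spans m k"
  shows "\<exists>r p \<xi>. dual_system n \<phi> r p \<xi>" using assms(1)
proof (induction n arbitrary: \<phi>)
  case 0
  show ?case by (rule exI[of _ 0]) (simp add: dual_system_def)
next
  case (Suc n)
  have \<phi>: "functional (\<phi> n)" by (rule Suc.prems) simp
  have kc: "k j \<in> carrier M" if "j < m" for j using k that by (simp add: spans_def)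
  define \<alpha> where "\<alpha> = (\<lambda>j. \<phi> n (k j))"
  have \<alpha>: "\<alpha> j \<in> A" if "j < m" for j unfolding \<alpha>_def by (rule functionalD(1)[OF \<phi> kc[OF that]])
  define J where "J = {\<Sum>j<m. v j o\<^sub>L \<alpha> j | v. \<forall>j<m. v j \<in> A}"
  have \<phi>J: "\<phi> n x \<in> J" if x: "x \<in> carrier M" for x
  proof -
    obtain v where v: "\<forall>j<m. v j \<in> A" "x = lincomb m v k" using k x unfolding spans_def by blast
    have "\<phi> n x = (\<Sum>j<m. v j o\<^sub>L \<alpha> j)"
      unfolding v(2) \<alpha>_def by (rule functional_lincomb[OF \<phi>]) (use v kc in simp_all)
    then show ?thesis using v(1) unfolding J_def by blast
  qed
  obtain \<theta> where \<theta>: "\<And>i x. i < m \<Longrightarrow> x \<in> J \<Longrightarrow> \<theta> i x \<in> A"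
    "\<And>i x y. i < m \<Longrightarrow> x \<in> J \<Longrightarrow> y \<in> J \<Longrightarrow> \<theta> i (x + y) = \<theta> i x + \<theta> i y"
    "\<And>i a x. i < m \<Longrightarrow> a \<in> A \<Longrightarrow> x \<in> J \<Longrightarrow> \<theta> i (a o\<^sub>L x) = a o\<^sub>L \<theta> i x"
    "\<And>x. x \<in> J \<Longrightarrow> (\<Sum>i<m. \<theta> i x o\<^sub>L \<alpha> i) = x"
    by (rule ideal_dual_basis[of m \<alpha>, OF \<alpha>, folded J_def]) (assumption, rule that)
  define \<psi> where "\<psi> = (\<lambda>j x. \<theta> j (\<phi> n x))"
  have \<psi>: "functional (\<psi> j)" if "j < m" for j
    unfolding functional_def \<psi>_def using \<phi>J \<theta>(1-3)[OF that] functionalD(1-3)[OF \<phi>] by simp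
  \<comment> \<open>Subtracts the lift of \<open>\<phi> n x\<close>. Thus \<open>T\<close> maps into
    the kernel of \<open>\<phi> n\<close> and fixes that kernel.\<close>
  define T where "T = (\<lambda>x. x \<ominus> lincomb m (\<lambda>j. \<psi> j x) k)"
  have L: "lincomb m (\<lambda>j. \<psi> j x) k \<in> carrier M" if "x \<in> carrier M" for x
    using functionalD(1)[OF \<psi> that] kc by simp
  have Tc: "T x \<in> carrier M" if "x \<in> carrier M" for x using that L by (simp add: T_def)
  have Thom: "T \<in> mod_hom R M M"
  proof (rule mod_homI)
    show "T (x \<oplus> y) = T x \<oplus> T y" if "x \<in> carrier M" "y \<in> carrier M" for x y
    proof -
      have "lincomb m (\<lambda>j. \<psi> j (x \<oplus> y)) k = lincomb m (\<lambda>j. \<psi> j x + \<psi> j y) k"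
        by (rule lincomb_cong) (simp_all add: functionalD(2)[OF \<psi> that])
      also have "\<dots> = lincomb m (\<lambda>j. \<psi> j x) k \<oplus> lincomb m (\<lambda>j. \<psi> j y) k"
        by (rule lincomb_add) (simp_all add: functionalD(1)[OF \<psi>] that kc)
      finally show ?thesis unfolding T_def using that L[OF that(1)] L[OF that(2)]
        by (simp add: M.M.minus_eq M.M.minus_add M.M.a_ac)
    qed
    show "T (a \<odot> x) = a \<odot> T x" if ax: "a \<in> carrier R" "x \<in> carrier M" for a x
    proof -
      have a: "a \<in> A" using ax by simp
      have "lincomb m (\<lambda>j. \<psi> j (a \<odot> x)) k = lincomb m (\<lambda>j. a o\<^sub>L \<psi> j x) k"
        by (rule lincomb_cong) (simp_all add: functionalD(3)[OF \<psi> a ax(2)])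
      also have "\<dots> = a \<odot> lincomb m (\<lambda>j. \<psi> j x) k"
        by (rule lincomb_smult[symmetric]) (simp_all add: a functionalD(1)[OF \<psi>] ax(2) kc)
      finally show ?thesis unfolding T_def using a ax(2) L[OF ax(2)] by (simp add: smult_simps)
    qed
  qed (rule Tc)
  interpret T: lmodule_hom R M M T
    by (simp add: lmodule_hom_def lmodule_hom_axioms_def M.lmodule_axioms Thom)
  have \<phi>T: "\<phi> n (T x) = 0" if x: "x \<in> carrier M" for x
  proof -
    have "\<phi> n (lincomb m (\<lambda>j. \<psi> j x) k) = (\<Sum>j<m. \<psi> j x o\<^sub>L \<alpha> j)"
      unfolding \<alpha>_def by (rule functional_lincomb[OF \<phi>]) (simp_all add: functionalD(1)[OF \<psi>] x kc)
    also have "\<dots> = \<phi> n x" unfolding \<psi>_def by (rule \<theta>(4)[OF \<phi>J[OF x]])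
    finally show ?thesis unfolding T_def using functionalD(5)[OF \<phi> x L[OF x]] by simp
  qed
  have "\<exists>r p \<xi>. dual_system n (\<lambda>i x. \<phi> i (T x)) r p \<xi>"
  proof (rule Suc.IH)
    fix i assume "i < n"
    then have i: "functional (\<phi> i)" using Suc.prems by simp
    show "functional (\<lambda>x. \<phi> i (T x))"
      unfolding functional_def using Tc functionalD[OF i] by (simp add: T.hom_add T.hom_smult)
  qed
  then obtain r p \<xi> where "dual_system n (\<lambda>i x. \<phi> i (T x)) r p \<xi>" by (elim exE)
  note p = dual_systemD(1)[OF this] and \<xi> = dual_systemD(2)[OF this]
    and \<xi>0 = dual_systemD(3)[OF this] and \<phi>0 = dual_systemD(4)[OF this]
  define p' where "p' = (\<lambda>l. if l < m then k l else T (p (l - m)))"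
  define \<xi>' where "\<xi>' = (\<lambda>l x. if l < m then \<psi> l x else \<xi> (l - m) x)"
  \<comment> \<open>The new remainder is \<open>T\<close> of the old one: \<open>\<phi> n\<close>
    kills it as a value of \<open>T\<close>, and the other functionals kill it by the induction
    hypothesis.\<close>
  have comb: "x \<ominus> lincomb (m + r) (\<lambda>l. \<xi>' l x) p' = T (x \<ominus> lincomb r (\<lambda>l. \<xi> l x) p)"
    if x: "x \<in> carrier M" for x
  proof -
    have c: "lincomb r (\<lambda>l. \<xi> l x) p \<in> carrier M" using functionalD(1)[OF \<xi> x] p by simp
    have "lincomb (m + r) (\<lambda>l. \<xi>' l x) p'
        = lincomb m (\<lambda>j. \<psi> j x) k \<oplus> lincomb r (\<lambda>l. \<xi> l x) (\<lambda>l. T (p l))" unfolding p'_def \<xi>'_def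
      by (rule lincomb_append) (simp_all add: functionalD(1)[OF \<psi>] functionalD(1)[OF \<xi>] x kc p)
    also have "lincomb r (\<lambda>l. \<xi> l x) (\<lambda>l. T (p l)) = T (lincomb r (\<lambda>l. \<xi> l x) p)"
      by (rule hom_lincomb[symmetric, OF vn_module' vn_module' Thom]) (simp_all add: functionalD(1)[OF \<xi>] x p)
    finally show ?thesis unfolding T.hom_diff[OF x c] using x c L[OF x] Tc[OF c] unfolding T_def[of]
      by (simp add: M.M.minus_eq M.M.minus_add M.M.a_ac)
  qed
  show ?case unfolding dual_system_def
  proof (rule exI[of _ "m + r"], rule exI[of _ p'], rule exI[of _ \<xi>'], intro conjI allI impI ballI)
    fix l assume l: "l < m + r"
    show "p' l \<in> carrier M" using l kc p Tc by (simp add: p'_def)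
    show "functional (\<xi>' l)" unfolding \<xi>'_def using l \<psi>[of l] \<xi>[of "l - m"] by (cases "l < m") simp_all
    fix x assume x: "x \<in> carrier M" and z: "\<forall>i<Suc n. \<phi> i x = 0"
    have \<psi>0: "\<psi> j x = 0" if j: "j < m" for j
    proof -
      have "\<theta> j (0 o\<^sub>L \<phi> n x) = 0 o\<^sub>L \<theta> j (\<phi> n x)" by (rule \<theta>(3)[OF j mem_0 \<phi>J[OF x]])
      then show ?thesis using z by (simp add: \<psi>_def)
    qed
    have "lincomb m (\<lambda>j. \<psi> j x) k = \<zero>" by (rule lincomb_zero) (simp_all add: \<psi>0 kc)
    then have "T x = x" using x by (simp add: T_def)
    then have "\<forall>i<n. \<phi> i (T x) = 0" using z by simp
    then show "\<xi>' l x = 0" using \<xi>0[OF _ x] l \<psi>0 by (simp add: \<xi>'_def)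
  next
    fix x i assume x: "x \<in> carrier M" and i: "i < Suc n"
    have c: "x \<ominus> lincomb r (\<lambda>l. \<xi> l x) p \<in> carrier M" using functionalD(1)[OF \<xi> x] p x by simp
    show "\<phi> i (x \<ominus> lincomb (m + r) (\<lambda>l. \<xi>' l x) p') = 0"
      unfolding comb[OF x] using i \<phi>0[OF x] \<phi>T[OF c] by (cases "i = n") simp_all
  qed
qed

text \<open>The coordinate functionals of the free module separate points of the summand, and the
  components in \<open>S\<close> of the unit vectors generate it.\<close>

lemma fg_projective_coordinates:
  assumes P: "fg_projective R M"
  obtains n \<phi> p where "spans n p" "\<And>i. i < n \<Longrightarrow> functional (\<phi> i)"
    "\<And>x. x \<in> carrier M \<Longrightarrow> \<forall>i<n. \<phi> i x = 0 \<Longrightarrow> x = \<zero>"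
proof -
  obtain n S S' where S: "submodule S R (free_mod R n)"
    and S': "submodule S' R (free_mod R n)"
    and int: "S \<inter> S' = {\<zero>\<^bsub>free_mod R n\<^esub>}"
    and sum: "S <+>\<^bsub>free_mod R n\<^esub> S' = carrier (free_mod R n)"
    and iso: "mod_isomorphic R M (restrict_mod (free_mod R n) S)"
    using P unfolding fg_projective_def by blast
  let ?F = "free_mod R n"
  interpret F: lmodule R ?F by (rule free_mod_lmodule[OF vn_ring])
  interpret FV: vn_module A tr ?F by unfold_locales
  interpret SM: lmodule R "restrict_mod ?F S" by (rule F.restrict_lmodule[OF S])
  obtain h where h: "h \<in> mod_hom R M (restrict_mod ?F S)"
    and hb: "bij_betw h (carrier M) S" using iso unfolding mod_isomorphic_def mod_iso_def by auto
  interpret h: lmodule_hom R M "restrict_mod ?F S" h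
    by (simp add: lmodule_hom_def lmodule_hom_axioms_def M.lmodule_axioms SM.lmodule_axioms h)
  have hF: "h \<in> mod_hom R M ?F"
    using h F.submoduleD(7)[OF S] by (intro mod_homI) (auto simp: mod_hom_def)
  have hc: "h x \<in> carrier ?F" "h x \<in> S" if "x \<in> carrier M" for x
    using mod_homD(1)[OF hF that] bij_betwE[OF hb] that by blast+
  define \<phi> where "\<phi> = (\<lambda>i x. h x i)"
  have \<phi>: "functional (\<phi> i)" if i: "i < n" for i unfolding functional_def \<phi>_def
    using i hc(1) mod_homD(2)[OF hF] mod_homD(3)[OF hF] by (simp add: free_mod_simps)
  define E :: "nat \<Rightarrow> nat \<Rightarrow> 'h \<Rightarrow>\<^sub>L 'h" where "E = (\<lambda>i. \<lambda>j\<in>{..<n}. if j = i then id_blinfun else 0)"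
  have E: "E i \<in> carrier ?F" for i by (simp add: E_def free_mod_simps)
  have Esum: "FV.lincomb n v E = v" if v: "v \<in> carrier ?F" for v
  proof (rule free_mod_ext)
    have vA: "v i \<in> A" if "i < n" for i using v that by (simp add: free_mod_simps)
    show "FV.lincomb n v E \<in> carrier ?F" using vA E by simp
    fix j assume j: "j < n"
    have "FV.functional (\<lambda>w. w j)" unfolding FV.functional_def using j by (simp add: free_mod_simps)
    then have "FV.lincomb n v E j = (\<Sum>i<n. v i o\<^sub>L E i j)"
      by (rule FV.functional_lincomb) (use vA E in simp_all)
    also have "\<dots> = (\<Sum>i<n. if i = j then v i else 0)" using j by (intro sum.cong) (auto simp: E_def)
    also have "\<dots> = v j" using j by simp
    finally show "FV.lincomb n v E j = v j" .
  qed (rule v)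
  have "\<exists>u w. u \<in> S \<and> w \<in> S' \<and> E i = u \<oplus>\<^bsub>?F\<^esub> w" for i
    using E[of i] unfolding sum[symmetric] set_add_def' by blast
  then obtain u w where uw: "\<And>i. u i \<in> S" "\<And>i. w i \<in> S'" "\<And>i. E i = u i \<oplus>\<^bsub>?F\<^esub> w i" by metis
  have uc: "u i \<in> carrier ?F" "w i \<in> carrier ?F" for i
    using F.submoduleD(7)[OF S uw(1)] F.submoduleD(7)[OF S' uw(2)] by blast+
  define p where "p = (\<lambda>i. inv_into (carrier M) h (u i))"
  have p: "p i \<in> carrier M" "h (p i) = u i" for i
    using uw(1)[of i] hb unfolding p_def bij_betw_def by (simp_all add: inv_into_into f_inv_into_f)
  have span: "x = lincomb n (\<lambda>i. \<phi> i x) p" if x: "x \<in> carrier M" for x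
  proof -
    have \<phi>A: "\<phi> i x \<in> A" if "i < n" for i by (rule functionalD(1)[OF \<phi>[OF that] x])
    have \<phi>h: "(\<lambda>i. \<phi> i x) = h x" by (simp add: \<phi>_def)
    define y where "y = FV.lincomb n (h x) u"
    define z where "z = FV.lincomb n (h x) w"
    have yS: "y \<in> S" unfolding y_def by (rule FV.lincomb_mem[OF S]) (use \<phi>A uw in \<open>simp_all add: \<phi>_def\<close>)
    have zS: "z \<in> S'" unfolding z_def by (rule FV.lincomb_mem[OF S']) (use \<phi>A uw in \<open>simp_all add: \<phi>_def\<close>)
    have yc: "y \<in> carrier ?F" "z \<in> carrier ?F"
      using F.submoduleD(7)[OF S yS] F.submoduleD(7)[OF S' zS] .
    have split: "FV.lincomb l a (\<lambda>i. u i \<oplus>\<^bsub>?F\<^esub> w i)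
        = FV.lincomb l a u \<oplus>\<^bsub>?F\<^esub> FV.lincomb l a w"
      if "\<And>i. i < l \<Longrightarrow> a i \<in> A" for l a using that
    proof (induction l)
      case (Suc l)
      have "FV.lincomb l a u \<in> carrier ?F" "FV.lincomb l a w \<in> carrier ?F"
        using Suc.prems uc by simp_all
      then show ?case using Suc uc by (simp add: FV.smult_simps F.M.a_ac)
    qed simp
    have "h x = FV.lincomb n (h x) E" by (rule Esum[symmetric, OF hc(1)[OF x]])
    also have "E = (\<lambda>i. u i \<oplus>\<^bsub>?F\<^esub> w i)" using uw(3) by (rule ext)
    also have "FV.lincomb n (h x) (\<lambda>i. u i \<oplus>\<^bsub>?F\<^esub> w i) = y \<oplus>\<^bsub>?F\<^esub> z"
      unfolding y_def z_def by (rule split) (use \<phi>A in \<open>simp add: \<phi>_def\<close>)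
    finally have hx: "h x = y \<oplus>\<^bsub>?F\<^esub> z" .
    have "h x \<ominus>\<^bsub>?F\<^esub> y = z"
      unfolding hx using yc by (simp add: F.M.minus_eq F.M.a_comm[of y z] F.M.a_assoc F.M.r_neg)
    then have "z \<in> S \<inter> S'" using F.submoduleD(6)[OF S hc(2)[OF x] yS] zS by simp
    then have "z = \<zero>\<^bsub>?F\<^esub>" using int by blast
    then have "h x = y" using hx yc by simp
    also have "y = FV.lincomb n (h x) (\<lambda>i. h (p i))" unfolding y_def p(2) ..
    also have "\<dots> = h (lincomb n (\<lambda>i. \<phi> i x) p)"
      unfolding \<phi>h[symmetric] by (rule hom_lincomb[symmetric, OF vn_module' FV.vn_module' hF]) (use \<phi>A p in simp_all)
    finally show ?thesis using bij_betw_imp_inj_on[OF hb] x \<phi>A p(1) by (auto dest: inj_onD)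
  qed
  show thesis
  proof (rule that[of n p \<phi>])
    show "spans n p" unfolding spans_def
    proof (intro conjI allI impI ballI)
      fix x assume x: "x \<in> carrier M"
      have "\<forall>j<n. \<phi> j x \<in> A" using functionalD(1)[OF \<phi> x] by blast
      then show "\<exists>v. (\<forall>j<n. v j \<in> A) \<and> x = lincomb n v p"
        using span[OF x] by (intro exI[of _ "\<lambda>i. \<phi> i x"]) (rule conjI)
    qed (rule p)
    show "x = \<zero>" if x: "x \<in> carrier M" and z: "\<forall>i<n. \<phi> i x = 0" for x
    proof -
      have "lincomb n (\<lambda>i. \<phi> i x) p = \<zero>" by (rule lincomb_zero) (simp_all add: z p)
      then show ?thesis using span[OF x] by simp
    qed
  qed (rule \<phi>)
qed

lemma finite_enumeration:
  assumes "finite S" obtains n :: nat and f where "S = f ` {..<n}"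
  using finite_imp_nat_seg_image_inj_on[OF assms] by (auto simp: lessThan_def)

text \<open>With \<open>f\<close> the range projection of \<open>\<psi> x\<close>, the multiples of
  \<open>f x\<close> that lie in \<open>K\<close> are exactly those whose coefficient kills
  \<open>f\<close>. Torsion puts \<open>f x\<close> into \<open>K\<close>, so \<open>f\<close> kills
  \<open>\<psi> x\<close>, whence \<open>f = 0\<close>.\<close>

lemma torsion_functional_zero:
  assumes K: "submodule K R M" and x: "x \<in> carrier M" and t: "K +> x \<in> torsion (quot_mod M K)"
    and \<psi>: "functional \<psi>" and \<psi>K: "\<And>y. y \<in> K \<Longrightarrow> \<psi> y = 0"
  shows "\<psi> x = 0"
proof -
  note \<psi>D = functionalD[OF \<psi>]
  obtain f where f: "projection f" and ann: "\<And>b. b \<in> A \<Longrightarrow> b o\<^sub>L \<psi> x = 0 \<longleftrightarrow> b o\<^sub>L f = 0"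
    by (rule left_annihilator[OF \<psi>D(1)[OF x]]) (rule that)
  note fD = projectionD[OF f]
  have "b \<odot> (f \<odot> x) \<in> K \<longleftrightarrow> b o\<^sub>L f = 0" if b: "b \<in> A" for b
  proof
    assume "b \<odot> (f \<odot> x) \<in> K"
    from \<psi>K[OF this] have "(b o\<^sub>L f) o\<^sub>L \<psi> x = 0" using b fD x by (simp add: \<psi>D compose_assoc)
    then have "(b o\<^sub>L f) o\<^sub>L f = 0" using ann[of "b o\<^sub>L f"] b fD by simp
    then show "b o\<^sub>L f = 0" using fD by (simp add: compose_assoc)
  next
    assume bf: "b o\<^sub>L f = 0"
    have "b \<odot> (f \<odot> x) = (b o\<^sub>L f) \<odot> x" using b fD x by (simp add: smult_simps)
    then show "b \<odot> (f \<odot> x) \<in> K" unfolding bf using x M.submoduleD(2)[OF K] by (simp add: smult_simps)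
  qed
  then have "f \<odot> x \<in> K" using t[unfolded torsion_quot_iff[OF K x]] f fD(1) by blast
  from \<psi>K[OF this] have "f o\<^sub>L \<psi> x = 0" using fD x by (simp add: \<psi>D)
  then have "f = 0" using ann[OF fD(1)] fD by simp
  then show ?thesis using ann[OF mem_id] by simp
qed

text \<open>A dual basis of the quotient of \<open>M\<close> by the closure of \<open>K\<close>.
  \<open>separation\<close> finds functionals vanishing on \<open>K\<close> whose common kernel is
  \<open>K\<close> up to regular multiples, and \<open>dual_basis\<close> expands modulo that
  kernel. It serves both the computation of closures and the flatness criterion.\<close>

lemma closure_dual_basis:
  assumes P: "fg_projective R M" and K: "submodule K R M"
    and fg: "fin_gen R (restrict_mod M K)"
  obtains r p \<xi> where
    "\<And>l. l < r \<Longrightarrow> p l \<in> carrier M" "\<And>l. l < r \<Longrightarrow> functional (\<xi> l)"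
    "\<And>l x. l < r \<Longrightarrow> x \<in> K \<Longrightarrow> \<xi> l x = 0"
    "\<And>x. x \<in> carrier M \<Longrightarrow> \<exists>s\<in>nzd. s \<odot> (x \<ominus> lincomb r (\<lambda>l. \<xi> l x) p) \<in> K"
proof -
  obtain S where S: "finite S" "S \<subseteq> K"
    and gen: "\<And>N. submodule N R (restrict_mod M K) \<Longrightarrow> S \<subseteq> N \<Longrightarrow> N = K"
    using fg unfolding fin_gen_def by auto
  obtain m k where k: "S = k ` {..<m::nat}" by (rule finite_enumeration[OF S(1)])
  have kK: "k j \<in> K" if "j < m" for j using S(2) that unfolding k by blast
  obtain n \<phi> g where g: "spans n g" and \<phi>: "\<And>i. i < n \<Longrightarrow> functional (\<phi> i)"
    and \<phi>0: "\<And>x. x \<in> carrier M \<Longrightarrow> \<forall>i<n. \<phi> i x = 0 \<Longrightarrow> x = \<zero>"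
    by (rule fg_projective_coordinates[OF P]) (rule that)
  obtain \<Psi> where \<Psi>: "separates n \<phi> m k \<Psi>"
    using separation[of n \<phi> m k, OF \<phi> M.submoduleD(7)[OF K kK]] by (rule exE)
  note \<Psi>D = separatesD[OF \<Psi>]
  obtain n' \<psi> where \<psi>: "\<Psi> = \<psi> ` {..<n'::nat}" by (rule finite_enumeration[OF \<Psi>D(1)])
  have \<psi>f: "functional (\<psi> i)" "\<And>j. j < m \<Longrightarrow> \<psi> i (k j) = 0" if "i < n'" for i
    using \<Psi>D(2,3) that unfolding \<psi> by blast+
  have \<psi>K: "\<psi> i y = 0" if i: "i < n'" and y: "y \<in> K" for i y
  proof -
    have "submodule {y \<in> K. \<psi> i y = 0} R (restrict_mod M K)"
      using M.submodule_restrict_iff[OF K] functional_kernel_submodule[OF \<psi>f(1)[OF i] K] by blast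
    then have "{y \<in> K. \<psi> i y = 0} = K" by (rule gen) (use kK \<psi>f(2)[OF i] in \<open>auto simp: k\<close>)
    then show ?thesis using y by blast
  qed
  have "\<exists>r p \<xi>. dual_system n' \<psi> r p \<xi>" by (rule dual_basis[OF _ g]) (rule \<psi>f(1))
  then obtain r p \<xi> where "dual_system n' \<psi> r p \<xi>" by (elim exE)
  note p = dual_systemD(1)[OF this] and \<xi> = dual_systemD(2)[OF this]
    and \<xi>0 = dual_systemD(3)[OF this] and \<psi>0 = dual_systemD(4)[OF this]
  show thesis
  proof (rule that[of r p \<xi>])
    show "\<xi> l x = 0" if "l < r" "x \<in> K" for l x
      using \<xi>0[OF that(1) M.submoduleD(7)[OF K that(2)]] \<psi>K that(2) by blast
    fix x assume x: "x \<in> carrier M"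
    define y where "y = x \<ominus> lincomb r (\<lambda>l. \<xi> l x) p"
    have y: "y \<in> carrier M" using x p functionalD(1)[OF \<xi> x] by (simp add: y_def)
    have "\<forall>\<psi>\<in>\<Psi>. \<psi> y = 0" unfolding \<psi> y_def using \<psi>0[OF x] by blast
    then obtain s z where sz: "s \<in> nzd" "z \<in> K" "\<forall>i<n. \<phi> i (s \<odot> y \<ominus> z) = 0"
      using \<Psi>D(4)[OF y _ K] kK by blast
    have zc: "z \<in> carrier M" by (rule M.submoduleD(7)[OF K sz(2)])
    have "s \<odot> y \<ominus> z = \<zero>" by (rule \<phi>0) (use sz y zc in simp_all)
    then have "s \<odot> y = z" using M.diff_eq_zero_iff[of "s \<odot> y" z] sz(1) y zc by simp
    then show "\<exists>s\<in>nzd. s \<odot> (x \<ominus> lincomb r (\<lambda>l. \<xi> l x) p) \<in> K"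
      unfolding y_def[symmetric] using sz(1,2) by blast
  qed (rule p, assumption, rule \<xi>)
qed

lemma cl_T_iff:
  assumes K: "submodule K R M"
  shows "x \<in> cl_T A tr M K \<longleftrightarrow> x \<in> carrier M \<and> K +> x \<in> torsion (quot_mod M K)"
  unfolding cl_T_def vn_module.T_sub_eq[OF quot_vn_module[OF K]] by simp

text \<open>For a torsion element all coefficients of the expansion vanish, so the remainder, which
  has a regular multiple in \<open>K\<close>, is \<open>x\<close> itself.\<close>

lemma cl_T_fin_gen:
  assumes P: "fg_projective R M" and K: "submodule K R M"
    and fg: "fin_gen R (restrict_mod M K)"
  shows "x \<in> cl_T A tr M K \<longleftrightarrow> x \<in> carrier M \<and> (\<exists>s\<in>nzd. s \<odot> x \<in> K)" unfolding cl_T_iff[OF K]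
proof (intro conj_cong refl iffI)
  assume x: "x \<in> carrier M" and t: "K +> x \<in> torsion (quot_mod M K)"
  obtain r p \<xi> where p: "\<And>l. l < r \<Longrightarrow> p l \<in> carrier M" and \<xi>: "\<And>l. l < r \<Longrightarrow> functional (\<xi> l)"
    and \<xi>K: "\<And>l x. l < r \<Longrightarrow> x \<in> K \<Longrightarrow> \<xi> l x = 0"
    and s: "\<And>x. x \<in> carrier M \<Longrightarrow> \<exists>s\<in>nzd. s \<odot> (x \<ominus> lincomb r (\<lambda>l. \<xi> l x) p) \<in> K"
    by (rule closure_dual_basis[OF P K fg]) (rule that)
  have "\<xi> l x = 0" if l: "l < r" for l by (rule torsion_functional_zero[OF K x t \<xi>[OF l] \<xi>K[OF l]])
  then have "lincomb r (\<lambda>l. \<xi> l x) p = \<zero>" by (intro lincomb_zero p)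
  then show "\<exists>s\<in>nzd. s \<odot> x \<in> K" using s[OF x] x by simp
next
  assume x: "x \<in> carrier M" and s: "\<exists>s\<in>nzd. s \<odot> x \<in> K"
  interpret Q: vn_module A tr "quot_mod M K" by (rule quot_vn_module[OF K])
  show "K +> x \<in> torsion (quot_mod M K)" using Q.nzd_torsion_subset nzd_torsion_quot_iff[OF K x] s by blast
qed

end

section \<open>Tensor products\<close>

abbreviation (input) keys :: "('a \<Rightarrow>\<^sub>0 'b::zero) \<Rightarrow> 'a set" where "keys \<equiv> Poly_Mapping.keys"

text \<open>An additive extension chosen by \<open>SOME\<close>; it is controlled only on formal
  sums supported in \<open>X\<close>, hence the hypotheses on \<open>keys\<close> in what
  follows.\<close>

definition frag_hom :: "'c set \<Rightarrow> ('a, 'm) ring_scheme \<Rightarrow> ('c \<Rightarrow> 'a) \<Rightarrow> ('c \<Rightarrow>\<^sub>0 int) \<Rightarrow> 'a" where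
  "frag_hom X P f = (SOME h. h \<in> hom (free_Abelian_group X) (add_monoid P) \<and> (\<forall>x\<in>X. h (frag_of x) = f x))"

lemma keys_diff_subset: "keys c \<subseteq> X \<Longrightarrow> keys d \<subseteq> X \<Longrightarrow> keys (c - d) \<subseteq> X"
  using keys_diff[of c d] by blast

lemma frag_hom:
  assumes P: "abelian_group P" and f: "f \<in> X \<rightarrow> carrier P"
  shows frag_hom_closed: "keys c \<subseteq> X \<Longrightarrow> frag_hom X P f c \<in> carrier P"
    and frag_hom_of: "x \<in> X \<Longrightarrow> frag_hom X P f (frag_of x) = f x"
    and frag_hom_add: "keys c \<subseteq> X \<Longrightarrow> keys d \<subseteq> X \<Longrightarrow>
      frag_hom X P f (c + d) = frag_hom X P f c \<oplus>\<^bsub>P\<^esub> frag_hom X P f d"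
    and frag_hom_zero: "frag_hom X P f 0 = \<zero>\<^bsub>P\<^esub>"
    and frag_hom_minus: "keys c \<subseteq> X \<Longrightarrow> frag_hom X P f (- c) = \<ominus>\<^bsub>P\<^esub> frag_hom X P f c"
    and frag_hom_diff: "keys c \<subseteq> X \<Longrightarrow> keys d \<subseteq> X \<Longrightarrow>
      frag_hom X P f (c - d) = frag_hom X P f c \<ominus>\<^bsub>P\<^esub> frag_hom X P f d"
proof -
  interpret P: abelian_group P by (rule P)
  have im: "f ` X \<subseteq> carrier (add_monoid P)" using f by auto
  obtain h0 where h0: "h0 \<in> hom (free_Abelian_group X) (add_monoid P)" "\<And>x. x \<in> X \<Longrightarrow> h0 (frag_of x) = f x"
    by (rule comm_group.free_Abelian_group_universal[OF P.a_comm_group im]) (rule that)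
  define h where "h = frag_hom X P f"
  have "h0 \<in> hom (free_Abelian_group X) (add_monoid P) \<and> (\<forall>x\<in>X. h0 (frag_of x) = f x)" using h0 by blast
  then have h: "h \<in> hom (free_Abelian_group X) (add_monoid P) \<and> (\<forall>x\<in>X. h (frag_of x) = f x)"
    unfolding h_def frag_hom_def by (rule someI[where P = "\<lambda>h. h \<in> hom (free_Abelian_group X) (add_monoid P) \<and> (\<forall>x\<in>X. h (frag_of x) = f x)"])
  show c: "frag_hom X P f c \<in> carrier P" if "keys c \<subseteq> X" for c
    using h that unfolding h_def[symmetric] hom_def by auto
  show "x \<in> X \<Longrightarrow> frag_hom X P f (frag_of x) = f x" using h unfolding h_def by blast
  show add: "frag_hom X P f (c + d) = frag_hom X P f c \<oplus>\<^bsub>P\<^esub> frag_hom X P f d"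
    if "keys c \<subseteq> X" "keys d \<subseteq> X" for c d
    using h that unfolding h_def[symmetric] hom_def by simp
  show z: "frag_hom X P f 0 = \<zero>\<^bsub>P\<^esub>" using add[of 0 0] c[of 0] by simp
  show m: "frag_hom X P f (- c) = \<ominus>\<^bsub>P\<^esub> frag_hom X P f c" if k: "keys c \<subseteq> X" for c
    by (rule P.minus_equality[symmetric]) (use add[of "- c" c] c[of c] c[of "- c"] k z in simp_all)
  show "frag_hom X P f (c - d) = frag_hom X P f c \<ominus>\<^bsub>P\<^esub> frag_hom X P f d"
    if k: "keys c \<subseteq> X" "keys d \<subseteq> X"
    using add[of c "- d"] m[OF k(2)] k by (simp add: P.minus_eq)
qed

lemma (in abelian_group) add_diff_cancel:
  assumes "x \<in> carrier G" "y \<in> carrier G" shows "x \<oplus> y \<ominus> x \<ominus> y = \<zero>"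
proof -
  have "x \<oplus> y \<ominus> x \<ominus> y = (x \<oplus> y) \<oplus> \<ominus> (x \<oplus> y)" using assms by (simp add: minus_eq minus_add a_assoc)
  then show ?thesis using assms by (simp add: r_neg)
qed

text \<open>Of \<open>N\<close> only closure under its operations is assumed, so that
  \<open>U\<close> can take its place on the strength of \<open>U_add_closed\<close> and
  \<open>U_act_closed\<close>.\<close>

locale balanced = M: lmodule R M
  for R :: "('a, 'r) ring_scheme" and N :: "('a, 'b, 'n) module_scheme" and M :: "('a, 'c, 'm) module_scheme" (structure) +
  assumes N_add: "x \<in> carrier N \<Longrightarrow> y \<in> carrier N \<Longrightarrow> x \<oplus>\<^bsub>N\<^esub> y \<in> carrier N"
    and N_smult: "a \<in> carrier R \<Longrightarrow> x \<in> carrier N \<Longrightarrow> a \<odot>\<^bsub>N\<^esub> x \<in> carrier N"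
begin

abbreviation pairs where "pairs \<equiv> carrier N \<times> carrier M"

abbreviation rels where "rels \<equiv> tensor_rels R N M"

definition generators where "generators =
  {frag_of (x \<oplus>\<^bsub>N\<^esub> y, m) - frag_of (x, m) - frag_of (y, m) | x y m.
         x \<in> carrier N \<and> y \<in> carrier N \<and> m \<in> carrier M} \<union>
      {frag_of (x, m \<oplus> m') - frag_of (x, m) - frag_of (x, m') | x m m'.
         x \<in> carrier N \<and> m \<in> carrier M \<and> m' \<in> carrier M} \<union>
      {frag_of (a \<odot>\<^bsub>N\<^esub> x, m) - frag_of (x, a \<odot> m) | a x m.
         a \<in> carrier R \<and> x \<in> carrier N \<and> m \<in> carrier M}"

lemma rels_generate: "rels = generate (free_Abelian_group pairs) generators"
  unfolding tensor_rels_def generators_def ..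

lemma keys_frag_of: "p \<in> pairs \<Longrightarrow> keys (frag_of p) \<subseteq> pairs" by simp

lemma generators_keys: "g \<in> generators \<Longrightarrow> keys g \<subseteq> pairs" unfolding generators_def
  by (elim UnE CollectE exE conjE; simp only:)
    (intro keys_diff_subset keys_frag_of SigmaI N_add N_smult M.M.a_closed M.smult_closed; assumption)+

lemma generators_carrier: "generators \<subseteq> carrier (free_Abelian_group pairs)" using generators_keys by auto

lemma rels_keys: "d \<in> rels \<Longrightarrow> keys d \<subseteq> pairs"
  unfolding rels_generate using group.generate_in_carrier[OF group_free_Abelian_group generators_carrier] by simp

lemma rels_subgroup: "subgroup rels (free_Abelian_group pairs)"
  unfolding rels_generate by (rule group.generate_is_subgroup[OF group_free_Abelian_group generators_carrier])

lemma rels_0: "0 \<in> rels" using subgroup.one_closed[OF rels_subgroup] by simp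

lemma rels_add: "c \<in> rels \<Longrightarrow> d \<in> rels \<Longrightarrow> c + d \<in> rels" using subgroup.m_closed[OF rels_subgroup] by simp

lemma rels_minus: "c \<in> rels \<Longrightarrow> - c \<in> rels"
  using subgroup.m_inv_closed[OF rels_subgroup, of c] rels_keys[of c] by simp

lemma rels_diff: "c \<in> rels \<Longrightarrow> d \<in> rels \<Longrightarrow> c - d \<in> rels" using rels_add[of c "- d"] rels_minus[of d] by simp

lemma rel_generators: "g \<in> generators \<Longrightarrow> g \<in> rels" unfolding rels_generate by (rule generate.incl)

lemma rel_add_left: "x \<in> carrier N \<Longrightarrow> y \<in> carrier N \<Longrightarrow> m \<in> carrier M \<Longrightarrow>
    frag_of (x \<oplus>\<^bsub>N\<^esub> y, m) - frag_of (x, m) - frag_of (y, m) \<in> rels"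
  by (rule rel_generators) (unfold generators_def, blast)

lemma rel_add_right: "x \<in> carrier N \<Longrightarrow> m \<in> carrier M \<Longrightarrow> m' \<in> carrier M \<Longrightarrow>
    frag_of (x, m \<oplus> m') - frag_of (x, m) - frag_of (x, m') \<in> rels"
  by (rule rel_generators) (unfold generators_def, blast)

lemma rel_smult: "a \<in> carrier R \<Longrightarrow> x \<in> carrier N \<Longrightarrow> m \<in> carrier M \<Longrightarrow>
    frag_of (a \<odot>\<^bsub>N\<^esub> x, m) - frag_of (x, a \<odot> m) \<in> rels"
  by (rule rel_generators) (unfold generators_def, blast)

lemma rels_induct [consumes 1, case_names zero add_left add_right smult add minus]:
  assumes "d \<in> rels" and "P 0"
    and "\<And>x y m. x \<in> carrier N \<Longrightarrow> y \<in> carrier N \<Longrightarrow> m \<in> carrier M \<Longrightarrow>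
      P (frag_of (x \<oplus>\<^bsub>N\<^esub> y, m) - frag_of (x, m) - frag_of (y, m))"
    and "\<And>x m m'. x \<in> carrier N \<Longrightarrow> m \<in> carrier M \<Longrightarrow> m' \<in> carrier M \<Longrightarrow>
      P (frag_of (x, m \<oplus> m') - frag_of (x, m) - frag_of (x, m'))"
    and "\<And>a x m. a \<in> carrier R \<Longrightarrow> x \<in> carrier N \<Longrightarrow> m \<in> carrier M \<Longrightarrow>
      P (frag_of (a \<odot>\<^bsub>N\<^esub> x, m) - frag_of (x, a \<odot> m))"
    and add: "\<And>c d. c \<in> rels \<Longrightarrow> d \<in> rels \<Longrightarrow> P c \<Longrightarrow> P d \<Longrightarrow> P (c + d)"
    and minus: "\<And>c. c \<in> rels \<Longrightarrow> P c \<Longrightarrow> P (- c)"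
  shows "P d"
proof -
  have gen: "P g" if "g \<in> generators" for g
    using that assms(3-5) unfolding generators_def by (elim UnE CollectE exE conjE; simp only:)
  \<comment> \<open>Membership is carried along so that the cases for sums and negatives can use
    it.\<close>
  have "d \<in> rels \<and> P d" using assms(1) unfolding rels_generate
  proof (induction rule: generate.induct)
    case one
    then show ?case using assms(2) generate.one by (simp flip: rels_generate add: rels_0)
  next
    case (incl h)
    then show ?case using gen generate.incl by metis
  next
    case (inv h)
    then have "P (- h)" by (intro minus rel_generators gen)
    moreover have "- h \<in> rels" using inv by (intro rels_minus rel_generators)
    ultimately show ?case using generators_keys[OF inv] by (simp flip: rels_generate)
  next
    case (eng c d)
    then show ?case using add rels_add by (simp flip: rels_generate)
  qed
  then show ?thesis ..
qed

definition tc where "tc c = tensor_class R N M c"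

lemma tc_iff:
  assumes "keys c \<subseteq> pairs" "keys d \<subseteq> pairs"
  shows "tc c = tc d \<longleftrightarrow> c - d \<in> rels"
proof -
  interpret G: group "free_Abelian_group pairs" by (rule group_free_Abelian_group)
  have "tc c = tc d \<longleftrightarrow> c \<in> tc d" unfolding tc_def tensor_class_def
    using G.repr_independence[of c rels d] G.rcos_self[of c rels] assms rels_subgroup by auto
  also have "\<dots> \<longleftrightarrow> c - d \<in> rels" unfolding tc_def tensor_class_def
    using subgroup.rcos_module[OF rels_subgroup group_free_Abelian_group, of d c] assms by simp
  finally show ?thesis .
qed

lemma tensor_one: "\<one>\<^bsub>tensor R N M\<^esub> = tc 0" unfolding tensor_def tc_def tensor_class_def FactGroup_def
  using group.coset_join3[OF group_free_Abelian_group _ rels_subgroup rels_0] by (simp add: group.coset_join2[OF group_free_Abelian_group _ rels_subgroup rels_0])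

lemma tensor_carrier: "carrier (tensor R N M) = {tc c | c. keys c \<subseteq> pairs}"
  unfolding tensor_def tc_def tensor_class_def FactGroup_def RCOSETS_def by auto

text \<open>One half of the universal property: a balanced map, extended additively, factors through
  the tensor product.\<close>

lemma frag_hom_rels:
  assumes P: "abelian_group P" and d: "d \<in> rels"
    and \<beta>: "\<And>x m. x \<in> carrier N \<Longrightarrow> m \<in> carrier M \<Longrightarrow> \<beta> (x, m) \<in> carrier P"
    and add_left: "\<And>x y m. x \<in> carrier N \<Longrightarrow> y \<in> carrier N \<Longrightarrow> m \<in> carrier M \<Longrightarrow>
      \<beta> (x \<oplus>\<^bsub>N\<^esub> y, m) = \<beta> (x, m) \<oplus>\<^bsub>P\<^esub> \<beta> (y, m)"
    and add_right: "\<And>x m m'. x \<in> carrier N \<Longrightarrow> m \<in> carrier M \<Longrightarrow> m' \<in> carrier M \<Longrightarrow>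
      \<beta> (x, m \<oplus> m') = \<beta> (x, m) \<oplus>\<^bsub>P\<^esub> \<beta> (x, m')"
    and smult: "\<And>a x m. a \<in> carrier R \<Longrightarrow> x \<in> carrier N \<Longrightarrow> m \<in> carrier M \<Longrightarrow>
      \<beta> (a \<odot>\<^bsub>N\<^esub> x, m) = \<beta> (x, a \<odot> m)"
  shows "frag_hom pairs P \<beta> d = \<zero>\<^bsub>P\<^esub>"
proof -
  interpret P: abelian_group P by (rule P)
  have \<beta>': "\<beta> \<in> pairs \<rightarrow> carrier P" using \<beta> by auto
  note h = frag_hom[OF P \<beta>']
  show ?thesis using d
  proof (induction rule: rels_induct)
    case (add_left x y m)
    then show ?case using assms(4)[of x y m] \<beta>[of x m] \<beta>[of y m] N_add[of x y]
      by (simp add: h keys_diff_subset P.add_diff_cancel)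
  next
    case (add_right x m m')
    then show ?case using assms(5)[of x m m'] \<beta>[of x m] \<beta>[of x m']
      by (simp add: h keys_diff_subset P.add_diff_cancel)
  next
    case (smult a x m)
    then show ?case using assms(6)[of a x m] \<beta>[of x "a \<odot> m"] N_smult[of a x]
      by (simp add: h P.minus_eq P.r_neg)
  next
    case (add c d)
    then show ?case using rels_keys[of c] rels_keys[of d] by (simp add: h)
  next
    case (minus c)
    then show ?case using rels_keys[of c] by (simp add: h)
  qed (simp add: h)
qed

lemma rels_sum:
  fixes r :: nat
  shows "(\<And>l. l < r \<Longrightarrow> h l \<in> rels) \<Longrightarrow> (\<Sum>l<r. h l) \<in> rels" by (induction r) (simp_all add: rels_0 rels_add)

lemma rel_zero_left: "x \<in> carrier N \<Longrightarrow> x \<oplus>\<^bsub>N\<^esub> x = x \<Longrightarrow> m \<in> carrier M \<Longrightarrow> frag_of (x, m) \<in> rels"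
  using rels_minus[OF rel_add_left[of x x m]] by simp

lemma rel_zero_right: "x \<in> carrier N \<Longrightarrow> frag_of (x, \<zero>) \<in> rels"
  using rels_minus[OF rel_add_right[of x "\<zero>" "\<zero>"]] by simp

end

definition tensor_ext :: "('b \<Rightarrow> 'c) \<Rightarrow> (('b \<times> 'd) \<Rightarrow>\<^sub>0 int) \<Rightarrow> (('c \<times> 'd) \<Rightarrow>\<^sub>0 int)" where
  "tensor_ext f = frag_extend (\<lambda>(x, m). frag_of (f x, m))"

lemma tensor_ext_simps [simp]:
  "tensor_ext f 0 = 0" "tensor_ext f (frag_of (x, m)) = frag_of (f x, m)"
  "tensor_ext f (c + d) = tensor_ext f c + tensor_ext f d" "tensor_ext f (- c) = - tensor_ext f c"
  "tensor_ext f (c - d) = tensor_ext f c - tensor_ext f d"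
  by (simp_all add: tensor_ext_def frag_extend_add frag_extend_minus frag_extend_diff)

lemma tensor_ext_keys:
  assumes "\<And>x. x \<in> X \<Longrightarrow> f x \<in> Y" "keys c \<subseteq> X \<times> Z"
  shows "keys (tensor_ext f c) \<subseteq> Y \<times> Z"
proof -
  have "keys (tensor_ext f c)
      \<subseteq> (\<Union>p\<in>keys c. keys ((\<lambda>(x, m). frag_of (f x, m)) p))"
    unfolding tensor_ext_def by (rule keys_frag_extend)
  also have "\<dots> \<subseteq> Y \<times> Z"
  proof (rule UN_least)
    fix p assume "p \<in> keys c"
    then have "fst p \<in> X" "snd p \<in> Z" using assms(2) by auto
    then show "keys ((\<lambda>(x, m). frag_of (f x, m)) p) \<subseteq> Y \<times> Z"
      using assms(1)[of "fst p"] by (simp add: case_prod_beta)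
  qed
  finally show ?thesis .
qed

locale balanced_hom = N: balanced R N M + N': balanced R N' M
  for R :: "('a, 'r) ring_scheme" and N :: "('a, 'b, 'n) module_scheme" and N' :: "('a, 'd, 'k) module_scheme"
    and M :: "('a, 'c, 'm) module_scheme" and f +
  assumes f: "f \<in> mod_hom R N N'"
begin

lemma f_closed: "x \<in> carrier N \<Longrightarrow> f x \<in> carrier N'" by (rule mod_homD(1)[OF f])

lemma ext_keys: "keys c \<subseteq> N.pairs \<Longrightarrow> keys (tensor_ext f c) \<subseteq> N'.pairs"
  by (rule tensor_ext_keys[of "carrier N"]) (rule f_closed)

lemma ext_rels: "d \<in> N.rels \<Longrightarrow> tensor_ext f d \<in> N'.rels"
proof (induction rule: N.rels_induct)
  case (add_left x y m)
  then show ?case using N'.rel_add_left[of "f x" "f y" m] f_closed mod_homD(2)[OF f] by simp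
next
  case (add_right x m m')
  then show ?case using N'.rel_add_right[of "f x" m m'] f_closed by simp
next
  case (smult a x m)
  then show ?case using N'.rel_smult[of a "f x" m] f_closed mod_homD(3)[OF f] by simp
qed (simp_all add: N'.rels_0 N'.rels_add N'.rels_minus)

lemma tensor_map_class:
  assumes c: "keys c \<subseteq> N.pairs"
  shows "tensor_map R N N' f M (N.tc c) = N'.tc (tensor_ext f c)"
proof -
  interpret G: group "free_Abelian_group N.pairs" by (rule group_free_Abelian_group)
  have cl: "N'.tc (tensor_ext f d) = N'.tc (tensor_ext f c)" if d: "d \<in> N.tc c" for d
  proof -
    have dk: "keys d \<subseteq> N.pairs"
      using G.r_coset_subset_G[of N.rels c] N.rels_keys c d unfolding N.tc_def tensor_class_def by fastforce
    have "d - c \<in> N.rels" using d c dk unfolding N.tc_def tensor_class_def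
      using subgroup.rcos_module[OF N.rels_subgroup group_free_Abelian_group, of c d] by simp
    from ext_rels[OF this] show ?thesis using ext_keys[OF dk] ext_keys[OF c] by (simp add: N'.tc_iff)
  qed
  have "c \<in> N.tc c" unfolding N.tc_def tensor_class_def using G.rcos_self[of c N.rels] c N.rels_subgroup by simp
  then have "(\<Union>d\<in>N.tc c. N'.tc (tensor_ext f d)) = N'.tc (tensor_ext f c)" using cl by blast
  then show ?thesis unfolding tensor_map_def tensor_ext_def N'.tc_def .
qed

text \<open>Replaces cosets by formal sums, on which relations can be analysed by induction.\<close>

lemma tensor_map_inj_iff:
  "inj_on (tensor_map R N N' f M) (carrier (tensor R N M)) \<longleftrightarrow>
    (\<forall>c. keys c \<subseteq> N.pairs \<and> tensor_ext f c \<in> N'.rels \<longrightarrow> c \<in> N.rels)"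
proof
  assume inj: "inj_on (tensor_map R N N' f M) (carrier (tensor R N M))"
  show "\<forall>c. keys c \<subseteq> N.pairs \<and> tensor_ext f c \<in> N'.rels \<longrightarrow> c \<in> N.rels"
  proof (intro allI impI)
    fix c assume c: "keys c \<subseteq> N.pairs \<and> tensor_ext f c \<in> N'.rels"
    have "N'.tc (tensor_ext f c) = N'.tc (tensor_ext f 0)" using c ext_keys[of c] by (simp add: N'.tc_iff)
    then have "tensor_map R N N' f M (N.tc c) = tensor_map R N N' f M (N.tc 0)"
      using c by (simp add: tensor_map_class)
    moreover have "N.tc c \<in> carrier (tensor R N M)" unfolding N.tensor_carrier using c by blast
    moreover have "N.tc 0 \<in> carrier (tensor R N M)" unfolding N.tensor_carrier by (rule CollectI, rule exI[of _ 0]) simp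
    ultimately have "N.tc c = N.tc 0" by (rule inj_onD[OF inj])
    then show "c \<in> N.rels" using c N.tc_iff[of c 0] by simp
  qed
next
  assume l: "\<forall>c. keys c \<subseteq> N.pairs \<and> tensor_ext f c \<in> N'.rels \<longrightarrow> c \<in> N.rels"
  show "inj_on (tensor_map R N N' f M) (carrier (tensor R N M))"
  proof (rule inj_onI)
    fix X Y assume X: "X \<in> carrier (tensor R N M)" and Y: "Y \<in> carrier (tensor R N M)"
      and eq: "tensor_map R N N' f M X = tensor_map R N N' f M Y"
    obtain c where c: "X = N.tc c" "keys c \<subseteq> N.pairs" using X unfolding N.tensor_carrier by blast
    obtain d where d: "Y = N.tc d" "keys d \<subseteq> N.pairs" using Y unfolding N.tensor_carrier by blast
    have "N'.tc (tensor_ext f c) = N'.tc (tensor_ext f d)" using eq c d by (simp add: tensor_map_class)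
    then have "tensor_ext f (c - d) \<in> N'.rels" using ext_keys[OF c(2)] ext_keys[OF d(2)] by (simp add: N'.tc_iff)
    then have "c - d \<in> N.rels" using l keys_diff_subset[OF c(2) d(2)] by blast
    then show "X = Y" using c d by (simp add: N.tc_iff)
  qed
qed

end

section \<open>The kernel of the map to the tensor product with \<open>U\<close>\<close>

locale vn_l2_module = l2_representation A tr \<iota> + vn_module A tr M
  for A :: "('h::chilbert \<Rightarrow>\<^sub>L 'h) set" and tr and \<iota> :: "('h \<Rightarrow>\<^sub>L 'h) \<Rightarrow> 'l::chilbert"
    and M :: "('h \<Rightarrow>\<^sub>L 'h, 'b, 'm) module_scheme" (structure)
begin

abbreviation UM :: "('h \<Rightarrow>\<^sub>L 'h, ('l \<times> 'l) set) module" where "UM \<equiv> U_right_mod A \<iota>"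

lemma UM_simps:
  "carrier UM = U" "u \<oplus>\<^bsub>UM\<^esub> v = U_add u v" "a \<odot>\<^bsub>UM\<^esub> u = U_act a u" "\<one>\<^bsub>U_ring A \<iota>\<^esub> = U_one"
  by (simp_all add: U_right_mod_def U_ring_def affiliated_ring_def U_def U_add_def U_act_def U_one_def lam_def[abs_def])

sublocale UB: balanced R UM M by unfold_locales (simp_all add: UM_simps U_add_closed U_act_closed)

lemma t_sub_iff: "m \<in> t_sub A \<iota> M \<longleftrightarrow> m \<in> carrier M \<and> frag_of (U_one, m) \<in> UB.rels"
proof -
  have "UB.tc (frag_of (U_one, m)) = UB.tc 0 \<longleftrightarrow> frag_of (U_one, m) \<in> UB.rels" if "m \<in> carrier M"
    using UB.tc_iff[of "frag_of (U_one, m)" 0] that U_one_closed by (simp add: UM_simps)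
  then show ?thesis unfolding t_sub_def UB.tensor_one UB.tc_def[symmetric] UM_simps by blast
qed

text \<open>The product \<open>s u\<close> when it lies in \<open>A\<close>. The default 0 makes the
  map total on \<open>U\<close>; additivity is used only for elements of which \<open>s\<close> is a
  denominator.\<close>

definition numer :: "('h \<Rightarrow>\<^sub>L 'h) \<Rightarrow> ('l \<times> 'l) set \<Rightarrow> ('h \<Rightarrow>\<^sub>L 'h)" where
  "numer s u = (if \<exists>a. den u s a then (THE a. den u s a) else 0)"

lemma numer_eq:
  assumes "u \<in> U" "den u s a" shows "numer s u = a"
proof -
  have "(THE a. den u s a) = a"
    by (rule the_equality[where P = "den u s", OF assms(2)]) (rule den_unique[OF assms(1) _ assms(2)])
  then show ?thesis unfolding numer_def using assms(2) by auto
qed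

lemma numer_mem: "u \<in> U \<Longrightarrow> numer s u \<in> A"
proof (cases "\<exists>a. den u s a")
  case True
  assume "u \<in> U"
  then show ?thesis using True numer_eq by (auto simp: den_def)
qed (simp add: numer_def)

text \<open>The map \<open>u \<otimes> m \<mapsto> (s u) m\<close> makes sense on fractions \<open>u\<close> with denominator \<open>s\<close> only, but the finitely
  many \<open>u\<close> that occur in a relation have a common denominator.\<close>

definition clear :: "('h \<Rightarrow>\<^sub>L 'h) \<Rightarrow> ((('l \<times> 'l) set \<times> 'b) \<Rightarrow>\<^sub>0 int) \<Rightarrow> 'b" where
  "clear s = frag_hom UB.pairs M (\<lambda>(u, m). numer s u \<odot> m)"

lemma clear_closed: "(\<lambda>(u, m). numer s u \<odot> m) \<in> UB.pairs \<rightarrow> carrier M"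
  by (auto simp: UM_simps numer_mem)

lemmas clear_hom = frag_hom[OF M.M.abelian_group_axioms clear_closed, folded clear_def]

lemma clear_of: "u \<in> U \<Longrightarrow> m \<in> carrier M \<Longrightarrow> clear s (frag_of (u, m)) = numer s u \<odot> m"
  using clear_hom(2)[of "(u, m)"] by (simp add: UM_simps)

lemmas clear = clear_of clear_hom(3-6)

text \<open>The conclusion is stated for all regular left multiples \<open>r s\<close>, so that for
  a sum of two relations a common multiple of their denominators works.\<close>

lemma clear_rels:
  assumes "d \<in> UB.rels"
  shows "\<exists>s\<in>nzd. \<forall>r\<in>A. r o\<^sub>L s \<in> nzd \<longrightarrow> clear (r o\<^sub>L s) d = \<zero>" using assms
proof (induction rule: UB.rels_induct)
  case zero
  show ?case by (rule bexI[OF _ nzd_id]) (simp add: clear_hom(4))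
next
  case (add_left u v m)
  have uv: "u \<in> U" "v \<in> U" and m: "m \<in> carrier M" using add_left by (simp_all add: UM_simps)
  obtain s1 a1 where 1: "den u s1 a1" by (rule affiliated_fractions[OF uv(1)]) (rule that)
  obtain s2 a2 where 2: "den v s2 a2" by (rule affiliated_fractions[OF uv(2)]) (rule that)
  obtain s a b where s: "den u s a" "den v s b" by (rule common_den[OF 1 2]) (rule that)
  have ab: "s \<in> nzd" "a \<in> A" "b \<in> A" using s by (simp_all add: den_def)
  show ?case
  proof (rule bexI[OF _ ab(1)], intro ballI impI)
    fix r assume r: "r \<in> A" "r o\<^sub>L s \<in> nzd"
    note d = den_mult[OF s(1) r] den_mult[OF s(2) r]
    have n: "numer (r o\<^sub>L s) u = r o\<^sub>L a" "numer (r o\<^sub>L s) v = r o\<^sub>L b"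
      "numer (r o\<^sub>L s) (U_add u v) = (r o\<^sub>L a) + (r o\<^sub>L b)"
      by (rule numer_eq[OF uv(1) d(1)], rule numer_eq[OF uv(2) d(2)],
        rule numer_eq[OF U_add_closed(1)[OF uv] U_add_den[OF uv d]])
    have "((r o\<^sub>L a) + (r o\<^sub>L b)) \<odot> m \<ominus> (r o\<^sub>L a) \<odot> m \<ominus> (r o\<^sub>L b) \<odot> m = \<zero>"
      using r ab m by (simp add: smult_simps(1) M.M.add_diff_cancel)
    then show "clear (r o\<^sub>L s) (frag_of (u \<oplus>\<^bsub>UM\<^esub> v, m) - frag_of (u, m) - frag_of (v, m)) = \<zero>"
      using uv m U_add_closed[OF uv] by (simp add: clear keys_diff_subset UM_simps n)
  qed
next
  case (add_right u m m')
  have u: "u \<in> U" using add_right by (simp add: UM_simps)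
  obtain s a where s: "den u s a" by (rule affiliated_fractions[OF u]) (rule that)
  have sn: "s \<in> nzd" using s by (simp add: den_def)
  show ?case
  proof (rule bexI[OF _ sn], intro ballI impI)
    fix r assume "r \<in> A" "r o\<^sub>L s \<in> nzd"
    show "clear (r o\<^sub>L s) (frag_of (u, m \<oplus> m') - frag_of (u, m) - frag_of (u, m')) = \<zero>"
      using u add_right numer_mem[OF u]
      by (simp add: clear keys_diff_subset UM_simps smult_simps(2) M.M.add_diff_cancel)
  qed
next
  case (smult a' u m)
  have u: "u \<in> U" and a': "a' \<in> A" and m: "m \<in> carrier M" using smult by (simp_all add: UM_simps)
  obtain s a where s: "den u s a" by (rule affiliated_fractions[OF u]) (rule that)
  have ab: "s \<in> nzd" "a \<in> A" using s by (simp_all add: den_def)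
  show ?case
  proof (rule bexI[OF _ ab(1)], intro ballI impI)
    fix r assume r: "r \<in> A" "r o\<^sub>L s \<in> nzd"
    note d = den_mult[OF s r]
    have n: "numer (r o\<^sub>L s) u = r o\<^sub>L a" "numer (r o\<^sub>L s) (U_act a' u) = (r o\<^sub>L a) o\<^sub>L a'"
      by (rule numer_eq[OF u d], rule numer_eq[OF U_act_closed(1)[OF u a'] U_act_den[OF u a' d]])
    show "clear (r o\<^sub>L s) (frag_of (a' \<odot>\<^bsub>UM\<^esub> u, m) - frag_of (u, a' \<odot> m)) = \<zero>"
      using u m a' r ab U_act_closed[OF u a'] by (simp add: clear UM_simps n smult_simps(3))
  qed
next
  case (add c d)
  obtain s1 where s1: "s1 \<in> nzd" "\<forall>r\<in>A. r o\<^sub>L s1 \<in> nzd \<longrightarrow> clear (r o\<^sub>L s1) c = \<zero>" using add by blast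
  obtain s2 where s2: "s2 \<in> nzd" "\<forall>r\<in>A. r o\<^sub>L s2 \<in> nzd \<longrightarrow> clear (r o\<^sub>L s2) d = \<zero>" using add by blast
  obtain p q where pq: "p \<in> A" "q \<in> A" "p o\<^sub>L s1 = q o\<^sub>L s2" "p o\<^sub>L s1 \<in> nzd"
    by (rule common_left_multiple[OF s1(1) s2(1)]) (rule that)
  show ?case
  proof (rule bexI[OF _ pq(4)], intro ballI impI)
    fix r assume r: "r \<in> A" "r o\<^sub>L (p o\<^sub>L s1) \<in> nzd"
    have 1: "(r o\<^sub>L p) o\<^sub>L s1 = r o\<^sub>L (p o\<^sub>L s1)" "(r o\<^sub>L q) o\<^sub>L s2 = r o\<^sub>L (p o\<^sub>L s1)"
      by (simp_all add: compose_assoc pq(3))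
    have "clear (r o\<^sub>L (p o\<^sub>L s1)) c = \<zero>" using s1(2)[THEN bspec, of "r o\<^sub>L p"] r pq(1) unfolding 1 by simp
    moreover have "clear (r o\<^sub>L (p o\<^sub>L s1)) d = \<zero>"
      using s2(2)[THEN bspec, of "r o\<^sub>L q"] r pq(2) unfolding 1 by simp
    ultimately show "clear (r o\<^sub>L (p o\<^sub>L s1)) (c + d) = \<zero>"
      using UB.rels_keys[OF add(1)] UB.rels_keys[OF add(2)] by (simp add: clear)
  qed
next
  case (minus c)
  then obtain s where s: "s \<in> nzd" "\<forall>r\<in>A. r o\<^sub>L s \<in> nzd \<longrightarrow> clear (r o\<^sub>L s) c = \<zero>" by blast
  show ?case by (rule bexI[OF _ s(1)]) (simp add: clear_hom(5)[OF UB.rels_keys[OF minus(1)]] s(2))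
qed

text \<open>If \<open>1 \<otimes> m\<close> vanishes, clearing denominators yields a regular
  \<open>s\<close> with \<open>s m = 0\<close>. Conversely
  \<open>1 \<otimes> m = s^-1 s \<otimes> m = s^-1 \<otimes> s m\<close>.\<close>

theorem t_sub_eq: "t_sub A \<iota> M = nzd_torsion M"
proof (rule Set.set_eqI)
  fix m
  show "m \<in> t_sub A \<iota> M \<longleftrightarrow> m \<in> nzd_torsion M" unfolding t_sub_iff nzd_torsion_def mem_Collect_eq
  proof (intro conj_cong refl)
    assume m: "m \<in> carrier M"
    show "frag_of (U_one, m) \<in> UB.rels \<longleftrightarrow> (\<exists>s\<in>nzd. s \<odot> m = \<zero>)"
    proof
      assume "frag_of (U_one, m) \<in> UB.rels"
      from clear_rels[OF this] obtain s where s: "s \<in> nzd"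
        and c: "\<forall>r\<in>A. r o\<^sub>L s \<in> nzd \<longrightarrow> clear (r o\<^sub>L s) (frag_of (U_one, m)) = \<zero>" by blast
      have "clear s (frag_of (U_one, m)) = \<zero>" using c[THEN bspec, of id_blinfun] s by simp
      then have "s \<odot> m = \<zero>"
        using numer_eq[OF U_one_closed U_one_den[OF s]] U_one_closed m by (simp add: clear)
      then show "\<exists>s\<in>nzd. s \<odot> m = \<zero>" using s by blast
    next
      assume "\<exists>s\<in>nzd. s \<odot> m = \<zero>"
      then obtain s where s: "s \<in> nzd" "s \<odot> m = \<zero>" by blast
      obtain u where u: "u \<in> U" "U_act s u = U_one" by (rule U_inverse[OF s(1)]) (rule that)
      have "frag_of (s \<odot>\<^bsub>UM\<^esub> u, m) - frag_of (u, s \<odot> m) \<in> UB.rels"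
        by (rule UB.rel_smult) (use s u m in \<open>simp_all add: UM_simps\<close>)
      then have "frag_of (U_one, m) - frag_of (u, \<zero>) \<in> UB.rels" by (simp add: UM_simps u s)
      moreover have "frag_of (u, \<zero>) \<in> UB.rels" by (rule UB.rel_zero_right) (simp add: UM_simps u)
      ultimately have "frag_of (U_one, m) - frag_of (u, \<zero>) + frag_of (u, \<zero>) \<in> UB.rels" by (rule UB.rels_add)
      then show "frag_of (U_one, m) \<in> UB.rels" by simp
    qed
  qed
qed

end

section \<open>Flatness\<close>

locale right_vn_module = finite_von_Neumann A tr +
  N: lmodule "vn_ring A\<lparr>mult := \<lambda>a b. b \<otimes>\<^bsub>vn_ring A\<^esub> a\<rparr>" N
  for A :: "('h::chilbert \<Rightarrow>\<^sub>L 'h) set" and tr and N :: "('h \<Rightarrow>\<^sub>L 'h, 'n, 'k) module_scheme"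
begin

lemma right_simps:
  "a \<in> A \<Longrightarrow> x \<in> carrier N \<Longrightarrow> a \<odot>\<^bsub>N\<^esub> x \<in> carrier N"
  "a \<in> A \<Longrightarrow> b \<in> A \<Longrightarrow> x \<in> carrier N \<Longrightarrow> (a + b) \<odot>\<^bsub>N\<^esub> x = a \<odot>\<^bsub>N\<^esub> x \<oplus>\<^bsub>N\<^esub> b \<odot>\<^bsub>N\<^esub> x"
  "a \<in> A \<Longrightarrow> x \<in> carrier N \<Longrightarrow> y \<in> carrier N \<Longrightarrow> a \<odot>\<^bsub>N\<^esub> (x \<oplus>\<^bsub>N\<^esub> y) = a \<odot>\<^bsub>N\<^esub> x \<oplus>\<^bsub>N\<^esub> a \<odot>\<^bsub>N\<^esub> y"
  "a \<in> A \<Longrightarrow> b \<in> A \<Longrightarrow> x \<in> carrier N \<Longrightarrow> b \<odot>\<^bsub>N\<^esub> (a \<odot>\<^bsub>N\<^esub> x) = (a o\<^sub>L b) \<odot>\<^bsub>N\<^esub> x"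
  using N.smult_closed N.smult_l_distr N.smult_r_distr N.smult_assoc1 by simp_all

end

context finite_von_Neumann
begin

lemma right_module_iff: "right_module R N \<longleftrightarrow> right_vn_module A tr N"
  unfolding right_module_def left_module_iff right_vn_module_def using finite_von_Neumann_axioms by blast

lemma op_ring: "ring (R\<lparr>mult := \<lambda>a b. b \<otimes>\<^bsub>R\<^esub> a\<rparr>)"
proof (rule ringI)
  have "abelian_group R" by (rule ring.is_abelian_group[OF vn_ring])
  then show "abelian_group (R\<lparr>mult := \<lambda>a b. b \<otimes>\<^bsub>R\<^esub> a\<rparr>)"
    by (simp add: abelian_group_def abelian_monoid_def abelian_group_axioms_def)
  show "Group.monoid (R\<lparr>mult := \<lambda>a b. b \<otimes>\<^bsub>R\<^esub> a\<rparr>)"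
    by (rule monoidI) (simp_all add: compose_assoc)
qed (simp_all add: compose_distrib)

text \<open>\<open>A\<close> as a right module over itself, moved along \<open>e\<close> into the
  type over which \<open>flat\<close> quantifies.\<close>

definition transported :: "(('h \<Rightarrow>\<^sub>L 'h) \<Rightarrow> 'n) \<Rightarrow> ('h \<Rightarrow>\<^sub>L 'h, 'n) module" where
  "transported e = \<lparr>carrier = e ` A, mult = undefined, one = undefined, ring.zero = e 0,
     ring.add = (\<lambda>x y. e (inv_into UNIV e x + inv_into UNIV e y)), smult = (\<lambda>a x. e (inv_into UNIV e x o\<^sub>L a))\<rparr>"

lemma transported_right_module:
  assumes e: "inj e" shows "right_vn_module A tr (transported e)"
proof -
  have inv: "inv_into UNIV e (e a) = a" for a by (rule inv_f_f[OF e])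
  have "abelian_group (transported e)"
  proof (rule abelian_groupI)
    show "\<exists>y\<in>carrier (transported e). y \<oplus>\<^bsub>transported e\<^esub> x = \<zero>\<^bsub>transported e\<^esub>"
      if x: "x \<in> carrier (transported e)" for x
    proof -
      obtain a where a: "a \<in> A" "x = e a" using x by (auto simp: transported_def)
      show ?thesis by (rule bexI[of _ "e (- a)"]) (use a in \<open>simp_all add: transported_def inv\<close>)
    qed
  qed (auto simp: transported_def inv algebra_simps)
  moreover have "lmodule_axioms (R\<lparr>mult := \<lambda>a b. b \<otimes>\<^bsub>R\<^esub> a\<rparr>) (transported e)"
    unfolding lmodule_axioms_def
    by (auto simp: transported_def inv compose_distrib compose_assoc)
  ultimately show ?thesis
    unfolding right_vn_module_def lmodule_def using finite_von_Neumann_axioms op_ring by blast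
qed

lemma right_balanced:
  assumes "right_vn_module A tr N" "lmodule R M" shows "balanced R N M"
proof -
  interpret right_vn_module A tr N by (rule assms)
  show ?thesis unfolding balanced_def balanced_axioms_def using assms(2) right_simps(1) by simp
qed

end

context vn_module
begin

text \<open>Left multiplication by \<open>s\<close> is an injective endomorphism of the right module
  \<open>A\<close> that sends \<open>1 \<otimes> x\<close> to
  \<open>s \<otimes> x = 1 \<otimes> s x = 0\<close>.\<close>

lemma flat_imp_torsion_free:
  fixes e :: "('h \<Rightarrow>\<^sub>L 'h) \<Rightarrow> 'n"
  assumes e: "inj e" and flat: "flat TYPE('n) R M"
    and s: "s \<in> nzd" and x: "x \<in> carrier M" and sx: "s \<odot> x = \<zero>"
  shows "x = \<zero>"
proof -
  define N where "N = transported e"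
  define g where "g = (\<lambda>y. e (s o\<^sub>L inv_into UNIV e y))"
  have inv: "inv_into UNIV e (e a) = a" for a by (rule inv_f_f[OF e])
  interpret N: right_vn_module A tr N unfolding N_def by (rule transported_right_module[OF e])
  have Nc: "carrier N = e ` A" "y \<oplus>\<^bsub>N\<^esub> z = e (inv_into UNIV e y + inv_into UNIV e z)" "a \<odot>\<^bsub>N\<^esub> y = e (inv_into UNIV e y o\<^sub>L a)" for y z a
    by (simp_all add: N_def transported_def)
  have sA: "s \<in> A" using s by simp
  have g: "g \<in> mod_hom R N N"
    by (rule mod_homI) (use sA in \<open>auto simp: Nc g_def inv compose_distrib compose_assoc\<close>)
  have "inj_on g (carrier N)"
  proof (rule inj_onI)
    fix y z assume yz: "y \<in> carrier N" "z \<in> carrier N" "g y = g z"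
    then obtain a b where ab: "y = e a" "z = e b" by (auto simp: Nc)
    have "s o\<^sub>L a = s o\<^sub>L b" using yz(3) inj_eq[OF e] by (simp add: g_def ab inv)
    then have "s o\<^sub>L (a - b) = 0" by (simp add: compose_distrib)
    from nzd_cancel_left[OF s this] show "y = z" by (simp add: ab)
  qed
  moreover have "right_module R N" unfolding right_module_iff by (rule N.right_vn_module_axioms)
  ultimately have inj: "inj_on (tensor_map R N N g M) (carrier (tensor R N M))"
    using flat g unfolding flat_def by blast
  interpret B: balanced R N M by (rule right_balanced[OF N.right_vn_module_axioms M.lmodule_axioms])
  interpret BH: balanced_hom R N N M g
    by (simp add: balanced_hom_def balanced_hom_axioms_def B.balanced_axioms g)
  have eid: "e id_blinfun \<in> carrier N" by (simp add: Nc)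
  have "frag_of (s \<odot>\<^bsub>N\<^esub> e id_blinfun, x) - frag_of (e id_blinfun, s \<odot> x) \<in> B.rels"
    by (rule B.rel_smult) (use sA eid x in simp_all)
  moreover have "frag_of (e id_blinfun, \<zero>) \<in> B.rels" by (rule B.rel_zero_right[OF eid])
  ultimately have "frag_of (s \<odot>\<^bsub>N\<^esub> e id_blinfun, x) - frag_of (e id_blinfun, \<zero>)
      + frag_of (e id_blinfun, \<zero>) \<in> B.rels" unfolding sx by (rule B.rels_add)
  then have "frag_of (e s, x) \<in> B.rels" by (simp add: Nc inv)
  then have "tensor_ext g (frag_of (e id_blinfun, x)) \<in> B.rels" by (simp add: g_def inv)
  then have r: "frag_of (e id_blinfun, x) \<in> B.rels"
    using inj eid x unfolding BH.tensor_map_inj_iff by (simp only: B.keys_frag_of SigmaI simp_thms)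
  \<comment> \<open>The multiplication map from the tensor product of \<open>A\<close> and
    \<open>M\<close> to \<open>M\<close> recovers \<open>x\<close> from
    \<open>1 \<otimes> x\<close>.\<close>
  have cl: "(\<lambda>(y, m). inv_into UNIV e y \<odot> m) \<in> B.pairs \<rightarrow> carrier M" by (auto simp: Nc inv)
  have "frag_hom B.pairs M (\<lambda>(y, m). inv_into UNIV e y \<odot> m) (frag_of (e id_blinfun, x)) = \<zero>"
    by (rule B.frag_hom_rels[OF M.M.abelian_group_axioms r]) (auto simp: Nc inv smult_simps(1-3))
  moreover have "frag_hom B.pairs M (\<lambda>(y, m). inv_into UNIV e y \<odot> m) (frag_of (e id_blinfun, x)) = x"
    using frag_hom(2)[OF M.M.abelian_group_axioms cl, of "(e id_blinfun, x)"] eid x by (simp add: inv smult_simps(4))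
  ultimately show ?thesis by simp
qed

end

locale presentation = finite_von_Neumann A tr + FV: vn_module A tr F + MV: vn_module A tr M
  for A :: "('h::chilbert \<Rightarrow>\<^sub>L 'h) set" and tr and F :: "('h \<Rightarrow>\<^sub>L 'h, 'f) module" (structure)
    and M :: "('h \<Rightarrow>\<^sub>L 'h, 'm) module" +
  fixes f :: "'f \<Rightarrow> 'm" and K :: "'f set" and I :: "'i set" and leq :: "'i \<Rightarrow> 'i \<Rightarrow> bool" and Ki :: "'i \<Rightarrow> 'f set"
  assumes proj: "fg_projective (vn_ring A) F"
    and f_hom: "f \<in> mod_hom (vn_ring A) F M" and f_surj: "f ` carrier F = carrier M"
    and K: "K = a_kernel F M f"
    and dir: "directed_on I leq"
    and Ki: "i \<in> I \<Longrightarrow> submodule (Ki i) (vn_ring A) F"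
    and Ki_fg: "i \<in> I \<Longrightarrow> fin_gen (vn_ring A) (restrict_mod F (Ki i))"
    and Ki_mono: "i \<in> I \<Longrightarrow> j \<in> I \<Longrightarrow> leq i j \<Longrightarrow> Ki i \<subseteq> Ki j"
    and Ki_union: "(\<Union>i\<in>I. Ki i) = K"
begin

sublocale f: lmodule_hom R F M f
  by (simp add: lmodule_hom_def lmodule_hom_axioms_def FV.M.lmodule_axioms MV.M.lmodule_axioms f_hom)

lemma K_iff: "x \<in> K \<longleftrightarrow> x \<in> carrier F \<and> f x = \<zero>\<^bsub>M\<^esub>" unfolding K by (rule f.kernel_iff)

lemma K_sub: "submodule K R F" unfolding K by (rule f.kernel_submodule)

text \<open>A section of \<open>f\<close> as a map of sets; its failure to be linear lies in
  \<open>K\<close>.\<close>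

definition \<sigma> :: "'m \<Rightarrow> 'f" where "\<sigma> = inv_into (carrier F) f"

lemma \<sigma>: "m \<in> carrier M \<Longrightarrow> \<sigma> m \<in> carrier F" "m \<in> carrier M \<Longrightarrow> f (\<sigma> m) = m"
  unfolding \<sigma>_def f_surj[symmetric] by (simp_all add: inv_into_into f_inv_into_f)

text \<open>Evaluates a functional of \<open>F\<close> in the second factor through the section. For
  a functional that vanishes only on some \<open>Ki i\<close> this does not descend to the tensor
  product; it kills a given relation once \<open>i\<close> is large enough for it.\<close>

definition contract :: "('h \<Rightarrow>\<^sub>L 'h, 'n, 'k) module_scheme \<Rightarrow> ('f \<Rightarrow> ('h \<Rightarrow>\<^sub>L 'h)) \<Rightarrow> (('n \<times> 'm) \<Rightarrow>\<^sub>0 int) \<Rightarrow> 'n" where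
  "contract N \<phi> = frag_hom (carrier N \<times> carrier M) N (\<lambda>(n, m). \<phi> (\<sigma> m) \<odot>\<^bsub>N\<^esub> n)"

lemma contract:
  assumes N: "right_vn_module A tr N" and \<phi>: "FV.functional \<phi>"
  defines "X \<equiv> carrier N \<times> carrier M"
  shows contract_closed: "keys c \<subseteq> X \<Longrightarrow> contract N \<phi> c \<in> carrier N"
    and contract_of: "n \<in> carrier N \<Longrightarrow> m \<in> carrier M \<Longrightarrow> contract N \<phi> (frag_of (n, m)) = \<phi> (\<sigma> m) \<odot>\<^bsub>N\<^esub> n"
    and contract_zero: "contract N \<phi> 0 = \<zero>\<^bsub>N\<^esub>"
    and contract_add: "keys c \<subseteq> X \<Longrightarrow> keys d \<subseteq> X \<Longrightarrow>
      contract N \<phi> (c + d) = contract N \<phi> c \<oplus>\<^bsub>N\<^esub> contract N \<phi> d"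
    and contract_minus: "keys c \<subseteq> X \<Longrightarrow> contract N \<phi> (- c) = \<ominus>\<^bsub>N\<^esub> contract N \<phi> c"
    and contract_diff: "keys c \<subseteq> X \<Longrightarrow> keys d \<subseteq> X \<Longrightarrow>
      contract N \<phi> (c - d) = contract N \<phi> c \<ominus>\<^bsub>N\<^esub> contract N \<phi> d"
proof -
  interpret N: right_vn_module A tr N by (rule N)
  have \<beta>: "(\<lambda>(n, m). \<phi> (\<sigma> m) \<odot>\<^bsub>N\<^esub> n) \<in> X \<rightarrow> carrier N"
    using FV.functionalD(1)[OF \<phi> \<sigma>(1)] by (auto simp: X_def N.right_simps(1))
  note h = frag_hom[OF N.N.M.abelian_group_axioms \<beta>]
  have eq: "contract N \<phi> = frag_hom X N (\<lambda>(n, m). \<phi> (\<sigma> m) \<odot>\<^bsub>N\<^esub> n)" unfolding contract_def X_def ..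
  show "keys c \<subseteq> X \<Longrightarrow> contract N \<phi> c \<in> carrier N" unfolding eq by (rule h(1))
  show "n \<in> carrier N \<Longrightarrow> m \<in> carrier M \<Longrightarrow> contract N \<phi> (frag_of (n, m)) = \<phi> (\<sigma> m) \<odot>\<^bsub>N\<^esub> n"
    unfolding eq using h(2)[of "(n, m)"] by (simp add: X_def)
  show "contract N \<phi> 0 = \<zero>\<^bsub>N\<^esub>" unfolding eq by (rule h(4))
  show "keys c \<subseteq> X \<Longrightarrow> keys d \<subseteq> X \<Longrightarrow>
      contract N \<phi> (c + d) = contract N \<phi> c \<oplus>\<^bsub>N\<^esub> contract N \<phi> d" unfolding eq by (rule h(3))
  show "keys c \<subseteq> X \<Longrightarrow> contract N \<phi> (- c) = \<ominus>\<^bsub>N\<^esub> contract N \<phi> c" unfolding eq by (rule h(5))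
  show "keys c \<subseteq> X \<Longrightarrow> keys d \<subseteq> X \<Longrightarrow>
      contract N \<phi> (c - d) = contract N \<phi> c \<ominus>\<^bsub>N\<^esub> contract N \<phi> d" unfolding eq by (rule h(6))
qed

text \<open>Each relation involves only finitely many elements of \<open>K\<close>, so it already holds over some \<open>Ki i\<close>.\<close>

lemma contract_rels:
  assumes N: "right_vn_module A tr N" and d: "d \<in> tensor_rels R N M"
  shows "\<exists>i\<in>I. \<forall>\<phi>. FV.functional \<phi> \<and> (\<forall>y\<in>Ki i. \<phi> y = 0) \<longrightarrow> contract N \<phi> d = \<zero>\<^bsub>N\<^esub>"
proof -
  interpret N: right_vn_module A tr N by (rule N)
  interpret B: balanced R N M by (rule right_balanced[OF N MV.M.lmodule_axioms])
  obtain i0 where i0: "i0 \<in> I" using dir by (auto simp: directed_on_def)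
  have inK: "\<exists>i\<in>I. y \<in> Ki i" if "y \<in> K" for y using that Ki_union by blast
  note c = contract[OF N]
  show ?thesis using d
  proof (induction rule: B.rels_induct)
    case zero
    show ?case using i0 by (auto simp: contract_zero[OF N])
  next
    case (add_left x y m)
    show ?case
    proof (rule bexI[OF _ i0], intro allI impI)
      fix \<phi> assume \<phi>: "FV.functional \<phi> \<and> (\<forall>y\<in>Ki i0. \<phi> y = 0)"
      have "\<phi> (\<sigma> m) \<in> A" using FV.functionalD(1)[OF conjunct1[OF \<phi>] \<sigma>(1)] add_left by blast
      then show "contract N \<phi> (frag_of (x \<oplus>\<^bsub>N\<^esub> y, m) - frag_of (x, m) - frag_of (y, m)) = \<zero>\<^bsub>N\<^esub>"
        using add_left by (simp add: c[OF conjunct1[OF \<phi>]] keys_diff_subset N.right_simps N.N.M.add_diff_cancel)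
    qed
  next
    case (add_right x m m')
    \<comment> \<open>The defect of additivity of \<sigma>; a functional that vanishes on a
      \<open>Ki i\<close> containing it treats \<sigma> as additive here.\<close>
    define y where "y = \<sigma> (m \<oplus>\<^bsub>M\<^esub> m') \<ominus> (\<sigma> m \<oplus> \<sigma> m')"
    have "y \<in> K" unfolding K_iff y_def using add_right \<sigma> by (simp add: f.hom_diff f.hom_add)
    then obtain i where i: "i \<in> I" "y \<in> Ki i" using inK by blast
    show ?case
    proof (rule bexI[OF _ i(1)], intro allI impI)
      fix \<phi> assume \<phi>: "FV.functional \<phi> \<and> (\<forall>y\<in>Ki i. \<phi> y = 0)"
      note \<phi>D = FV.functionalD[OF conjunct1[OF \<phi>]]
      have A: "\<phi> (\<sigma> m) \<in> A" "\<phi> (\<sigma> m') \<in> A" using \<phi>D(1)[OF \<sigma>(1)] add_right by blast+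
      have "\<phi> y = 0" using \<phi> i(2) by blast
      then have "\<phi> (\<sigma> (m \<oplus>\<^bsub>M\<^esub> m')) = \<phi> (\<sigma> m) + \<phi> (\<sigma> m')"
        unfolding y_def using add_right \<sigma>(1) by (simp add: \<phi>D)
      then show "contract N \<phi> (frag_of (x, m \<oplus>\<^bsub>M\<^esub> m') - frag_of (x, m) - frag_of (x, m')) = \<zero>\<^bsub>N\<^esub>"
        using A add_right by (simp add: c[OF conjunct1[OF \<phi>]] keys_diff_subset N.right_simps N.N.M.add_diff_cancel)
    qed
  next
    case (smult a x m)
    then have a: "a \<in> A" by simp
    define y where "y = \<sigma> (a \<odot>\<^bsub>M\<^esub> m) \<ominus> a \<odot> \<sigma> m"
    have "y \<in> K" unfolding K_iff y_def using smult \<sigma> by (simp add: f.hom_diff f.hom_smult)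
    then obtain i where i: "i \<in> I" "y \<in> Ki i" using inK by blast
    show ?case
    proof (rule bexI[OF _ i(1)], intro allI impI)
      fix \<phi> assume \<phi>: "FV.functional \<phi> \<and> (\<forall>y\<in>Ki i. \<phi> y = 0)"
      note \<phi>D = FV.functionalD[OF conjunct1[OF \<phi>]]
      have A: "\<phi> (\<sigma> m) \<in> A" using \<phi>D(1)[OF \<sigma>(1)] smult by blast
      have "\<phi> y = 0" using \<phi> i(2) by blast
      then have "\<phi> (\<sigma> (a \<odot>\<^bsub>M\<^esub> m)) = a o\<^sub>L \<phi> (\<sigma> m)" unfolding y_def using smult \<sigma>(1) by (simp add: \<phi>D)
      then show "contract N \<phi> (frag_of (a \<odot>\<^bsub>N\<^esub> x, m) - frag_of (x, a \<odot>\<^bsub>M\<^esub> m)) = \<zero>\<^bsub>N\<^esub>"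
        using A a smult by (simp add: c[OF conjunct1[OF \<phi>]] N.right_simps)
    qed
  next
    case (add d d')
    obtain i where i: "i \<in> I" "\<forall>\<phi>. FV.functional \<phi> \<and> (\<forall>y\<in>Ki i. \<phi> y = 0) \<longrightarrow> contract N \<phi> d = \<zero>\<^bsub>N\<^esub>"
      using add by blast
    obtain j where j: "j \<in> I" "\<forall>\<phi>. FV.functional \<phi> \<and> (\<forall>y\<in>Ki j. \<phi> y = 0) \<longrightarrow> contract N \<phi> d' = \<zero>\<^bsub>N\<^esub>"
      using add by blast
    obtain k where k: "k \<in> I" "leq i k" "leq j k" using dir i(1) j(1) unfolding directed_on_def by blast
    have sub: "Ki i \<subseteq> Ki k" "Ki j \<subseteq> Ki k" using Ki_mono i(1) j(1) k by blast+
    show ?case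
    proof (rule bexI[OF _ k(1)], intro allI impI)
      fix \<phi> assume \<phi>: "FV.functional \<phi> \<and> (\<forall>y\<in>Ki k. \<phi> y = 0)"
      have "contract N \<phi> d = \<zero>\<^bsub>N\<^esub>" using i(2) \<phi> sub(1) by blast
      moreover have "contract N \<phi> d' = \<zero>\<^bsub>N\<^esub>" using j(2) \<phi> sub(2) by blast
      ultimately show "contract N \<phi> (d + d') = \<zero>\<^bsub>N\<^esub>"
        using B.rels_keys[OF add(1)] B.rels_keys[OF add(2)] by (simp add: c[OF conjunct1[OF \<phi>]])
    qed
  next
    case (minus d)
    then obtain i where i: "i \<in> I" "\<forall>\<phi>. FV.functional \<phi> \<and> (\<forall>y\<in>Ki i. \<phi> y = 0) \<longrightarrow> contract N \<phi> d = \<zero>\<^bsub>N\<^esub>"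
      by blast
    show ?case
    proof (rule bexI[OF _ i(1)], intro allI impI)
      fix \<phi> assume \<phi>: "FV.functional \<phi> \<and> (\<forall>y\<in>Ki i. \<phi> y = 0)"
      have "contract N \<phi> d = \<zero>\<^bsub>N\<^esub>" using i(2) \<phi> by blast
      then show "contract N \<phi> (- d) = \<zero>\<^bsub>N\<^esub>" using B.rels_keys[OF minus(1)] by (simp add: c[OF conjunct1[OF \<phi>]])
    qed
  qed
qed

lemma contract_natural:
  assumes N: "right_vn_module A tr N" and N': "right_vn_module A tr N'" and g: "g \<in> mod_hom R N N'"
    and \<phi>: "FV.functional \<phi>" and c: "keys c \<subseteq> carrier N \<times> carrier M"
  shows "contract N' \<phi> (tensor_ext g c) = g (contract N \<phi> c)"
proof -
  interpret N: right_vn_module A tr N by (rule N)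
  interpret N': right_vn_module A tr N' by (rule N')
  have g': "g \<in> mod_hom (R\<lparr>mult := \<lambda>a b. b \<otimes>\<^bsub>R\<^esub> a\<rparr>) N N'" using g by (simp add: mod_hom_def)
  interpret g: lmodule_hom "R\<lparr>mult := \<lambda>a b. b \<otimes>\<^bsub>R\<^esub> a\<rparr>" N N' g
    unfolding lmodule_hom_def lmodule_hom_axioms_def
    using N.N.lmodule_axioms N'.N.lmodule_axioms g' by blast
  have k: "keys (tensor_ext g d) \<subseteq> carrier N' \<times> carrier M"
    if "keys d \<subseteq> carrier N \<times> carrier M" for d
    by (rule tensor_ext_keys[OF _ that]) (rule g.hom_closed)
  show ?thesis
  proof (rule free_Abelian_group_induct[OF c])
    show "contract N' \<phi> (tensor_ext g 0) = g (contract N \<phi> 0)"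
      by (simp add: contract_zero[OF N \<phi>] contract_zero[OF N' \<phi>])
  next
    fix x y
    assume xy: "keys x \<subseteq> carrier N \<times> carrier M" "keys y \<subseteq> carrier N \<times> carrier M"
      "contract N' \<phi> (tensor_ext g x) = g (contract N \<phi> x)" "contract N' \<phi> (tensor_ext g y) = g (contract N \<phi> y)"
    then show "contract N' \<phi> (tensor_ext g (x - y)) = g (contract N \<phi> (x - y))"
      using k[OF xy(1)] k[OF xy(2)] by (simp add: contract[OF N \<phi>] contract[OF N' \<phi>] g.hom_diff)
  next
    fix p assume "p \<in> carrier N \<times> carrier M"
    then obtain n m where p: "p = (n, m)" "n \<in> carrier N" "m \<in> carrier M" by blast
    have "\<phi> (\<sigma> m) \<in> A" by (rule FV.functionalD(1)[OF \<phi> \<sigma>(1)[OF p(3)]])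
    then show "contract N' \<phi> (tensor_ext g (frag_of p)) = g (contract N \<phi> (frag_of p))"
      using p mod_homD(1,3)[OF g] by (simp add: contract[OF N \<phi>] contract[OF N' \<phi>])
  qed
qed

text \<open>Modulo \<open>K\<close> every \<open>x\<close> in \<open>F\<close> is its expansion, so
  \<open>n \<otimes> m\<close> equals the sum of
  \<open>n \<otimes> \<xi> l (\<sigma> m) f (p l)\<close>; balancing moves the coefficients to
  \<open>n\<close>, and additivity extends this to all formal sums.\<close>

lemma contract_expansion:
  assumes N: "right_vn_module A tr N"
    and p: "\<And>l. l < r \<Longrightarrow> p l \<in> carrier F" and \<xi>: "\<And>l. l < r \<Longrightarrow> FV.functional (\<xi> l)"
    and pK: "\<And>x. x \<in> carrier F \<Longrightarrow> x \<ominus> FV.lincomb r (\<lambda>l. \<xi> l x) p \<in> K"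
    and c: "keys c \<subseteq> carrier N \<times> carrier M"
  shows "c - (\<Sum>l<r. frag_of (contract N (\<xi> l) c, f (p l))) \<in> tensor_rels R N M"
proof -
  interpret N: right_vn_module A tr N by (rule N)
  interpret B: balanced R N M by (rule right_balanced[OF N MV.M.lmodule_axioms])
  have q: "f (p l) \<in> carrier M" if "l < r" for l using f.hom_closed[OF p[OF that]] .
  have zero_left: "frag_of (\<zero>\<^bsub>N\<^esub>, m) \<in> B.rels" if "m \<in> carrier M" for m
    by (rule B.rel_zero_left) (use that in simp_all)
  have comb: "frag_of (n, MV.lincomb r' a k) - (\<Sum>l<r'. frag_of (a l \<odot>\<^bsub>N\<^esub> n, k l)) \<in> B.rels"
    if n: "n \<in> carrier N" and "\<And>l. l < r' \<Longrightarrow> a l \<in> A" "\<And>l. l < r' \<Longrightarrow> k l \<in> carrier M" for n a k and r' :: nat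
    using that(2,3)
  proof (induction r')
    case 0
    show ?case by (simp add: B.rel_zero_right[OF n])
  next
    case (Suc r')
    let ?z = "MV.lincomb r' a k" and ?s = "\<Sum>l<r'. frag_of (a l \<odot>\<^bsub>N\<^esub> n, k l)"
    have z: "?z \<in> carrier M" using Suc.prems by simp
    have 1: "frag_of (n, ?z \<oplus>\<^bsub>M\<^esub> a r' \<odot>\<^bsub>M\<^esub> k r') - frag_of (n, ?z) - frag_of (n, a r' \<odot>\<^bsub>M\<^esub> k r') \<in> B.rels"
      by (rule B.rel_add_right[OF n z]) (use Suc.prems in simp)
    have 2: "frag_of (a r' \<odot>\<^bsub>N\<^esub> n, k r') - frag_of (n, a r' \<odot>\<^bsub>M\<^esub> k r') \<in> B.rels"
      by (rule B.rel_smult) (use Suc.prems n in simp_all)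
    have 3: "frag_of (n, ?z) - ?s \<in> B.rels" using Suc by simp
    from B.rels_add[OF B.rels_diff[OF 1 2] 3] show ?case by (simp add: algebra_simps)
  qed
  show ?thesis
  proof (rule free_Abelian_group_induct[OF c])
    have "(\<Sum>l<r. frag_of (\<zero>\<^bsub>N\<^esub>, f (p l))) \<in> B.rels" by (rule B.rels_sum) (rule zero_left[OF q])
    then have "- (\<Sum>l<r. frag_of (\<zero>\<^bsub>N\<^esub>, f (p l))) \<in> B.rels" by (rule B.rels_minus)
    moreover have "(\<Sum>l<r. frag_of (contract N (\<xi> l) 0, f (p l))) = (\<Sum>l<r. frag_of (\<zero>\<^bsub>N\<^esub>, f (p l)))"
      by (rule sum.cong) (simp_all add: contract_zero[OF N \<xi>])
    ultimately show "0 - (\<Sum>l<r. frag_of (contract N (\<xi> l) 0, f (p l))) \<in> B.rels" by simp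
  next
    fix x y
    assume xy: "keys x \<subseteq> B.pairs" "keys y \<subseteq> B.pairs"
      and IH: "x - (\<Sum>l<r. frag_of (contract N (\<xi> l) x, f (p l))) \<in> B.rels"
        "y - (\<Sum>l<r. frag_of (contract N (\<xi> l) y, f (p l))) \<in> B.rels"
    let ?S = "\<lambda>c. \<Sum>l<r. frag_of (contract N (\<xi> l) c, f (p l))"
    have "(\<Sum>l<r. frag_of (contract N (\<xi> l) x, f (p l)) - frag_of (contract N (\<xi> l) (x - y), f (p l))
        - frag_of (contract N (\<xi> l) y, f (p l))) \<in> B.rels"
    proof (rule B.rels_sum)
      fix l assume l: "l < r"
      note cl = contract_closed[OF N \<xi>[OF l]]
      have "contract N (\<xi> l) (x - y) \<oplus>\<^bsub>N\<^esub> contract N (\<xi> l) y = contract N (\<xi> l) x"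
        using contract_add[OF N \<xi>[OF l] keys_diff_subset[OF xy] xy(2)] by simp
      then show "frag_of (contract N (\<xi> l) x, f (p l)) - frag_of (contract N (\<xi> l) (x - y), f (p l))
        - frag_of (contract N (\<xi> l) y, f (p l)) \<in> B.rels"
        using B.rel_add_left[OF cl[OF keys_diff_subset[OF xy]] cl[OF xy(2)] q[OF l]] by simp
    qed
    then have "?S x - ?S (x - y) - ?S y \<in> B.rels" by (simp add: sum_subtractf)
    from B.rels_add[OF this B.rels_diff[OF IH]]
    show "x - y - ?S (x - y) \<in> B.rels" by (simp add: algebra_simps)
  next
    fix z assume "z \<in> B.pairs"
    then obtain n m where z: "z = (n, m)" "n \<in> carrier N" "m \<in> carrier M" by blast
    define x where "x = \<sigma> m"
    have x: "x \<in> carrier F" "f x = m" using \<sigma> z(3) by (simp_all add: x_def)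
    have A: "\<xi> l x \<in> A" if "l < r" for l by (rule FV.functionalD(1)[OF \<xi>[OF that] x(1)])
    have L: "FV.lincomb r (\<lambda>l. \<xi> l x) p \<in> carrier F" using A p by simp
    have "f (x \<ominus> FV.lincomb r (\<lambda>l. \<xi> l x) p) = \<zero>\<^bsub>M\<^esub>" using pK[OF x(1)] K_iff by blast
    then have "f x = f (FV.lincomb r (\<lambda>l. \<xi> l x) p)"
      using MV.M.diff_eq_zero_iff[of "f x" "f (FV.lincomb r (\<lambda>l. \<xi> l x) p)"] x(1) L by (simp add: f.hom_diff)
    also have "\<dots> = MV.lincomb r (\<lambda>l. \<xi> l x) (\<lambda>l. f (p l))"
      by (rule hom_lincomb[OF FV.vn_module' MV.vn_module' f_hom]) (use A p in simp_all)
    finally have m: "m = MV.lincomb r (\<lambda>l. \<xi> l x) (\<lambda>l. f (p l))" using x(2) by simp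
    have "frag_of (n, m) - (\<Sum>l<r. frag_of (\<xi> l x \<odot>\<^bsub>N\<^esub> n, f (p l))) \<in> B.rels"
      using comb[OF z(2), of r "\<lambda>l. \<xi> l x" "\<lambda>l. f (p l)"] A q unfolding m[symmetric] by simp
    moreover have "(\<Sum>l<r. frag_of (contract N (\<xi> l) (frag_of z), f (p l)))
        = (\<Sum>l<r. frag_of (\<xi> l x \<odot>\<^bsub>N\<^esub> n, f (p l)))"
      by (rule sum.cong) (simp_all add: z contract_of[OF N \<xi>] x_def)
    ultimately show "frag_of z - (\<Sum>l<r. frag_of (contract N (\<xi> l) (frag_of z), f (p l))) \<in> B.rels"
      by (simp add: z(1))
  qed
qed

lemma torsion_free_imp_flat:
  assumes tf: "\<And>s x. s \<in> nzd \<Longrightarrow> x \<in> carrier F \<Longrightarrow> s \<odot> x \<in> K \<Longrightarrow> x \<in> K"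
  shows "flat TYPE('n) R M" unfolding flat_def
proof (intro allI impI)
  fix N N' :: "('h \<Rightarrow>\<^sub>L 'h, 'n) module" and g
  assume l: "right_module R N \<and> right_module R N' \<and> g \<in> mod_hom R N N' \<and> inj_on g (carrier N)"
  then have N: "right_vn_module A tr N" and N': "right_vn_module A tr N'"
    and g: "g \<in> mod_hom R N N'" and inj: "inj_on g (carrier N)"
    unfolding right_module_iff by blast+
  interpret N: right_vn_module A tr N by (rule N)
  interpret N': right_vn_module A tr N' by (rule N')
  interpret B: balanced R N M by (rule right_balanced[OF N MV.M.lmodule_axioms])
  interpret B': balanced R N' M by (rule right_balanced[OF N' MV.M.lmodule_axioms])
  interpret BH: balanced_hom R N N' M g
    by (simp add: balanced_hom_def balanced_hom_axioms_def B.balanced_axioms B'.balanced_axioms g)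
  have g0: "g \<zero>\<^bsub>N\<^esub> = \<zero>\<^bsub>N'\<^esub>"
    using mod_homD(2)[OF g N.N.M.zero_closed N.N.M.zero_closed] mod_homD(1)[OF g N.N.M.zero_closed]
    by (simp add: N'.N.M.add.l_cancel_one')
  show "inj_on (tensor_map R N N' g M) (carrier (tensor R N M))"
    unfolding BH.tensor_map_inj_iff
  proof (intro allI impI)
    fix c assume c: "keys c \<subseteq> B.pairs \<and> tensor_ext g c \<in> B'.rels"
    obtain i where i: "i \<in> I"
      and kill: "\<forall>\<phi>. FV.functional \<phi> \<and> (\<forall>y\<in>Ki i. \<phi> y = 0) \<longrightarrow> contract N' \<phi> (tensor_ext g c) = \<zero>\<^bsub>N'\<^esub>"
      using contract_rels[OF N' conjunct2[OF c]] by blast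
    obtain r p \<xi> where p: "\<And>l. l < r \<Longrightarrow> p l \<in> carrier F" and \<xi>: "\<And>l. l < r \<Longrightarrow> FV.functional (\<xi> l)"
      and \<xi>K: "\<And>l x. l < r \<Longrightarrow> x \<in> Ki i \<Longrightarrow> \<xi> l x = 0"
      and cl: "\<And>x. x \<in> carrier F \<Longrightarrow> \<exists>s\<in>nzd. s \<odot> (x \<ominus> FV.lincomb r (\<lambda>l. \<xi> l x) p) \<in> Ki i"
      by (rule FV.closure_dual_basis[OF proj Ki[OF i] Ki_fg[OF i]]) (rule that)
    \<comment> \<open>The expansion holds only up to a regular multiple lying in
      \<open>Ki i\<close>; torsion-freeness of \<open>M\<close> turns this into a remainder in
      \<open>K\<close>.\<close>
    have pK: "x \<ominus> FV.lincomb r (\<lambda>l. \<xi> l x) p \<in> K" if x: "x \<in> carrier F" for x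
    proof -
      obtain s where s: "s \<in> nzd" "s \<odot> (x \<ominus> FV.lincomb r (\<lambda>l. \<xi> l x) p) \<in> Ki i" using cl[OF x] by blast
      have "FV.lincomb r (\<lambda>l. \<xi> l x) p \<in> carrier F" using FV.functionalD(1)[OF \<xi> x] p by simp
      then have c: "x \<ominus> FV.lincomb r (\<lambda>l. \<xi> l x) p \<in> carrier F" using x by simp
      have "s \<odot> (x \<ominus> FV.lincomb r (\<lambda>l. \<xi> l x) p) \<in> K" using s(2) i Ki_union by blast
      then show ?thesis by (rule tf[OF s(1) c])
    qed
    have z: "contract N (\<xi> l) c = \<zero>\<^bsub>N\<^esub>" if l: "l < r" for l
    proof -
      have "contract N' (\<xi> l) (tensor_ext g c) = \<zero>\<^bsub>N'\<^esub>" using kill \<xi>[OF l] \<xi>K[OF l] by blast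
      then have "g (contract N (\<xi> l) c) = g \<zero>\<^bsub>N\<^esub>"
        using contract_natural[OF N N' g \<xi>[OF l] conjunct1[OF c]] g0 by simp
      then show ?thesis
        by (rule inj_onD[OF inj _ contract_closed[OF N \<xi>[OF l] conjunct1[OF c]] N.N.M.zero_closed])
    qed
    have zero: "frag_of (\<zero>\<^bsub>N\<^esub>, m) \<in> B.rels" if "m \<in> carrier M" for m
    by (rule B.rel_zero_left) (use that in simp_all)
    have "(\<Sum>l<r. frag_of (contract N (\<xi> l) c, f (p l))) \<in> B.rels"
      by (rule B.rels_sum) (simp add: z zero f.hom_closed p)
    from B.rels_add[OF contract_expansion[OF N p \<xi> pK conjunct1[OF c]] this]
    show "c \<in> B.rels" by simp
  qed
qed

end

section \<open>The closures of the kernel\<close>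

lemma (in lmodule) quot_map_hom:
  assumes K: "submodule K R M" shows "(\<lambda>x. K +> x) \<in> mod_hom R M (quot_mod M K)"
  by (rule mod_homI) (simp_all add: quot_carrierI quot_add[OF K] quot_smult[OF K])

lemma (in lmodule_hom) preimage_submodule:
  assumes P: "submodule P R N" shows "submodule {x \<in> carrier M. h x \<in> P} R M"
  by (rule M.submoduleI) (use N.submoduleD(2-4)[OF P] in \<open>simp_all add: hom_add hom_smult\<close>)

locale l2_presentation = presentation A tr F M f K I leq Ki + l2_representation A tr \<iota>
  for A :: "('h::chilbert \<Rightarrow>\<^sub>L 'h) set" and tr and F :: "('h \<Rightarrow>\<^sub>L 'h, 'f) module" (structure)
    and M :: "('h \<Rightarrow>\<^sub>L 'h, 'm) module" and f K and I :: "'i set" and leq Ki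
    and \<iota> :: "('h \<Rightarrow>\<^sub>L 'h) \<Rightarrow> 'l::chilbert"
begin

abbreviation clT where "clT \<equiv> cl_T A tr F"
abbreviation clt where "clt \<equiv> cl_t A \<iota> F"

lemma t_sub_M: "t_sub A \<iota> M = nzd_torsion M"
proof -
  interpret vn_l2_module A tr \<iota> M by unfold_locales
  show ?thesis by (rule t_sub_eq)
qed

lemma cl_t_iff: "x \<in> clt K \<longleftrightarrow> x \<in> carrier F \<and> (\<exists>s\<in>nzd. s \<odot> x \<in> K)"
proof -
  interpret Q: vn_module A tr "quot_mod F K" by (rule FV.quot_vn_module[OF K_sub])
  interpret Q: vn_l2_module A tr \<iota> "quot_mod F K" by unfold_locales
  show ?thesis unfolding cl_t_def Q.t_sub_eq using FV.nzd_torsion_quot_iff[OF K_sub] by blast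
qed

lemma smult_K_iff: "a \<in> A \<Longrightarrow> x \<in> carrier F \<Longrightarrow> a \<odot> x \<in> K \<longleftrightarrow> a \<odot>\<^bsub>M\<^esub> f x = \<zero>\<^bsub>M\<^esub>" by (simp add: K_iff f.hom_smult)

lemma cl_t_iff': "x \<in> clt K \<longleftrightarrow> x \<in> carrier F \<and> f x \<in> nzd_torsion M"
  unfolding cl_t_iff nzd_torsion_def by (auto simp: smult_K_iff)

text \<open>Torsion depends only on which multiples of an element vanish, and these are the same for
  a coset in \<open>F / K\<close> and its image in \<open>M\<close>.\<close>

lemma cl_T_iff': "x \<in> clT K \<longleftrightarrow> x \<in> carrier F \<and> f x \<in> torsion M"
proof -
  have "K +> x \<in> torsion (quot_mod F K) \<longleftrightarrow> f x \<in> torsion M" if x: "x \<in> carrier F"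
  proof -
    have 1: "b \<odot> (a \<odot> x) \<in> K \<longleftrightarrow> b \<odot>\<^bsub>M\<^esub> (a \<odot>\<^bsub>M\<^esub> f x) = \<zero>\<^bsub>M\<^esub>" if "a \<in> A" "b \<in> A" for a b
      using that x by (simp add: smult_K_iff f.hom_smult)
    have "f x \<in> torsion M \<longleftrightarrow> (\<forall>a\<in>A. \<forall>e. projection e \<and>
        (\<forall>b\<in>A. b \<odot>\<^bsub>M\<^esub> (a \<odot>\<^bsub>M\<^esub> f x) = \<zero>\<^bsub>M\<^esub> \<longleftrightarrow> b o\<^sub>L e = 0) \<longrightarrow> a \<odot>\<^bsub>M\<^esub> f x = \<zero>\<^bsub>M\<^esub>)"
      unfolding torsion_def ann_by_def using f.hom_closed[OF x] by blast
    also have "\<dots> \<longleftrightarrow> (\<forall>a\<in>A. \<forall>e. projection e \<and>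
        (\<forall>b\<in>A. b \<odot> (a \<odot> x) \<in> K \<longleftrightarrow> b o\<^sub>L e = 0) \<longrightarrow> a \<odot> x \<in> K)"
      using 1 smult_K_iff[OF _ x] by (simp cong: ball_cong)
    also have "\<dots> \<longleftrightarrow> K +> x \<in> torsion (quot_mod F K)" by (rule FV.torsion_quot_iff[OF K_sub x, symmetric])
    finally show ?thesis by (rule sym)
  qed
  then show ?thesis unfolding FV.cl_T_iff[OF K_sub] by blast
qed

lemma cl_T_Ki: "i \<in> I \<Longrightarrow> x \<in> clT (Ki i) \<longleftrightarrow> x \<in> carrier F \<and> (\<exists>s\<in>nzd. s \<odot> x \<in> Ki i)"
  by (rule FV.cl_T_fin_gen[OF proj Ki Ki_fg])

lemma cl_T_union: "(\<Union>i\<in>I. clT (Ki i)) = clt K"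
proof
  show "(\<Union>i\<in>I. clT (Ki i)) \<subseteq> clt K"
  proof
    fix x assume "x \<in> (\<Union>i\<in>I. clT (Ki i))"
    then obtain i where i: "i \<in> I" "x \<in> clT (Ki i)" by blast
    then obtain s where "s \<in> nzd" "s \<odot> x \<in> Ki i" "x \<in> carrier F" using cl_T_Ki[OF i(1)] by blast
    then show "x \<in> clt K" unfolding cl_t_iff using i(1) Ki_union by blast
  qed
  show "clt K \<subseteq> (\<Union>i\<in>I. clT (Ki i))"
  proof
    fix x assume "x \<in> clt K"
    then obtain s where s: "s \<in> nzd" "s \<odot> x \<in> K" "x \<in> carrier F" unfolding cl_t_iff by blast
    then obtain i where i: "i \<in> I" "s \<odot> x \<in> Ki i" using Ki_union by blast
    then have "x \<in> clT (Ki i)" using s cl_T_Ki[OF i(1)] by blast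
    then show "x \<in> (\<Union>i\<in>I. clT (Ki i))" using i(1) by blast
  qed
qed

lemma cl_T_submodule: assumes L: "submodule L R F" shows "submodule (clT L) R F"
proof -
  interpret Q: vn_module A tr "quot_mod F L" by (rule FV.quot_vn_module[OF L])
  interpret q: lmodule_hom R F "quot_mod F L" "\<lambda>x. L +> x" unfolding lmodule_hom_def lmodule_hom_axioms_def
    using FV.M.lmodule_axioms Q.M.lmodule_axioms FV.M.quot_map_hom[OF L] by blast
  have "clT L = {x \<in> carrier F. L +> x \<in> torsion (quot_mod F L)}" by (auto simp: FV.cl_T_iff[OF L])
  then show ?thesis using q.preimage_submodule[OF Q.torsion_submodule] by simp
qed

lemma cl_t_submodule: "submodule (clt K) R F"
proof -
  have "clt K = {x \<in> carrier F. f x \<in> nzd_torsion M}" by (auto simp: cl_t_iff')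
  then show ?thesis using f.preimage_submodule[OF MV.nzd_torsion_submodule] by simp
qed

lemma Ki_cl_T: "i \<in> I \<Longrightarrow> Ki i \<subseteq> clT (Ki i)"
proof
  fix x assume i: "i \<in> I" and x: "x \<in> Ki i"
  have xc: "x \<in> carrier F" by (rule FV.M.submoduleD(7)[OF Ki[OF i] x])
  show "x \<in> clT (Ki i)" unfolding cl_T_Ki[OF i]
    using xc x by (intro conjI bexI[OF _ nzd_id]) (simp_all add: FV.smult_simps)
qed

lemma cl_T_mono:
  assumes ij: "i \<in> I" "j \<in> I" "leq i j" shows "clT (Ki i) \<subseteq> clT (Ki j)"
  unfolding subset_iff cl_T_Ki[OF ij(1)] cl_T_Ki[OF ij(2)] using Ki_mono[OF ij] by blast

lemma cl_t_subset_cl_T: "clt K \<subseteq> clT K" using MV.nzd_torsion_subset by (auto simp: cl_t_iff' cl_T_iff')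

lemma cl_T_Ki_subset: "i \<in> I \<Longrightarrow> clT (Ki i) \<subseteq> clT K" using cl_t_subset_cl_T cl_T_union by blast

lemma K_subset: "K \<subseteq> clt K" using Ki_cl_T Ki_union cl_T_union by blast

lemma t_iso: "(\<lambda>X. the_elem (f ` X)) \<in> mod_iso R (quot_mod (restrict_mod F (clt K)) K) (restrict_mod M (t_sub A \<iota> M))"
proof -
  have im: "f ` clt K = nzd_torsion M"
  proof
    show "f ` clt K \<subseteq> nzd_torsion M" using cl_t_iff' by blast
    show "nzd_torsion M \<subseteq> f ` clt K"
    proof
      fix m assume m: "m \<in> nzd_torsion M"
      then have "m \<in> carrier M" by (simp add: nzd_torsion_def)
      then show "m \<in> f ` clt K" using m \<sigma>[of m] cl_t_iff'[of "\<sigma> m"] by (intro image_eqI[of _ _ "\<sigma> m"]) simp_all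
    qed
  qed
  have ker: "a_kernel F M f \<subseteq> clt K" using K_subset unfolding K[symmetric] .
  show ?thesis unfolding t_sub_M
    using f.first_isomorphism[OF cl_t_submodule ker im MV.nzd_torsion_submodule] unfolding K[symmetric] .
qed

lemma t_limit:
  "mod_isomorphic R (quot_mod (restrict_mod F (clt K)) K)
    (direct_limit I leq (\<lambda>i. quot_mod (restrict_mod F (clT (Ki i))) (Ki i)) (\<lambda>i j X. Ki j <+>\<^bsub>F\<^esub> X))"
proof -
  interpret quotient_system R F I leq Ki "\<lambda>i. clT (Ki i)"
    by (rule quotient_system.intro[OF FV.M.lmodule_axioms quotient_system_axioms.intro])
      (rule dir Ki cl_T_submodule[OF Ki] Ki_cl_T Ki_mono cl_T_mono; assumption?)+
  show ?thesis using quotient_limit_iso unfolding Ki_union cl_T_union .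
qed

lemma T_quot_Ki:
  assumes i: "i \<in> I"
  shows "quot_mod (restrict_mod F (clT (Ki i))) (Ki i) = restrict_mod (quot_mod F (Ki i)) (T_sub A tr (quot_mod F (Ki i)))"
proof -
  have "{Ki i +> x | x. x \<in> clT (Ki i)} = T_sub A tr (quot_mod F (Ki i))"
    unfolding vn_module.T_sub_eq[OF FV.quot_vn_module[OF Ki[OF i]]] by (auto simp: FV.cl_T_iff[OF Ki[OF i]])
      (use FV.M.quot_carrier[of "Ki i"] in \<open>auto simp: torsion_def\<close>)
  then show ?thesis using FV.M.restrict_quot[of "clT (Ki i)" "Ki i"] by simp
qed

lemma flat_iff:
  fixes e :: "('h \<Rightarrow>\<^sub>L 'h) \<Rightarrow> 'n"
  assumes e: "inj e"
  shows "flat TYPE('n) R M \<longleftrightarrow> clt K = K"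
proof
  assume fl: "flat TYPE('n) R M"
  have "x \<in> K" if x: "x \<in> clt K" for x
  proof -
    obtain s where s: "s \<in> nzd" "s \<odot> x \<in> K" and xc: "x \<in> carrier F" using x cl_t_iff by blast
    have "s \<odot>\<^bsub>M\<^esub> f x = \<zero>\<^bsub>M\<^esub>" using s xc smult_K_iff[of s x] by simp
    then have "f x = \<zero>\<^bsub>M\<^esub>" by (rule MV.flat_imp_torsion_free[OF e fl s(1) f.hom_closed[OF xc]])
    then show ?thesis using xc K_iff by blast
  qed
  then show "clt K = K" using K_subset by blast
next
  assume eq: "clt K = K"
  show "flat TYPE('n) R M"
  proof (rule torsion_free_imp_flat)
    fix s x assume "s \<in> nzd" "x \<in> carrier F" "s \<odot> x \<in> K"
    then have "x \<in> clt K" using cl_t_iff by blast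
    then show "x \<in> K" unfolding eq .
  qed
qed

lemma quot_composite:
  assumes N: "submodule N R M"
  shows "lmodule_hom R F (quot_mod M N) (\<lambda>x. N +>\<^bsub>M\<^esub> f x)"
    and "a_kernel F (quot_mod M N) (\<lambda>x. N +>\<^bsub>M\<^esub> f x) = {x \<in> carrier F. f x \<in> N}"
proof -
  have Q: "lmodule R (quot_mod M N)" by (rule MV.M.quot_lmodule[OF N])
  have "(\<lambda>x. N +>\<^bsub>M\<^esub> f x) \<in> mod_hom R F (quot_mod M N)"
    by (rule mod_homI) (simp_all add: MV.M.quot_carrierI MV.M.quot_add[OF N] MV.M.quot_smult[OF N] f.hom_add f.hom_smult)
  then show h: "lmodule_hom R F (quot_mod M N) (\<lambda>x. N +>\<^bsub>M\<^esub> f x)"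
    unfolding lmodule_hom_def lmodule_hom_axioms_def using Q FV.M.lmodule_axioms by blast
  show "a_kernel F (quot_mod M N) (\<lambda>x. N +>\<^bsub>M\<^esub> f x) = {x \<in> carrier F. f x \<in> N}"
    unfolding set_eq_iff lmodule_hom.kernel_iff[OF h] mem_Collect_eq
    using MV.M.quot_eq_zero_iff[OF N f.hom_closed] by blast
qed

text \<open>The composite of \<open>f\<close> with the projection modulo \<open>t M\<close> has
  kernel \<open>clt K\<close>, and by \<open>torsion_quot_torsion_iff\<close> it maps
  \<open>clT K\<close> onto the torsion of the quotient.\<close>

lemma T_p_iso:
  "mod_isomorphic R
    (restrict_mod (quot_mod M (t_sub A \<iota> M)) (T_sub A tr (quot_mod M (t_sub A \<iota> M))))
    (quot_mod (restrict_mod F (clT K)) (clt K))"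
proof -
  define tM where "tM = nzd_torsion M"
  have N: "submodule tM R M" unfolding tM_def by (rule MV.nzd_torsion_submodule)
  have NT: "tM \<subseteq> torsion M" unfolding tM_def by (rule MV.nzd_torsion_subset)
  interpret Q: vn_module A tr "quot_mod M tM" by (rule MV.quot_vn_module[OF N])
  interpret g: lmodule_hom R F "quot_mod M tM" "\<lambda>x. tM +>\<^bsub>M\<^esub> f x" by (rule quot_composite(1)[OF N])
  have ker: "a_kernel F (quot_mod M tM) (\<lambda>x. tM +>\<^bsub>M\<^esub> f x) = clt K"
    unfolding quot_composite(2)[OF N] unfolding tM_def set_eq_iff mem_Collect_eq cl_t_iff' by (rule allI, rule refl)
  have im: "(\<lambda>x. tM +>\<^bsub>M\<^esub> f x) ` clT K = torsion (quot_mod M tM)"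
  proof
    show "(\<lambda>x. tM +>\<^bsub>M\<^esub> f x) ` clT K \<subseteq> torsion (quot_mod M tM)"
      using MV.torsion_quot_torsion_iff[OF N NT f.hom_closed] cl_T_iff' by blast
    show "torsion (quot_mod M tM) \<subseteq> (\<lambda>x. tM +>\<^bsub>M\<^esub> f x) ` clT K"
    proof
      fix X assume X: "X \<in> torsion (quot_mod M tM)"
      then obtain m where m: "X = tM +>\<^bsub>M\<^esub> m" "m \<in> carrier M"
        using Q.torsion_carrier[OF X] MV.M.quot_carrier[of tM] by blast
      then have "m \<in> torsion M" using MV.torsion_quot_torsion_iff[OF N NT m(2)] X by simp
      then show "X \<in> (\<lambda>x. tM +>\<^bsub>M\<^esub> f x) ` clT K"
        using m \<sigma>[OF m(2)] cl_T_iff'[of "\<sigma> m"] by (intro image_eqI[of _ _ "\<sigma> m"]) simp_all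
    qed
  qed
  have T: "submodule (clT K) R F" by (rule cl_T_submodule[OF K_sub])
  interpret FT: lmodule R "restrict_mod F (clT K)" by (rule FV.M.restrict_lmodule[OF T])
  have "submodule (clt K) R (restrict_mod F (clT K))"
    unfolding FV.M.submodule_restrict_iff[OF T] using cl_t_submodule cl_t_subset_cl_T by blast
  then have 1: "lmodule R (quot_mod (restrict_mod F (clT K)) (clt K))" by (rule FT.quot_lmodule)
  have 2: "lmodule R (restrict_mod (quot_mod M tM) (torsion (quot_mod M tM)))"
    by (rule Q.M.restrict_lmodule[OF Q.torsion_submodule])
  have "mod_isomorphic R (quot_mod (restrict_mod F (clT K)) (clt K)) (restrict_mod (quot_mod M tM) (torsion (quot_mod M tM)))"
    using mod_isomorphicI[OF g.first_isomorphism[OF T _ im Q.torsion_submodule]] cl_t_subset_cl_T unfolding ker by blast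
  then show ?thesis unfolding t_sub_M tM_def[symmetric] Q.T_sub_eq by (rule mod_isomorphic_sym[OF 1 2])
qed

lemma T_p_limit:
  "mod_isomorphic R (quot_mod (restrict_mod F (clT K)) (clt K))
    (direct_limit I leq (\<lambda>i. quot_mod (restrict_mod F (clT K)) (clT (Ki i))) (\<lambda>i j X. clT (Ki j) <+>\<^bsub>F\<^esub> X))"
proof -
  interpret quotient_system R F I leq "\<lambda>i. clT (Ki i)" "\<lambda>_. clT K"
    by (rule quotient_system.intro[OF FV.M.lmodule_axioms quotient_system_axioms.intro])
      (rule dir cl_T_submodule[OF Ki] cl_T_submodule[OF K_sub] cl_T_mono cl_T_Ki_subset order_refl; assumption?)+
  have "(\<Union>i\<in>I. clT K) = clT K" using I_nonempty by simp
  then show ?thesis using quotient_limit_iso unfolding cl_T_union by simp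
qed

lemma P_iso: "mod_isomorphic R (quot_mod M (T_sub A tr M)) (quot_mod F (clT K))"
proof -
  define TM where "TM = torsion M"
  have N: "submodule TM R M" unfolding TM_def by (rule MV.torsion_submodule)
  interpret Q: lmodule R "quot_mod M TM" by (rule MV.M.quot_lmodule[OF N])
  interpret g: lmodule_hom R F "quot_mod M TM" "\<lambda>x. TM +>\<^bsub>M\<^esub> f x" by (rule quot_composite(1)[OF N])
  have ker: "a_kernel F (quot_mod M TM) (\<lambda>x. TM +>\<^bsub>M\<^esub> f x) = clT K"
    unfolding quot_composite(2)[OF N] unfolding TM_def set_eq_iff mem_Collect_eq cl_T_iff' by (rule allI, rule refl)
  have im: "(\<lambda>x. TM +>\<^bsub>M\<^esub> f x) ` carrier F = carrier (quot_mod M TM)"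
    unfolding MV.M.quot_carrier f_surj[symmetric] by blast
  have T: "submodule (clT K) R F" by (rule cl_T_submodule[OF K_sub])
  have "mod_isomorphic R (quot_mod (restrict_mod F (carrier F)) (clT K)) (restrict_mod (quot_mod M TM) (carrier (quot_mod M TM)))"
    using mod_isomorphicI[OF g.first_isomorphism[OF FV.M.submodule_carrier _ im Q.submodule_carrier]]
      FV.M.submoduleD(1)[OF T] unfolding ker by blast
  then have "mod_isomorphic R (quot_mod F (clT K)) (quot_mod M TM)"
    unfolding FV.M.restrict_carrier Q.restrict_carrier .
  then show ?thesis unfolding MV.T_sub_eq TM_def[symmetric]
    by (rule mod_isomorphic_sym[OF FV.M.quot_lmodule[OF T] Q.lmodule_axioms])
qed

end

theorem proposition6p1:
  fixes A :: "('h::chilbert \<Rightarrow>\<^sub>L 'h) set"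
    and tr :: "('h \<Rightarrow>\<^sub>L 'h) \<Rightarrow> complex"
    and \<iota> :: "('h \<Rightarrow>\<^sub>L 'h) \<Rightarrow> 'l::chilbert"
    and M :: "('h \<Rightarrow>\<^sub>L 'h, 'm) module"
    and F :: "('h \<Rightarrow>\<^sub>L 'h, 'f) module"
    and f :: "'f \<Rightarrow> 'm"
    and K :: "'f set"
    and I :: "'i set"
    and leq :: "'i \<Rightarrow> 'i \<Rightarrow> bool"
    and Ki :: "'i \<Rightarrow> 'f set"
  defines "R \<equiv> vn_ring A"
  assumes "von_Neumann_algebra A"
    and "normal_faithful_trace A tr"
    and "l2_completion A tr \<iota>"
    and "left_module R M" and "fin_gen R M"
    and "fg_projective R F"
    and "f \<in> mod_hom R F M" and "f ` carrier F = carrier M"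
    and "K = a_kernel F M f"
    and "directed_on I leq"
    and "\<And>i. i \<in> I \<Longrightarrow> submodule (Ki i) R F \<and> Ki i \<subseteq> K \<and> fin_gen R (restrict_mod F (Ki i))"
    and "\<And>i j. i \<in> I \<Longrightarrow> j \<in> I \<Longrightarrow> leq i j \<Longrightarrow> Ki i \<subseteq> Ki j"
    and "(\<Union>i\<in>I. Ki i) = K"
  shows
    \<comment> \<open>(1)\<close>
    "((\<lambda>X. the_elem (f ` X)) \<in> mod_iso R
        (quot_mod (restrict_mod F (cl_t A \<iota> F K)) K)
        (restrict_mod M (t_sub A \<iota> M)) \<and>
      mod_isomorphic R
        (quot_mod (restrict_mod F (cl_t A \<iota> F K)) K)
        (direct_limit I leq
          (\<lambda>i. quot_mod (restrict_mod F (cl_T A tr F (Ki i))) (Ki i))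
          (\<lambda>i j X. Ki j <+>\<^bsub>F\<^esub> X)) \<and>
      direct_limit I leq
          (\<lambda>i. quot_mod (restrict_mod F (cl_T A tr F (Ki i))) (Ki i))
          (\<lambda>i j X. Ki j <+>\<^bsub>F\<^esub> X) =
        direct_limit I leq
          (\<lambda>i. restrict_mod (quot_mod F (Ki i)) (T_sub A tr (quot_mod F (Ki i))))
          (\<lambda>i j X. Ki j <+>\<^bsub>F\<^esub> X) \<and>
      ((\<exists>e :: ('h \<Rightarrow>\<^sub>L 'h) \<Rightarrow> 'n. inj e) \<longrightarrow>
        (flat TYPE('n) R M \<longleftrightarrow>
          cl_t A \<iota> F K = (\<Union>i\<in>I. cl_T A tr F (Ki i)) \<and> (\<Union>i\<in>I. cl_T A tr F (Ki i)) = K))) \<and>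
    \<comment> \<open>(2)\<close>
    (mod_isomorphic R
        (restrict_mod (quot_mod M (t_sub A \<iota> M)) (T_sub A tr (quot_mod M (t_sub A \<iota> M))))
        (quot_mod (restrict_mod F (cl_T A tr F K)) (cl_t A \<iota> F K)) \<and>
      mod_isomorphic R
        (quot_mod (restrict_mod F (cl_T A tr F K)) (cl_t A \<iota> F K))
        (direct_limit I leq
          (\<lambda>i. quot_mod (restrict_mod F (cl_T A tr F K)) (cl_T A tr F (Ki i)))
          (\<lambda>i j X. cl_T A tr F (Ki j) <+>\<^bsub>F\<^esub> X))) \<and>
    \<comment> \<open>(3)\<close>
    mod_isomorphic R (quot_mod M (T_sub A tr M)) (quot_mod F (cl_T A tr F K))"
proof -
  have vn: "finite_von_Neumann A tr" by (rule finite_von_Neumann.intro[OF assms(2,3)])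
  have FM: "lmodule (vn_ring A) F" "lmodule (vn_ring A) M"
    using assms(5,7) by (simp_all add: R_def fg_projective_def left_module_iff)
  have V: "vn_module A tr F" "vn_module A tr M" using vn FM by (simp_all add: vn_module_def)
  have pres: "presentation A tr F M f K I leq Ki"
  proof (rule presentation.intro[OF vn V presentation_axioms.intro])
    fix i assume i: "i \<in> I"
    show "submodule (Ki i) (vn_ring A) F" "fin_gen (vn_ring A) (restrict_mod F (Ki i))"
      using assms(12)[OF i] unfolding R_def by blast+
  qed (rule assms(7-14)[unfolded R_def]; assumption)+
  have l2: "l2_representation A tr \<iota>"
    by (rule l2_representation.intro[OF vn l2_representation_axioms.intro[OF assms(4)]])
  interpret l2_presentation A tr F M f K I leq Ki \<iota> by (rule l2_presentation.intro[OF pres l2])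
  \<comment> \<open>By \<open>cl_T_union\<close> the chain of equalities reduces to
    \<open>cl_t A \<iota> F K = K\<close>.\<close>
  have "(\<exists>e :: ('h \<Rightarrow>\<^sub>L 'h) \<Rightarrow> 'n. inj e) \<longrightarrow> (flat TYPE('n) (vn_ring A) M \<longleftrightarrow>
      cl_t A \<iota> F K = (\<Union>i\<in>I. cl_T A tr F (Ki i)) \<and> (\<Union>i\<in>I. cl_T A tr F (Ki i)) = K)"
    using flat_iff unfolding cl_T_union by blast
  then show ?thesis
    unfolding R_def by (intro conjI t_iso t_limit direct_limit_cong T_quot_Ki T_p_iso T_p_limit P_iso)
qed

end
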